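(* Let $E\subseteq H$ be a closed set and assume that $A(G)$ has a (possibly unbounded) approximate identity. If $E$ is an ultra strong Ditkin set, then $\theta^{-1}(E)$ is an ultra strong Ditkin set.
   Context: Let $G,H$ be locally compact second countable groups with Haar measures $\mu,\nu$, and $\theta:G\to H$ a continuous homomorphism with $\theta_*(\mu)(\alpha)=\mu(\theta^{-1}(\alpha))$ absolutely continuous with respect to $\nu$; $H_0=\theta(G)$ is an open subgroup of $H$. Standing assumption: $\theta_*(\mu)$ is a Haar measure of $H_0$, normalized so that $\theta_*(\mu)(\alpha)=\nu(\alpha)$ for all Borel $\alpha\subseteq H_0$. $A(K)$ is the Fourier algebra of a group $K$. For closed $E\subseteq K$: $I_K(E)=\{u\in A(K): u|_E=0\}$ and $J^0_K(E)=\{u\in A(K): u \text{ vanishes on some open set containing }E\}$. $E$ is an ultra strong Ditkin set if there is a bounded net $(u_\lambda)\subseteq J^0_K(E)$ with $u_\lambda u\to u$ in $A(K)$ for every $u\in I_K(E)$. *)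

theory Defs
  imports "HOL-Analysis.Analysis"
begin

text \<open>Groups are written additively (class group_add, not necessarily abelian).
  A locally compact second countable (Hausdorff) topological group is a type of class
  topological_group_add, t2_space, second_countable_topology whose topology is locally compact.\<close>

definition lcsc_group :: "'g::{topological_group_add, t2_space, second_countable_topology} itself \<Rightarrow> bool" where
  "lcsc_group _ \<longleftrightarrow> locally_compact_space (euclidean :: 'g topology)"

definition haar_measure :: "'g::{topological_group_add, t2_space, second_countable_topology} measure \<Rightarrow> bool" where
  "haar_measure M \<longleftrightarrow>
     sets M = sets borel \<and>
     (\<forall>x A. A \<in> sets borel \<longrightarrow> emeasure M ((\<lambda>y. x + y) ` A) = emeasure M A) \<and>
     (\<forall>K. compact K \<longrightarrow> emeasure M K < \<infinity>) \<and>
     (\<forall>U. open U \<and> U \<noteq> {} \<longrightarrow> emeasure M U > 0)"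

definition L2fun :: "'g measure \<Rightarrow> ('g \<Rightarrow> complex) \<Rightarrow> bool" where
  "L2fun M f \<longleftrightarrow> f \<in> borel_measurable M \<and> integrable M (\<lambda>x. (cmod (f x))\<^sup>2)"

definition L2norm :: "'g measure \<Rightarrow> ('g \<Rightarrow> complex) \<Rightarrow> real" where
  "L2norm M f = sqrt (integral\<^sup>L M (\<lambda>x. (cmod (f x))\<^sup>2))"

text \<open>The convolution f * g-check, g-check(x) = g(x^{-1}):
  (f * g-check)(x) = integral of f(y) g(x^{-1} y) dy.\<close>

definition conv_check :: "'g::group_add measure \<Rightarrow> ('g \<Rightarrow> complex) \<Rightarrow> ('g \<Rightarrow> complex) \<Rightarrow> 'g \<Rightarrow> complex" where
  "conv_check M f g x = integral\<^sup>L M (\<lambda>y. f y * g (- x + y))"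

text \<open>Representations of u as an absolutely convergent series sum_n f_n * g_n-check
  (Eymard's description of the Fourier algebra).\<close>

definition fourier_rep :: "'g::group_add measure \<Rightarrow> ('g \<Rightarrow> complex) \<Rightarrow> (nat \<Rightarrow> 'g \<Rightarrow> complex) \<Rightarrow> (nat \<Rightarrow> 'g \<Rightarrow> complex) \<Rightarrow> bool" where
  "fourier_rep M u f g \<longleftrightarrow>
     (\<forall>n. L2fun M (f n) \<and> L2fun M (g n)) \<and>
     summable (\<lambda>n. L2norm M (f n) * L2norm M (g n)) \<and>
     (\<forall>x. u x = (\<Sum>n. conv_check M (f n) (g n) x))"

definition fourier_algebra :: "'g::group_add measure \<Rightarrow> ('g \<Rightarrow> complex) set" where
  "fourier_algebra M = {u. \<exists>f g. fourier_rep M u f g}"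

definition fourier_norm :: "'g::group_add measure \<Rightarrow> ('g \<Rightarrow> complex) \<Rightarrow> real" where
  "fourier_norm M u = Inf {\<Sum>n. L2norm M (f n) * L2norm M (g n) | f g. fourier_rep M u f g}"

definition I_ideal :: "'g::{group_add, topological_space} measure \<Rightarrow> 'g set \<Rightarrow> ('g \<Rightarrow> complex) set" where
  "I_ideal M E = {u \<in> fourier_algebra M. \<forall>x\<in>E. u x = 0}"

definition J0_ideal :: "'g::{group_add, topological_space} measure \<Rightarrow> 'g set \<Rightarrow> ('g \<Rightarrow> complex) set" where
  "J0_ideal M E = {u \<in> fourier_algebra M. \<exists>U. open U \<and> E \<subseteq> U \<and> (\<forall>x\<in>U. u x = 0)}"

text \<open>Nets are represented by proper filters on the space of functions (the image filter
  of the net); a net with values in a set S exists iff such a filter exists.\<close>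

definition ultra_strong_ditkin :: "'g::{group_add, topological_space} measure \<Rightarrow> 'g set \<Rightarrow> bool" where
  "ultra_strong_ditkin M E \<longleftrightarrow>
     (\<exists>(F :: ('g \<Rightarrow> complex) filter) C. F \<noteq> bot \<and>
        eventually (\<lambda>v. v \<in> J0_ideal M E \<and> fourier_norm M v \<le> C) F \<and>
        (\<forall>u \<in> I_ideal M E.
           ((\<lambda>v. fourier_norm M (\<lambda>x. v x * u x - u x)) \<longlongrightarrow> 0) F))"

definition has_approx_identity :: "'g::group_add measure \<Rightarrow> bool" where
  "has_approx_identity M \<longleftrightarrow>
     (\<exists>(F :: ('g \<Rightarrow> complex) filter). F \<noteq> bot \<and>
        eventually (\<lambda>v. v \<in> fourier_algebra M) F \<and>
        (\<forall>u \<in> fourier_algebra M.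
           ((\<lambda>v. fourier_norm M (\<lambda>x. v x * u x - u x)) \<longlongrightarrow> 0) F))"

end

theory Submission
  imports Defs
begin

text \<open>Composition with \<open>\<theta>\<close> maps \<open>A(H)\<close> boundedly to \<open>A(G)\<close>, so the pulled-back net is bounded and lies in
  \<open>J\<^sup>0(\<theta>\<^sup>-\<^sup>1(E))\<close>. It clearly acts as an approximate unit on products \<open>d \<cdot> (a \<circ> \<theta>)\<close> with \<open>d \<in> A(G)\<close> and
  \<open>a \<in> I(E)\<close>; by boundedness it remains to see that these span a dense subspace of \<open>I(\<theta>\<^sup>-\<^sup>1(E))\<close>.
  For \<open>w\<close> in this ideal the averages of its translates over \<open>\<theta>\<^sup>-\<^sup>1(V)\<close> converge, as \<open>V\<close> shrinks to 0, to some
  \<open>a \<circ> \<theta>\<close> with \<open>a \<in> I(E)\<close>. Hence averages of \<open>k(x, y) v(- y + x)\<close> over \<open>y \<in> \<theta>\<^sup>-\<^sup>1(V)\<close> tend into the closed span when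
  the kernel \<open>k\<close> comes from a finite sum of elementary tensors, and therefore, by density in Hilbert--Schmidt norm, for
  every square-integrable kernel. If the kernel only charges \<open>y\<close> close to 0 in the kernel of \<open>\<theta>\<close>, such an average is
  close to \<open>v \<cdot> b\<close> with a coefficient function \<open>b\<close>. So the closed span contains \<open>v \<cdot> A(G)\<close>, and the approximate
  identity of \<open>A(G)\<close> puts \<open>v\<close> itself into it.\<close>

section \<open>Square-integrable functions\<close>

text \<open>Apart from sums and series, norm estimates in the Fourier algebra rest on one device: a
  function is exhibited as a coefficient \<open>dcoef\<close> of a multiple of the regular
  representation. Products, pull-backs and averages differ only in the multiplicity space and in the
  two vectors. The preimage of a small \<open>V\<close>, which has the finite mass of
  \<open>V\<close>, stands in for Haar measure on the kernel of \<open>\<theta>\<close>. The order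
  of choices shapes the argument. A window \<open>Q\<close> leaves on the fibres a mass that tends
  to some \<open>n > 0\<close>, about which nothing is known before \<open>Q\<close> is fixed. The
  error caused by the modulus of continuity of \<open>v\<close> is committed before \<open>Q\<close>
  exists, so it must be bounded by a multiple of \<open>n\<close> itself; the other errors are made
  small afterwards. The set \<open>V\<close> comes last, so bounds for kernels must be uniform in
  \<open>V\<close>. Moreover the windows are translated by group elements, so that \<open>y\<close>
  is only conjugate to a small element; a vector of compact support tames this.\<close>

definition E2 :: "'a measure \<Rightarrow> ('a \<Rightarrow> complex) \<Rightarrow> ennreal" where
  "E2 X f = (\<integral>\<^sup>+x. ennreal ((cmod (f x))\<^sup>2) \<partial>X)"

text \<open>\<open>E2\<close> stays in \<open>ennreal\<close> so that Tonelli and monotonicity apply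
  before integrability is known; \<open>L2norm\<close> is read off once finiteness has been
  shown.\<close>

lemma L2fun_iff: "L2fun X f \<longleftrightarrow> f \<in> borel_measurable X \<and> E2 X f < \<infinity>"
  unfolding L2fun_def E2_def integrable_iff_bounded by auto

lemma L2fun_measurable[measurable_dest]: "L2fun X f \<Longrightarrow> f \<in> borel_measurable X"
  by (simp add: L2fun_def)

lemma L2norm_nonneg[simp]: "0 \<le> L2norm X f"
  unfolding L2norm_def by simp

lemma E2_eq_L2norm: "L2fun X f \<Longrightarrow> E2 X f = ennreal ((L2norm X f)\<^sup>2)"
  unfolding E2_def L2norm_def L2fun_def
  by (subst nn_integral_eq_integral) (auto simp: integral_nonneg_AE)

text \<open>The usual exit from \<open>ennreal\<close>: a single computation of \<open>E2\<close>
  delivers membership and the norm bound together.\<close>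

lemma L2I:
  assumes "f \<in> borel_measurable X" "E2 X f \<le> ennreal (c\<^sup>2)" "0 \<le> c"
  shows "L2fun X f" and "L2norm X f \<le> c"
proof -
  show 1: "L2fun X f" using assms le_less_trans[OF assms(2)] by (auto simp: L2fun_iff)
  have "(L2norm X f)\<^sup>2 \<le> c\<^sup>2" using assms(2) unfolding E2_eq_L2norm[OF 1] by simp
  then show "L2norm X f \<le> c" using assms(3) power2_le_imp_le by blast
qed

lemma L2norm_cong: "(\<And>x. x \<in> space X \<Longrightarrow> cmod (f x) = cmod (g x)) \<Longrightarrow> L2norm X f = L2norm X g"
  unfolding L2norm_def by (auto intro!: arg_cong[where f=sqrt] Bochner_Integration.integral_cong)

lemma E2_CS:
  assumes [measurable]: "f \<in> borel_measurable X" "g \<in> borel_measurable X"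
  shows "(\<integral>\<^sup>+x. ennreal (cmod (f x * g x)) \<partial>X)\<^sup>2 \<le> E2 X f * E2 X g"
  using Cauchy_Schwarz_nn_integral[of "\<lambda>x. ennreal (cmod (f x))" X "\<lambda>x. ennreal (cmod (g x))"]
  by (simp add: E2_def norm_mult ennreal_mult ennreal_power)

lemma ennreal_power2_le_imp_le:
  assumes "a\<^sup>2 \<le> (ennreal r)\<^sup>2" "0 \<le> r" shows "a \<le> ennreal r"
proof (cases a)
  case (real s)
  then have "ennreal (s\<^sup>2) \<le> ennreal (r\<^sup>2)" using assms by (simp add: ennreal_power)
  then have "s\<^sup>2 \<le> r\<^sup>2" using assms(2) by simp
  then show ?thesis using real power2_le_imp_le[OF _ assms(2)] by (simp add: ennreal_leI)
next
  case top
  then show ?thesis using assms by (simp add: ennreal_power power2_eq_square ennreal_top_mult ennreal_mult'[symmetric] top_unique)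
qed

lemma nn_CS:
  assumes "L2fun X f" "L2fun X g"
  shows "(\<integral>\<^sup>+x. ennreal (cmod (f x * g x)) \<partial>X) \<le> ennreal (L2norm X f * L2norm X g)"
proof -
  have "(\<integral>\<^sup>+x. ennreal (cmod (f x * g x)) \<partial>X)\<^sup>2 \<le> (ennreal (L2norm X f * L2norm X g))\<^sup>2"
    using E2_CS[of f X g] assms
    by (simp add: E2_eq_L2norm L2fun_measurable ennreal_mult[symmetric] power_mult_distrib ennreal_power)
  then show ?thesis by (rule ennreal_power2_le_imp_le) simp
qed

lemma L2_mult_integrable:
  assumes "L2fun X f" "L2fun X g"
  shows "integrable X (\<lambda>x. f x * g x)"
proof -
  note [measurable] = L2fun_measurable[OF assms(1)] L2fun_measurable[OF assms(2)]
  show ?thesis unfolding integrable_iff_bounded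
    using le_less_trans[OF nn_CS[OF assms]] by auto
qed

lemma L2_CS:
  assumes "L2fun X f" "L2fun X g"
  shows "cmod (\<integral>x. f x * g x \<partial>X) \<le> L2norm X f * L2norm X g"
proof -
  have "ennreal (cmod (\<integral>x. f x * g x \<partial>X)) \<le> ennreal (L2norm X f * L2norm X g)"
    using integral_norm_bound_ennreal[OF L2_mult_integrable[OF assms]] nn_CS[OF assms] order_trans by blast
  then show ?thesis by simp
qed

lemma L2_mult_integral_eq_0:
  assumes "L2fun X f" "L2norm X f = 0"
  shows "(\<integral>x. f x * g x \<partial>X) = 0"
proof -
  have "E2 X f = 0" using assms by (simp add: E2_eq_L2norm)
  then have "AE x in X. f x = 0"
    using assms unfolding E2_def L2fun_def by (subst (asm) nn_integral_0_iff_AE) auto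
  then have "AE x in X. f x * g x = 0" by eventually_elim simp
  then show ?thesis by (rule integral_eq_zero_AE)
qed

lemma L2_scale:
  assumes "L2fun X f"
  shows L2fun_scale: "L2fun X (\<lambda>x. c * f x)" and L2norm_scale: "L2norm X (\<lambda>x. c * f x) = cmod c * L2norm X f"
  using assms by (auto simp: L2fun_def L2norm_def norm_mult power_mult_distrib real_sqrt_mult)

lemma L2fun_zero[simp]: "L2fun X (\<lambda>x. 0)" and L2norm_zero[simp]: "L2norm X (\<lambda>x. 0) = 0"
  by (auto simp: L2fun_def L2norm_def)

lemma L2_add:
  assumes f: "L2fun X f" and g: "L2fun X g"
  shows L2fun_add: "L2fun X (\<lambda>x. f x + g x)"
    and L2norm_triangle: "L2norm X (\<lambda>x. f x + g x) \<le> L2norm X f + L2norm X g"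
proof -
  note [measurable] = L2fun_measurable[OF f] L2fun_measurable[OF g]
  have "E2 X (\<lambda>x. f x + g x) \<le> (\<integral>\<^sup>+x. ennreal ((cmod (f x))\<^sup>2) + 2 * ennreal (cmod (f x * g x)) + ennreal ((cmod (g x))\<^sup>2) \<partial>X)"
    unfolding E2_def
  proof (intro nn_integral_mono)
    fix x
    have "(cmod (f x + g x))\<^sup>2 \<le> (cmod (f x) + cmod (g x))\<^sup>2"
      by (intro power_mono norm_triangle_ineq) auto
    also have "\<dots> = (cmod (f x))\<^sup>2 + 2 * cmod (f x * g x) + (cmod (g x))\<^sup>2"
      by (simp add: power2_sum norm_mult)
    finally show "ennreal ((cmod (f x + g x))\<^sup>2) \<le> ennreal ((cmod (f x))\<^sup>2) + 2 * ennreal (cmod (f x * g x)) + ennreal ((cmod (g x))\<^sup>2)"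
      by (simp add: ennreal_mult'[symmetric] ennreal_plus[symmetric] ennreal_numeral[symmetric] ennreal_leI
            del: ennreal_plus ennreal_numeral)
  qed
  also have "\<dots> = E2 X f + 2 * (\<integral>\<^sup>+x. ennreal (cmod (f x * g x)) \<partial>X) + E2 X g"
    unfolding E2_def by (simp add: nn_integral_add nn_integral_cmult)
  also have "\<dots> \<le> ennreal ((L2norm X f)\<^sup>2) + 2 * ennreal (L2norm X f * L2norm X g) + ennreal ((L2norm X g)\<^sup>2)"
    using nn_CS[OF f g] by (intro add_mono mult_left_mono) (auto simp: E2_eq_L2norm f g)
  also have "\<dots> = ennreal ((L2norm X f + L2norm X g)\<^sup>2)"
    by (simp add: power2_sum ennreal_mult'[symmetric] ennreal_plus[symmetric] ennreal_numeral[symmetric] algebra_simps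
            del: ennreal_plus ennreal_numeral)
  finally have *: "E2 X (\<lambda>x. f x + g x) \<le> ennreal ((L2norm X f + L2norm X g)\<^sup>2)" .
  have m: "(\<lambda>x. f x + g x) \<in> borel_measurable X" by measurable
  show "L2fun X (\<lambda>x. f x + g x)" and "L2norm X (\<lambda>x. f x + g x) \<le> L2norm X f + L2norm X g"
    using L2I[OF m *] by auto
qed

lemma L2_diff:
  assumes f: "L2fun X f" and g: "L2fun X g"
  shows L2fun_diff: "L2fun X (\<lambda>x. f x - g x)"
    and L2norm_triangle_diff: "L2norm X (\<lambda>x. f x - g x) \<le> L2norm X f + L2norm X g"
  using L2_add[OF f L2fun_scale[OF g, of "-1"]] L2norm_scale[OF g, of "-1"] by auto

lemma L2norm_minus_commute: "L2norm X (\<lambda>x. f x - g x) = L2norm X (\<lambda>x. g x - f x)"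
  by (rule L2norm_cong) (simp add: norm_minus_commute)

lemma L2norm_triangle3:
  assumes "L2fun X f" "L2fun X g" "L2fun X h"
  shows "L2norm X (\<lambda>x. f x - h x) \<le> L2norm X (\<lambda>x. f x - g x) + L2norm X (\<lambda>x. g x - h x)"
  using L2norm_triangle[OF L2fun_diff[OF assms(1,2)] L2fun_diff[OF assms(2,3)]] by simp

lemma L2norm_le_add_diff:
  assumes "L2fun X f" "L2fun X g"
  shows "L2norm X f \<le> L2norm X g + L2norm X (\<lambda>x. f x - g x)"
  using L2norm_triangle[OF assms(2) L2fun_diff[OF assms(1,2)]] by simp

lemma L2fun_sum:
  "(\<And>i. i \<in> I \<Longrightarrow> L2fun X (f i)) \<Longrightarrow> L2fun X (\<lambda>x. \<Sum>i\<in>I. f i x)"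
  by (induction I rule: infinite_finite_induct) (auto intro: L2fun_add)

lemma L2fun_bmult:
  assumes f: "L2fun X f" and [measurable]: "g \<in> borel_measurable X" and b: "\<And>x. cmod (g x) \<le> c" "0 \<le> c"
  shows "L2fun X (\<lambda>x. f x * g x)"
proof -
  note [measurable] = L2fun_measurable[OF f]
  have m: "(\<lambda>x. f x * g x) \<in> borel_measurable X" by measurable
  have "E2 X (\<lambda>x. f x * g x) \<le> (\<integral>\<^sup>+x. ennreal (c\<^sup>2) * ennreal ((cmod (f x))\<^sup>2) \<partial>X)"
    unfolding E2_def using b
    by (intro nn_integral_mono)
       (auto simp: norm_mult power_mult_distrib ennreal_mult[symmetric] mult.commute[of "c\<^sup>2"] intro!: ennreal_leI mult_left_mono power_mono)
  also have "\<dots> = ennreal (c\<^sup>2) * E2 X f"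
    unfolding E2_def by (simp add: nn_integral_cmult)
  also have "\<dots> = ennreal ((c * L2norm X f)\<^sup>2)"
    by (simp add: E2_eq_L2norm f power_mult_distrib ennreal_mult)
  finally have *: "E2 X (\<lambda>x. f x * g x) \<le> ennreal ((c * L2norm X f)\<^sup>2)" .
  show ?thesis using L2I(1)[OF m *] b by auto
qed

lemma L2fun_indicator: "A \<in> sets X \<Longrightarrow> emeasure X A < \<infinity> \<Longrightarrow> L2fun X (indicator A)"
proof -
  assume A: "A \<in> sets X" "emeasure X A < \<infinity>"
  have "(cmod (indicator A x))\<^sup>2 = indicator A x" for x :: 'a by (auto simp: indicator_def)
  then show "L2fun X (indicator A)" unfolding L2fun_def using A by auto
qed

lemma L2_dominated_convergence:
  assumes f: "\<And>i. f i \<in> borel_measurable X" and g: "L2fun X g" and w: "L2fun X w"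
    and lim: "\<And>x. x \<in> space X \<Longrightarrow> (\<lambda>i. f i x) \<longlonglongrightarrow> g x"
    and dom: "\<And>i x. x \<in> space X \<Longrightarrow> cmod (f i x) \<le> cmod (w x)"
  shows "(\<lambda>i. L2norm X (\<lambda>x. g x - f i x)) \<longlonglongrightarrow> 0"
proof -
  note [measurable] = f L2fun_measurable[OF g] L2fun_measurable[OF w]
  have "(\<lambda>i. \<integral>x. (cmod (g x - f i x))\<^sup>2 \<partial>X) \<longlonglongrightarrow> (\<integral>x. 0 \<partial>X)"
  proof (rule integral_dominated_convergence[where w="\<lambda>x. (2 * cmod (w x))\<^sup>2"])
    show "integrable X (\<lambda>x. (2 * cmod (w x))\<^sup>2)" using w by (simp add: L2fun_def power_mult_distrib)
    show "AE x in X. (\<lambda>i. (cmod (g x - f i x))\<^sup>2) \<longlonglongrightarrow> 0"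
    proof (rule AE_I2)
      fix x assume "x \<in> space X"
      from tendsto_diff[OF tendsto_const[of "g x"] lim[OF this]]
      have "(\<lambda>i. g x - f i x) \<longlonglongrightarrow> 0" by simp
      from tendsto_power[OF tendsto_norm[OF this], of 2] show "(\<lambda>i. (cmod (g x - f i x))\<^sup>2) \<longlonglongrightarrow> 0" by simp
    qed
    fix i show "AE x in X. norm ((cmod (g x - f i x))\<^sup>2) \<le> (2 * cmod (w x))\<^sup>2"
    proof (rule AE_I2)
      fix x assume x: "x \<in> space X"
      have "cmod (g x) \<le> cmod (w x)"
        by (rule tendsto_upperbound[OF tendsto_norm[OF lim[OF x]]]) (auto simp: dom[OF x])
      then have "cmod (g x - f i x) \<le> 2 * cmod (w x)"
        using dom[OF x, of i] norm_triangle_ineq4[of "g x" "f i x"] by linarith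
      then show "norm ((cmod (g x - f i x))\<^sup>2) \<le> (2 * cmod (w x))\<^sup>2"
        using power_mono[of "cmod (g x - f i x)" "2 * cmod (w x)" 2] by simp
    qed
  qed auto
  then show ?thesis unfolding L2norm_def using tendsto_real_sqrt[of _ 0 sequentially] by fastforce
qed

text \<open>A pi-lambda argument on the generator, then simple functions, then dominated
  convergence. Closure under limits is asked in the form of approximability within every
  \<open>\<epsilon>\<close>, because the properties fed in are themselves statements about every
  \<open>\<epsilon>\<close>.\<close>

lemma L2_dense_induct:
  assumes f: "L2fun X f"
    and gen: "sets X = sigma_sets (space X) G" and Gs: "G \<subseteq> Pow (space X)" and stab: "Int_stable G"
    and fin: "\<And>A. A \<in> G \<Longrightarrow> emeasure X A < \<infinity>"
    and om: "range Om \<subseteq> G" "incseq Om" "(\<Union>i. Om i) = space X"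
    and ind: "\<And>A. A \<in> G \<Longrightarrow> P (indicator A)"
    and add: "\<And>f g. L2fun X f \<Longrightarrow> L2fun X g \<Longrightarrow> P f \<Longrightarrow> P g \<Longrightarrow> P (\<lambda>x. f x + g x)"
    and scale: "\<And>c f. L2fun X f \<Longrightarrow> P f \<Longrightarrow> P (\<lambda>x. c * f x)"
    and lim: "\<And>f. L2fun X f \<Longrightarrow> (\<And>\<epsilon>. \<epsilon> > 0 \<Longrightarrow> \<exists>g. L2fun X g \<and> P g \<and> L2norm X (\<lambda>x. f x - g x) < \<epsilon>) \<Longrightarrow> P f"
  shows "P f"
proof -
  have Gsets: "A \<in> sets X" if "A \<in> G" for A using that gen by auto
  have seq: "P f" if "L2fun X f" "\<And>i. L2fun X (g i)" "\<And>i. P (g i)"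
     "(\<lambda>i. L2norm X (\<lambda>x. f x - g i x)) \<longlonglongrightarrow> 0" for f g
  proof (rule lim[OF that(1)])
    fix \<epsilon> :: real assume "\<epsilon> > 0"
    with that(4) have "\<forall>\<^sub>F i in sequentially. L2norm X (\<lambda>x. f x - g i x) < \<epsilon>" by (rule order_tendstoD)
    then obtain i where "L2norm X (\<lambda>x. f x - g i x) < \<epsilon>" by (auto simp: eventually_sequentially)
    then show "\<exists>g. L2fun X g \<and> P g \<and> L2norm X (\<lambda>x. f x - g x) < \<epsilon>" using that(2,3) by blast
  qed
  have omS: "Om n \<in> sets X" "emeasure X (Om n) < \<infinity>" for n using om(1) fin Gsets by auto
  have finI: "emeasure X (A \<inter> Om n) < \<infinity>" if "A \<in> sets X" for A n
    using omS[of n] emeasure_mono[of "A \<inter> Om n" "Om n" X] le_less_trans by blast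
  have PO: "P (indicator (Om n))" for n using om(1) by (intro ind) auto
  have zero: "P (\<lambda>x. 0)" using scale[OF L2fun_indicator[OF omS(1,2)] ind, of 0 0] om(1) by auto
  have sum: "P (\<lambda>x. \<Sum>i\<in>I. F i x)" if "\<And>i. i \<in> I \<Longrightarrow> L2fun X (F i)" "\<And>i. i \<in> I \<Longrightarrow> P (F i)" for I :: "'i set" and F
    using that by (induction I rule: infinite_finite_induct) (auto intro!: zero add L2fun_sum)
  \<comment> \<open>Complements may have infinite measure, so the Dynkin argument runs on the traces
    on \<open>Om n\<close>.\<close>
  have A1: "P (indicator (A \<inter> Om n))" if "A \<in> sets X" for A n
  proof -
    have "A \<in> sigma_sets (space X) G" using that gen by simp
    then show ?thesis
    proof (induction A rule: sigma_sets_induct_disjoint[OF stab Gs, consumes 1, case_names basic empty compl union])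
      case (basic A)
      then have "A \<inter> Om n \<in> G" using stab om(1) by (auto simp: Int_stable_def image_subset_iff)
      then show ?case by (rule ind)
    next
      case empty show ?case using zero by (simp add: indicator_def[abs_def])
    next
      case (compl A)
      then have A: "A \<in> sets X" using gen by simp
      have "P (\<lambda>x. indicator (Om n) x + (-1) * indicator (A \<inter> Om n) x)"
        using compl PO omS finI[OF A] A
        by (intro add scale L2fun_scale L2fun_indicator) auto
      also have "(\<lambda>x. indicator (Om n) x + (-1) * indicator (A \<inter> Om n) x) = (indicator ((space X - A) \<inter> Om n) :: _ \<Rightarrow> complex)"
        using sets.sets_into_space[OF omS(1)[of n]] by (auto simp: indicator_def fun_eq_iff)
      finally show ?case .
    next
      case (union A)
      then have A: "A i \<in> sets X" for i using gen by auto
      have S: "L2fun X (indicator (A i \<inter> Om n))" for i using A omS finI by (intro L2fun_indicator) auto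
      have UA: "(\<Union>i. A i) \<in> sets X" using A by auto
      show ?case
      proof (rule seq)
        show "L2fun X (indicator (\<Union> (range A) \<inter> Om n))"
          using UA omS finI[OF UA] by (intro L2fun_indicator) auto
        show "L2fun X (\<lambda>x. \<Sum>i<k. indicator (A i \<inter> Om n) x)" for k by (intro L2fun_sum S)
        show "P (\<lambda>x. \<Sum>i<k. indicator (A i \<inter> Om n) x)" for k by (intro sum S union)
        have eq: "(\<Sum>i<k. indicator (A i \<inter> Om n) x) = (indicator (\<Union>i<k. A i \<inter> Om n) x :: complex)" for k x
          using union(1) by (intro indicator_UN_disjoint[symmetric]) (auto simp: disjoint_family_on_def)
        show "(\<lambda>k. L2norm X (\<lambda>x. indicator (\<Union> (range A) \<inter> Om n) x - (\<Sum>i<k. indicator (A i \<inter> Om n) x))) \<longlonglongrightarrow> 0"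
          unfolding eq
        proof (rule L2_dominated_convergence[where w="indicator (Om n)"])
          show "L2fun X (indicator (\<Union> (range A) \<inter> Om n))"
            using UA omS finI[OF UA] by (intro L2fun_indicator) auto
          show "L2fun X (indicator (Om n))" using omS by (intro L2fun_indicator)
          show "indicator (\<Union>i<k. A i \<inter> Om n) \<in> borel_measurable X" for k using A omS by auto
          show "(\<lambda>k. indicator (\<Union>i<k. A i \<inter> Om n) x) \<longlonglongrightarrow> (indicator (\<Union> (range A) \<inter> Om n) x :: complex)" for x
            using LIMSEQ_indicator_UN[where A="\<lambda>i. A i \<inter> Om n"] by (simp add: Int_UN_distrib2)
        qed (auto simp: indicator_def)
      qed
    qed
  qed
  have A2: "P (indicator A)" if A: "A \<in> sets X" "emeasure X A < \<infinity>" for A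
  proof (rule seq)
    show L: "L2fun X (indicator A)" using A by (rule L2fun_indicator)
    show "L2fun X (indicator (A \<inter> Om n))" for n using A omS finI by (intro L2fun_indicator) auto
    show "P (indicator (A \<inter> Om n))" for n using A1 A by simp
    show "(\<lambda>n. L2norm X (\<lambda>x. indicator A x - indicator (A \<inter> Om n) x)) \<longlonglongrightarrow> 0"
    proof (rule L2_dominated_convergence[OF _ L L])
      show "indicator (A \<inter> Om n) \<in> borel_measurable X" for n using A omS by auto
      have "incseq (\<lambda>n. A \<inter> Om n)" using om(2) by (auto simp: incseq_def)
      from LIMSEQ_indicator_incseq[OF this]
      show "(\<lambda>n. indicator (A \<inter> Om n) x) \<longlonglongrightarrow> (indicator A x :: complex)" for x
        using om(3) sets.sets_into_space[OF A(1)] by (simp add: Int_absorb2 flip: Int_UN_distrib)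
    qed (auto simp: indicator_def)
  qed
  have A3: "P s" if s: "simple_function X s" "L2fun X s" for s
  proof -
    define R where "R = s ` space X - {0}"
    have Rf: "finite R" using s(1) by (auto simp: R_def simple_function_def)
    have pre: "s -` {c} \<inter> space X \<in> sets X" for c using s(1) by (rule simple_functionD)
    \<comment> \<open>Chebyshev: a nonzero value is taken on a set of finite measure. The value 0
      was left out of \<open>R\<close> for this reason.\<close>
    have fin: "emeasure X (s -` {c} \<inter> space X) < \<infinity>" if "c \<in> R" for c
    proof -
      have c0: "cmod c > 0" using that by (auto simp: R_def)
      have "ennreal ((cmod c)\<^sup>2) * emeasure X (s -` {c} \<inter> space X) = (\<integral>\<^sup>+x. ennreal ((cmod c)\<^sup>2) * indicator (s -` {c} \<inter> space X) x \<partial>X)"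
        using pre by (simp add: nn_integral_cmult_indicator)
      also have "\<dots> \<le> E2 X s" unfolding E2_def by (intro nn_integral_mono) (auto simp: indicator_def)
      also have "\<dots> < \<infinity>" using s(2) by (simp add: L2fun_iff)
      finally show ?thesis using c0 by (auto simp: ennreal_mult_less_top)
    qed
    have Pr: "P (\<lambda>x. \<Sum>c\<in>R. c * indicator (s -` {c} \<inter> space X) x)"
      using fin pre by (intro sum scale L2fun_scale L2fun_indicator A2)
    have L: "L2fun X (\<lambda>x. \<Sum>c\<in>R. c * indicator (s -` {c} \<inter> space X) x)"
      using fin pre by (intro L2fun_sum L2fun_scale L2fun_indicator)
    have eq: "s x = (\<Sum>c\<in>R. c * indicator (s -` {c} \<inter> space X) x)" if "x \<in> space X" for x
    proof (cases "s x = 0")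
      case True then show ?thesis using that by (auto simp: R_def indicator_def intro!: sum.neutral[symmetric])
    next
      case False
      then have "s x \<in> R" using that by (auto simp: R_def)
      then have "(\<Sum>c\<in>R. c * indicator (s -` {c} \<inter> space X) x) = (\<Sum>c\<in>{s x}. c * indicator (s -` {c} \<inter> space X) x)"
        using Rf that by (intro sum.mono_neutral_right) (auto simp: indicator_def)
      then show ?thesis using that by simp
    qed
    have "L2norm X (\<lambda>x. s x - (\<Sum>c\<in>R. c * indicator (s -` {c} \<inter> space X) x)) = L2norm X (\<lambda>x. 0)"
      by (rule L2norm_cong) (subst eq, assumption, simp)
    then have N: "L2norm X (\<lambda>x. s x - (\<Sum>c\<in>R. c * indicator (s -` {c} \<inter> space X) x)) = 0" by simp
    show ?thesis
    proof (rule seq[OF s(2) L Pr])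
      show "(\<lambda>i. L2norm X (\<lambda>x. s x - (\<Sum>c\<in>R. c * indicator (s -` {c} \<inter> space X) x))) \<longlonglongrightarrow> 0"
        unfolding N by (rule tendsto_const)
    qed
  qed
  show ?thesis
  proof -
    note [measurable] = L2fun_measurable[OF f]
    obtain s where s: "\<And>i. simple_function X (s i)" "\<And>x. x \<in> space X \<Longrightarrow> (\<lambda>i. s i x) \<longlonglongrightarrow> f x"
      "\<And>i x. x \<in> space X \<Longrightarrow> dist (s i x) 0 \<le> 2 * dist (f x) 0"
      using borel_measurable_implies_sequence_metric[OF L2fun_measurable[OF f], of 0] by blast
    have w: "L2fun X (\<lambda>x. 2 * f x)" using f by (rule L2fun_scale)
    have sm: "s i \<in> borel_measurable X" for i using s(1) by (rule borel_measurable_simple_function)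
    have L: "L2fun X (s i)" for i
    proof -
      have "E2 X (s i) \<le> E2 X (\<lambda>x. 2 * f x)" unfolding E2_def using s(3)[of _ i]
        by (intro nn_integral_mono ennreal_leI power_mono) (auto simp: norm_mult)
      then show ?thesis using w sm by (auto simp: L2fun_iff intro: le_less_trans)
    qed
    show ?thesis
    proof (rule seq[OF f, of s])
      show "(\<lambda>i. L2norm X (\<lambda>x. f x - s i x)) \<longlonglongrightarrow> 0"
        using s(2,3) by (intro L2_dominated_convergence[OF sm f w]) (auto simp: norm_mult)
      show "P (s i)" for i using s(1) L by (rule A3)
    qed (rule L)
  qed
qed

section \<open>Left Haar measure\<close>

lemma borel_measurable_group_uminus[measurable (raw)]:
  fixes f :: "'a \<Rightarrow> 'b::{second_countable_topology, topological_group_add}"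
  shows "f \<in> borel_measurable X \<Longrightarrow> (\<lambda>x. - f x) \<in> borel_measurable X"
  by (rule measurable_compose[where N=borel]) (auto intro!: borel_measurable_continuous_onI continuous_intros)

text \<open>Rearrangement of a dominated double series along the Cantor enumeration. It merges
  countably many series representations into one, keeping both the values and the sum of the
  norms.\<close>

lemma sums_prod_decode:
  fixes a :: "nat \<Rightarrow> nat \<Rightarrow> complex" and b :: "nat \<Rightarrow> nat \<Rightarrow> real"
  assumes ab: "\<And>k n. cmod (a k n) \<le> b k n" and b: "\<And>k. summable (b k)" and s: "summable (\<lambda>k. suminf (b k))"
  shows "(\<lambda>i. case prod_decode i of (k, n) \<Rightarrow> b k n) sums (\<Sum>k. suminf (b k))"
    and "(\<Sum>i. case prod_decode i of (k, n) \<Rightarrow> a k n) = (\<Sum>k. suminf (a k))"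
proof -
  have b0: "0 \<le> b k n" for k n using ab[of k n] norm_ge_zero order_trans by blast
  let ?B = "\<lambda>i. case prod_decode i of (k, n) \<Rightarrow> b k n"
  have B0: "0 \<le> ?B i" for i using b0 by (auto split: prod.split)
  have sb0: "0 \<le> suminf (b k)" for k using b b0 by (simp add: suminf_nonneg)
  have "(\<Sum>i. ennreal (?B i)) = (\<Sum>i. (\<lambda>(k,n). ennreal (b k n)) (prod_decode i))"
    by (auto intro!: suminf_cong split: prod.split)
  also have "\<dots> = (\<Sum>k. \<Sum>n. ennreal (b k n))"
    by (rule suminf_ennreal_2dimen) simp
  also have "\<dots> = (\<Sum>k. ennreal (suminf (b k)))"
    using b b0 by (intro suminf_cong suminf_ennreal2) auto
  also have "\<dots> = ennreal (\<Sum>k. suminf (b k))" by (intro suminf_ennreal2 sb0 s)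
  finally have e: "(\<Sum>i. ennreal (?B i)) = ennreal (\<Sum>k. suminf (b k))" .
  have sB: "summable ?B" using e B0 by (intro summable_suminf_not_top) auto
  have "ennreal (suminf ?B) = ennreal (\<Sum>k. suminf (b k))"
    using e suminf_ennreal2[OF B0 sB] by simp
  then have "suminf ?B = (\<Sum>k. suminf (b k))"
    using suminf_nonneg[OF sB B0] suminf_nonneg[OF s sb0] by simp
  with sB show "?B sums (\<Sum>k. suminf (b k))" by (simp add: sums_iff)
  let ?A = "\<lambda>i. case prod_decode i of (k, n) \<Rightarrow> a k n"
  have AB: "cmod (?A i) \<le> ?B i" for i using ab by (auto split: prod.split)
  have sA: "summable (\<lambda>i. cmod (?A i))"
    using sB AB by (intro summable_comparison_test'[OF sB, of 0]) auto
  have hA: "(?A has_sum suminf ?A) UNIV"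
    by (rule norm_summable_imp_has_sum[OF sA summable_sums[OF summable_norm_cancel[OF sA]]])
  have "((\<lambda>i. case_prod a (prod_decode i)) has_sum suminf ?A) UNIV" using hA by simp
  then have hP: "(case_prod a has_sum suminf ?A) (UNIV \<times> UNIV)"
    using has_sum_reindex_bij_betw[OF bij_prod_decode, of "case_prod a"] by simp
  have sk: "summable (\<lambda>n. cmod (a k n))" for k
    using ab b[of k] by (intro summable_comparison_test'[OF b[of k], of 0]) auto
  have "infsum (a k) UNIV = suminf (a k)" for k
    using norm_summable_imp_has_sum[OF sk] summable_norm_cancel[OF sk] by (intro infsumI) (simp add: summable_sums)
  moreover have "infsum (\<lambda>k. infsum (a k) UNIV) UNIV = infsum (case_prod a) (UNIV \<times> UNIV)"
    using hP by (intro infsum_Sigma'_banach) (auto simp: summable_on_def)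
  moreover have "infsum (\<lambda>k. suminf (a k)) UNIV = (\<Sum>k. suminf (a k))"
  proof -
    have "cmod (suminf (a k)) \<le> suminf (b k)" for k
      using summable_norm[OF sk[of k]] suminf_le[OF ab sk b] by (rule order_trans)
    then have "summable (\<lambda>k. cmod (suminf (a k)))"
      by (intro summable_comparison_test'[OF s, of 0]) auto
    then show ?thesis
      by (intro infsumI norm_summable_imp_has_sum[OF _ summable_sums[OF summable_norm_cancel]])
  qed
  ultimately show "suminf ?A = (\<Sum>k. suminf (a k))"
    using infsumI[OF hP] by simp
qed

locale lcsc_haar =
  fixes M :: "'g::{topological_group_add, t2_space, second_countable_topology} measure"
  assumes lcsc: "lcsc_group TYPE('g)" and haar: "haar_measure M"
begin

lemma sets_M[measurable_cong, simp]: "sets M = sets borel"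
  using haar by (simp add: haar_measure_def)

lemma space_M[simp]: "space M = UNIV"
  using sets_eq_imp_space_eq[OF sets_M] by simp

lemma compact_finite: "compact K \<Longrightarrow> emeasure M K < \<infinity>"
  using haar by (simp add: haar_measure_def)

lemma open_pos: "open U \<Longrightarrow> U \<noteq> {} \<Longrightarrow> emeasure M U > 0"
  using haar by (simp add: haar_measure_def)

text \<open>The Hausdorff property upgrades local compactness to a base of compact
  neighbourhoods.\<close>

lemma small_compact:
  fixes x :: 'g
  assumes "open U" "x \<in> U"
  obtains V K where "open V" "compact K" "x \<in> V" "V \<subseteq> K" "K \<subseteq> U"
proof -
  have "Hausdorff_space (euclidean :: 'g topology)"
    unfolding Hausdorff_space_def by (simp add: disjnt_def) (metis hausdorff)
  then have "neighbourhood_base_of (compactin euclidean) (euclidean :: 'g topology)"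
    using lcsc locally_compact_space_neighbourhood_base[of "euclidean :: 'g topology"]
    by (auto simp: lcsc_group_def)
  then have "\<exists>V K. openin euclidean V \<and> compactin euclidean K \<and> x \<in> V \<and> V \<subseteq> K \<and> K \<subseteq> U"
    using assms unfolding neighbourhood_base_of by (auto simp flip: open_openin)
  then show ?thesis using that by (auto simp: compactin_euclidean_iff simp flip: open_openin)
qed

lemma small_open:
  fixes x :: 'g
  assumes "open U" "x \<in> U"
  obtains V where "open V" "x \<in> V" "V \<subseteq> U" "emeasure M V < \<infinity>"
proof -
  obtain V K where "open V" "compact K" "x \<in> V" "V \<subseteq> K" "K \<subseteq> U" using small_compact[OF assms] by blast
  moreover then have "emeasure M V < \<infinity>"
    using emeasure_mono[of V K M] compact_finite[of K] by (auto intro: le_less_trans borel_compact)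
  ultimately show ?thesis using that by blast
qed

text \<open>Lindelof reduces the cover by relatively compact open sets to a countable one; finite
  unions make it increasing. The same sequence gives sigma-finiteness and, later, the cut-off of
  vectors to compact support.\<close>

lemma open_exhaustion:
  obtains Om :: "nat \<Rightarrow> 'g set" where "\<And>n. open (Om n)" "\<And>n. emeasure M (Om n) < \<infinity>" "incseq Om" "(\<Union>n. Om n) = UNIV"
    "\<And>n. \<exists>K. compact K \<and> Om n \<subseteq> K"
proof -
  let ?F = "{U :: 'g set. open U \<and> (\<exists>K. compact K \<and> U \<subseteq> K)}"
  obtain F where F: "F \<subseteq> ?F" "countable F" "\<Union>F = \<Union>?F" by (rule Lindelof[of ?F]) auto
  have "\<Union>?F = UNIV"
  proof -
    have "x \<in> \<Union>?F" for x :: 'g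
      using small_compact[of UNIV x] by (metis (mono_tags, lifting) UNIV_I UnionI mem_Collect_eq open_UNIV)
    then show ?thesis by blast
  qed
  then have FU: "\<Union>F = UNIV" using F by simp
  then have "F \<noteq> {}" by auto
  then obtain A where A: "range (A :: nat \<Rightarrow> _) = F" using F(2) by (metis uncountable_def)
  define Om where "Om n = (\<Union>i\<le>n. A i)" for n
  have A': "open (A i)" "\<exists>K. compact K \<and> A i \<subseteq> K" for i using A F(1) by auto
  then obtain K where K: "\<And>i. compact (K i)" "\<And>i. A i \<subseteq> K i" by metis
  have 1: "open (Om n)" for n unfolding Om_def using A' by auto
  have 2: "\<exists>K. compact K \<and> Om n \<subseteq> K" for n unfolding Om_def
    using K by (intro exI[of _ "\<Union>i\<le>n. K i"]) (auto intro!: compact_UN)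
  have 3: "emeasure M (Om n) < \<infinity>" for n
    using 2[of n] emeasure_mono[of "Om n" _ M] compact_finite by (auto intro: le_less_trans borel_compact)
  have 4: "incseq Om" unfolding Om_def incseq_def by (auto intro: order_trans)
  have 5: "(\<Union>n. Om n) = UNIV" using FU A unfolding Om_def by auto
  show ?thesis using that[OF 1 3 4 5 2] .
qed

text \<open>Lets an argument by \<open>L2_dense_induct\<close> start from open sets of finite
  measure, whose translates can be compared pointwise.\<close>

lemma generates_borel:
  "sets M = sigma_sets UNIV {U. open U \<and> emeasure M U < \<infinity>}" (is "_ = sigma_sets UNIV ?G")
proof -
  obtain Om :: "nat \<Rightarrow> 'g set" where Om: "\<And>n. open (Om n)" "\<And>n. emeasure M (Om n) < \<infinity>" "(\<Union>n. Om n) = UNIV"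
    using open_exhaustion by metis
  interpret sigma_algebra UNIV "sigma_sets UNIV ?G" by (rule sigma_algebra_sigma_sets) auto
  have "U \<in> sigma_sets UNIV ?G" if U: "open U" for U
  proof -
    have "U \<inter> Om n \<in> sigma_sets UNIV ?G" for n
      using U Om(1,2)[of n] emeasure_mono[of "U \<inter> Om n" "Om n" M] by (auto intro!: sigma_sets.Basic intro: le_less_trans)
    then have "(\<Union>n. U \<inter> Om n) \<in> sigma_sets UNIV ?G" by (rule sigma_sets.Union)
    also have "(\<Union>n. U \<inter> Om n) = U" using Om(3) by auto
    finally show ?thesis .
  qed
  then have "sigma_sets UNIV {U. open U} \<subseteq> sigma_sets UNIV ?G" by (intro sigma_sets_mono) auto
  moreover have "sigma_sets UNIV ?G \<subseteq> sigma_sets UNIV {U. open U}" by (intro sigma_sets_mono') auto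
  ultimately show ?thesis by (auto simp: borel_def sets_measure_of)
qed

sublocale sigma_finite_measure M
proof
  obtain Om :: "nat \<Rightarrow> 'g set" where Om: "\<And>n. open (Om n)" "\<And>n. emeasure M (Om n) < \<infinity>" "(\<Union>n. Om n) = UNIV"
    using open_exhaustion by metis
  then show "\<exists>A. countable A \<and> A \<subseteq> sets M \<and> \<Union>A = space M \<and> (\<forall>a\<in>A. emeasure M a \<noteq> \<infinity>)"
    by (intro exI[of _ "range Om"]) (auto simp: less_top)
qed

lemma distr_shift: "distr M M (\<lambda>x. a + x) = M"
proof (rule measure_eqI)
  fix A assume "A \<in> sets (distr M M (\<lambda>x. a + x))"
  then have A: "A \<in> sets borel" by simp
  have "(\<lambda>x. a + x) -` A = (\<lambda>y. - a + y) ` A"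
    by (auto simp: image_iff add.assoc[symmetric] intro!: bexI[of _ "a + _"])
  then show "emeasure (distr M M (\<lambda>x. a + x)) A = emeasure M A"
    using A haar by (subst emeasure_distr) (auto simp: haar_measure_def)
qed simp

lemma nn_integral_shift:
  assumes [measurable]: "f \<in> borel_measurable M"
  shows "(\<integral>\<^sup>+x. f (a + x) \<partial>M) = (\<integral>\<^sup>+x. f x \<partial>M)"
  by (subst (2) distr_shift[of a, symmetric], subst nn_integral_distr) auto

lemma integral_shift:
  fixes f :: "'g \<Rightarrow> complex"
  assumes [measurable]: "f \<in> borel_measurable M"
  shows "(\<integral>x. f (a + x) \<partial>M) = (\<integral>x. f x \<partial>M)"
  by (subst (2) distr_shift[of a, symmetric], subst integral_distr) auto

lemma integrable_shift:
  fixes f :: "'g \<Rightarrow> complex"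
  assumes "integrable M f"
  shows "integrable M (\<lambda>x. f (a + x))"
  using assms by (subst (asm) distr_shift[of a, symmetric], subst (asm) integrable_distr_eq) auto

lemma E2_shift: "f \<in> borel_measurable M \<Longrightarrow> E2 M (\<lambda>x. f (a + x)) = E2 M f"
  unfolding E2_def by (rule nn_integral_shift[of "\<lambda>x. ennreal ((cmod (f x))\<^sup>2)"]) simp

lemma L2_shift:
  assumes "L2fun M f"
  shows L2fun_shift: "L2fun M (\<lambda>x. f (a + x))" and L2norm_shift: "L2norm M (\<lambda>x. f (a + x)) = L2norm M f"
proof -
  note [measurable] = L2fun_measurable[OF assms]
  show 1: "L2fun M (\<lambda>x. f (a + x))" using assms by (simp add: L2fun_iff E2_shift)
  show "L2norm M (\<lambda>x. f (a + x)) = L2norm M f"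
    using E2_shift[of f a] by (simp add: E2_eq_L2norm 1 assms)
qed

section \<open>The norm of the Fourier algebra\<close>

lemma conv_check_bound:
  assumes "L2fun M f" "L2fun M g"
  shows "cmod (conv_check M f g x) \<le> L2norm M f * L2norm M g"
  using L2_CS[OF assms(1) L2fun_shift[OF assms(2), of "-x"]] by (simp add: conv_check_def L2norm_shift assms)

lemma conv_check_integrable:
  "L2fun M f \<Longrightarrow> L2fun M g \<Longrightarrow> integrable M (\<lambda>y. f y * g (- x + y))"
  by (intro L2_mult_integrable L2fun_shift)

text \<open>Membership with a norm bound; the norm alone is a junk value outside the algebra.\<close>

definition fbound :: "('g \<Rightarrow> complex) \<Rightarrow> real \<Rightarrow> bool" where
  "fbound u c \<longleftrightarrow> u \<in> fourier_algebra M \<and> fourier_norm M u \<le> c"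

lemma fourier_norm_le_rep:
  assumes "fourier_rep M u f g"
  shows "fourier_norm M u \<le> (\<Sum>n. L2norm M (f n) * L2norm M (g n))"
  unfolding fourier_norm_def
  using assms by (intro cInf_lower) (auto intro!: bdd_belowI[of _ 0] suminf_nonneg simp: fourier_rep_def)

lemma fourier_norm_nonneg:
  assumes "u \<in> fourier_algebra M"
  shows "0 \<le> fourier_norm M u"
  unfolding fourier_norm_def
  using assms by (intro cInf_greatest) (auto intro!: suminf_nonneg simp: fourier_rep_def fourier_algebra_def)

lemma fboundI: "u \<in> fourier_algebra M \<Longrightarrow> fbound u (fourier_norm M u)"
  by (simp add: fbound_def)

lemma fbound_nonneg: "fbound u c \<Longrightarrow> 0 \<le> c"
  using fourier_norm_nonneg[of u] by (auto simp: fbound_def)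

lemma fbound_mono: "fbound u c \<Longrightarrow> c \<le> d \<Longrightarrow> fbound u d"
  by (auto simp: fbound_def)

lemma fbound_rep:
  assumes "fbound u c" "\<epsilon> > 0"
  obtains f g where "fourier_rep M u f g" "(\<Sum>n. L2norm M (f n) * L2norm M (g n)) < c + \<epsilon>"
proof -
  have 1: "fourier_norm M u < c + \<epsilon>" using assms by (simp add: fbound_def)
  have 2: "{\<Sum>n. L2norm M (f n) * L2norm M (g n) |f g. fourier_rep M u f g} \<noteq> {}"
    using assms by (auto simp: fbound_def fourier_algebra_def)
  from cInf_lessD[OF 2 1[unfolded fourier_norm_def]] show ?thesis using that by auto
qed

text \<open>Completeness of the Fourier algebra in series form: representations of the
  \<open>u k\<close> with geometrically small excess are merged along the Cantor enumeration. Later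
  infinite sums in the algebra go through this lemma.\<close>

lemma fbound_suminf:
  assumes u: "\<And>k. fbound (u k) (c k)" and c: "summable c" and v: "\<And>x. (\<lambda>k. u k x) sums v x"
  shows "fbound v (suminf c)"
proof -
  have *: "\<exists>f g. fourier_rep M v f g \<and> (\<Sum>n. L2norm M (f n) * L2norm M (g n)) \<le> suminf c + \<epsilon>" if "\<epsilon> > 0" for \<epsilon>
  proof -
    \<comment> \<open>The excesses add up to exactly \<open>\<epsilon>\<close>.\<close>
    define d where "d k = c k + \<epsilon> * (1/2)^Suc k" for k
    have "\<exists>f g. fourier_rep M (u k) f g \<and> (\<Sum>n. L2norm M (f n) * L2norm M (g n)) < d k" for k
    proof -
      have pos: "\<epsilon> * (1/2)^Suc k > 0" using \<open>\<epsilon> > 0\<close> by simp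
      show ?thesis by (rule fbound_rep[OF u[of k] pos]) (auto simp: d_def)
    qed
    then obtain f g where fg: "\<And>k. fourier_rep M (u k) (f k) (g k)"
      "\<And>k. (\<Sum>n. L2norm M (f k n) * L2norm M (g k n)) < d k" by metis
    define b where "b k n = L2norm M (f k n) * L2norm M (g k n)" for k n
    have L: "L2fun M (f k n)" "L2fun M (g k n)" and sb: "summable (b k)"
      and uk: "u k x = (\<Sum>n. conv_check M (f k n) (g k n) x)" for k n x
      using fg(1)[of k] unfolding fourier_rep_def b_def[abs_def] by auto
    have b0: "0 \<le> b k n" for k n by (simp add: b_def)
    have "(\<lambda>k. \<epsilon> * (1/2)^Suc k) sums (\<epsilon> * 1)" using power_half_series by (intro sums_mult)
    then have ds: "d sums (suminf c + \<epsilon>)" unfolding d_def using c by (intro sums_add) (auto simp: summable_sums)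
    have bd: "suminf (b k) \<le> d k" for k using fg(2)[of k] by (simp add: b_def[abs_def])
    have sbs: "summable (\<lambda>k. suminf (b k))"
      using bd sb b0 by (intro summable_comparison_test'[OF sums_summable[OF ds], of 0]) (auto simp: suminf_nonneg)
    define F where "F i = (case prod_decode i of (k, n) \<Rightarrow> f k n)" for i
    define G where "G i = (case prod_decode i of (k, n) \<Rightarrow> g k n)" for i
    have FG: "L2norm M (F i) * L2norm M (G i) = (case prod_decode i of (k, n) \<Rightarrow> b k n)" for i
      by (auto simp: F_def G_def b_def split: prod.split)
    have cFG: "conv_check M (F i) (G i) x = (case prod_decode i of (k, n) \<Rightarrow> conv_check M (f k n) (g k n) x)" for i x
      by (auto simp: F_def G_def split: prod.split)
    have cb: "cmod (conv_check M (f k n) (g k n) x) \<le> b k n" for k n x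
      unfolding b_def using L by (rule conv_check_bound)
    note S = sums_prod_decode[OF cb sb sbs]
    have "fourier_rep M v F G"
      unfolding fourier_rep_def
    proof (intro conjI allI)
      show "L2fun M (F n)" "L2fun M (G n)" for n using L by (auto simp: F_def G_def split: prod.split)
      show "summable (\<lambda>n. L2norm M (F n) * L2norm M (G n))" unfolding FG using S(1) by (rule sums_summable)
      show "v x = (\<Sum>n. conv_check M (F n) (G n) x)" for x
        unfolding cFG S(2) using v[of x] by (simp add: sums_iff uk)
    qed
    moreover have "(\<Sum>n. L2norm M (F n) * L2norm M (G n)) \<le> suminf c + \<epsilon>"
      unfolding FG using S(1) ds suminf_le[OF bd sbs sums_summable[OF ds]] by (simp add: sums_iff)
    ultimately show ?thesis by blast
  qed
  have "v \<in> fourier_algebra M" using *[of 1] by (auto simp: fourier_algebra_def)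
  moreover have "fourier_norm M v \<le> suminf c"
  proof (rule field_le_epsilon)
    fix \<epsilon> :: real assume "\<epsilon> > 0"
    from *[OF this] show "fourier_norm M v \<le> suminf c + \<epsilon>" using fourier_norm_le_rep by fastforce
  qed
  ultimately show ?thesis by (simp add: fbound_def)
qed

lemma fbound_conv_check:
  assumes "L2fun M f" "L2fun M g"
  shows "fbound (conv_check M f g) (L2norm M f * L2norm M g)"
proof -
  define F where "F n = (if n = 0 then f else (\<lambda>x. 0))" for n :: nat
  define G where "G n = (if n = 0 then g else (\<lambda>x. 0))" for n :: nat
  have 1: "(\<lambda>n. L2norm M (F n) * L2norm M (G n)) sums (L2norm M f * L2norm M g)"
    using sums_If_finite_set[of "{0::nat}" "\<lambda>n. L2norm M f * L2norm M g"]
    by (auto simp: F_def G_def if_distrib if_distribR cong: if_cong elim!: back_subst[of "\<lambda>s. s sums _"])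
  have 2: "(\<lambda>n. conv_check M (F n) (G n) x) sums conv_check M f g x" for x
  proof -
    have "(\<lambda>n. conv_check M (F n) (G n) x) = (\<lambda>n. if n \<in> {0} then conv_check M f g x else 0)"
      by (auto simp: F_def G_def conv_check_def fun_eq_iff)
    then show ?thesis using sums_If_finite_set[of "{0::nat}" "\<lambda>n. conv_check M f g x"] by simp
  qed
  have "fourier_rep M (conv_check M f g) F G"
    unfolding fourier_rep_def using assms 1 2 by (auto simp: sums_iff F_def G_def)
  then show ?thesis using fourier_norm_le_rep 1 by (fastforce simp: fbound_def fourier_algebra_def sums_iff)
qed

lemma fbound_scale:
  assumes "fbound u c" shows "fbound (\<lambda>x. a * u x) (cmod a * c)"
proof -
  obtain f g where fg: "fourier_rep M u f g" using assms by (auto simp: fbound_def fourier_algebra_def)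
  have rep: "fourier_rep M (\<lambda>x. a * u x) (\<lambda>n x. a * f n x) g" if fg: "fourier_rep M u f g" for f g
  proof -
    have L: "L2fun M (f n)" "L2fun M (g n)" for n using fg by (auto simp: fourier_rep_def)
    have s: "summable (\<lambda>n. L2norm M (f n) * L2norm M (g n))" using fg by (simp add: fourier_rep_def)
    have "summable (\<lambda>n. conv_check M (f n) (g n) x)" for x
      using conv_check_bound[OF L] by (intro summable_comparison_test'[OF s, of 0]) auto
    moreover have "conv_check M (\<lambda>x. a * f n x) (g n) x = a * conv_check M (f n) (g n) x" for n x
      by (simp add: conv_check_def mult.assoc)
    ultimately show ?thesis
      using fg by (auto simp: fourier_rep_def L2_scale L2fun_scale mult.assoc suminf_mult)
  qed
  have "fourier_norm M (\<lambda>x. a * u x) \<le> cmod a * c"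
  proof (rule field_le_epsilon)
    fix \<epsilon> :: real assume e: "\<epsilon> > 0"
    \<comment> \<open>The summand 1 guards against division by zero when \<open>a = 0\<close>; the
      same guard recurs in later tolerances.\<close>
    define d where "d = \<epsilon> / (cmod a + 1)"
    have d: "d > 0" using e by (simp add: d_def add_nonneg_pos)
    obtain f g where fg: "fourier_rep M u f g" "(\<Sum>n. L2norm M (f n) * L2norm M (g n)) < c + d"
      using fbound_rep[OF assms d] .
    have "fourier_norm M (\<lambda>x. a * u x) \<le> (\<Sum>n. L2norm M (\<lambda>x. a * f n x) * L2norm M (g n))"
      by (rule fourier_norm_le_rep[OF rep[OF fg(1)]])
    also have "\<dots> = cmod a * (\<Sum>n. L2norm M (f n) * L2norm M (g n))"
      using fg(1) by (simp add: fourier_rep_def L2norm_scale mult.assoc suminf_mult)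
    also have "\<dots> \<le> cmod a * (c + d)" using fg(2) by (intro mult_left_mono) auto
    also have "\<dots> \<le> cmod a * c + \<epsilon>"
    proof -
      have "cmod a + 1 \<noteq> 0" using norm_ge_zero[of a] by linarith
      then have "(cmod a + 1) * d = \<epsilon>" unfolding d_def by simp
      then have "cmod a * d \<le> \<epsilon>" using d by (simp add: algebra_simps)
      then show ?thesis by (simp add: algebra_simps)
    qed
    finally show "fourier_norm M (\<lambda>x. a * u x) \<le> cmod a * c + \<epsilon>" .
  qed
  then show ?thesis using rep[OF fg] by (auto simp: fbound_def fourier_algebra_def)
qed

lemma fbound_zero: "fbound (\<lambda>x. 0) 0"
  using fbound_conv_check[OF L2fun_zero L2fun_zero] by (simp add: conv_check_def[abs_def])

lemma fbound_sum:
  assumes "\<And>i. i < n \<Longrightarrow> fbound (u i) (c i)"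
  shows "fbound (\<lambda>x. \<Sum>i<(n::nat). u i x) (\<Sum>i<n. c i)"
proof -
  have "fbound (\<lambda>x. \<Sum>i<n. u i x) (suminf (\<lambda>i. if i \<in> {..<n} then c i else 0))"
  proof (rule fbound_suminf)
    show "fbound (\<lambda>x. if k \<in> {..<n} then u k x else 0) (if k \<in> {..<n} then c k else 0)" for k
      using assms[of k] fbound_zero by auto
    show "(\<lambda>k. if k \<in> {..<n} then u k x else 0) sums (\<Sum>i<n. u i x)" for x
      by (rule sums_If_finite_set) simp
  qed (simp only: summable_If_finite_set finite_lessThan)
  then show ?thesis using sums_If_finite_set[of "{..<n}" c] by (simp add: sums_iff)
qed

lemma fbound_add:
  assumes "fbound u c" "fbound v d" shows "fbound (\<lambda>x. u x + v x) (c + d)"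
  using fbound_sum[of 2 "\<lambda>i. if i = 0 then u else v" "\<lambda>i. if i = 0 then c else d"] assms
  by (simp add: numeral_2_eq_2)

lemma fbound_diff:
  assumes "fbound u c" "fbound v d" shows "fbound (\<lambda>x. u x - v x) (c + d)"
  using fbound_add[OF assms(1) fbound_scale[OF assms(2), of "-1"]] by simp

lemma fbound_rep_sums:
  assumes "u \<in> fourier_algebra M"
  obtains f g where "\<And>n. L2fun M (f n)" "\<And>n. L2fun M (g n)" "summable (\<lambda>n. L2norm M (f n) * L2norm M (g n))"
    "\<And>x. (\<lambda>n. conv_check M (f n) (g n) x) sums u x"
proof -
  obtain f g where fg: "fourier_rep M u f g" using assms by (auto simp: fourier_algebra_def)
  then have L: "L2fun M (f n)" "L2fun M (g n)" and s: "summable (\<lambda>n. L2norm M (f n) * L2norm M (g n))" for n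
    by (auto simp: fourier_rep_def)
  have "summable (\<lambda>n. conv_check M (f n) (g n) x)" for x
    using conv_check_bound[OF L] by (intro summable_comparison_test'[OF s, of 0]) auto
  then have "(\<lambda>n. conv_check M (f n) (g n) x) sums u x" for x
    using fg by (auto simp: fourier_rep_def sums_iff)
  then show ?thesis using that L s by blast
qed

lemma fbound_sup:
  assumes "fbound u c" shows "cmod (u x) \<le> c"
proof (rule field_le_epsilon)
  fix \<epsilon> :: real assume "\<epsilon> > 0"
  then obtain f g where fg: "fourier_rep M u f g" "(\<Sum>n. L2norm M (f n) * L2norm M (g n)) < c + \<epsilon>"
    using fbound_rep[OF assms] by blast
  then have L: "L2fun M (f n)" "L2fun M (g n)" and s: "summable (\<lambda>n. L2norm M (f n) * L2norm M (g n))" for n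
    by (auto simp: fourier_rep_def)
  have cs: "summable (\<lambda>n. cmod (conv_check M (f n) (g n) x))"
    using conv_check_bound[OF L] by (intro summable_comparison_test'[OF s, of 0]) auto
  have "cmod (u x) \<le> (\<Sum>n. cmod (conv_check M (f n) (g n) x))"
    using fg summable_norm[OF cs] by (auto simp: fourier_rep_def)
  also have "\<dots> \<le> (\<Sum>n. L2norm M (f n) * L2norm M (g n))"
    by (intro suminf_le conv_check_bound L cs s)
  finally show "cmod (u x) \<le> c + \<epsilon>" using fg(2) by simp
qed

lemma conv_check_measurable:
  assumes [measurable]: "f \<in> borel_measurable M" "g \<in> borel_measurable M"
  shows "conv_check M f g \<in> borel_measurable borel"
  unfolding conv_check_def[abs_def] by measurable

lemma fourier_algebra_measurable:
  assumes "u \<in> fourier_algebra M" shows "u \<in> borel_measurable borel"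
proof -
  obtain f g where fg: "\<And>n. L2fun M (f n)" "\<And>n. L2fun M (g n)" "\<And>x. (\<lambda>n. conv_check M (f n) (g n) x) sums u x"
    using fbound_rep_sums[OF assms] by metis
  have "(\<lambda>x. \<Sum>n. conv_check M (f n) (g n) x) \<in> borel_measurable borel"
    using fg conv_check_measurable L2fun_measurable by (intro borel_measurable_suminf) blast
  then show ?thesis using fg(3) by (simp add: sums_iff)
qed

end

section \<open>Square-integrable functions on products\<close>

text \<open>Lying in the closure of \<open>D\<close> is a property stable under sums, scalars and
  limits, so \<open>L2_dense_induct\<close> applies to it.\<close>

lemma L2_dense:
  assumes f: "L2fun X f"
    and gen: "sets X = sigma_sets (space X) G" and Gs: "G \<subseteq> Pow (space X)" and stab: "Int_stable G"
    and fin: "\<And>A. A \<in> G \<Longrightarrow> emeasure X A < \<infinity>"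
    and om: "range Om \<subseteq> G" "incseq Om" "(\<Union>i. Om i) = space X"
    and DL: "\<And>d. D d \<Longrightarrow> L2fun X d"
    and ind: "\<And>A. A \<in> G \<Longrightarrow> D (indicator A)"
    and add: "\<And>f g. D f \<Longrightarrow> D g \<Longrightarrow> D (\<lambda>x. f x + g x)"
    and scale: "\<And>c f. D f \<Longrightarrow> D (\<lambda>x. c * f x)"
    and e: "\<epsilon> > 0"
  obtains d where "D d" "L2norm X (\<lambda>x. f x - d x) < \<epsilon>"
proof -
  define P where "P f \<longleftrightarrow> (\<forall>\<epsilon>>0. \<exists>d. D d \<and> L2norm X (\<lambda>x. f x - d x) < \<epsilon>)" for f
  have "P f"
  proof (rule L2_dense_induct[OF f gen Gs stab fin om])
    fix A assume "A \<in> G"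
    from ind[OF this] show "P (indicator A)" unfolding P_def by (auto intro!: exI[of _ "indicator A"])
  next
    fix f g assume L: "L2fun X f" "L2fun X g" and P: "P f" "P g"
    show "P (\<lambda>x. f x + g x)" unfolding P_def
    proof (intro allI impI)
      fix \<epsilon> :: real assume "\<epsilon> > 0"
      then have "\<epsilon> / 2 > 0" by simp
      with P obtain d1 d2 where d: "D d1" "D d2" "L2norm X (\<lambda>x. f x - d1 x) < \<epsilon> / 2" "L2norm X (\<lambda>x. g x - d2 x) < \<epsilon> / 2"
        unfolding P_def by meson
      have "L2norm X (\<lambda>x. (f x - d1 x) + (g x - d2 x)) \<le> L2norm X (\<lambda>x. f x - d1 x) + L2norm X (\<lambda>x. g x - d2 x)"
        by (intro L2norm_triangle L2fun_diff L DL[OF d(1)] DL[OF d(2)])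
      also have "\<dots> < \<epsilon>" using d by simp
      finally have "L2norm X (\<lambda>x. f x + g x - (d1 x + d2 x)) < \<epsilon>" by (simp add: algebra_simps)
      with add[OF d(1,2)] show "\<exists>d. D d \<and> L2norm X (\<lambda>x. f x + g x - d x) < \<epsilon>" by blast
    qed
  next
    fix c f assume L: "L2fun X f" and P: "P f"
    show "P (\<lambda>x. c * f x)" unfolding P_def
    proof (intro allI impI)
      fix \<epsilon> :: real assume e: "\<epsilon> > 0"
      have c1: "cmod c + 1 > 0" using norm_ge_zero[of c] by linarith
      then have e': "\<epsilon> / (cmod c + 1) > 0" using e by simp
      then obtain d where d: "D d" "L2norm X (\<lambda>x. f x - d x) < \<epsilon> / (cmod c + 1)" using P unfolding P_def by meson
      have "L2norm X (\<lambda>x. c * f x - c * d x) = cmod c * L2norm X (\<lambda>x. f x - d x)"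
        using L2norm_scale[OF L2fun_diff[OF L DL[OF d(1)]], of c] by (simp add: algebra_simps)
      also have "\<dots> \<le> cmod c * (\<epsilon> / (cmod c + 1))" using d by (intro mult_left_mono) auto
      also have "\<dots> < (cmod c + 1) * (\<epsilon> / (cmod c + 1))" using e' by (intro mult_strict_right_mono) auto
      also have "\<dots> = \<epsilon>" using c1 by simp
      finally show "\<exists>d. D d \<and> L2norm X (\<lambda>x. c * f x - d x) < \<epsilon>" using scale[OF d(1), of c] by blast
    qed
  next
    fix f assume L: "L2fun X f" and A: "\<And>\<epsilon>. \<epsilon> > 0 \<Longrightarrow> \<exists>g. L2fun X g \<and> P g \<and> L2norm X (\<lambda>x. f x - g x) < \<epsilon>"
    show "P f" unfolding P_def
    proof (intro allI impI)
      fix \<epsilon> :: real assume "\<epsilon> > 0"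
      then have e2: "\<epsilon> / 2 > 0" by simp
      from A[OF this] obtain g where g: "L2fun X g" "P g" "L2norm X (\<lambda>x. f x - g x) < \<epsilon> / 2" by blast
      then obtain d where d: "D d" "L2norm X (\<lambda>x. g x - d x) < \<epsilon> / 2" using e2 unfolding P_def by meson
      have "L2norm X (\<lambda>x. f x - d x) < \<epsilon>"
        using L2norm_triangle3[OF L g(1) DL[OF d(1)]] g d by linarith
      then show "\<exists>d. D d \<and> L2norm X (\<lambda>x. f x - d x) < \<epsilon>" using d by blast
    qed
  qed
  then show ?thesis using e that unfolding P_def by blast
qed

context pair_sigma_finite
begin

lemma E2_fst:
  assumes [measurable]: "F \<in> borel_measurable (M1 \<Otimes>\<^sub>M M2)"
  shows "E2 (M1 \<Otimes>\<^sub>M M2) F = (\<integral>\<^sup>+x. E2 M2 (\<lambda>y. F (x, y)) \<partial>M1)"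
  unfolding E2_def by (subst M2.nn_integral_fst[symmetric]) auto

lemma E2_snd:
  assumes [measurable]: "F \<in> borel_measurable (M1 \<Otimes>\<^sub>M M2)"
  shows "E2 (M1 \<Otimes>\<^sub>M M2) F = (\<integral>\<^sup>+y. E2 M1 (\<lambda>x. F (x, y)) \<partial>M2)"
  unfolding E2_def by (subst nn_integral_snd[symmetric]) auto

lemma L2_tensor:
  assumes f: "L2fun M1 f" and g: "L2fun M2 g"
  shows L2fun_tensor: "L2fun (M1 \<Otimes>\<^sub>M M2) (\<lambda>p. f (fst p) * g (snd p))"
    and L2norm_tensor: "L2norm (M1 \<Otimes>\<^sub>M M2) (\<lambda>p. f (fst p) * g (snd p)) \<le> L2norm M1 f * L2norm M2 g"
proof -
  note [measurable] = L2fun_measurable[OF f] L2fun_measurable[OF g]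
  have m: "(\<lambda>p. f (fst p) * g (snd p)) \<in> borel_measurable (M1 \<Otimes>\<^sub>M M2)" by measurable
  have "E2 (M1 \<Otimes>\<^sub>M M2) (\<lambda>p. f (fst p) * g (snd p)) = (\<integral>\<^sup>+x. ennreal ((cmod (f x))\<^sup>2) * E2 M2 g \<partial>M1)"
    unfolding E2_fst[OF m] unfolding E2_def
    by (simp add: norm_mult power_mult_distrib ennreal_mult nn_integral_cmult)
  also have "\<dots> = E2 M1 f * E2 M2 g" unfolding E2_def by (simp add: nn_integral_multc)
  also have "\<dots> \<le> ennreal ((L2norm M1 f * L2norm M2 g)\<^sup>2)"
    using f g by (simp add: E2_eq_L2norm power_mult_distrib ennreal_mult)
  finally show "L2fun (M1 \<Otimes>\<^sub>M M2) (\<lambda>p. f (fst p) * g (snd p))"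
    "L2norm (M1 \<Otimes>\<^sub>M M2) (\<lambda>p. f (fst p) * g (snd p)) \<le> L2norm M1 f * L2norm M2 g"
    using L2I[OF m] by simp_all
qed

text \<open>Rectangles with sides of finite measure are stable under intersection, and they still
  generate the product sigma-algebra, as cutting with an exhaustion of each factor shows.\<close>

lemma L2_dense_rect:
  assumes f: "L2fun (M1 \<Otimes>\<^sub>M M2) f"
    and DL: "\<And>d. D d \<Longrightarrow> L2fun (M1 \<Otimes>\<^sub>M M2) d"
    and ind: "\<And>A B. A \<in> sets M1 \<Longrightarrow> emeasure M1 A < \<infinity> \<Longrightarrow> B \<in> sets M2 \<Longrightarrow> emeasure M2 B < \<infinity> \<Longrightarrow> D (\<lambda>p. indicator A (fst p) * indicator B (snd p))"
    and add: "\<And>f g. D f \<Longrightarrow> D g \<Longrightarrow> D (\<lambda>x. f x + g x)"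
    and scale: "\<And>c f. D f \<Longrightarrow> D (\<lambda>x. c * f x)"
    and e: "\<epsilon> > 0"
  obtains d where "D d" "L2norm (M1 \<Otimes>\<^sub>M M2) (\<lambda>x. f x - d x) < \<epsilon>"
proof -
  define G where "G = {A \<times> B | A B. A \<in> sets M1 \<and> emeasure M1 A < \<infinity> \<and> B \<in> sets M2 \<and> emeasure M2 B < \<infinity>}"
  obtain A1 :: "nat \<Rightarrow> 'a set" where A1: "range A1 \<subseteq> sets M1" "(\<Union>i. A1 i) = space M1" "\<And>i. emeasure M1 (A1 i) \<noteq> \<infinity>" "incseq A1"
    using M1.sigma_finite_incseq by blast
  obtain A2 :: "nat \<Rightarrow> 'b set" where A2: "range A2 \<subseteq> sets M2" "(\<Union>i. A2 i) = space M2" "\<And>i. emeasure M2 (A2 i) \<noteq> \<infinity>" "incseq A2"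
    using M2.sigma_finite_incseq by blast
  define Om where "Om i = A1 i \<times> A2 i" for i
  have S: "A1 i \<in> sets M1" "A2 i \<in> sets M2" for i using A1 A2 by auto
  have F: "emeasure M1 (A1 i) < \<infinity>" "emeasure M2 (A2 i) < \<infinity>" for i using A1(3) A2(3) by (auto simp: less_top)
  have "Om i \<in> G" for i unfolding Om_def G_def using S[of i] F[of i] by blast
  then have OmG: "range Om \<subseteq> G" by blast
  have Ominc: "incseq Om" unfolding Om_def incseq_def
    using incseqD[OF A1(4)] incseqD[OF A2(4)] by (intro allI impI Sigma_mono)
  have OmU: "(\<Union>i. Om i) = space (M1 \<Otimes>\<^sub>M M2)"
  proof -
    have "(a, b) \<in> (\<Union>i. Om i)" if "a \<in> space M1" "b \<in> space M2" for a b
    proof -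
      from that have "a \<in> (\<Union>i. A1 i)" "b \<in> (\<Union>i. A2 i)" using A1(2) A2(2) by auto
      then obtain i j where "a \<in> A1 i" "b \<in> A2 j" by blast
      then have "a \<in> A1 (max i j)" "b \<in> A2 (max i j)"
        using incseqD[OF A1(4), of i "max i j"] incseqD[OF A2(4), of j "max i j"] by auto
      then have "(a, b) \<in> Om (max i j)" by (simp add: Om_def)
      then show ?thesis by blast
    qed
    moreover have "(\<Union>i. Om i) \<subseteq> space M1 \<times> space M2" using A1(2) A2(2) by (auto simp: Om_def)
    ultimately show ?thesis by (auto simp: space_pair_measure)
  qed
  have GP: "G \<subseteq> Pow (space (M1 \<Otimes>\<^sub>M M2))" by (auto simp: G_def space_pair_measure dest: sets.sets_into_space)
  have stab: "Int_stable G"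
  proof (rule Int_stableI)
    fix a b assume "a \<in> G" "b \<in> G"
    then obtain A B A' B' where *: "a = A \<times> B" "b = A' \<times> B'" "A \<in> sets M1" "A' \<in> sets M1" "B \<in> sets M2" "B' \<in> sets M2"
      "emeasure M1 A < \<infinity>" "emeasure M2 B < \<infinity>" by (auto simp: G_def)
    have "emeasure M1 (A \<inter> A') < \<infinity>" "emeasure M2 (B \<inter> B') < \<infinity>"
      using emeasure_mono[of "A \<inter> A'" A M1] emeasure_mono[of "B \<inter> B'" B M2] * by (auto intro: le_less_trans)
    moreover have "a \<inter> b = (A \<inter> A') \<times> (B \<inter> B')" using * by auto
    ultimately show "a \<inter> b \<in> G" using * by (auto simp: G_def)
  qed
  have gen: "sets (M1 \<Otimes>\<^sub>M M2) = sigma_sets (space (M1 \<Otimes>\<^sub>M M2)) G"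
  proof
    interpret G: sigma_algebra "space (M1 \<Otimes>\<^sub>M M2)" "sigma_sets (space (M1 \<Otimes>\<^sub>M M2)) G"
      using GP by (rule sigma_algebra_sigma_sets)
    have "A \<times> B \<in> sigma_sets (space (M1 \<Otimes>\<^sub>M M2)) G" if AB: "A \<in> sets M1" "B \<in> sets M2" for A B
    proof -
      have "(A \<inter> A1 i) \<times> (B \<inter> A2 i) \<in> G" for i
      proof -
        have "emeasure M1 (A \<inter> A1 i) < \<infinity>" "emeasure M2 (B \<inter> A2 i) < \<infinity>"
          using S[of i] F[of i] emeasure_mono[of "A \<inter> A1 i" "A1 i" M1] emeasure_mono[of "B \<inter> A2 i" "A2 i" M2]
          by (auto intro: le_less_trans)
        then show ?thesis unfolding G_def using AB S[of i] by blast
      qed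
      then have "(\<Union>i. (A \<inter> A1 i) \<times> (B \<inter> A2 i)) \<in> sigma_sets (space (M1 \<Otimes>\<^sub>M M2)) G"
        by (intro sigma_sets.Union sigma_sets.Basic)
      also have "(\<Union>i. (A \<inter> A1 i) \<times> (B \<inter> A2 i)) = (A \<times> B) \<inter> (\<Union>i. Om i)" by (auto simp: Om_def)
      also have "\<dots> = A \<times> B" unfolding OmU using AB by (auto simp: space_pair_measure dest: sets.sets_into_space)
      finally show ?thesis .
    qed
    then show "sets (M1 \<Otimes>\<^sub>M M2) \<subseteq> sigma_sets (space (M1 \<Otimes>\<^sub>M M2)) G"
      unfolding sets_pair_measure space_pair_measure by (intro sigma_sets_mono) auto
    show "sigma_sets (space (M1 \<Otimes>\<^sub>M M2)) G \<subseteq> sets (M1 \<Otimes>\<^sub>M M2)"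
      by (intro sets.sigma_sets_subset) (auto simp: G_def)
  qed
  show ?thesis
  proof (rule L2_dense[where D=D, OF f gen GP stab _ OmG Ominc OmU DL])
    show "emeasure (M1 \<Otimes>\<^sub>M M2) A < \<infinity>" if "A \<in> G" for A
      using that by (auto simp: G_def M2.emeasure_pair_measure_Times ennreal_mult_less_top)
    show "D (indicator A)" if "A \<in> G" for A
    proof -
      from that obtain A' B where *: "A = A' \<times> B" "A' \<in> sets M1" "emeasure M1 A' < \<infinity>" "B \<in> sets M2" "emeasure M2 B < \<infinity>"
        by (auto simp: G_def)
      have "(\<lambda>p. indicator A' (fst p) * indicator B (snd p)) = (indicator A :: _ \<Rightarrow> complex)"
        by (auto simp: * indicator_def fun_eq_iff)
      with ind[OF *(2-5)] show ?thesis by simp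
    qed
  qed (use add scale e that in auto)
qed

lemma integral_tensor:
  fixes f :: "'a \<Rightarrow> complex" and g :: "'b \<Rightarrow> complex"
  assumes f: "integrable M1 f" and g: "integrable M2 g"
  shows integrable_tensor: "integrable (M1 \<Otimes>\<^sub>M M2) (\<lambda>p. f (fst p) * g (snd p))"
    and "(\<integral>p. f (fst p) * g (snd p) \<partial>(M1 \<Otimes>\<^sub>M M2)) = (\<integral>x. f x \<partial>M1) * (\<integral>y. g y \<partial>M2)"
proof -
  note [measurable] = borel_measurable_integrable[OF f] borel_measurable_integrable[OF g]
  have "(\<integral>\<^sup>+p. ennreal (cmod (f (fst p) * g (snd p))) \<partial>(M1 \<Otimes>\<^sub>M M2)) = (\<integral>\<^sup>+x. \<integral>\<^sup>+y. ennreal (cmod (f x)) * ennreal (cmod (g y)) \<partial>M2 \<partial>M1)"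
    by (subst M2.nn_integral_fst[symmetric]) (auto simp: norm_mult ennreal_mult)
  also have "\<dots> = (\<integral>\<^sup>+x. ennreal (cmod (f x)) \<partial>M1) * (\<integral>\<^sup>+y. ennreal (cmod (g y)) \<partial>M2)"
    by (simp add: nn_integral_cmult nn_integral_multc)
  also have "\<dots> < \<infinity>" using f g unfolding integrable_iff_bounded by (simp add: ennreal_mult_less_top)
  finally show 1: "integrable (M1 \<Otimes>\<^sub>M M2) (\<lambda>p. f (fst p) * g (snd p))"
    unfolding integrable_iff_bounded by simp
  show "(\<integral>p. f (fst p) * g (snd p) \<partial>(M1 \<Otimes>\<^sub>M M2)) = (\<integral>x. f x \<partial>M1) * (\<integral>y. g y \<partial>M2)"
    using integral_fst'[OF 1] by simp
qed

end

section \<open>Coefficients of multiples of the regular representation\<close>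

context lcsc_haar
begin

text \<open>A coefficient of the left regular representation tensored with the trivial
  representation on the square-integrable functions on \<open>S\<close>; the second vector is left
  unconjugated, as in \<open>conv_check\<close>. The space \<open>S\<close> accounts for the
  multiplicity.\<close>

definition dcoef :: "'s measure \<Rightarrow> ('g \<times> 's \<Rightarrow> complex) \<Rightarrow> ('g \<times> 's \<Rightarrow> complex) \<Rightarrow> 'g \<Rightarrow> complex" where
  "dcoef S F G x = (\<integral>p. F p * G (- x + fst p, snd p) \<partial>(M \<Otimes>\<^sub>M S))"

lemma pair_sigma_finite_M: "sigma_finite_measure S \<Longrightarrow> pair_sigma_finite M S"
  unfolding pair_sigma_finite_def using sigma_finite_measure_axioms by blast

lemma E2_pair_shift:
  assumes S: "sigma_finite_measure S" and [measurable]: "G \<in> borel_measurable (M \<Otimes>\<^sub>M S)"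
  shows "E2 (M \<Otimes>\<^sub>M S) (\<lambda>p. G (a + fst p, snd p)) = E2 (M \<Otimes>\<^sub>M S) G"
proof -
  interpret pair_sigma_finite M S using S by (rule pair_sigma_finite_M)
  have m: "(\<lambda>p. G (a + fst p, snd p)) \<in> borel_measurable (M \<Otimes>\<^sub>M S)" by measurable
  have "E2 (M \<Otimes>\<^sub>M S) (\<lambda>p. G (a + fst p, snd p)) = (\<integral>\<^sup>+s. E2 M (\<lambda>y. G (a + y, s)) \<partial>S)"
    by (subst E2_snd[OF m]) simp
  also have "\<dots> = (\<integral>\<^sup>+s. E2 M (\<lambda>y. G (y, s)) \<partial>S)"
    by (intro nn_integral_cong E2_shift) measurable
  finally show ?thesis by (simp add: E2_snd)
qed

lemma L2_pair_shift:
  assumes S: "sigma_finite_measure S" and G: "L2fun (M \<Otimes>\<^sub>M S) G"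
  shows L2fun_pair_shift: "L2fun (M \<Otimes>\<^sub>M S) (\<lambda>p. G (a + fst p, snd p))"
    and L2norm_pair_shift: "L2norm (M \<Otimes>\<^sub>M S) (\<lambda>p. G (a + fst p, snd p)) = L2norm (M \<Otimes>\<^sub>M S) G"
proof -
  note [measurable] = L2fun_measurable[OF G]
  show 1: "L2fun (M \<Otimes>\<^sub>M S) (\<lambda>p. G (a + fst p, snd p))"
    using G by (simp add: L2fun_iff E2_pair_shift[OF S])
  show "L2norm (M \<Otimes>\<^sub>M S) (\<lambda>p. G (a + fst p, snd p)) = L2norm (M \<Otimes>\<^sub>M S) G"
    using E2_pair_shift[OF S L2fun_measurable[OF G], of a] by (simp add: E2_eq_L2norm 1 G)
qed

lemma dcoef_integrable:
  assumes "sigma_finite_measure S" "L2fun (M \<Otimes>\<^sub>M S) F" "L2fun (M \<Otimes>\<^sub>M S) G"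
  shows "integrable (M \<Otimes>\<^sub>M S) (\<lambda>p. F p * G (a + fst p, snd p))"
  using assms by (intro L2_mult_integrable L2fun_pair_shift)

lemma dcoef_bound:
  assumes "sigma_finite_measure S" "L2fun (M \<Otimes>\<^sub>M S) F" "L2fun (M \<Otimes>\<^sub>M S) G"
  shows "cmod (dcoef S F G x) \<le> L2norm (M \<Otimes>\<^sub>M S) F * L2norm (M \<Otimes>\<^sub>M S) G"
  using L2_CS[OF assms(2) L2fun_pair_shift[OF assms(1,3), of "-x"]]
  by (simp add: dcoef_def L2norm_pair_shift assms)

lemma dcoef_diff_left:
  assumes "sigma_finite_measure S" "L2fun (M \<Otimes>\<^sub>M S) F" "L2fun (M \<Otimes>\<^sub>M S) F'" "L2fun (M \<Otimes>\<^sub>M S) G"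
  shows "dcoef S (\<lambda>p. F p - F' p) G x = dcoef S F G x - dcoef S F' G x"
  unfolding dcoef_def left_diff_distrib
  using assms by (intro Bochner_Integration.integral_diff dcoef_integrable)

lemma dcoef_diff_right:
  assumes "sigma_finite_measure S" "L2fun (M \<Otimes>\<^sub>M S) F" "L2fun (M \<Otimes>\<^sub>M S) G" "L2fun (M \<Otimes>\<^sub>M S) G'"
  shows "dcoef S F (\<lambda>p. G p - G' p) x = dcoef S F G x - dcoef S F G' x"
  unfolding dcoef_def right_diff_distrib
  using assms by (intro Bochner_Integration.integral_diff dcoef_integrable)

text \<open>The index 0 is reserved for the part where the function vanishes.\<close>

definition step_data :: "'s measure \<Rightarrow> ('s \<Rightarrow> nat) \<Rightarrow> nat \<Rightarrow> bool" where
  "step_data S h k \<longleftrightarrow> h \<in> measurable S (count_space UNIV) \<and> (\<forall>s. h s \<le> k) \<and>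
     (\<forall>i. emeasure S (h -` {Suc i} \<inter> space S) < \<infinity>)"

definition step_family :: "(nat \<Rightarrow> 'g \<Rightarrow> complex) \<Rightarrow> bool" where
  "step_family \<Phi> \<longleftrightarrow> (\<forall>i. L2fun M (\<Phi> i)) \<and> \<Phi> 0 = (\<lambda>x. 0)"

text \<open>The labels \<open>h\<close> cut \<open>S\<close> into disjoint pieces. Disjointness
  makes the norm an exact weighted sum of squares, which is what allows
  \<open>fbound_dcoef_step\<close> to end with the product of the norms; overlapping tensors would
  not give it directly.\<close>

definition step_fun :: "'s measure \<Rightarrow> ('g \<times> 's \<Rightarrow> complex) \<Rightarrow> bool" where
  "step_fun S F \<longleftrightarrow> (\<exists>h k \<Phi>. step_data S h k \<and> step_family \<Phi> \<and> F = (\<lambda>p. \<Phi> (h (snd p)) (fst p)))"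

text \<open>Common refinement: labels are paired by \<open>prod_encode\<close>. The pair of zeros is
  encoded by 0, so the reserved label survives; any other pair has a nonzero component, whose piece
  has finite measure.\<close>

lemma step_fun_common:
  assumes "step_fun S F" "step_fun S G"
  obtains h k \<Phi> \<Gamma> where "step_data S h k" "step_family \<Phi>" "step_family \<Gamma>"
    "F = (\<lambda>p. \<Phi> (h (snd p)) (fst p))" "G = (\<lambda>p. \<Gamma> (h (snd p)) (fst p))"
proof -
  obtain h k \<Phi> where F: "step_data S h k" "step_family \<Phi>" "F = (\<lambda>p. \<Phi> (h (snd p)) (fst p))"
    using assms(1) by (auto simp: step_fun_def)
  obtain h' k' \<Gamma> where G: "step_data S h' k'" "step_family \<Gamma>" "G = (\<lambda>p. \<Gamma> (h' (snd p)) (fst p))"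
    using assms(2) by (auto simp: step_fun_def)
  define g where "g s = prod_encode (h s, h' s)" for s
  define l where "l = Max (prod_encode ` ({..k} \<times> {..k'}))"
  have mh[measurable]: "h \<in> measurable S (count_space UNIV)" and hk: "\<And>s. h s \<le> k"
    and hf: "\<And>i. emeasure S (h -` {Suc i} \<inter> space S) < \<infinity>" using F(1) by (auto simp: step_data_def)
  have mh'[measurable]: "h' \<in> measurable S (count_space UNIV)" and hk': "\<And>s. h' s \<le> k'"
    and hf': "\<And>i. emeasure S (h' -` {Suc i} \<inter> space S) < \<infinity>" using G(1) by (auto simp: step_data_def)
  have e00: "prod_encode (0, 0) = 0" by (simp add: prod_encode_def)
  have "step_data S g l"
    unfolding step_data_def
  proof (intro conjI allI)
    have "(\<lambda>s. (\<lambda>(a, b). prod_encode (a, b)) (h s, h' s)) \<in> measurable S (count_space UNIV)"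
      by measurable
    then show "g \<in> measurable S (count_space UNIV)" by (simp add: g_def[abs_def])
    show "g s \<le> l" for s unfolding g_def l_def using hk hk' by (intro Max_ge) auto
    fix i
    obtain a b where ab: "prod_decode (Suc i) = (a, b)" by fastforce
    then have ab': "Suc i = prod_encode (a, b)" by (metis prod_decode_inverse)
    have nz: "a \<noteq> 0 \<or> b \<noteq> 0" by (rule ccontr) (use e00 ab' in auto)
    have sub: "g -` {Suc i} \<inter> space S \<subseteq> h -` {a} \<inter> space S" "g -` {Suc i} \<inter> space S \<subseteq> h' -` {b} \<inter> space S"
      by (auto simp: g_def ab')
    have M: "h -` {a} \<inter> space S \<in> sets S" "h' -` {b} \<inter> space S \<in> sets S" by measurable
    from nz show "emeasure S (g -` {Suc i} \<inter> space S) < \<infinity>"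
    proof
      assume "a \<noteq> 0"
      then obtain j where "a = Suc j" by (cases a) auto
      then show ?thesis using emeasure_mono[OF sub(1) M(1)] hf[of j] by (auto intro: le_less_trans)
    next
      assume "b \<noteq> 0"
      then obtain j where "b = Suc j" by (cases b) auto
      then show ?thesis using emeasure_mono[OF sub(2) M(2)] hf'[of j] by (auto intro: le_less_trans)
    qed
  qed
  moreover have "prod_decode 0 = (0, 0)" using e00 by (metis prod_encode_inverse)
  then have "step_family (\<lambda>i. \<Phi> (fst (prod_decode i)))" "step_family (\<lambda>i. \<Gamma> (snd (prod_decode i)))"
    using F(2) G(2) by (auto simp: step_family_def)
  ultimately show ?thesis using F(3) G(3)
    by (intro that[of g l "\<lambda>i. \<Phi> (fst (prod_decode i))" "\<lambda>i. \<Gamma> (snd (prod_decode i))"]) (auto simp: g_def)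
qed

lemma step_fun_add:
  assumes "step_fun S F" "step_fun S G" shows "step_fun S (\<lambda>p. F p + G p)"
proof -
  obtain h k \<Phi> \<Gamma> where *: "step_data S h k" "step_family \<Phi>" "step_family \<Gamma>"
    "F = (\<lambda>p. \<Phi> (h (snd p)) (fst p))" "G = (\<lambda>p. \<Gamma> (h (snd p)) (fst p))"
    by (rule step_fun_common[OF assms])
  have "step_family (\<lambda>i x. \<Phi> i x + \<Gamma> i x)" using *(2,3) by (auto simp: step_family_def intro: L2fun_add)
  then show ?thesis unfolding step_fun_def using *
    by (intro exI[of _ h] exI[of _ k] exI[of _ "\<lambda>i x. \<Phi> i x + \<Gamma> i x"]) auto
qed

lemma step_fun_scale:
  assumes "step_fun S F" shows "step_fun S (\<lambda>p. c * F p)"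
proof -
  obtain h k \<Phi> where F: "step_data S h k" "step_family \<Phi>" "F = (\<lambda>p. \<Phi> (h (snd p)) (fst p))"
    using assms by (auto simp: step_fun_def)
  have "step_family (\<lambda>i x. c * \<Phi> i x)" using F(2) by (auto simp: step_family_def intro: L2fun_scale)
  then show ?thesis unfolding step_fun_def using F
    by (intro exI[of _ h] exI[of _ k] exI[of _ "\<lambda>i x. c * \<Phi> i x"]) auto
qed

lemma step_fun_indicator:
  assumes "A \<in> sets M" "emeasure M A < \<infinity>" "B \<in> sets S" "emeasure S B < \<infinity>"
  shows "step_fun S (\<lambda>p. indicator A (fst p) * indicator B (snd p))"
proof -
  define h where "h s = (if s \<in> B then Suc 0 else 0)" for s
  define \<Phi> where "\<Phi> i = (if i = Suc 0 then indicator A else (\<lambda>x. 0 :: complex))" for i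
  have [measurable]: "B \<in> sets S" by fact
  have "step_data S h 1" unfolding step_data_def
  proof (intro conjI allI)
    show "h \<in> measurable S (count_space UNIV)" unfolding h_def by measurable
    show "h s \<le> 1" for s by (simp add: h_def)
    show "emeasure S (h -` {Suc i} \<inter> space S) < \<infinity>" for i
    proof -
      have "emeasure S (h -` {Suc i} \<inter> space S) \<le> emeasure S B"
        using assms(3) by (intro emeasure_mono) (auto simp: h_def split: if_splits)
      then show ?thesis using assms(4) by (rule le_less_trans)
    qed
  qed
  moreover have "step_family \<Phi>" using assms by (auto simp: step_family_def \<Phi>_def intro: L2fun_indicator)
  moreover have "(\<lambda>p. indicator A (fst p) * indicator B (snd p)) = (\<lambda>p. \<Phi> (h (snd p)) (fst p))"
    by (auto simp: fun_eq_iff \<Phi>_def h_def indicator_def)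
  ultimately show ?thesis unfolding step_fun_def by blast
qed

lemma step_sets:
  "step_data S h k \<Longrightarrow> h -` {i} \<inter> space S \<in> sets S"
  by (auto simp: step_data_def intro!: measurable_sets)

text \<open>The reserved label contributes nothing, so only the pieces labelled
  \<open>Suc i\<close>, which have finite mass, enter the sum.\<close>

lemma step_L2:
  assumes S: "sigma_finite_measure S" and h: "step_data S h k" and \<Phi>: "step_family \<Phi>"
  shows "L2fun (M \<Otimes>\<^sub>M S) (\<lambda>p. \<Phi> (h (snd p)) (fst p))"
    and "(L2norm (M \<Otimes>\<^sub>M S) (\<lambda>p. \<Phi> (h (snd p)) (fst p)))\<^sup>2 = (\<Sum>i<k. measure S (h -` {Suc i} \<inter> space S) * (L2norm M (\<Phi> (Suc i)))\<^sup>2)"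
proof -
  interpret pair_sigma_finite M S using S by (rule pair_sigma_finite_M)
  have L: "L2fun M (\<Phi> i)" for i using \<Phi> by (simp add: step_family_def)
  have [measurable]: "\<Phi> i \<in> borel_measurable M" for i using L by (rule L2fun_measurable)
  have [measurable]: "h \<in> measurable S (count_space UNIV)" using h by (simp add: step_data_def)
  have Bs: "h -` {Suc i} \<inter> space S \<in> sets S" for i using h by (rule step_sets)
  have fin: "emeasure S (h -` {Suc i} \<inter> space S) = ennreal (measure S (h -` {Suc i} \<inter> space S))" for i
    using h by (intro emeasure_eq_ennreal_measure) (auto simp: step_data_def less_top)
  have m: "(\<lambda>p. \<Phi> (h (snd p)) (fst p)) \<in> borel_measurable (M \<Otimes>\<^sub>M S)"
    by (rule measurable_compose_countable[where f="\<lambda>i p. \<Phi> i (fst p)" and g="\<lambda>p. h (snd p)"]) measurable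
  have E0: "E2 M (\<lambda>x. 0) = 0" by (simp add: E2_def)
  have ex: "E2 M (\<Phi> (h s)) = (\<Sum>i<k. E2 M (\<Phi> (Suc i)) * indicator (h -` {Suc i} \<inter> space S) s)" if "s \<in> space S" for s
  proof (cases "h s")
    case 0
    then show ?thesis using \<Phi> by (auto simp: step_family_def E0)
  next
    case (Suc j)
    then have "j < k" using h by (auto simp: step_data_def dest!: spec[of _ s])
    then have "(\<Sum>i<k. E2 M (\<Phi> (Suc i)) * indicator (h -` {Suc i} \<inter> space S) s) = (\<Sum>i\<in>{j}. E2 M (\<Phi> (Suc i)) * indicator (h -` {Suc i} \<inter> space S) s)"
      using Suc by (intro sum.mono_neutral_right) (auto simp: indicator_def)
    then show ?thesis using Suc that by (simp add: indicator_def)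
  qed
  have "E2 (M \<Otimes>\<^sub>M S) (\<lambda>p. \<Phi> (h (snd p)) (fst p)) = (\<integral>\<^sup>+s. (\<Sum>i<k. E2 M (\<Phi> (Suc i)) * indicator (h -` {Suc i} \<inter> space S) s) \<partial>S)"
    unfolding E2_snd[OF m] by (intro nn_integral_cong) (simp add: ex)
  also have "\<dots> = (\<Sum>i<k. E2 M (\<Phi> (Suc i)) * emeasure S (h -` {Suc i} \<inter> space S))"
    by (subst nn_integral_sum, intro borel_measurable_times_ennreal borel_measurable_const borel_measurable_indicator Bs)
       (intro sum.cong refl nn_integral_cmult_indicator Bs)
  also have "\<dots> = ennreal (\<Sum>i<k. measure S (h -` {Suc i} \<inter> space S) * (L2norm M (\<Phi> (Suc i)))\<^sup>2)"
    by (simp add: fin E2_eq_L2norm L ennreal_mult'[symmetric] mult.commute)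
  finally have e: "E2 (M \<Otimes>\<^sub>M S) (\<lambda>p. \<Phi> (h (snd p)) (fst p)) = ennreal (\<Sum>i<k. measure S (h -` {Suc i} \<inter> space S) * (L2norm M (\<Phi> (Suc i)))\<^sup>2)" .
  then show L2: "L2fun (M \<Otimes>\<^sub>M S) (\<lambda>p. \<Phi> (h (snd p)) (fst p))" using m by (simp add: L2fun_iff)
  show "(L2norm (M \<Otimes>\<^sub>M S) (\<lambda>p. \<Phi> (h (snd p)) (fst p)))\<^sup>2 = (\<Sum>i<k. measure S (h -` {Suc i} \<inter> space S) * (L2norm M (\<Phi> (Suc i)))\<^sup>2)"
    using e unfolding E2_eq_L2norm[OF L2] by (simp add: sum_nonneg)
qed

lemma step_fun_L2: "sigma_finite_measure S \<Longrightarrow> step_fun S F \<Longrightarrow> L2fun (M \<Otimes>\<^sub>M S) F"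
  using step_L2(1) by (auto simp: step_fun_def)

text \<open>On a common partition the coefficient is a finite sum of \<open>conv_check\<close> terms
  weighted by the masses of the pieces. Splitting each mass into two square roots and applying
  Cauchy-Schwarz yields the product of the norms with constant 1.\<close>

lemma fbound_dcoef_step:
  assumes S: "sigma_finite_measure S" and "step_fun S F" "step_fun S G"
  shows "fbound (dcoef S F G) (L2norm (M \<Otimes>\<^sub>M S) F * L2norm (M \<Otimes>\<^sub>M S) G)"
proof -
  interpret pair_sigma_finite M S using S by (rule pair_sigma_finite_M)
  obtain h k \<Phi> \<Gamma> where *: "step_data S h k" "step_family \<Phi>" "step_family \<Gamma>"
    "F = (\<lambda>p. \<Phi> (h (snd p)) (fst p))" "G = (\<lambda>p. \<Gamma> (h (snd p)) (fst p))"
    by (rule step_fun_common[OF assms(2,3)])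
  define B where "B i = h -` {Suc i} \<inter> space S" for i
  have Bs: "B i \<in> sets S" "emeasure S (B i) < \<infinity>" for i
    using step_sets[OF *(1)] *(1) by (auto simp: step_data_def B_def)
  have L: "L2fun M (\<Phi> i)" "L2fun M (\<Gamma> i)" for i using * by (auto simp: step_family_def)
  have oi: "(indicator (B i) :: _ \<Rightarrow> complex) = (\<lambda>s. of_real (indicator (B i) s))" for i
    by (auto simp: indicator_def)
  have ib: "integrable S (indicator (B i) :: _ \<Rightarrow> complex)" for i
    unfolding oi using Bs by (intro integrable_of_real integrable_real_indicator)
  have "dcoef S F G x = (\<Sum>i<k. of_real (measure S (B i)) * conv_check M (\<Phi> (Suc i)) (\<Gamma> (Suc i)) x)" for x
  proof -
    have ex: "\<Phi> (h s) y * \<Gamma> (h s) (- x + y) = (\<Sum>i<k. (\<Phi> (Suc i) y * \<Gamma> (Suc i) (- x + y)) * indicator (B i) s)" if "s \<in> space S" for s y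
    proof (cases "h s")
      case 0
      then show ?thesis using * by (auto simp: step_family_def B_def intro!: sum.neutral[symmetric])
    next
      case (Suc j)
      then have "j < k" using *(1) by (auto simp: step_data_def dest!: spec[of _ s])
      then have "(\<Sum>i<k. (\<Phi> (Suc i) y * \<Gamma> (Suc i) (- x + y)) * indicator (B i) s) = (\<Sum>i\<in>{j}. (\<Phi> (Suc i) y * \<Gamma> (Suc i) (- x + y)) * indicator (B i) s)"
        using Suc by (intro sum.mono_neutral_right) (auto simp: indicator_def B_def)
      then show ?thesis using Suc that by (simp add: indicator_def B_def)
    qed
    have "dcoef S F G x = (\<integral>p. (\<Sum>i<k. (\<Phi> (Suc i) (fst p) * \<Gamma> (Suc i) (- x + fst p)) * indicator (B i) (snd p)) \<partial>(M \<Otimes>\<^sub>M S))"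
      unfolding dcoef_def *(4,5) by (intro Bochner_Integration.integral_cong) (auto simp: ex space_pair_measure)
    also have "\<dots> = (\<Sum>i<k. (\<integral>p. (\<Phi> (Suc i) (fst p) * \<Gamma> (Suc i) (- x + fst p)) * indicator (B i) (snd p) \<partial>(M \<Otimes>\<^sub>M S)))"
      by (intro Bochner_Integration.integral_sum integrable_tensor[of "\<lambda>y. \<Phi> (Suc _) y * \<Gamma> (Suc _) (- x + y)"] conv_check_integrable L ib)
    also have "\<dots> = (\<Sum>i<k. conv_check M (\<Phi> (Suc i)) (\<Gamma> (Suc i)) x * (\<integral>s. indicator (B i) s \<partial>S))"
      unfolding conv_check_def
      by (intro sum.cong refl integral_tensor(2)[of "\<lambda>y. \<Phi> (Suc _) y * \<Gamma> (Suc _) (- x + y)"] conv_check_integrable L ib)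
    also have "\<dots> = (\<Sum>i<k. of_real (measure S (B i)) * conv_check M (\<Phi> (Suc i)) (\<Gamma> (Suc i)) x)"
    proof (intro sum.cong refl)
      fix i
      have "B i \<inter> space S = B i" by (auto simp: B_def)
      then show "conv_check M (\<Phi> (Suc i)) (\<Gamma> (Suc i)) x * (\<integral>s. indicator (B i) s \<partial>S) = of_real (measure S (B i)) * conv_check M (\<Phi> (Suc i)) (\<Gamma> (Suc i)) x"
        unfolding oi integral_complex_of_real by (simp add: mult.commute)
    qed
    finally show ?thesis .
  qed
  then have d: "dcoef S F G = (\<lambda>x. \<Sum>i<k. of_real (measure S (B i)) * conv_check M (\<Phi> (Suc i)) (\<Gamma> (Suc i)) x)" by auto
  have 1: "fbound (dcoef S F G) (\<Sum>i<k. cmod (of_real (measure S (B i))) * (L2norm M (\<Phi> (Suc i)) * L2norm M (\<Gamma> (Suc i))))"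
    unfolding d by (intro fbound_sum fbound_scale fbound_conv_check L)
  let ?a = "\<lambda>i. sqrt (measure S (B i)) * L2norm M (\<Phi> (Suc i))"
  let ?b = "\<lambda>i. sqrt (measure S (B i)) * L2norm M (\<Gamma> (Suc i))"
  have eq: "cmod (of_real (measure S (B i))) * (L2norm M (\<Phi> (Suc i)) * L2norm M (\<Gamma> (Suc i))) = \<bar>?a i\<bar> * \<bar>?b i\<bar>" for i
    by (simp add: abs_mult)
  have "(\<Sum>i<k. \<bar>?a i\<bar> * \<bar>?b i\<bar>) \<le> L2_set ?a {..<k} * L2_set ?b {..<k}" by (rule L2_set_mult_ineq)
  also have "L2_set ?a {..<k} = L2norm (M \<Otimes>\<^sub>M S) F"
    unfolding *(4) using step_L2(2)[OF S *(1,2)]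
    by (auto simp: L2_set_def power_mult_distrib B_def intro!: real_sqrt_unique)
  also have "L2_set ?b {..<k} = L2norm (M \<Otimes>\<^sub>M S) G"
    unfolding *(5) using step_L2(2)[OF S *(1,3)]
    by (auto simp: L2_set_def power_mult_distrib B_def intro!: real_sqrt_unique)
  finally show ?thesis using 1 unfolding eq by (auto intro: fbound_mono)
qed

text \<open>The constant 24 is what a telescoping series of step function approximations costs; the true bound is 1, but
  only boundedness matters.\<close>

lemma fbound_dcoef:
  assumes S: "sigma_finite_measure S" and F: "L2fun (M \<Otimes>\<^sub>M S) F" and G: "L2fun (M \<Otimes>\<^sub>M S) G"
  shows "fbound (dcoef S F G) (24 * (L2norm (M \<Otimes>\<^sub>M S) F * L2norm (M \<Otimes>\<^sub>M S) G))"
proof (cases "L2norm (M \<Otimes>\<^sub>M S) F = 0 \<or> L2norm (M \<Otimes>\<^sub>M S) G = 0")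
  case True
  then have "cmod (dcoef S F G x) \<le> 0" for x using dcoef_bound[OF S F G, of x] by auto
  then have "dcoef S F G = (\<lambda>x. 0)" by auto
  then show ?thesis using fbound_mono[OF fbound_zero] by simp
next
  case False
  interpret pair_sigma_finite M S using S by (rule pair_sigma_finite_M)
  let ?N = "L2norm (M \<Otimes>\<^sub>M S)"
  define a where "a = ?N F"
  define b where "b = ?N G"
  \<comment> \<open>Positivity is what permits the relative tolerances \<open>(1/2)^k * a\<close>
    and \<open>(1/2)^k * b\<close> below.\<close>
  have ab: "a > 0" "b > 0" using False L2norm_nonneg[of "M \<Otimes>\<^sub>M S"] unfolding a_def b_def by (auto simp: less_le)
  have ex: "\<exists>d. step_fun S d \<and> ?N (\<lambda>p. f p - d p) < \<epsilon>" if "L2fun (M \<Otimes>\<^sub>M S) f" "\<epsilon> > 0" for f \<epsilon>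
    by (rule L2_dense_rect[where D="step_fun S", OF that(1) step_fun_L2[OF S] _ _ _ that(2)])
       (auto intro: step_fun_indicator step_fun_add step_fun_scale)
  have "\<forall>k. \<exists>d. step_fun S d \<and> ?N (\<lambda>p. F p - d p) < (1/2)^k * a" using ex[OF F] ab by simp
  then obtain Fs where Fs: "\<And>k. step_fun S (Fs k)" "\<And>k. ?N (\<lambda>p. F p - Fs k p) < (1/2)^k * a" by metis
  have "\<forall>k. \<exists>d. step_fun S d \<and> ?N (\<lambda>p. G p - d p) < (1/2)^k * b" using ex[OF G] ab by simp
  then obtain Gs where Gs: "\<And>k. step_fun S (Gs k)" "\<And>k. ?N (\<lambda>p. G p - Gs k p) < (1/2)^k * b" by metis
  have L: "L2fun (M \<Otimes>\<^sub>M S) (Fs k)" "L2fun (M \<Otimes>\<^sub>M S) (Gs k)" for k using Fs Gs step_fun_L2[OF S] by auto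
  have p1: "(1/2::real)^k \<le> 1" for k by (simp add: power_le_one)
  have bF: "?N (Fs k) \<le> 2 * a" for k
  proof -
    have "?N (Fs k) \<le> ?N F + ?N (\<lambda>p. Fs k p - F p)" by (rule L2norm_le_add_diff[OF L(1) F])
    also have "\<dots> \<le> a + (1/2)^k * a" using Fs(2)[of k] by (simp add: L2norm_minus_commute[of _ "Fs k"] a_def)
    also have "\<dots> \<le> 2 * a" using mult_right_mono[OF p1[of k], of a] ab by simp
    finally show ?thesis .
  qed
  have bG: "?N (Gs k) \<le> 2 * b" for k
  proof -
    have "?N (Gs k) \<le> ?N G + ?N (\<lambda>p. Gs k p - G p)" by (rule L2norm_le_add_diff[OF L(2) G])
    also have "\<dots> \<le> b + (1/2)^k * b" using Gs(2)[of k] by (simp add: L2norm_minus_commute[of _ "Gs k"] b_def)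
    also have "\<dots> \<le> 2 * b" using mult_right_mono[OF p1[of k], of b] ab by simp
    finally show ?thesis .
  qed
  have dF: "?N (\<lambda>p. Fs (Suc k) p - Fs k p) \<le> 3/2 * (1/2)^k * a" for k
    using L2norm_triangle3[OF L(1) F L(1), of "Suc k" k] Fs(2)[of k] Fs(2)[of "Suc k"]
    by (simp add: L2norm_minus_commute[of _ "Fs (Suc k)" F])
  have dG: "?N (\<lambda>p. Gs (Suc k) p - Gs k p) \<le> 3/2 * (1/2)^k * b" for k
    using L2norm_triangle3[OF L(2) G L(2), of "Suc k" k] Gs(2)[of k] Gs(2)[of "Suc k"]
    by (simp add: L2norm_minus_commute[of _ "Gs (Suc k)" G])
  define D where "D k = dcoef S (Fs k) (Gs k)" for k
  define u where "u k x = (case k of 0 \<Rightarrow> D 0 x | Suc j \<Rightarrow> D (Suc j) x - D j x)" for k x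
  \<comment> \<open>For \<open>k = Suc j\<close> the differences in the two vectors contribute at
    most \<open>3 * (1/2)^j * (a * b)\<close> each, together \<open>12 * (1/2)^k * (a * b)\<close>;
    the geometric series then produces 24.\<close>
  have ub: "fbound (u k) (12 * (1/2)^k * (a * b))" for k
  proof (cases k)
    case 0
    have "?N (Fs 0) * ?N (Gs 0) \<le> (2 * a) * (2 * b)" using ab by (intro mult_mono bF bG) auto
    then have "?N (Fs 0) * ?N (Gs 0) \<le> 12 * (a * b)" using mult_pos_pos[OF ab] by linarith
    then show ?thesis using fbound_mono[OF fbound_dcoef_step[OF S Fs(1) Gs(1)]] by (simp add: 0 u_def[abs_def] D_def)
  next
    case (Suc j)
    have stF: "step_fun S (\<lambda>p. Fs (Suc j) p - Fs j p)"
      using step_fun_add[OF Fs(1) step_fun_scale[OF Fs(1), of "-1"]] by simp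
    have stG: "step_fun S (\<lambda>p. Gs (Suc j) p - Gs j p)"
      using step_fun_add[OF Gs(1) step_fun_scale[OF Gs(1), of "-1"]] by simp
    have eq: "u k = (\<lambda>x. dcoef S (\<lambda>p. Fs (Suc j) p - Fs j p) (Gs (Suc j)) x + dcoef S (Fs j) (\<lambda>p. Gs (Suc j) p - Gs j p) x)"
      by (auto simp: Suc u_def D_def dcoef_diff_left[OF S L(1) L(1) L(2)] dcoef_diff_right[OF S L(1) L(2) L(2)])
    have "fbound (u k) (?N (\<lambda>p. Fs (Suc j) p - Fs j p) * ?N (Gs (Suc j)) + ?N (Fs j) * ?N (\<lambda>p. Gs (Suc j) p - Gs j p))"
      unfolding eq by (intro fbound_add fbound_dcoef_step S stF stG Fs Gs)
    moreover have "?N (\<lambda>p. Fs (Suc j) p - Fs j p) * ?N (Gs (Suc j)) \<le> (3/2 * (1/2)^j * a) * (2 * b)"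
      using ab by (intro mult_mono dF bG) auto
    moreover have "?N (Fs j) * ?N (\<lambda>p. Gs (Suc j) p - Gs j p) \<le> (2 * a) * (3/2 * (1/2)^j * b)"
      using ab by (intro mult_mono dG bF) auto
    ultimately show ?thesis by (elim fbound_mono) (simp add: Suc algebra_simps)
  qed
  have "fbound (dcoef S F G) (\<Sum>k. 12 * (1/2)^k * (a * b))"
  proof (rule fbound_suminf[OF ub])
    show "summable (\<lambda>k. 12 * (1/2)^k * (a * b))" by (intro summable_mult summable_mult2 summable_geometric) simp
    fix x
    have sumu: "(\<Sum>i<Suc n. u i x) = D n x" for n
    proof (induction n)
      case 0 show ?case by (simp add: u_def)
    next
      case (Suc n) then show ?case by (subst sum.lessThan_Suc) (simp add: u_def)
    qed
    have "(\<lambda>n. D n x) \<longlonglongrightarrow> dcoef S F G x"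
    proof -
      have "(\<lambda>n. dcoef S F G x - D n x) \<longlonglongrightarrow> 0"
      proof (rule Lim_null_comparison[of _ "\<lambda>n. (1/2)^n * (3 * (a * b))"])
        show "\<forall>\<^sub>F n in sequentially. norm (dcoef S F G x - D n x) \<le> (1/2)^n * (3 * (a * b))"
        proof (rule always_eventually, rule allI)
          fix n
          have "dcoef S F G x - D n x = dcoef S (\<lambda>p. F p - Fs n p) G x + dcoef S (Fs n) (\<lambda>p. G p - Gs n p) x"
            by (simp add: D_def dcoef_diff_left[OF S F L(1) G] dcoef_diff_right[OF S L(1) G L(2)])
          also have "cmod \<dots> \<le> ?N (\<lambda>p. F p - Fs n p) * ?N G + ?N (Fs n) * ?N (\<lambda>p. G p - Gs n p)"
            by (intro norm_triangle_le add_mono dcoef_bound S L2fun_diff F G L)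
          also have "\<dots> \<le> (1/2)^n * a * b + (2 * a) * ((1/2)^n * b)"
            using ab Fs(2)[of n] Gs(2)[of n] bF[of n] by (intro add_mono mult_mono) (auto simp: b_def)
          also have "\<dots> = (1/2)^n * (3 * (a * b))" by (simp add: algebra_simps)
          finally show "norm (dcoef S F G x - D n x) \<le> (1/2)^n * (3 * (a * b))" .
        qed
        show "(\<lambda>n. (1/2)^n * (3 * (a * b))) \<longlonglongrightarrow> 0"
          by (intro tendsto_mult_left_zero LIMSEQ_power_zero) simp
      qed
      from tendsto_diff[OF tendsto_const this, of "dcoef S F G x"] show ?thesis by simp
    qed
    then have "(\<lambda>n. \<Sum>i<Suc n. u i x) \<longlonglongrightarrow> dcoef S F G x" by (simp only: sumu)
    then show "(\<lambda>k. u k x) sums dcoef S F G x" unfolding sums_def by (rule LIMSEQ_imp_Suc)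
  qed
  moreover have "(\<Sum>k. 12 * (1/2)^k * (a * b)) = 24 * (a * b)"
    by (subst suminf_mult2[symmetric] | subst suminf_mult | simp add: suminf_geometric summable_geometric summable_mult)+
  ultimately show ?thesis by (simp add: a_def b_def)
qed

end

section \<open>The Fourier algebra is closed under multiplication\<close>

context lcsc_haar
begin

text \<open>For fixed \<open>y\<close> the map from \<open>w\<close> to \<open>y + w\<close>
  preserves the measure, so the integral over \<open>w\<close> no longer depends on \<open>y\<close>
  and the two factors separate.\<close>

lemma E2_product_family:
  fixes F H :: "'g \<times> 's \<Rightarrow> complex"
  assumes S: "sigma_finite_measure S"
    and [measurable]: "F \<in> borel_measurable (M \<Otimes>\<^sub>M S)" "H \<in> borel_measurable (M \<Otimes>\<^sub>M S)"
  shows "E2 (M \<Otimes>\<^sub>M (S \<Otimes>\<^sub>M M)) (\<lambda>p. F (fst p, fst (snd p)) * H (fst p + snd (snd p), fst (snd p))) =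
    (\<integral>\<^sup>+s. E2 M (\<lambda>y. F (y, s)) * E2 M (\<lambda>z. H (z, s)) \<partial>S)"
proof -
  interpret S: sigma_finite_measure S by fact
  interpret SM: pair_sigma_finite S M ..
  interpret MM: pair_sigma_finite M M ..
  interpret MSM: pair_sigma_finite M "S \<Otimes>\<^sub>M M" ..
  let ?F = "\<lambda>p. F (fst p, fst (snd p)) * H (fst p + snd (snd p), fst (snd p))"
  have m: "?F \<in> borel_measurable (M \<Otimes>\<^sub>M (S \<Otimes>\<^sub>M M))" by measurable
  have "E2 (M \<Otimes>\<^sub>M (S \<Otimes>\<^sub>M M)) ?F = (\<integral>\<^sup>+q. (\<integral>\<^sup>+y. ennreal ((cmod (F (y, fst q) * H (y + snd q, fst q)))\<^sup>2) \<partial>M) \<partial>(S \<Otimes>\<^sub>M M))"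
    unfolding MSM.E2_snd[OF m] by (simp add: E2_def)
  also have "\<dots> = (\<integral>\<^sup>+s. \<integral>\<^sup>+w. (\<integral>\<^sup>+y. ennreal ((cmod (F (y, s) * H (y + w, s)))\<^sup>2) \<partial>M) \<partial>M \<partial>S)"
    by (subst nn_integral_fst[symmetric]) auto
  also have "\<dots> = (\<integral>\<^sup>+s. E2 M (\<lambda>y. F (y, s)) * E2 M (\<lambda>z. H (z, s)) \<partial>S)"
  proof (intro nn_integral_cong)
    fix s assume s[measurable]: "s \<in> space S"
    have "(\<integral>\<^sup>+w. (\<integral>\<^sup>+y. ennreal ((cmod (F (y, s) * H (y + w, s)))\<^sup>2) \<partial>M) \<partial>M) = (\<integral>\<^sup>+y. (\<integral>\<^sup>+w. ennreal ((cmod (F (y, s) * H (y + w, s)))\<^sup>2) \<partial>M) \<partial>M)"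
      by (rule MM.Fubini') measurable
    also have "\<dots> = (\<integral>\<^sup>+y. ennreal ((cmod (F (y, s)))\<^sup>2) * (\<integral>\<^sup>+w. ennreal ((cmod (H (y + w, s)))\<^sup>2) \<partial>M) \<partial>M)"
      by (simp add: norm_mult power_mult_distrib ennreal_mult nn_integral_cmult)
    also have "\<dots> = (\<integral>\<^sup>+y. ennreal ((cmod (F (y, s)))\<^sup>2) * E2 M (\<lambda>z. H (z, s)) \<partial>M)"
      unfolding E2_def
      by (intro nn_integral_cong arg_cong2[where f="(*)"] refl nn_integral_shift[of "\<lambda>z. ennreal ((cmod (H (z, s)))\<^sup>2)"]) measurable
    also have "\<dots> = E2 M (\<lambda>y. F (y, s)) * E2 M (\<lambda>z. H (z, s))"
      unfolding E2_def by (simp add: nn_integral_multc)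
    finally show "(\<integral>\<^sup>+w. (\<integral>\<^sup>+y. ennreal ((cmod (F (y, s) * H (y + w, s)))\<^sup>2) \<partial>M) \<partial>M) = E2 M (\<lambda>y. F (y, s)) * E2 M (\<lambda>z. H (z, s))" .
  qed
  finally show ?thesis .
qed

text \<open>The tensor product of the regular representation with itself is a multiple of the regular
  representation: substitute \<open>z = y + w\<close> in the second factor.\<close>

lemma product_family:
  fixes F G H K :: "'g \<times> 's \<Rightarrow> complex"
  assumes S: "sigma_finite_measure S"
    and [measurable]: "F \<in> borel_measurable (M \<Otimes>\<^sub>M S)" "H \<in> borel_measurable (M \<Otimes>\<^sub>M S)"
      "G \<in> borel_measurable (M \<Otimes>\<^sub>M S)" "K \<in> borel_measurable (M \<Otimes>\<^sub>M S)"
    and A: "(\<integral>\<^sup>+s. E2 M (\<lambda>y. F (y, s)) * E2 M (\<lambda>z. H (z, s)) \<partial>S) \<le> ennreal (a\<^sup>2)" "0 \<le> a"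
    and B: "(\<integral>\<^sup>+s. E2 M (\<lambda>y. G (y, s)) * E2 M (\<lambda>z. K (z, s)) \<partial>S) \<le> ennreal (b\<^sup>2)" "0 \<le> b"
  shows "fbound (\<lambda>x. \<integral>s. (\<integral>y. F (y, s) * G (- x + y, s) \<partial>M) * (\<integral>z. H (z, s) * K (- x + z, s) \<partial>M) \<partial>S) (24 * (a * b))" (is "fbound ?u _")
    and "integrable S (\<lambda>s. (\<integral>y. F (y, s) * G (- x + y, s) \<partial>M) * (\<integral>z. H (z, s) * K (- x + z, s) \<partial>M))"
proof -
  interpret S: sigma_finite_measure S by fact
  interpret SM: pair_sigma_finite S M ..
  interpret MM: pair_sigma_finite M M ..
  interpret MSM: pair_sigma_finite M "S \<Otimes>\<^sub>M M" ..
  define F' where "F' p = F (fst p, fst (snd p)) * H (fst p + snd (snd p), fst (snd p))" for p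
  define G' where "G' p = G (fst p, fst (snd p)) * K (fst p + snd (snd p), fst (snd p))" for p
  have mF: "F' \<in> borel_measurable (M \<Otimes>\<^sub>M (S \<Otimes>\<^sub>M M))" and mG: "G' \<in> borel_measurable (M \<Otimes>\<^sub>M (S \<Otimes>\<^sub>M M))"
    unfolding F'_def[abs_def] G'_def[abs_def] by measurable
  have EF: "E2 (M \<Otimes>\<^sub>M (S \<Otimes>\<^sub>M M)) F' = (\<integral>\<^sup>+s. E2 M (\<lambda>y. F (y, s)) * E2 M (\<lambda>z. H (z, s)) \<partial>S)"
    unfolding F'_def[abs_def] by (rule E2_product_family[OF S]) measurable
  have EG: "E2 (M \<Otimes>\<^sub>M (S \<Otimes>\<^sub>M M)) G' = (\<integral>\<^sup>+s. E2 M (\<lambda>y. G (y, s)) * E2 M (\<lambda>z. K (z, s)) \<partial>S)"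
    unfolding G'_def[abs_def] by (rule E2_product_family[OF S]) measurable
  note LF = L2I[OF mF A(1)[folded EF] A(2)]
  note LG = L2I[OF mG B(1)[folded EG] B(2)]
  have SSM: "sigma_finite_measure (S \<Otimes>\<^sub>M M)" ..
  have mE[measurable]: "(\<lambda>s. E2 M (\<lambda>y. F (y, s))) \<in> borel_measurable S" "(\<lambda>s. E2 M (\<lambda>y. G (y, s))) \<in> borel_measurable S"
     "(\<lambda>s. E2 M (\<lambda>y. H (y, s))) \<in> borel_measurable S" "(\<lambda>s. E2 M (\<lambda>y. K (y, s))) \<in> borel_measurable S"
    unfolding E2_def by measurable
  \<comment> \<open>Only the product of the two norms is known to be finite, and only for almost
    every \<open>s\<close>. That is exactly what makes the tensor of the two sections
    square-integrable and allows Fubini for this \<open>s\<close>.\<close>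
  have fin1: "AE s in S. E2 M (\<lambda>y. F (y, s)) * E2 M (\<lambda>z. H (z, s)) < \<infinity>"
    using A(1) nn_integral_PInf_AE[of "\<lambda>s. E2 M (\<lambda>y. F (y, s)) * E2 M (\<lambda>z. H (z, s))" S]
    by (simp add: less_top le_less_trans[OF _ ennreal_less_top])
  have fin2: "AE s in S. E2 M (\<lambda>y. G (y, s)) * E2 M (\<lambda>z. K (z, s)) < \<infinity>"
    using B(1) nn_integral_PInf_AE[of "\<lambda>s. E2 M (\<lambda>y. G (y, s)) * E2 M (\<lambda>z. K (z, s))" S]
    by (simp add: less_top le_less_trans[OF _ ennreal_less_top])
  have main: "integrable S (\<lambda>s. (\<integral>y. F (y, s) * G (- x + y, s) \<partial>M) * (\<integral>z. H (z, s) * K (- x + z, s) \<partial>M))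
    \<and> dcoef (S \<Otimes>\<^sub>M M) F' G' x = ?u x" for x
  proof -
    define f where "f p = F' p * G' (- x + fst p, snd p)" for p
    have If: "integrable (M \<Otimes>\<^sub>M (S \<Otimes>\<^sub>M M)) f" unfolding f_def
      by (rule dcoef_integrable[OF SSM LF(1) LG(1)])
    then have If': "integrable (M \<Otimes>\<^sub>M (S \<Otimes>\<^sub>M M)) (case_prod (\<lambda>y q. f (y, q)))" by simp
    have mf[measurable]: "f \<in> borel_measurable (M \<Otimes>\<^sub>M (S \<Otimes>\<^sub>M M))" using If by (rule borel_measurable_integrable)
    define c where "c q = (\<integral>y. f (y, q) \<partial>M)" for q
    have Ic: "integrable (S \<Otimes>\<^sub>M M) c" unfolding c_def using MSM.integrable_snd[OF If'] .
    have d: "dcoef (S \<Otimes>\<^sub>M M) F' G' x = (\<integral>q. c q \<partial>(S \<Otimes>\<^sub>M M))"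
    proof -
      have e: "case_prod (\<lambda>y q. f (y, q)) = f" by auto
      have "dcoef (S \<Otimes>\<^sub>M M) F' G' x = integral\<^sup>L (M \<Otimes>\<^sub>M (S \<Otimes>\<^sub>M M)) f"
        by (simp add: dcoef_def f_def[abs_def])
      then show ?thesis using MSM.integral_snd[OF If'] unfolding e c_def[abs_def] by simp
    qed
    also have "\<dots> = (\<integral>s. (\<integral>w. c (s, w) \<partial>M) \<partial>S)" using SM.integral_fst'[OF Ic] by simp
    finally have d2: "dcoef (S \<Otimes>\<^sub>M M) F' G' x = (\<integral>s. (\<integral>w. c (s, w) \<partial>M) \<partial>S)" .
    have Is: "integrable S (\<lambda>s. \<integral>w. c (s, w) \<partial>M)" by (rule SM.integrable_fst'[OF Ic])
    have ae: "AE s in S. (\<integral>w. c (s, w) \<partial>M) = (\<integral>y. F (y, s) * G (- x + y, s) \<partial>M) * (\<integral>z. H (z, s) * K (- x + z, s) \<partial>M)"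
      using fin1 fin2 AE_space
    proof eventually_elim
      fix s assume f1: "E2 M (\<lambda>y. F (y, s)) * E2 M (\<lambda>z. H (z, s)) < \<infinity>"
        and f2: "E2 M (\<lambda>y. G (y, s)) * E2 M (\<lambda>z. K (z, s)) < \<infinity>" and s[measurable]: "s \<in> space S"
      have E: "E2 (M \<Otimes>\<^sub>M M) (\<lambda>p. A (fst p, s) * B (fst p + snd p, s)) = E2 M (\<lambda>y. A (y, s)) * E2 M (\<lambda>z. B (z, s))"
        if [measurable]: "A \<in> borel_measurable (M \<Otimes>\<^sub>M S)" "B \<in> borel_measurable (M \<Otimes>\<^sub>M S)" for A B :: "'g \<times> 's \<Rightarrow> complex"
      proof -
        have "E2 (M \<Otimes>\<^sub>M M) (\<lambda>p. A (fst p, s) * B (fst p + snd p, s)) = (\<integral>\<^sup>+y. E2 M (\<lambda>w. A (y, s) * B (y + w, s)) \<partial>M)"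
          by (subst MM.E2_fst) auto
        also have "\<dots> = (\<integral>\<^sup>+y. ennreal ((cmod (A (y, s)))\<^sup>2) * (\<integral>\<^sup>+w. ennreal ((cmod (B (y + w, s)))\<^sup>2) \<partial>M) \<partial>M)"
          unfolding E2_def by (simp add: norm_mult power_mult_distrib ennreal_mult nn_integral_cmult)
        also have "\<dots> = (\<integral>\<^sup>+y. ennreal ((cmod (A (y, s)))\<^sup>2) * E2 M (\<lambda>z. B (z, s)) \<partial>M)"
          unfolding E2_def
          by (intro nn_integral_cong arg_cong2[where f="(*)"] refl nn_integral_shift[of "\<lambda>z. ennreal ((cmod (B (z, s)))\<^sup>2)"]) measurable
        also have "\<dots> = E2 M (\<lambda>y. A (y, s)) * E2 M (\<lambda>z. B (z, s))"
          unfolding E2_def by (simp add: nn_integral_multc)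
        finally show ?thesis .
      qed
      have L1: "L2fun (M \<Otimes>\<^sub>M M) (\<lambda>p. F (fst p, s) * H (fst p + snd p, s))"
        using f1 by (simp add: L2fun_iff E)
      have L2: "L2fun (M \<Otimes>\<^sub>M M) (\<lambda>p. G (fst p, s) * K (fst p + snd p, s))"
        using f2 by (simp add: L2fun_iff E)
      have I: "integrable (M \<Otimes>\<^sub>M M) (\<lambda>(y, w). f (y, (s, w)))"
        using dcoef_integrable[OF sigma_finite_measure_axioms L1 L2, of "-x"]
        by (simp add: f_def F'_def G'_def case_prod_beta')
      have "(\<integral>w. c (s, w) \<partial>M) = (\<integral>y. (\<integral>w. f (y, (s, w)) \<partial>M) \<partial>M)"
        unfolding c_def by (rule MM.Fubini_integral[OF I])
      also have "\<dots> = (\<integral>y. (F (y, s) * G (- x + y, s)) * (\<integral>z. H (z, s) * K (- x + z, s) \<partial>M) \<partial>M)"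
      proof (intro Bochner_Integration.integral_cong refl)
        fix y
        have "(\<integral>w. f (y, (s, w)) \<partial>M) = (\<integral>w. (F (y, s) * G (- x + y, s)) * (H (y + w, s) * K (- x + (y + w), s)) \<partial>M)"
          by (simp add: f_def F'_def G'_def mult_ac add.assoc)
        also have "\<dots> = (F (y, s) * G (- x + y, s)) * (\<integral>w. H (y + w, s) * K (- x + (y + w), s) \<partial>M)"
          by (rule integral_mult_right_zero)
        also have "(\<integral>w. H (y + w, s) * K (- x + (y + w), s) \<partial>M) = (\<integral>z. H (z, s) * K (- x + z, s) \<partial>M)"
          by (rule integral_shift[of "\<lambda>z. H (z, s) * K (- x + z, s)"]) measurable
        finally show "(\<integral>w. f (y, (s, w)) \<partial>M) = (F (y, s) * G (- x + y, s)) * (\<integral>z. H (z, s) * K (- x + z, s) \<partial>M)" .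
      qed
      also have "\<dots> = (\<integral>y. F (y, s) * G (- x + y, s) \<partial>M) * (\<integral>z. H (z, s) * K (- x + z, s) \<partial>M)"
        by (rule integral_mult_left_zero)
      finally show "(\<integral>w. c (s, w) \<partial>M) = (\<integral>y. F (y, s) * G (- x + y, s) \<partial>M) * (\<integral>z. H (z, s) * K (- x + z, s) \<partial>M)" .
    qed
    have mR: "(\<lambda>s. (\<integral>y. F (y, s) * G (- x + y, s) \<partial>M) * (\<integral>z. H (z, s) * K (- x + z, s) \<partial>M)) \<in> borel_measurable S"
      by measurable
    note mL = borel_measurable_integrable[OF Is]
    show ?thesis
      using integrable_cong_AE[OF mL mR ae] Is integral_cong_AE[OF mL mR ae] d2 by simp
  qed
  have "L2norm (M \<Otimes>\<^sub>M (S \<Otimes>\<^sub>M M)) F' * L2norm (M \<Otimes>\<^sub>M (S \<Otimes>\<^sub>M M)) G' \<le> a * b"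
    using LF(2) LG(2) A(2) by (intro mult_mono) auto
  then have "fbound (dcoef (S \<Otimes>\<^sub>M M) F' G') (24 * (a * b))"
    by (intro fbound_mono[OF fbound_dcoef[OF SSM LF(1) LG(1)]]) simp
  moreover have "dcoef (S \<Otimes>\<^sub>M M) F' G' = ?u" using main by auto
  ultimately show "fbound ?u (24 * (a * b))" by simp
  show "integrable S (\<lambda>s. (\<integral>y. F (y, s) * G (- x + y, s) \<partial>M) * (\<integral>z. H (z, s) * K (- x + z, s) \<partial>M))"
    using main by blast
qed

text \<open>\<open>product_family\<close> over a one-point parameter space.\<close>

lemma fbound_mult_conv:
  assumes "L2fun M f" "L2fun M g" "L2fun M h" "L2fun M k"
  shows "fbound (\<lambda>x. conv_check M f g x * conv_check M h k x) (24 * ((L2norm M f * L2norm M h) * (L2norm M g * L2norm M k)))"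
proof -
  let ?S = "count_space {()}"
  note [measurable] = assms[THEN L2fun_measurable]
  have "sigma_finite_measure ?S" by (rule sigma_finite_measure_count_space_finite) simp
  from product_family(1)[OF this, of "\<lambda>p. f (fst p)" "\<lambda>p. h (fst p)" "\<lambda>p. g (fst p)" "\<lambda>p. k (fst p)"
     "L2norm M f * L2norm M h" "L2norm M g * L2norm M k"] assms
  show ?thesis
    by (simp add: nn_integral_count_space_finite E2_eq_L2norm power_mult_distrib ennreal_mult
        lebesgue_integral_count_space_finite conv_check_def[abs_def])
qed

lemma fbound_mult:
  assumes u: "fbound u a" and v: "fbound v b"
  shows "fbound (\<lambda>x. u x * v x) (24 * (a * b))"
proof -
  have *: "fbound (\<lambda>x. u x * v x) (24 * ((a + \<epsilon>) * (b + \<epsilon>)))" if e: "\<epsilon> > 0" for \<epsilon>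
  proof -
    obtain f g where fg: "fourier_rep M u f g" "(\<Sum>n. L2norm M (f n) * L2norm M (g n)) < a + \<epsilon>" using fbound_rep[OF u e] .
    obtain h k where hk: "fourier_rep M v h k" "(\<Sum>n. L2norm M (h n) * L2norm M (k n)) < b + \<epsilon>" using fbound_rep[OF v e] .
    have L: "L2fun M (f n)" "L2fun M (g n)" "L2fun M (h n)" "L2fun M (k n)" for n
      using fg hk by (auto simp: fourier_rep_def)
    have s1: "summable (\<lambda>n. L2norm M (f n) * L2norm M (g n))" and s2: "summable (\<lambda>n. L2norm M (h n) * L2norm M (k n))"
      using fg hk by (auto simp: fourier_rep_def)
    have su: "(\<lambda>n. conv_check M (f n) (g n) x) sums u x" for x
    proof -
      have "summable (\<lambda>n. conv_check M (f n) (g n) x)"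
        using conv_check_bound[OF L(1,2)] by (intro summable_comparison_test'[OF s1, of 0]) auto
      then show ?thesis using fg by (simp add: fourier_rep_def sums_iff)
    qed
    have sv: "(\<lambda>n. conv_check M (h n) (k n) x) sums v x" for x
    proof -
      have "summable (\<lambda>n. conv_check M (h n) (k n) x)"
        using conv_check_bound[OF L(3,4)] by (intro summable_comparison_test'[OF s2, of 0]) auto
      then show ?thesis using hk by (simp add: fourier_rep_def sums_iff)
    qed
    let ?B = "\<Sum>m. L2norm M (h m) * L2norm M (k m)"
    have 1: "fbound (\<lambda>x. conv_check M (f n) (g n) x * v x) (24 * ((L2norm M (f n) * L2norm M (g n)) * ?B))" for n
    proof -
      have "fbound (\<lambda>x. conv_check M (f n) (g n) x * v x) (\<Sum>m. 24 * ((L2norm M (f n) * L2norm M (g n)) * (L2norm M (h m) * L2norm M (k m))))"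
      proof (rule fbound_suminf)
        show "fbound (\<lambda>x. conv_check M (f n) (g n) x * conv_check M (h m) (k m) x) (24 * ((L2norm M (f n) * L2norm M (g n)) * (L2norm M (h m) * L2norm M (k m))))" for m
          using fbound_mult_conv[OF L(1)[of n] L(2)[of n] L(3)[of m] L(4)[of m]] by (simp add: mult_ac)
        show "summable (\<lambda>m. 24 * ((L2norm M (f n) * L2norm M (g n)) * (L2norm M (h m) * L2norm M (k m))))"
          by (intro summable_mult s2)
        show "(\<lambda>m. conv_check M (f n) (g n) x * conv_check M (h m) (k m) x) sums (conv_check M (f n) (g n) x * v x)" for x
          by (intro sums_mult sv)
      qed
      then show ?thesis by (simp only: suminf_mult summable_mult s2)
    qed
    have "fbound (\<lambda>x. u x * v x) (\<Sum>n. 24 * ((L2norm M (f n) * L2norm M (g n)) * ?B))"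
      by (rule fbound_suminf[OF 1]) (intro summable_mult summable_mult2 s1 sums_mult2 su)+
    also have "(\<Sum>n. 24 * ((L2norm M (f n) * L2norm M (g n)) * ?B)) = 24 * ((\<Sum>n. L2norm M (f n) * L2norm M (g n)) * ?B)"
      by (simp only: suminf_mult suminf_mult2[symmetric] summable_mult2 s1)
    finally have *: "fbound (\<lambda>x. u x * v x) (24 * ((\<Sum>n. L2norm M (f n) * L2norm M (g n)) * ?B))" .
    have "(\<Sum>n. L2norm M (f n) * L2norm M (g n)) * ?B \<le> (a + \<epsilon>) * (b + \<epsilon>)"
      using fg(2) hk(2) s1 s2 fbound_nonneg[OF u] e by (intro mult_mono) (auto intro!: suminf_nonneg)
    then show ?thesis by (intro fbound_mono[OF *]) simp
  qed
  \<comment> \<open>The excess \<open>\<epsilon>\<close> enters both factors, so it is removed by a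
    limit from the right and not by a linear estimate.\<close>
  have lim: "((\<lambda>\<epsilon>. 24 * ((a + \<epsilon>) * (b + \<epsilon>))) \<longlongrightarrow> 24 * ((a + 0) * (b + 0))) (at_right 0)"
    by (intro tendsto_intros)
  have "fourier_norm M (\<lambda>x. u x * v x) \<le> 24 * ((a + 0) * (b + 0))"
    by (rule tendsto_lowerbound[OF lim])
       (auto simp: eventually_at_right_field fbound_def dest: * intro!: exI[of _ 1] dest!: *)
  then show ?thesis using *[of 1] by (simp add: fbound_def)
qed

section \<open>Continuity of translation\<close>

text \<open>For the indicator of an open set \<open>U\<close> of finite mass, the part common to
  \<open>U\<close> and its translate is split off. Both remainders have the same norm because
  translation preserves the mass of \<open>U\<close>. So it is enough that the common part fills
  \<open>U\<close> pointwise, which openness gives, and \<open>U\<close> itself dominates.\<close>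

lemma L2_translation_continuous:
  assumes f: "L2fun M f" and \<epsilon>: "\<epsilon> > 0"
  shows "\<forall>\<^sub>F y in nhds 0. L2norm M (\<lambda>z. f (- y + z) - f z) < \<epsilon>"
proof -
  define P where "P f \<longleftrightarrow> (\<forall>\<epsilon>>0. \<forall>\<^sub>F y in nhds 0. L2norm M (\<lambda>z. f (- y + z) - f z) < \<epsilon>)" for f
  let ?G = "{U :: 'g set. open U \<and> emeasure M U < \<infinity>}"
  obtain Om :: "nat \<Rightarrow> 'g set" where Om: "\<And>n. open (Om n)" "\<And>n. emeasure M (Om n) < \<infinity>" "incseq Om" "(\<Union>n. Om n) = UNIV"
    using open_exhaustion by metis
  have "P f"
  proof (rule L2_dense_induct[OF f, of ?G Om])
    show "sets M = sigma_sets (space M) ?G" using generates_borel by simp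
    show "Int_stable ?G"
    proof (rule Int_stableI)
      fix a b assume "a \<in> ?G" "b \<in> ?G"
      then show "a \<inter> b \<in> ?G" using emeasure_mono[of "a \<inter> b" a M] by (auto intro: le_less_trans)
    qed
    show "range Om \<subseteq> ?G" using Om by auto
    show "P (indicator U)" if U': "U \<in> ?G" for U
    proof -
      have U: "open U" "emeasure M U < \<infinity>" using U' by auto
      have sU: "U \<in> sets M" using U by simp
      have L: "L2fun M (indicator U)" using sU U(2) by (rule L2fun_indicator)
      show ?thesis unfolding P_def
      proof (intro allI impI)
        fix \<epsilon> :: real assume e: "\<epsilon> > 0"
        show "\<forall>\<^sub>F y in nhds 0. L2norm M (\<lambda>z. indicator U (- y + z) - indicator U z) < \<epsilon>"
        \<comment> \<open>Dominated convergence is sequential; first countability makes sequences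
          sufficient.\<close>
        proof (rule sequentially_imp_eventually_nhds_within[where a=0 and s=UNIV, simplified], intro allI impI)
          fix y :: "nat \<Rightarrow> 'g" assume "y \<longlonglongrightarrow> 0"
          then have y: "y \<longlonglongrightarrow> 0" .
          define V where "V n = {z. z \<in> U \<and> - y n + z \<in> U}" for n
          have sV[measurable]: "V n \<in> sets M" for n
          proof -
            have "open ((\<lambda>z. - y n + z) -` U)" using U by (intro open_vimage continuous_intros)
            then show ?thesis using U by (auto simp: V_def vimage_def Collect_conj_eq)
          qed
          have fV: "emeasure M (V n) < \<infinity>" for n
            using emeasure_mono[of "V n" U M] sU U(2) by (auto simp: V_def intro: le_less_trans)
          have "(\<lambda>n. L2norm M (\<lambda>z. indicator U z - indicator (V n) z)) \<longlonglongrightarrow> 0"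
          proof (rule L2_dominated_convergence[OF _ L L])
            show "indicator (V n) \<in> borel_measurable M" for n by measurable
            fix z
            show "(\<lambda>n. indicator (V n) z) \<longlonglongrightarrow> (indicator U z :: complex)"
            proof (cases "z \<in> U")
              case True
              have "(\<lambda>n. - y n + z) \<longlonglongrightarrow> - 0 + z" using y by (intro tendsto_intros)
              then have "\<forall>\<^sub>F n in sequentially. - y n + z \<in> U" using U True by (intro topological_tendstoD) auto
              then have "\<forall>\<^sub>F n in sequentially. indicator (V n) z = (indicator U z :: complex)"
                by eventually_elim (use True in \<open>auto simp: V_def indicator_def\<close>)
              then show ?thesis by (rule tendsto_eventually)
            qed (auto simp: V_def indicator_def)
          qed (auto simp: V_def indicator_def)
          then have "(\<lambda>n. 2 * L2norm M (\<lambda>z. indicator U z - indicator (V n) z)) \<longlonglongrightarrow> 2 * 0" by (intro tendsto_intros)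
          then have "\<forall>\<^sub>F n in sequentially. 2 * L2norm M (\<lambda>z. indicator U z - indicator (V n) z) < \<epsilon>"
            using e by (intro order_tendstoD) auto
          then show "\<forall>\<^sub>F n in sequentially. L2norm M (\<lambda>z. indicator U (- y n + z) - indicator U z) < \<epsilon>"
          proof eventually_elim
            fix n assume n: "2 * L2norm M (\<lambda>z. indicator U z - indicator (V n) z) < \<epsilon>"
            let ?Uy = "\<lambda>z. indicator U (- y n + z) :: complex"
            have Ly: "L2fun M ?Uy" by (rule L2fun_shift[OF L])
            have LV: "L2fun M (indicator (V n))" by (intro L2fun_indicator sV fV)
            have sq: "(L2norm M A)\<^sup>2 = enn2real (E2 M A)" if "L2fun M A" for A
              using E2_eq_L2norm[OF that] by simp
            have EV: "E2 M (\<lambda>z. A z - indicator (V n) z) + E2 M (indicator (V n)) = E2 M A"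
              if "A = ?Uy \<or> A = indicator U" "A \<in> borel_measurable M" for A :: "'g \<Rightarrow> complex"
            proof -
              note [measurable] = that(2)
              have "ennreal ((cmod (A z - indicator (V n) z))\<^sup>2) + ennreal ((cmod (indicator (V n) z))\<^sup>2) = ennreal ((cmod (A z))\<^sup>2)" for z
                using that(1) by (auto simp: V_def indicator_def)
              then show ?thesis unfolding E2_def by (subst nn_integral_add[symmetric]) auto
            qed
            have EE: "E2 M ?Uy = E2 M (indicator U)" by (rule E2_shift) (use sU in measurable)
            have finV: "E2 M (indicator (V n)) < top" using LV by (simp add: L2fun_iff)
            have "E2 M (\<lambda>z. ?Uy z - indicator (V n) z) = E2 M (\<lambda>z. indicator U z - indicator (V n) z)"
            proof -
              have "E2 M (\<lambda>z. ?Uy z - indicator (V n) z) + E2 M (indicator (V n)) = E2 M (\<lambda>z. indicator U z - indicator (V n) z) + E2 M (indicator (V n))"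
                using EV[of ?Uy] EV[of "indicator U"] EE L Ly by (simp add: L2fun_measurable)
              then show ?thesis using finV by (auto simp add: ennreal_add_left_cancel add.commute[of _ "E2 M (indicator (V n))"])
            qed
            then have "L2norm M (\<lambda>z. ?Uy z - indicator (V n) z) = L2norm M (\<lambda>z. indicator U z - indicator (V n) z)"
              by (intro power2_eq_imp_eq[OF _ L2norm_nonneg L2norm_nonneg, of M _ M])
                 (simp only: sq[OF L2fun_diff[OF Ly LV]] sq[OF L2fun_diff[OF L LV]])
            moreover have "L2norm M (\<lambda>z. ?Uy z - indicator U z) \<le> L2norm M (\<lambda>z. ?Uy z - indicator (V n) z) + L2norm M (\<lambda>z. indicator (V n) z - indicator U z)"
              by (rule L2norm_triangle3[OF Ly LV L])
            moreover have "L2norm M (\<lambda>z. indicator (V n) z - indicator U z) = L2norm M (\<lambda>z. indicator U z - indicator (V n) z)"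
              by (rule L2norm_minus_commute)
            ultimately show "L2norm M (\<lambda>z. ?Uy z - indicator U z) < \<epsilon>" using n by linarith
          qed
        qed
      qed
    qed
  next
    fix f g assume L: "L2fun M f" "L2fun M g" and Pf: "P f" and Pg: "P g"
    show "P (\<lambda>x. f x + g x)" unfolding P_def
    proof (intro allI impI)
      fix \<epsilon> :: real assume "\<epsilon> > 0"
      then have e: "\<epsilon> / 2 > 0" by simp
      from Pf[unfolded P_def, rule_format, OF e] Pg[unfolded P_def, rule_format, OF e]
      show "\<forall>\<^sub>F y in nhds 0. L2norm M (\<lambda>z. (f (- y + z) + g (- y + z)) - (f z + g z)) < \<epsilon>"
      proof eventually_elim
        case (elim y)
        have "L2norm M (\<lambda>z. (f (- y + z) - f z) + (g (- y + z) - g z)) < \<epsilon>"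
          using L2norm_triangle[OF L2fun_diff[OF L2fun_shift[OF L(1)] L(1)] L2fun_diff[OF L2fun_shift[OF L(2)] L(2)], of "-y" "-y"] elim by linarith
        then show ?case by (simp add: algebra_simps)
      qed
    qed
  next
    fix c f assume L: "L2fun M f" and Pf: "P f"
    show "P (\<lambda>x. c * f x)" unfolding P_def
    proof (intro allI impI)
      fix \<epsilon> :: real assume e: "\<epsilon> > 0"
      have c1: "cmod c + 1 > 0" using norm_ge_zero[of c] by linarith
      then have e': "\<epsilon> / (cmod c + 1) > 0" using e by simp
      from Pf[unfolded P_def, rule_format, OF e']
      show "\<forall>\<^sub>F y in nhds 0. L2norm M (\<lambda>z. c * f (- y + z) - c * f z) < \<epsilon>"
      proof eventually_elim
        case (elim y)
        have "L2norm M (\<lambda>z. c * f (- y + z) - c * f z) = cmod c * L2norm M (\<lambda>z. f (- y + z) - f z)"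
          using L2norm_scale[OF L2fun_diff[OF L2fun_shift[OF L] L], of c "-y"] by (simp add: algebra_simps)
        also have "\<dots> \<le> cmod c * (\<epsilon> / (cmod c + 1))" using elim by (intro mult_left_mono) auto
        also have "\<dots> < (cmod c + 1) * (\<epsilon> / (cmod c + 1))" using e' by (intro mult_strict_right_mono) auto
        also have "\<dots> = \<epsilon>" using c1 by simp
        finally show ?case .
      qed
    qed
  next
    fix f assume L: "L2fun M f" and A: "\<And>\<epsilon>. \<epsilon> > 0 \<Longrightarrow> \<exists>g. L2fun M g \<and> P g \<and> L2norm M (\<lambda>x. f x - g x) < \<epsilon>"
    show "P f" unfolding P_def
    proof (intro allI impI)
      fix \<epsilon> :: real assume "\<epsilon> > 0"
      then have e: "\<epsilon> / 3 > 0" by simp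
      from A[OF this] obtain g where g: "L2fun M g" "P g" "L2norm M (\<lambda>x. f x - g x) < \<epsilon> / 3" by blast
      from g(2)[unfolded P_def, rule_format, OF e]
      show "\<forall>\<^sub>F y in nhds 0. L2norm M (\<lambda>z. f (- y + z) - f z) < \<epsilon>"
      proof eventually_elim
        case (elim y)
        have Ly: "L2fun M (\<lambda>z. f (- y + z))" "L2fun M (\<lambda>z. g (- y + z))" using L g by (auto intro: L2fun_shift)
        have "L2norm M (\<lambda>z. f (- y + z) - g (- y + z)) = L2norm M (\<lambda>z. f z - g z)"
          using L2norm_shift[OF L2fun_diff[OF L g(1)], of "-y"] by simp
        moreover have "L2norm M (\<lambda>z. f (- y + z) - f z) \<le> L2norm M (\<lambda>z. f (- y + z) - g (- y + z)) + L2norm M (\<lambda>z. g (- y + z) - f z)"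
          by (rule L2norm_triangle3[OF Ly L])
        moreover have "L2norm M (\<lambda>z. g (- y + z) - f z) \<le> L2norm M (\<lambda>z. g (- y + z) - g z) + L2norm M (\<lambda>z. g z - f z)"
          by (rule L2norm_triangle3[OF Ly(2) g(1) L])
        ultimately show ?case using g(3) elim by (simp add: L2norm_minus_commute[of _ g])
      qed
    qed
  qed (use Om in auto)
  then show ?thesis using \<epsilon> by (simp add: P_def)
qed

end

section \<open>Uniform continuity of functions in the Fourier algebra\<close>

lemma suminf_dominated_tendsto_0:
  fixes a :: "'x \<Rightarrow> nat \<Rightarrow> real"
  assumes lim: "\<And>n. ((\<lambda>x. a x n) \<longlongrightarrow> 0) F" and b: "summable b"
    and dom: "\<forall>\<^sub>F x in F. \<forall>n. \<bar>a x n\<bar> \<le> b n"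
  shows "((\<lambda>x. suminf (a x)) \<longlongrightarrow> 0) F"
proof (cases "F = bot")
  case False
  have "\<forall>\<^sub>F (n, x) in at_top \<times>\<^sub>F F. norm (a x n) \<le> b n"
    unfolding eventually_prod_filter using dom
    by (intro exI[of _ "\<lambda>_. True"] exI[of _ "\<lambda>x. \<forall>n. \<bar>a x n\<bar> \<le> b n"]) auto
  from tannerys_theorem[OF lim this b False] show ?thesis by simp
qed simp

context lcsc_haar
begin

lemma fbound_epsilon: "(\<And>\<epsilon>. \<epsilon> > 0 \<Longrightarrow> fbound u (c + \<epsilon>)) \<Longrightarrow> fbound u c"
  unfolding fbound_def by (meson field_le_epsilon zero_less_one)

lemma L2_translation_tendsto:
  assumes f: "L2fun M f"
  shows "((\<lambda>y. L2norm M (\<lambda>z. f (- y + z) - f z)) \<longlongrightarrow> 0) (nhds 0)"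
    and "((\<lambda>y. L2norm M (\<lambda>z. f (y + z) - f z)) \<longlongrightarrow> 0) (nhds 0)"
proof -
  show 1: "((\<lambda>y. L2norm M (\<lambda>z. f (- y + z) - f z)) \<longlongrightarrow> 0) (nhds 0)"
    using L2_translation_continuous[OF f] by (intro tendstoI) (simp add: dist_norm)
  have "((\<lambda>y. - y) \<longlongrightarrow> - 0) (nhds (0 :: 'g))" by (intro tendsto_intros filterlim_ident)
  then have "filterlim (\<lambda>y. - y) (nhds 0) (nhds (0 :: 'g))" by simp
  from filterlim_compose[OF 1 this] show "((\<lambda>y. L2norm M (\<lambda>z. f (y + z) - f z)) \<longlongrightarrow> 0) (nhds 0)" by simp
qed

lemma L2_translation_bound: "L2fun M f \<Longrightarrow> L2norm M (\<lambda>z. f (a + z) - f z) \<le> 2 * L2norm M f"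
  using L2norm_triangle_diff[OF L2fun_shift[of f a]] L2norm_shift[of f a] by fastforce

lemma conv_check_shift:
  assumes [measurable]: "f \<in> borel_measurable M" "g \<in> borel_measurable M"
  shows "conv_check M f g (a + x) = conv_check M (\<lambda>y. f (a + y)) g x"
  unfolding conv_check_def
  by (subst integral_shift[of "\<lambda>y. f y * g (- (a + x) + y)" a, symmetric])
     (measurable, simp only: minus_add add.assoc minus_add_cancel)

lemma conv_check_diff_left:
  assumes "L2fun M f" "L2fun M f'" "L2fun M g"
  shows "conv_check M (\<lambda>y. f y - f' y) g x = conv_check M f g x - conv_check M f' g x"
  unfolding conv_check_def left_diff_distrib
  using assms by (intro Bochner_Integration.integral_diff conv_check_integrable)

text \<open>Left translation of a coefficient moves only its first vector, so each term is
  controlled by \<open>L2_translation_tendsto\<close> uniformly in \<open>x\<close>; Tannery's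
  theorem sums the moduli.\<close>

lemma fourier_algebra_uniformly_continuous:
  assumes u: "u \<in> fourier_algebra M" and \<epsilon>: "\<epsilon> > 0"
  shows "\<forall>\<^sub>F a in nhds 0. \<forall>x. cmod (u (a + x) - u x) < \<epsilon>"
proof -
  obtain f g where L: "\<And>n. L2fun M (f n)" "\<And>n. L2fun M (g n)" and s: "summable (\<lambda>n. L2norm M (f n) * L2norm M (g n))"
    and su: "\<And>x. (\<lambda>n. conv_check M (f n) (g n) x) sums u x"
    by (fact fbound_rep_sums[OF u])
  define b where "b a n = L2norm M (\<lambda>z. f n (a + z) - f n z) * L2norm M (g n)" for a n
  have bb: "\<bar>b a n\<bar> \<le> 2 * (L2norm M (f n) * L2norm M (g n))" for a n
    unfolding b_def using mult_right_mono[OF L2_translation_bound[OF L(1), of n a] L2norm_nonneg[of M "g n"]]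
    by (simp add: abs_mult mult.assoc)
  have sb: "summable (b a)" for a
    using bb by (intro summable_comparison_test'[OF summable_mult[OF s, of 2], of 0]) auto
  have "((\<lambda>a. suminf (b a)) \<longlongrightarrow> 0) (nhds 0)"
  proof (rule suminf_dominated_tendsto_0)
    show "((\<lambda>a. b a n) \<longlongrightarrow> 0) (nhds 0)" for n
      unfolding b_def by (intro tendsto_mult_left_zero L2_translation_tendsto L)
    show "summable (\<lambda>n. 2 * (L2norm M (f n) * L2norm M (g n)))" by (intro summable_mult s)
  qed (use bb in auto)
  then have "\<forall>\<^sub>F a in nhds 0. suminf (b a) < \<epsilon>" using \<epsilon> by (rule order_tendstoD)
  then show ?thesis
  proof eventually_elim
    case (elim a)
    show ?case
    proof
      fix x
      have c: "conv_check M (f n) (g n) (a + x) - conv_check M (f n) (g n) x = conv_check M (\<lambda>y. f n (a + y) - f n y) (g n) x" for n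
        by (simp add: conv_check_diff_left L2fun_shift L conv_check_shift L2fun_measurable)
      have cb: "cmod (conv_check M (\<lambda>y. f n (a + y) - f n y) (g n) x) \<le> b a n" for n
        unfolding b_def by (intro conv_check_bound L2fun_diff L2fun_shift L)
      have sn: "summable (\<lambda>n. cmod (conv_check M (\<lambda>y. f n (a + y) - f n y) (g n) x))"
        using cb by (intro summable_comparison_test'[OF sb, of 0]) auto
      have "(\<lambda>n. conv_check M (\<lambda>y. f n (a + y) - f n y) (g n) x) sums (u (a + x) - u x)"
        using sums_diff[OF su su, of "a + x" x] by (simp add: c)
      then have "cmod (u (a + x) - u x) \<le> (\<Sum>n. cmod (conv_check M (\<lambda>y. f n (a + y) - f n y) (g n) x))"
        using summable_norm[OF sn] by (simp add: sums_iff)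
      also have "\<dots> \<le> suminf (b a)" by (intro suminf_le cb sn sb)
      finally show "cmod (u (a + x) - u x) < \<epsilon>" using elim by simp
    qed
  qed
qed

end

section \<open>Restriction along the homomorphism\<close>

locale haar_hom = G: lcsc_haar M + H: lcsc_haar N
  for M :: "'g::{topological_group_add, t2_space, second_countable_topology} measure"
    and N :: "'h::{topological_group_add, t2_space, second_countable_topology} measure" +
  fixes \<theta> :: "'g \<Rightarrow> 'h"
  assumes theta_cont: "continuous_on UNIV \<theta>"
    and theta_add: "\<theta> (x + y) = \<theta> x + \<theta> y"
    and range_open: "open (range \<theta>)"
    and theta_measure: "\<alpha> \<in> sets borel \<Longrightarrow> \<alpha> \<subseteq> range \<theta> \<Longrightarrow> emeasure M (\<theta> -` \<alpha>) = emeasure N \<alpha>"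
begin

lemma theta_measurable[measurable]: "\<theta> \<in> borel_measurable borel"
  using theta_cont by (rule borel_measurable_continuous_onI)

lemma theta_zero[simp]: "\<theta> 0 = 0"
  using theta_add[of 0 0] by (metis add_left_cancel add_0_right)

lemma theta_uminus[simp]: "\<theta> (- x) = - \<theta> x"
  using theta_add[of "- x" x] by (simp add: eq_neg_iff_add_eq_0)

lemma range_add: "a \<in> range \<theta> \<Longrightarrow> b \<in> range \<theta> \<Longrightarrow> a + b \<in> range \<theta>"
  by (auto simp flip: theta_add)

lemma range_uminus: "a \<in> range \<theta> \<Longrightarrow> - a \<in> range \<theta>"
  by (auto simp del: theta_uminus simp flip: theta_uminus)

lemma range_zero: "0 \<in> range \<theta>"
  by (metis rangeI theta_zero)

lemma range_measurable[measurable]: "range \<theta> \<in> sets borel"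
  using range_open by simp

lemma distr_theta: "distr M N \<theta> = density N (indicator (range \<theta>))"
proof (rule measure_eqI)
  fix A assume "A \<in> sets (distr M N \<theta>)"
  then have A[measurable]: "A \<in> sets borel" by simp
  have "emeasure (distr M N \<theta>) A = emeasure M (\<theta> -` (A \<inter> range \<theta>))"
    by (subst emeasure_distr) (auto intro!: arg_cong[where f="emeasure M"])
  also have "\<dots> = emeasure N (A \<inter> range \<theta>)" by (rule theta_measure) auto
  also have "\<dots> = emeasure (density N (indicator (range \<theta>))) A"
    by (subst emeasure_density) (auto simp: nn_integral_indicator[symmetric] indicator_inter_arith mult.commute simp del: nn_integral_indicator)
  finally show "emeasure (distr M N \<theta>) A = emeasure (density N (indicator (range \<theta>))) A" .
qed simp

lemma nn_integral_theta:
  assumes [measurable]: "\<phi> \<in> borel_measurable N"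
  shows "(\<integral>\<^sup>+x. \<phi> (\<theta> x) \<partial>M) = (\<integral>\<^sup>+h. indicator (range \<theta>) h * \<phi> h \<partial>N)"
proof -
  have "(\<integral>\<^sup>+x. \<phi> (\<theta> x) \<partial>M) = (\<integral>\<^sup>+h. \<phi> h \<partial>distr M N \<theta>)" by (subst nn_integral_distr) auto
  also have "\<dots> = (\<integral>\<^sup>+h. indicator (range \<theta>) h * \<phi> h \<partial>N)"
    unfolding distr_theta by (subst nn_integral_density) auto
  finally show ?thesis .
qed

lemma small_symmetric:
  assumes U: "open U" "(0::'h) \<in> U"
  obtains W where "open W" "0 \<in> W" "W \<subseteq> U" "W \<subseteq> range \<theta>" "\<And>h. h \<in> W \<Longrightarrow> - h \<in> W" "emeasure N W < \<infinity>" "emeasure N W > 0"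
proof -
  have "open (U \<inter> range \<theta>)" "0 \<in> U \<inter> range \<theta>" using U range_open range_zero by auto
  then obtain V where V: "open V" "0 \<in> V" "V \<subseteq> U \<inter> range \<theta>" "emeasure N V < \<infinity>" using H.small_open by blast
  define W where "W = V \<inter> uminus -` V"
  have W: "open W" unfolding W_def using V by (intro open_Int open_vimage continuous_intros)
  have "0 \<in> W" using V by (simp add: W_def)
  moreover have "emeasure N W < \<infinity>" using emeasure_mono[of W V N] V by (auto simp: W_def intro: le_less_trans)
  moreover have "emeasure N W > 0" using H.open_pos[OF W] \<open>0 \<in> W\<close> by auto
  ultimately show ?thesis using W V that[of W] by (auto simp: W_def)
qed

text \<open>The indicator of \<open>\<Omega>\<close> is a Bruhat function for the right cosets of the range.\<close>

lemma bruhat_set: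
  obtains \<Omega> c where "open \<Omega>" "c > 0" "\<And>y. (\<integral>\<^sup>+z. indicator \<Omega> (- \<theta> z + y) \<partial>M) = ennreal c"
proof -
  obtain W where W: "open W" "0 \<in> W" "W \<subseteq> UNIV" "W \<subseteq> range \<theta>" "\<And>h. h \<in> W \<Longrightarrow> - h \<in> W" "emeasure N W < \<infinity>" "emeasure N W > 0"
    by (fact small_symmetric[OF open_UNIV UNIV_I])
  \<comment> \<open>An arbitrary choice of representatives of the right cosets of the range; no
    measurability is expected of it.\<close>
  define rep where "rep h = (SOME t. h - t \<in> range \<theta>)" for h
  have rep: "h - rep h \<in> range \<theta>" for h
    unfolding rep_def by (rule someI[of "\<lambda>t. h - t \<in> range \<theta>" h]) (simp add: range_zero)
  have repeq: "rep h = rep h'" if "h - h' \<in> range \<theta>" for h h'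
  proof -
    have "h - t \<in> range \<theta> \<longleftrightarrow> h' - t \<in> range \<theta>" for t
    proof
      assume "h - t \<in> range \<theta>"
      from range_add[OF range_uminus[OF that] this] show "h' - t \<in> range \<theta>" by (simp add: algebra_simps)
    next
      assume "h' - t \<in> range \<theta>"
      from range_add[OF that this] show "h - t \<in> range \<theta>" by (simp add: algebra_simps)
    qed
    then show ?thesis by (simp add: rep_def)
  qed
  define \<Omega> where "\<Omega> = {y. y - rep y \<in> W}"
  \<comment> \<open>A copy of \<open>W\<close> sits at each representative. Written as a union of
    translates of \<open>W\<close>, the set is open however \<open>rep\<close> was chosen; as
    \<open>W\<close> lies in the range, the copy at one representative stays inside its
    coset.\<close>
  have "\<Omega> = (\<Union>t\<in>range rep. (\<lambda>y. y - t) -` W)"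
  proof (intro equalityI subsetI)
    fix y assume "y \<in> (\<Union>t\<in>range rep. (\<lambda>y. y - t) -` W)"
    then obtain h where h: "y - rep h \<in> W" by auto
    then have "y - rep h \<in> range \<theta>" using W by auto
    from range_add[OF this range_uminus[OF rep[of h]]] have "y - h \<in> range \<theta>" by (simp add: algebra_simps)
    from repeq[OF this] h show "y \<in> \<Omega>" by (simp add: \<Omega>_def)
  qed (auto simp: \<Omega>_def)
  moreover have "open (\<Union>t\<in>range rep. (\<lambda>y. y - t) -` W)"
    using W by (intro open_UN ballI open_vimage continuous_intros)
  ultimately have op: "open \<Omega>" by simp
  have "(\<integral>\<^sup>+z. indicator \<Omega> (- \<theta> z + y) \<partial>M) = emeasure N W" for y
  proof -
    let ?r = "y - rep y"
    have eq: "rep (- \<theta> z + y) = rep y" for z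
      by (rule repeq) (simp add: add_diff_eq[symmetric] range_uminus)
    have opA: "open ((\<lambda>h. - ?r + h) -` W)" using W by (intro open_vimage continuous_intros)
    \<comment> \<open>Symmetry of \<open>W\<close> rewrites the condition as membership of
      \<open>\<theta> z\<close> in the left translate of \<open>W\<close> by \<open>?r\<close>,
      whose mass is that of \<open>W\<close> for every \<open>y\<close>.\<close>
    have ind: "indicator \<Omega> (- \<theta> z + y) = indicator ((\<lambda>h. - ?r + h) -` W) (\<theta> z)" for z
    proof -
      have "- \<theta> z + y \<in> \<Omega> \<longleftrightarrow> - \<theta> z + ?r \<in> W" by (simp add: \<Omega>_def eq add_diff_eq)
      also have "\<dots> \<longleftrightarrow> - ?r + \<theta> z \<in> W"
        using W(5)[of "- \<theta> z + ?r"] W(5)[of "- ?r + \<theta> z"] by (auto simp: minus_add minus_diff_eq)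
      finally show ?thesis by (simp add: indicator_def)
    qed
    have "(\<integral>\<^sup>+z. indicator \<Omega> (- \<theta> z + y) \<partial>M) = emeasure M (\<theta> -` ((\<lambda>h. - ?r + h) -` W))"
    proof -
      have "indicator A (\<theta> z) = (indicator (\<theta> -` A) z :: ennreal)" for A z by (simp add: indicator_def)
      then show ?thesis unfolding ind using open_vimage[OF opA theta_cont] by (simp del: diff_conv_add_uminus)
    qed
    also have "\<dots> = emeasure N ((\<lambda>h. - ?r + h) -` W)"
    proof (rule theta_measure)
      show "(\<lambda>h. - ?r + h) -` W \<subseteq> range \<theta>"
      proof
        fix h assume "h \<in> (\<lambda>h. - ?r + h) -` W"
        then have "- ?r + h \<in> range \<theta>" using W by auto
        from range_add[OF rep[of y] this] show "h \<in> range \<theta>" by (simp only: add.assoc[symmetric] right_minus add_0_left)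
      qed
    qed (use opA in simp)
    also have "\<dots> = emeasure (distr N N (\<lambda>h. - ?r + h)) W"
      using W by (subst emeasure_distr) auto
    finally show ?thesis by (simp add: H.distr_shift)
  qed
  moreover have e: "emeasure N W = ennreal (measure N W)"
    using W(6) by (intro emeasure_eq_ennreal_measure) auto
  moreover have "measure N W > 0" using W(7) unfolding e by simp
  ultimately show ?thesis using that[OF op, of "measure N W"] by simp
qed

text \<open>Restricted along \<open>\<theta>\<close>, the regular representation of the target
  embeds into a multiple of that of the source: \<open>f\<close> becomes the vector
  \<open>sqrt (w h) * f (\<theta> z + h)\<close> in the variables \<open>z\<close> and
  \<open>h\<close>. The weight \<open>w\<close> is a Bruhat function scaled to have integral 1 along
  every orbit; this makes the embedding isometric and lets the extra integral over \<open>z\<close>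
  drop out of the coefficient.\<close>

lemma fbound_pullback_conv:
  assumes f: "L2fun N f" and g: "L2fun N g"
  shows "G.fbound (\<lambda>x. conv_check N f g (\<theta> x)) (24 * (L2norm N f * L2norm N g))"
proof -
  obtain \<Omega> c where \<Omega>: "open \<Omega>" "c > 0" and br: "\<And>y. (\<integral>\<^sup>+z. indicator \<Omega> (- \<theta> z + y) \<partial>M) = ennreal c"
    using bruhat_set by metis
  note [measurable] = L2fun_measurable[OF f] L2fun_measurable[OF g]
  have [measurable]: "\<Omega> \<in> sets borel" using \<Omega> by simp
  interpret MN: pair_sigma_finite M N ..
  define w :: "'h \<Rightarrow> real" where "w h = indicator \<Omega> h / c" for h
  have w0: "w h \<ge> 0" for h using \<Omega> by (simp add: w_def)
  have [measurable]: "w \<in> borel_measurable borel" unfolding w_def by measurable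
  have br': "(\<integral>\<^sup>+z. ennreal (w (- \<theta> z + y)) \<partial>M) = 1" for y
  proof -
    have "ennreal (w h) = ennreal (1 / c) * indicator \<Omega> h" for h using \<Omega> by (auto simp: w_def indicator_def)
    then have "(\<integral>\<^sup>+z. ennreal (w (- \<theta> z + y)) \<partial>M) = ennreal (1 / c) * ennreal c"
      by (simp add: nn_integral_cmult br)
    then show ?thesis using \<Omega>(2) by (simp add: ennreal_mult[symmetric])
  qed
  define F where "F p = complex_of_real (sqrt (w (snd p))) * f (\<theta> (fst p) + snd p)" for p
  define G where "G p = complex_of_real (sqrt (w (snd p))) * g (\<theta> (fst p) + snd p)" for p
  have mF: "F \<in> borel_measurable (M \<Otimes>\<^sub>M N)" unfolding F_def by measurable
  have mG: "G \<in> borel_measurable (M \<Otimes>\<^sub>M N)" unfolding G_def by measurable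
  have E: "E2 (M \<Otimes>\<^sub>M N) (\<lambda>p. complex_of_real (sqrt (w (snd p))) * k (\<theta> (fst p) + snd p)) = E2 N k"
    if [measurable]: "k \<in> borel_measurable N" for k
  proof -
    have "E2 (M \<Otimes>\<^sub>M N) (\<lambda>p. complex_of_real (sqrt (w (snd p))) * k (\<theta> (fst p) + snd p)) =
      (\<integral>\<^sup>+z. \<integral>\<^sup>+h. ennreal (w h) * ennreal ((cmod (k (\<theta> z + h)))\<^sup>2) \<partial>N \<partial>M)"
      by (subst MN.E2_fst) (auto simp: E2_def norm_mult power_mult_distrib ennreal_mult w0 real_sqrt_pow2)
    also have "\<dots> = (\<integral>\<^sup>+z. \<integral>\<^sup>+h. ennreal (w (- \<theta> z + h)) * ennreal ((cmod (k h))\<^sup>2) \<partial>N \<partial>M)"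
    proof (rule nn_integral_cong)
      fix z
      have "(\<integral>\<^sup>+h. ennreal (w (- \<theta> z + (\<theta> z + h))) * ennreal ((cmod (k (\<theta> z + h)))\<^sup>2) \<partial>N) =
        (\<integral>\<^sup>+h. ennreal (w (- \<theta> z + h)) * ennreal ((cmod (k h))\<^sup>2) \<partial>N)"
        by (rule H.nn_integral_shift[of "\<lambda>h. ennreal (w (- \<theta> z + h)) * ennreal ((cmod (k h))\<^sup>2)"]) measurable
      then show "(\<integral>\<^sup>+h. ennreal (w h) * ennreal ((cmod (k (\<theta> z + h)))\<^sup>2) \<partial>N) =
        (\<integral>\<^sup>+h. ennreal (w (- \<theta> z + h)) * ennreal ((cmod (k h))\<^sup>2) \<partial>N)" by simp
    qed
    also have "\<dots> = (\<integral>\<^sup>+h. \<integral>\<^sup>+z. ennreal (w (- \<theta> z + h)) * ennreal ((cmod (k h))\<^sup>2) \<partial>M \<partial>N)"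
      by (rule MN.Fubini'[symmetric]) measurable
    also have "\<dots> = E2 N k" unfolding E2_def by (simp add: nn_integral_multc br')
    finally show ?thesis .
  qed
  have "E2 (M \<Otimes>\<^sub>M N) F \<le> ennreal ((L2norm N f)\<^sup>2)" unfolding F_def[abs_def] by (simp add: E E2_eq_L2norm f)
  note LF = L2I[OF mF this L2norm_nonneg]
  have "E2 (M \<Otimes>\<^sub>M N) G \<le> ennreal ((L2norm N g)\<^sup>2)" unfolding G_def[abs_def] by (simp add: E E2_eq_L2norm g)
  note LG = L2I[OF mG this L2norm_nonneg]
  have "conv_check N f g (\<theta> x) = G.dcoef N F G x" for x
  proof -
    let ?k = "\<lambda>z h. complex_of_real (w (- \<theta> z + h)) * (f h * g (- \<theta> x + h))"
    have I: "integrable (M \<Otimes>\<^sub>M N) (\<lambda>(z, h). ?k z h)"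
      unfolding integrable_iff_bounded
    proof
      have "(\<integral>\<^sup>+p. ennreal (norm (case p of (z, h) \<Rightarrow> ?k z h)) \<partial>(M \<Otimes>\<^sub>M N)) =
        (\<integral>\<^sup>+h. \<integral>\<^sup>+z. ennreal (w (- \<theta> z + h)) * ennreal (cmod (f h * g (- \<theta> x + h))) \<partial>M \<partial>N)"
        by (subst MN.nn_integral_snd[symmetric]) (auto simp: norm_mult ennreal_mult w0)
      also have "\<dots> = (\<integral>\<^sup>+h. ennreal (cmod (f h * g (- \<theta> x + h))) \<partial>N)" by (simp add: nn_integral_multc br')
      also have "\<dots> < \<infinity>" using H.conv_check_integrable[OF f g, of "\<theta> x"] by (simp add: integrable_iff_bounded)
      finally show "(\<integral>\<^sup>+p. ennreal (norm (case p of (z, h) \<Rightarrow> ?k z h)) \<partial>(M \<Otimes>\<^sub>M N)) < \<infinity>" .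
    qed measurable
    have "G.dcoef N F G x = (\<integral>z. (\<integral>h. F (z, h) * G (- x + z, h) \<partial>N) \<partial>M)"
      unfolding G.dcoef_def
      using MN.integral_fst'[OF G.dcoef_integrable[OF H.sigma_finite_measure_axioms LF(1) LG(1), of "- x"]] by simp
    also have "\<dots> = (\<integral>z. (\<integral>h. ?k z h \<partial>N) \<partial>M)"
    proof (rule Bochner_Integration.integral_cong[OF refl])
      fix z
      have "F (z, h) * G (- x + z, h) = ?k z (\<theta> z + h)" for h
        using w0[of h] by (simp add: F_def G_def theta_add add.assoc[symmetric] flip: of_real_mult)
      moreover have "(\<integral>h. ?k z (\<theta> z + h) \<partial>N) = (\<integral>h. ?k z h \<partial>N)"
        by (rule H.integral_shift) measurable
      ultimately show "(\<integral>h. F (z, h) * G (- x + z, h) \<partial>N) = (\<integral>h. ?k z h \<partial>N)" by simp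
    qed
    also have "\<dots> = (\<integral>h. (\<integral>z. ?k z h \<partial>M) \<partial>N)" by (rule MN.Fubini_integral[OF I, symmetric])
    also have "\<dots> = (\<integral>h. f h * g (- \<theta> x + h) \<partial>N)"
    proof (rule Bochner_Integration.integral_cong[OF refl])
      fix h
      have "(\<integral>z. w (- \<theta> z + h) \<partial>M) = 1"
        using br'[of h] w0 by (subst integral_eq_nn_integral) auto
      then show "(\<integral>z. ?k z h \<partial>M) = f h * g (- \<theta> x + h)" by simp
    qed
    finally show ?thesis by (simp add: conv_check_def)
  qed
  then have "(\<lambda>x. conv_check N f g (\<theta> x)) = G.dcoef N F G" by auto
  moreover have "L2norm (M \<Otimes>\<^sub>M N) F * L2norm (M \<Otimes>\<^sub>M N) G \<le> L2norm N f * L2norm N g"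
    using LF LG by (intro mult_mono) auto
  ultimately show ?thesis
    using G.fbound_dcoef[OF H.sigma_finite_measure_axioms LF(1) LG(1)] by (auto intro: G.fbound_mono)
qed

lemma fbound_pullback:
  assumes u: "H.fbound u c" shows "G.fbound (\<lambda>x. u (\<theta> x)) (24 * c)"
proof (rule G.fbound_epsilon)
  fix \<epsilon> :: real assume "\<epsilon> > 0"
  then have e: "\<epsilon> / 24 > 0" by simp
  obtain f g where fg: "fourier_rep N u f g" "(\<Sum>n. L2norm N (f n) * L2norm N (g n)) < c + \<epsilon> / 24"
    using H.fbound_rep[OF u e] .
  have L: "L2fun N (f n)" "L2fun N (g n)" and s: "summable (\<lambda>n. L2norm N (f n) * L2norm N (g n))" for n
    using fg by (auto simp: fourier_rep_def)
  have "G.fbound (\<lambda>x. u (\<theta> x)) (\<Sum>n. 24 * (L2norm N (f n) * L2norm N (g n)))"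
  proof (rule G.fbound_suminf[OF fbound_pullback_conv[OF L]])
    show "summable (\<lambda>n. 24 * (L2norm N (f n) * L2norm N (g n)))" by (intro summable_mult s)
    fix x
    have "summable (\<lambda>n. conv_check N (f n) (g n) (\<theta> x))"
      using H.conv_check_bound[OF L] by (intro summable_comparison_test'[OF s, of 0]) auto
    then show "(\<lambda>n. conv_check N (f n) (g n) (\<theta> x)) sums u (\<theta> x)"
      using fg by (simp add: fourier_rep_def sums_iff)
  qed
  then show "G.fbound (\<lambda>x. u (\<theta> x)) (24 * c + \<epsilon>)"
    by (rule G.fbound_mono) (use fg(2) in \<open>simp add: suminf_mult s\<close>)
qed

end

section \<open>Uniqueness of the Haar measure and right translations\<close>

context lcsc_haar
begin

text \<open>Both sides of the final identity arise from the double integral of \<open>1\<^sub>A(x) 1\<^sub>U(y + x) / c(x)\<close>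
  with \<open>c(x) = \<integral> 1\<^sub>U(t + x) dt\<close> by substituting first \<open>x \<mapsto> - y + x\<close> and then \<open>y \<mapsto> x + y\<close>.\<close>

lemma left_invariant_unique:
  assumes M': "sets M' = sets borel" "sigma_finite_measure M'"
    and inv: "\<And>a f. f \<in> borel_measurable borel \<Longrightarrow> (\<integral>\<^sup>+x. f (a + x) \<partial>M') = (\<integral>\<^sup>+x. f x \<partial>M')"
    and U: "open U" "U \<noteq> {}" "compact K" "U \<subseteq> K"
    and A: "A \<in> sets borel"
  shows "emeasure M' A * emeasure M U = emeasure M A * emeasure M' U"
proof -
  interpret M': sigma_finite_measure M' by fact
  have [measurable_cong]: "sets M' = sets borel" by fact
  have [measurable]: "U \<in> sets borel" "A \<in> sets borel" using U A by auto
  define c where "c x = (\<integral>\<^sup>+t. indicator U (t + x) \<partial>M)" for x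
  have [measurable]: "c \<in> borel_measurable borel" unfolding c_def by measurable
  \<comment> \<open>The value is the mass of a right translate of \<open>U\<close>, which is open,
    nonempty and contained in a compact set.\<close>
  have cx: "c x > 0" "c x < \<infinity>" for x
  proof -
    have op: "open ((\<lambda>t. t + x) -` U)" using U by (intro open_vimage continuous_intros)
    have c: "c x = emeasure M ((\<lambda>t. t + x) -` U)"
    proof -
      have "indicator U (t + x) = (indicator ((\<lambda>t. t + x) -` U) t :: ennreal)" for t by (simp add: indicator_def)
      then show ?thesis unfolding c_def using op by simp
    qed
    obtain u where "u \<in> U" using U by auto
    then have "u - x \<in> (\<lambda>t. t + x) -` U" by simp
    then show "c x > 0" unfolding c using open_pos[OF op] by blast
    have comp: "compact ((\<lambda>t. t - x) ` K)" using U by (intro compact_continuous_image continuous_intros)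
    have "(\<lambda>t. t + x) -` U \<subseteq> (\<lambda>t. t - x) ` K"
    proof
      fix t assume "t \<in> (\<lambda>t. t + x) -` U"
      then have "t + x \<in> K" "t = (t + x) - x" using U by auto
      then show "t \<in> (\<lambda>t. t - x) ` K" by blast
    qed
    then have "c x \<le> emeasure M ((\<lambda>t. t - x) ` K)" unfolding c using comp by (intro emeasure_mono) (auto intro: borel_compact)
    then show "c x < \<infinity>" using compact_finite[OF comp] by (rule le_less_trans)
  qed
  define C where "C = (\<integral>\<^sup>+y. indicator A (- y) / c (- y) \<partial>M)"
  \<comment> \<open>\<open>C\<close> is built from \<open>M\<close>, \<open>A\<close> and
    \<open>U\<close> alone, so the same constant serves for every left invariant \<open>L\<close>;
    applying this to \<open>M'\<close> and to \<open>M\<close> eliminates it.\<close>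
  have key: "emeasure L A = emeasure L U * C"
    if L: "sets L = sets borel" "sigma_finite_measure L"
      and Linv: "\<And>a f. f \<in> borel_measurable borel \<Longrightarrow> (\<integral>\<^sup>+x. f (a + x) \<partial>L) = (\<integral>\<^sup>+x. f x \<partial>L)" for L
  proof -
    interpret L: sigma_finite_measure L by fact
    have [measurable_cong]: "sets L = sets borel" by fact
    interpret LM: pair_sigma_finite L M ..
    have "emeasure L A = (\<integral>\<^sup>+x. indicator A x * (c x / c x) \<partial>L)"
    proof -
      have "c x / c x = 1" for x using cx[of x] by (intro ennreal_divide_self) auto
      then show ?thesis using L A by simp
    qed
    also have "\<dots> = (\<integral>\<^sup>+x. \<integral>\<^sup>+y. indicator A x / c x * indicator U (y + x) \<partial>M \<partial>L)"
    proof (rule nn_integral_cong)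
      fix x
      have "(\<integral>\<^sup>+y. indicator A x / c x * indicator U (y + x) \<partial>M) = indicator A x / c x * c x"
        unfolding c_def by (rule nn_integral_cmult) measurable
      then show "indicator A x * (c x / c x) = (\<integral>\<^sup>+y. indicator A x / c x * indicator U (y + x) \<partial>M)"
        by (simp add: divide_ennreal_def mult_ac)
    qed
    also have "\<dots> = (\<integral>\<^sup>+y. \<integral>\<^sup>+x. indicator A x / c x * indicator U (y + x) \<partial>L \<partial>M)"
      by (rule LM.Fubini'[symmetric]) measurable
    also have "\<dots> = (\<integral>\<^sup>+y. \<integral>\<^sup>+x. indicator A (- y + x) / c (- y + x) * indicator U x \<partial>L \<partial>M)"
    proof (rule nn_integral_cong)
      fix y
      have "(\<integral>\<^sup>+x. indicator A (- y + x) / c (- y + x) * indicator U (y + (- y + x)) \<partial>L) = (\<integral>\<^sup>+x. indicator A x / c x * indicator U (y + x) \<partial>L)"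
        by (rule Linv[of "\<lambda>x. indicator A x / c x * indicator U (y + x)" "- y"]) measurable
      then show "(\<integral>\<^sup>+x. indicator A x / c x * indicator U (y + x) \<partial>L) = (\<integral>\<^sup>+x. indicator A (- y + x) / c (- y + x) * indicator U x \<partial>L)"
        by simp
    qed
    also have "\<dots> = (\<integral>\<^sup>+x. \<integral>\<^sup>+y. indicator A (- y + x) / c (- y + x) * indicator U x \<partial>M \<partial>L)"
      by (rule LM.Fubini') measurable
    also have "\<dots> = (\<integral>\<^sup>+x. indicator U x * C \<partial>L)"
    proof (rule nn_integral_cong)
      fix x :: 'g
      have e: "- (x + y) + x = - y" for y
        by (simp only: minus_add add.assoc left_minus add_0_right)
      have "(\<integral>\<^sup>+y. indicator A (- y + x) / c (- y + x) * indicator U x \<partial>M) = (\<integral>\<^sup>+y. indicator A (- (x + y) + x) / c (- (x + y) + x) * indicator U x \<partial>M)"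
        by (rule nn_integral_shift[symmetric, of "\<lambda>y. indicator A (- y + x) / c (- y + x) * indicator U x"]) measurable
      also have "\<dots> = indicator U x * C" unfolding e C_def by (subst nn_integral_multc) (auto simp: mult.commute)
      finally show "(\<integral>\<^sup>+y. indicator A (- y + x) / c (- y + x) * indicator U x \<partial>M) = indicator U x * C" .
    qed
    also have "\<dots> = emeasure L U * C" using L by (simp add: nn_integral_multc)
    finally show ?thesis .
  qed
  have "emeasure M' A = emeasure M' U * C" by (rule key[OF M' inv])
  moreover have "emeasure M A = emeasure M U * C"
    by (rule key[OF sets_M sigma_finite_measure_axioms]) (simp add: nn_integral_shift)
  ultimately show ?thesis by (simp add: mult_ac)
qed

text \<open>Right translations commute with left ones, so the translated measure is again left
  invariant and uniqueness makes it a multiple of \<open>M\<close>. Up to convention,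
  \<open>c\<close> is a value of the modular function.\<close>

lemma right_translation:
  obtains c where "c > 0" "distr M M (\<lambda>y. y + z) = density M (\<lambda>_. ennreal c)"
proof -
  let ?M' = "distr M M (\<lambda>y. y + z)"
  obtain U K where U: "open U" "compact K" "(0::'g) \<in> U" "U \<subseteq> K" "K \<subseteq> UNIV" by (fact small_compact[OF open_UNIV UNIV_I])
  then have Une: "U \<noteq> {}" by auto
  have em: "emeasure ?M' A = emeasure M ((\<lambda>y. y + z) -` A)" if "A \<in> sets borel" for A
    using that by (subst emeasure_distr) auto
  have fin: "emeasure ?M' A < \<infinity>" if A: "A \<in> sets borel" "A \<subseteq> L" "compact L" for A L
  proof -
    have comp: "compact ((\<lambda>t. t - z) ` L)" using A by (intro compact_continuous_image continuous_intros)
    have "(\<lambda>y. y + z) -` A \<subseteq> (\<lambda>t. t - z) ` L"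
    proof
      fix t assume "t \<in> (\<lambda>t. t + z) -` A"
      then have "t + z \<in> L" "t = (t + z) - z" using A by auto
      then show "t \<in> (\<lambda>t. t - z) ` L" by blast
    qed
    then have "emeasure ?M' A \<le> emeasure M ((\<lambda>t. t - z) ` L)"
      unfolding em[OF A(1)] using comp by (intro emeasure_mono) (auto intro: borel_compact)
    then show ?thesis using compact_finite[OF comp] by (rule le_less_trans)
  qed
  have sf: "sigma_finite_measure ?M'"
  proof
    obtain Om :: "nat \<Rightarrow> 'g set" where Om: "\<And>n. open (Om n)" "\<And>n. emeasure M (Om n) < \<infinity>" "incseq Om" "(\<Union>n. Om n) = UNIV"
        "\<And>n. \<exists>K. compact K \<and> Om n \<subseteq> K" by (fact open_exhaustion)
    have "emeasure ?M' (Om n) < \<infinity>" for n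
    proof -
      obtain L where "compact L" "Om n \<subseteq> L" using Om(5)[of n] by blast
      then show ?thesis using fin[of "Om n" L] Om(1)[of n] by simp
    qed
    then show "\<exists>A. countable A \<and> A \<subseteq> sets ?M' \<and> \<Union>A = space ?M' \<and> (\<forall>a\<in>A. emeasure ?M' a \<noteq> \<infinity>)"
      using Om(1,4) by (intro exI[of _ "range Om"]) (auto simp: less_top)
  qed
  have inv: "(\<integral>\<^sup>+x. f (a + x) \<partial>?M') = (\<integral>\<^sup>+x. f x \<partial>?M')" if [measurable]: "f \<in> borel_measurable borel" for a and f :: "'g \<Rightarrow> ennreal"
    using nn_integral_shift[of "\<lambda>y. f (y + z)" a] by (simp add: nn_integral_distr add.assoc)
  have uniq: "emeasure ?M' A * emeasure M U = emeasure M A * emeasure ?M' U" if "A \<in> sets borel" for A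
    by (rule left_invariant_unique[OF _ sf inv U(1) Une U(2,4) that]) auto
  have MU: "emeasure M U > 0" "emeasure M U < \<infinity>"
    using open_pos[OF U(1) Une] emeasure_mono[OF U(4), of M] compact_finite[OF U(2)] U(2)
    by (auto intro: le_less_trans borel_compact)
  have M'U: "emeasure ?M' U > 0" "emeasure ?M' U < \<infinity>"
  proof -
    have "open ((\<lambda>y. y + z) -` U)" using U by (intro open_vimage continuous_intros)
    moreover have "0 - z \<in> (\<lambda>y. y + z) -` U" using U by simp
    ultimately have "emeasure M ((\<lambda>y. y + z) -` U) > 0" by (intro open_pos) blast+
    then show "emeasure ?M' U > 0" using em[of U] U(1) by simp
    show "emeasure ?M' U < \<infinity>" using fin[of U K] U by auto
  qed
  obtain a b where ab: "emeasure M U = ennreal a" "emeasure ?M' U = ennreal b" "a > 0" "b > 0"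
    using MU M'U by (cases "emeasure M U"; cases "emeasure ?M' U") auto
  show ?thesis
  proof (rule that[of "b / a"])
    show "b / a > 0" using ab by simp
    show "?M' = density M (\<lambda>_. ennreal (b / a))"
    proof (rule measure_eqI)
      fix A assume "A \<in> sets ?M'"
      then have A: "A \<in> sets borel" by simp
      have "emeasure ?M' A * (ennreal a * ennreal (1 / a)) = emeasure M A * (ennreal b * ennreal (1 / a))"
        using uniq[OF A] by (simp add: ab mult.assoc[symmetric])
      moreover have "ennreal a * ennreal (1 / a) = 1" "ennreal b * ennreal (1 / a) = ennreal (b / a)"
        using ab by (simp_all add: ennreal_mult[symmetric])
      ultimately show "emeasure ?M' A = emeasure (density M (\<lambda>_. ennreal (b / a))) A"
        using A by (simp add: emeasure_density nn_integral_cmult_indicator) (simp add: mult.commute)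
    qed simp
  qed
qed

text \<open>Prepares Fubini for averages of coefficients: the inner integral is bounded by the two
  norms uniformly in \<open>y\<close>, and \<open>V\<close> has finite mass.\<close>

lemma conv_average_integrable:
  assumes F: "L2fun M F" and G: "L2fun M G" and V[measurable]: "V \<in> sets M" and fin: "emeasure M V < \<infinity>"
  shows "integrable (M \<Otimes>\<^sub>M M) (\<lambda>(y, z). indicator V y * (F z * G (- (- y + x) + z)))"
proof -
  note [measurable] = L2fun_measurable[OF F] L2fun_measurable[OF G]
  have "(\<integral>\<^sup>+p. ennreal (norm (case p of (y, z) \<Rightarrow> indicator V y * (F z * G (- (- y + x) + z)))) \<partial>(M \<Otimes>\<^sub>M M)) =
    (\<integral>\<^sup>+y. indicator V y * (\<integral>\<^sup>+z. ennreal (cmod (F z * G (- (- y + x) + z))) \<partial>M) \<partial>M)"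
    by (subst nn_integral_fst[symmetric])
       (auto simp: norm_mult ennreal_mult nn_integral_cmult[symmetric] indicator_def intro!: nn_integral_cong)
  also have "\<dots> \<le> (\<integral>\<^sup>+y. ennreal (L2norm M F * L2norm M G) * indicator V y \<partial>M)"
  proof (rule nn_integral_mono)
    fix y
    have "(\<integral>\<^sup>+z. ennreal (cmod (F z * G (- (- y + x) + z))) \<partial>M) \<le> ennreal (L2norm M F * L2norm M G)"
      using nn_CS[OF F L2fun_shift[OF G, of "- (- y + x)"]] by (simp add: L2norm_shift G)
    then show "indicator V y * (\<integral>\<^sup>+z. ennreal (cmod (F z * G (- (- y + x) + z))) \<partial>M) \<le> ennreal (L2norm M F * L2norm M G) * indicator V y"
      by (auto simp: indicator_def)
  qed
  also have "\<dots> < \<infinity>" using fin V by (simp add: nn_integral_cmult_indicator ennreal_mult_less_top)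
  finally show ?thesis unfolding integrable_iff_bounded by simp
qed

end

lemma integral_uniform_measure:
  fixes f :: "'a \<Rightarrow> complex"
  assumes [measurable]: "A \<in> sets X" "f \<in> borel_measurable X" and fin: "emeasure X A < \<infinity>" "emeasure X A > 0"
  shows "(\<integral>x. f x \<partial>uniform_measure X A) = (\<integral>x. indicator A x * f x \<partial>X) / of_real (measure X A)"
proof -
  have e: "emeasure X A = ennreal (measure X A)" using fin by (intro emeasure_eq_ennreal_measure) auto
  have p: "measure X A > 0" using fin(2) unfolding e by simp
  have "uniform_measure X A = density X (\<lambda>x. ennreal (indicator A x / measure X A))"
    unfolding uniform_measure_def e using p
    by (intro arg_cong[where f="density X"] ext) (auto simp: indicator_def divide_ennreal[symmetric] ennreal_1[symmetric] simp del: ennreal_1)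
  then have "(\<integral>x. f x \<partial>uniform_measure X A) = (\<integral>x. (indicator A x / measure X A) *\<^sub>R f x \<partial>X)"
    by (simp add: integral_density)
  also have "\<dots> = (\<integral>x. indicator A x * f x / of_real (measure X A) \<partial>X)"
    by (intro Bochner_Integration.integral_cong) (auto simp: indicator_def scaleR_conv_of_real)
  finally show ?thesis by simp
qed

section \<open>Push-forward of square-integrable functions\<close>

lemma ennreal_AMGM: "2 * (a * b) \<le> a\<^sup>2 + (b::ennreal)\<^sup>2"
proof (cases "a = top \<or> b = top")
  case False
  then obtain x y where xy: "a = ennreal x" "b = ennreal y" "x \<ge> 0" "y \<ge> 0" by (cases a; cases b) auto
  have "2 * (x * y) \<le> x\<^sup>2 + y\<^sup>2" using sum_squares_bound[of x y] by simp
  then have "ennreal (2 * (x * y)) \<le> ennreal (x\<^sup>2 + y\<^sup>2)" by (rule ennreal_leI)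
  then show ?thesis using xy by (simp add: ennreal_mult ennreal_power)
qed (auto simp: power2_eq_square ennreal_mult_top)

context haar_hom
begin

text \<open>Both modular factors are tested on a small open subset of the range, where the image of
  \<open>M\<close> agrees with \<open>N\<close>. Averages of coefficients involve right translations
  in both groups, and there the two factors have to cancel.\<close>

lemma right_translation_common:
  obtains c where "c > 0" "distr M M (\<lambda>y. y + z) = density M (\<lambda>_. ennreal c)"
    "distr N N (\<lambda>h. h + \<theta> z) = density N (\<lambda>_. ennreal c)"
proof -
  obtain c where c: "c > 0" "distr M M (\<lambda>y. y + z) = density M (\<lambda>_. ennreal c)" by (fact G.right_translation)
  obtain d where d: "d > 0" "distr N N (\<lambda>h. h + \<theta> z) = density N (\<lambda>_. ennreal d)" by (fact H.right_translation)
  obtain W where W: "open W" "0 \<in> W" "W \<subseteq> UNIV" "W \<subseteq> range \<theta>" "\<And>h. h \<in> W \<Longrightarrow> - h \<in> W" "emeasure N W < \<infinity>" "emeasure N W > 0"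
    by (fact small_symmetric[OF open_UNIV UNIV_I])
  have [measurable]: "W \<in> sets borel" using W by simp
  have o1: "open (\<theta> -` W)" using W theta_cont by (intro open_vimage) auto
  have o2: "open ((\<lambda>h. h + \<theta> z) -` W)" using W by (intro open_vimage continuous_intros)
  have sub: "(\<lambda>h. h + \<theta> z) -` W \<subseteq> range \<theta>"
  proof
    fix h assume "h \<in> (\<lambda>h. h + \<theta> z) -` W"
    then have "h + \<theta> z \<in> range \<theta>" using W by auto
    from range_add[OF this range_uminus[OF rangeI[of \<theta> z]]] show "h \<in> range \<theta>" by (simp add: add.assoc)
  qed
  have "ennreal c * emeasure N W = emeasure (density M (\<lambda>_. ennreal c)) (\<theta> -` W)"
    using o1 W theta_measure[of W] by (simp add: emeasure_density nn_integral_cmult_indicator)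
  also have "\<dots> = emeasure M ((\<lambda>y. y + z) -` (\<theta> -` W))"
    unfolding c(2)[symmetric] using o1 by (subst emeasure_distr) auto
  also have "(\<lambda>y. y + z) -` (\<theta> -` W) = \<theta> -` ((\<lambda>h. h + \<theta> z) -` W)" by (auto simp: theta_add)
  also have "emeasure M \<dots> = emeasure N ((\<lambda>h. h + \<theta> z) -` W)" using o2 sub by (intro theta_measure) auto
  also have "\<dots> = emeasure (density N (\<lambda>_. ennreal d)) W"
    unfolding d(2)[symmetric] using W by (subst emeasure_distr) auto
  also have "\<dots> = ennreal d * emeasure N W" using W by (simp add: emeasure_density nn_integral_cmult_indicator)
  finally have eq: "ennreal c * emeasure N W = ennreal d * emeasure N W" .
  obtain w where w: "emeasure N W = ennreal w" "w > 0" using W(6,7) by (cases "emeasure N W") auto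
  have "ennreal (c * w) = ennreal (d * w)" using eq w c d by (simp add: ennreal_mult)
  then have "c = d" using w c d by simp
  then show ?thesis using that c d by blast
qed

text \<open>\<open>f'\<close> is the density of the image under \<open>\<theta>\<close> of the
  measure with density \<open>f\<close>, that is, the integral of \<open>f\<close> over the fibres.
  Its norm is bounded by testing it against its own truncations and using
  \<open>2 * (a * b) \<le> a\<^sup>2 + b\<^sup>2\<close>.\<close>

lemma push_nonneg:
  fixes f :: "'g \<Rightarrow> real"
  assumes f: "L2fun M (\<lambda>x. of_real (f x))" and f0: "\<And>x. f x \<ge> 0"
  obtains f' :: "'h \<Rightarrow> real" where "\<And>h. f' h \<ge> 0" "L2fun N (\<lambda>h. of_real (f' h))" "L2norm N (\<lambda>h. of_real (f' h)) \<le> L2norm M (\<lambda>x. of_real (f x))"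
    "\<And>h. h \<notin> range \<theta> \<Longrightarrow> f' h = 0" "f' \<in> borel_measurable borel" "distr (density M (\<lambda>x. ennreal (f x))) N \<theta> = density N (\<lambda>h. ennreal (f' h))"
proof -
  let ?c = "\<lambda>x. complex_of_real (f x)"
  have fm: "f \<in> borel_measurable borel"
    using measurable_compose[OF L2fun_measurable[OF f] borel_measurable_continuous_onI[OF continuous_on_Re[OF continuous_on_id]]]
    by simp
  note [measurable] = fm
  let ?D = "density M (\<lambda>x. ennreal (f x))"
  let ?\<nu> = "distr ?D N \<theta>"
  have ac: "absolutely_continuous N ?\<nu>"
    unfolding absolutely_continuous_def
  proof
    fix A assume A: "A \<in> null_sets N"
    then have [measurable]: "A \<in> sets borel" by auto
    have "emeasure M (\<theta> -` A) = emeasure M (\<theta> -` (A \<inter> range \<theta>))" by (intro arg_cong[where f="emeasure M"]) auto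
    also have "\<dots> = emeasure N (A \<inter> range \<theta>)" by (rule theta_measure) auto
    also have "\<dots> = 0" using A by (metis Int_lower1 \<open>A \<in> sets borel\<close> emeasure_eq_0 null_setsD1 null_setsD2)
    finally have "\<theta> -` A \<in> null_sets M" by (auto intro!: null_setsI measurable_sets_borel[OF theta_measurable])
    then have "\<theta> -` A \<in> null_sets ?D"
      using absolutely_continuousI_density[of "\<lambda>x. ennreal (f x)" M] by (auto simp: absolutely_continuous_def)
    then show "A \<in> null_sets ?\<nu>" by (intro null_setsI) (auto simp: emeasure_distr)
  qed
  have seq: "sets ?\<nu> = sets N" by simp
  obtain r where rm[measurable]: "r \<in> borel_measurable N" and r: "density N r = ?\<nu>"
    using H.Radon_Nikodym[OF ac seq] by blast
  have rint: "(\<integral>\<^sup>+h. r h * \<phi> h \<partial>N) = (\<integral>\<^sup>+x. ennreal (f x) * \<phi> (\<theta> x) \<partial>M)" if [measurable]: "\<phi> \<in> borel_measurable borel" for \<phi>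
  proof -
    have "(\<integral>\<^sup>+h. r h * \<phi> h \<partial>N) = (\<integral>\<^sup>+h. \<phi> h \<partial>?\<nu>)" unfolding r[symmetric] by (subst nn_integral_density) auto
    also have "\<dots> = (\<integral>\<^sup>+x. ennreal (f x) * \<phi> (\<theta> x) \<partial>M)"
      by (subst nn_integral_distr) (auto simp: nn_integral_density)
    finally show ?thesis .
  qed
  obtain Om :: "nat \<Rightarrow> 'h set" where Om: "\<And>n. open (Om n)" "\<And>n. emeasure N (Om n) < \<infinity>" "incseq Om" "(\<Union>n. Om n) = UNIV"
      "\<And>n. \<exists>K. compact K \<and> Om n \<subseteq> K" by (fact H.open_exhaustion)
  have [measurable]: "Om n \<in> sets borel" for n using Om by auto
  \<comment> \<open>Truncated in height and in support, so that the integral of its square is finite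
    and can be cancelled from both sides of the estimate.\<close>
  define \<psi> where "\<psi> n h = min (r h) (of_nat n) * indicator (Om n) h" for n h
  have [measurable]: "\<psi> n \<in> borel_measurable borel" for n unfolding \<psi>_def using rm by measurable
  have b\<psi>: "(\<integral>\<^sup>+h. (\<psi> n h)\<^sup>2 \<partial>N) \<le> E2 M ?c" for n
  proof -
    let ?I = "\<integral>\<^sup>+h. (\<psi> n h)\<^sup>2 \<partial>N"
    have "?I \<le> (\<integral>\<^sup>+h. (of_nat n)\<^sup>2 * indicator (Om n) h \<partial>N)"
      by (intro nn_integral_mono) (auto simp: \<psi>_def indicator_def power2_eq_square intro!: mult_mono)
    also have "\<dots> < \<infinity>" using Om(2)[of n] by (simp add: nn_integral_cmult_indicator ennreal_mult_less_top power2_eq_square of_nat_less_top)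
    finally have fin: "?I < \<infinity>" .
    have "?I \<le> (\<integral>\<^sup>+h. r h * \<psi> n h \<partial>N)"
      by (intro nn_integral_mono) (auto simp: \<psi>_def indicator_def power2_eq_square intro!: mult_mono)
    also have "\<dots> = (\<integral>\<^sup>+x. ennreal (f x) * \<psi> n (\<theta> x) \<partial>M)" by (rule rint) measurable
    finally have "2 * ?I \<le> 2 * (\<integral>\<^sup>+x. ennreal (f x) * \<psi> n (\<theta> x) \<partial>M)" by (rule mult_left_mono) simp
    also have "\<dots> = (\<integral>\<^sup>+x. 2 * (ennreal (f x) * \<psi> n (\<theta> x)) \<partial>M)" by (rule nn_integral_cmult[symmetric]) measurable
    also have "\<dots> \<le> (\<integral>\<^sup>+x. (ennreal (f x))\<^sup>2 + (\<psi> n (\<theta> x))\<^sup>2 \<partial>M)" by (intro nn_integral_mono ennreal_AMGM)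
    also have "\<dots> = E2 M ?c + (\<integral>\<^sup>+x. (\<psi> n (\<theta> x))\<^sup>2 \<partial>M)"
      unfolding E2_def using f0 by (simp add: nn_integral_add ennreal_power)
    also have "(\<integral>\<^sup>+x. (\<psi> n (\<theta> x))\<^sup>2 \<partial>M) \<le> ?I"
      by (subst nn_integral_theta[of "\<lambda>h. (\<psi> n h)\<^sup>2"]) (auto intro!: nn_integral_mono simp: indicator_def)
    finally have "?I + ?I \<le> ?I + E2 M ?c" by (simp add: mult_2 add.commute add_left_mono)
    then show ?thesis using fin by (auto simp: ennreal_add_left_cancel_le)
  qed
  have r2: "(\<integral>\<^sup>+h. (r h)\<^sup>2 \<partial>N) \<le> E2 M ?c"
  proof -
    have lim: "(\<lambda>n. (\<psi> n h)\<^sup>2) \<longlonglongrightarrow> (r h)\<^sup>2" for h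
    proof -
      have "(\<lambda>n. min (r h) (of_nat n)) \<longlonglongrightarrow> min (r h) top"
        by (intro tendsto_min tendsto_const of_nat_tendsto_top_ennreal)
      then have "(\<lambda>n. min (r h) (of_nat n) * min (r h) (of_nat n)) \<longlonglongrightarrow> r h * r h"
        by (intro tendsto_mult_ennreal) auto
      moreover obtain n0 where "h \<in> Om n0" using Om(4) by blast
      then have "h \<in> Om n" if "n \<ge> n0" for n using incseqD[OF Om(3) that] by auto
      then have "\<forall>\<^sub>F n in sequentially. min (r h) (of_nat n) * min (r h) (of_nat n) = (\<psi> n h)\<^sup>2"
        unfolding eventually_sequentially by (intro exI[of _ n0]) (auto simp: \<psi>_def power2_eq_square)
      ultimately show ?thesis by (simp add: power2_eq_square tendsto_cong)
    qed
    have "(\<integral>\<^sup>+h. (r h)\<^sup>2 \<partial>N) = (\<integral>\<^sup>+h. liminf (\<lambda>n. (\<psi> n h)\<^sup>2) \<partial>N)"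
      by (intro nn_integral_cong lim_imp_Liminf[symmetric] lim) simp
    also have "\<dots> \<le> liminf (\<lambda>n. \<integral>\<^sup>+h. (\<psi> n h)\<^sup>2 \<partial>N)" by (rule nn_integral_liminf) measurable
    also have "\<dots> \<le> liminf (\<lambda>n. E2 M ?c)" by (intro Liminf_mono always_eventually allI b\<psi>)
    also have "\<dots> = E2 M ?c" by (simp add: Liminf_const)
    finally show ?thesis .
  qed
  then have "(\<integral>\<^sup>+h. (r h)\<^sup>2 \<partial>N) < \<infinity>" using f by (auto simp: L2fun_iff intro: le_less_trans)
  then have "AE h in N. (r h)\<^sup>2 \<noteq> \<infinity>" by (intro nn_integral_PInf_AE) auto
  then have ae1: "AE h in N. r h \<noteq> \<infinity>" by eventually_elim (auto simp: power2_eq_square ennreal_mult_top)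
  have "(\<integral>\<^sup>+h. r h * indicator (- range \<theta>) h \<partial>N) = 0" by (subst rint) auto
  then have ae2: "AE h in N. r h * indicator (- range \<theta>) h = 0" by (subst (asm) nn_integral_0_iff_AE) auto
  \<comment> \<open>A version of the density that is real-valued and zero off the range everywhere,
    not merely almost everywhere: supports are later examined point by point.\<close>
  define f' where "f' h = indicator (range \<theta>) h * enn2real (r h)" for h
  have f'm[measurable]: "f' \<in> borel_measurable borel" unfolding f'_def using rm by measurable
  have ae: "AE h in N. ennreal (f' h) = r h"
    using ae1 ae2 by eventually_elim (auto simp: f'_def indicator_def less_top split: if_splits)
  have "density N (\<lambda>h. ennreal (f' h)) = density N r" by (rule density_cong) (use ae in auto)
  then have 1: "?\<nu> = density N (\<lambda>h. ennreal (f' h))" using r by simp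
  have f'0: "f' h \<ge> 0" for h by (simp add: f'_def)
  have "E2 N (\<lambda>h. of_real (f' h)) = (\<integral>\<^sup>+h. (r h)\<^sup>2 \<partial>N)"
    unfolding E2_def using ae by (intro nn_integral_cong_AE) (auto elim!: eventually_mono simp: ennreal_power[symmetric] f'0)
  with r2 have e: "E2 N (\<lambda>h. of_real (f' h)) \<le> ennreal ((L2norm M ?c)\<^sup>2)" by (simp add: E2_eq_L2norm[OF f])
  have mc: "(\<lambda>h. complex_of_real (f' h)) \<in> borel_measurable N" by measurable
  show ?thesis
    by (rule that[OF f'0 L2I(1)[OF mc e L2norm_nonneg] L2I(2)[OF mc e L2norm_nonneg] _ f'm 1]) (simp add: f'_def)
qed

text \<open>The fibre integral of \<open>F\<close>, specified by duality with functions of the form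
  \<open>\<phi> \<circ> \<theta>\<close>. This fixes \<open>F'\<close> up to null sets; off the
  range it is pinned to 0 so that coefficients of pushed vectors vanish there.\<close>

definition push :: "('g \<Rightarrow> complex) \<Rightarrow> ('h \<Rightarrow> complex) \<Rightarrow> bool" where
  "push F F' \<longleftrightarrow> L2fun M F \<and> L2fun N F' \<and> (\<forall>h. h \<notin> range \<theta> \<longrightarrow> F' h = 0) \<and>
    (\<forall>\<phi> \<in> borel_measurable borel. integrable M (\<lambda>x. F x * \<phi> (\<theta> x)) \<longrightarrow>
       integrable N (\<lambda>h. F' h * \<phi> h) \<and> (\<integral>x. F x * \<phi> (\<theta> x) \<partial>M) = (\<integral>h. F' h * \<phi> h \<partial>N))"

lemma push_real:
  fixes f :: "'g \<Rightarrow> real" and f' :: "'h \<Rightarrow> real" and \<phi> :: "'h \<Rightarrow> complex"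
  assumes fm[measurable]: "f \<in> borel_measurable borel" "f' \<in> borel_measurable borel" "\<phi> \<in> borel_measurable borel"
    and nn: "\<And>x. f x \<ge> 0" "\<And>h. f' h \<ge> 0"
    and d: "distr (density M (\<lambda>x. ennreal (f x))) N \<theta> = density N (\<lambda>h. ennreal (f' h))"
    and I: "integrable M (\<lambda>x. of_real (f x) * \<phi> (\<theta> x))"
  shows "integrable N (\<lambda>h. of_real (f' h) * \<phi> h)" "(\<integral>x. of_real (f x) * \<phi> (\<theta> x) \<partial>M) = (\<integral>h. of_real (f' h) * \<phi> h \<partial>N)"
proof -
  have "integrable (distr (density M (\<lambda>x. ennreal (f x))) N \<theta>) \<phi>"
    using I nn by (subst integrable_distr_eq) (auto simp: integrable_density scaleR_conv_of_real)
  then show "integrable N (\<lambda>h. of_real (f' h) * \<phi> h)"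
    unfolding d using nn by (subst (asm) integrable_density) (auto simp: scaleR_conv_of_real)
  have "(\<integral>h. \<phi> h \<partial>distr (density M (\<lambda>x. ennreal (f x))) N \<theta>) = (\<integral>x. of_real (f x) * \<phi> (\<theta> x) \<partial>M)"
    using nn by (subst integral_distr) (auto simp: integral_density scaleR_conv_of_real)
  moreover have "(\<integral>h. \<phi> h \<partial>density N (\<lambda>h. ennreal (f' h))) = (\<integral>h. of_real (f' h) * \<phi> h \<partial>N)"
    using nn by (subst integral_density) (auto simp: scaleR_conv_of_real)
  ultimately show "(\<integral>x. of_real (f x) * \<phi> (\<theta> x) \<partial>M) = (\<integral>h. of_real (f' h) * \<phi> h \<partial>N)"
    unfolding d by simp
qed

text \<open>Four nonnegative parts with coefficients \<open>\<i> ^ k\<close> are pushed separately.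
  The factor 4 is the cost of recombining them by the triangle inequality; only boundedness
  matters.\<close>

lemma push_exists:
  assumes F: "L2fun M F"
  obtains F' where "push F F'" "L2norm N F' \<le> 4 * L2norm M F"
proof -
  note [measurable] = L2fun_measurable[OF F]
  define f where "f k x = (if k = 0 then max (Re (F x)) 0 else if k = 1 then max (Im (F x)) 0
    else if k = 2 then max (- Re (F x)) 0 else max (- Im (F x)) 0)" for k :: nat and x
  have fm[measurable]: "f k \<in> borel_measurable borel" for k unfolding f_def by measurable
  have f0: "f k x \<ge> 0" for k x by (simp add: f_def)
  have fb: "f k x \<le> cmod (F x)" for k x
    using abs_Re_le_cmod[of "F x"] abs_Im_le_cmod[of "F x"] by (auto simp: f_def)
  have Fsum: "F x = (\<Sum>k<4. \<i> ^ k * of_real (f k x))" for x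
    by (simp add: f_def numeral_eq_Suc complex_eq_iff power2_i[unfolded power2_eq_square])
       (auto simp: max_def)
  have Lf: "L2fun M (\<lambda>x. of_real (f k x))" and Nf: "L2norm M (\<lambda>x. of_real (f k x)) \<le> L2norm M F" for k
  proof -
    have "E2 M (\<lambda>x. of_real (f k x)) \<le> E2 M F" unfolding E2_def using f0 fb
      by (intro nn_integral_mono ennreal_leI power_mono) auto
    then have e: "E2 M (\<lambda>x. of_real (f k x)) \<le> ennreal ((L2norm M F)\<^sup>2)" by (simp add: E2_eq_L2norm[OF F])
    have m: "(\<lambda>x. complex_of_real (f k x)) \<in> borel_measurable M" by measurable
    show "L2fun M (\<lambda>x. of_real (f k x))" "L2norm M (\<lambda>x. of_real (f k x)) \<le> L2norm M F" using L2I[OF m e] by auto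
  qed
  have "\<exists>f'. (\<forall>h. f' h \<ge> 0) \<and> L2fun N (\<lambda>h. of_real (f' h)) \<and> L2norm N (\<lambda>h. of_real (f' h)) \<le> L2norm M (\<lambda>x. of_real (f k x)) \<and>
    (\<forall>h. h \<notin> range \<theta> \<longrightarrow> f' h = 0) \<and> f' \<in> borel_measurable borel \<and> distr (density M (\<lambda>x. ennreal (f k x))) N \<theta> = density N (\<lambda>h. ennreal (f' h))" for k
    by (rule push_nonneg[OF Lf f0]) blast
  then obtain f' where f': "\<And>k h. f' k h \<ge> 0" "\<And>k. L2fun N (\<lambda>h. of_real (f' k h))"
    "\<And>k. L2norm N (\<lambda>h. of_real (f' k h)) \<le> L2norm M (\<lambda>x. of_real (f k x))" "\<And>k h. h \<notin> range \<theta> \<Longrightarrow> f' k h = 0"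
    "\<And>k. f' k \<in> borel_measurable borel" "\<And>k. distr (density M (\<lambda>x. ennreal (f k x))) N \<theta> = density N (\<lambda>h. ennreal (f' k h))"
    by metis
  define F' where "F' h = (\<Sum>k<4. \<i> ^ k * of_real (f' k h))" for h
  have LF': "L2fun N F'" unfolding F'_def by (intro L2fun_sum L2fun_scale f')
  have "push F F'" unfolding push_def
  proof (intro conjI allI impI ballI F LF')
    show "F' h = 0" if "h \<notin> range \<theta>" for h using f'(4)[OF that] by (simp add: F'_def)
    fix \<phi> :: "'h \<Rightarrow> complex" assume [measurable]: "\<phi> \<in> borel_measurable borel" and I: "integrable M (\<lambda>x. F x * \<phi> (\<theta> x))"
    have Ik: "integrable M (\<lambda>x. of_real (f k x) * \<phi> (\<theta> x))" for k
      by (rule Bochner_Integration.integrable_bound[OF I]) (auto simp: norm_mult f0 intro!: mult_right_mono fb)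
    note P = push_real[OF fm f'(5) \<open>\<phi> \<in> borel_measurable borel\<close> f0 f'(1) f'(6) Ik]
    have "(\<lambda>h. F' h * \<phi> h) = (\<lambda>h. \<Sum>k<4. \<i> ^ k * (of_real (f' k h) * \<phi> h))"
      by (simp add: F'_def sum_distrib_right mult.assoc)
    moreover have "(\<lambda>x. F x * \<phi> (\<theta> x)) = (\<lambda>x. \<Sum>k<4. \<i> ^ k * (of_real (f k x) * \<phi> (\<theta> x)))"
      by (subst Fsum) (simp add: sum_distrib_right mult.assoc)
    ultimately show "integrable N (\<lambda>h. F' h * \<phi> h)" "(\<integral>x. F x * \<phi> (\<theta> x) \<partial>M) = (\<integral>h. F' h * \<phi> h \<partial>N)"
      using P Ik by (simp_all add: Bochner_Integration.integral_sum)
  qed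
  moreover have "L2norm N F' \<le> 4 * L2norm M F"
  proof -
    have "L2norm N (\<lambda>h. \<Sum>k<n. \<i> ^ k * of_real (f' k h)) \<le> real n * L2norm M F" for n :: nat
    proof (induction n)
      case (Suc n)
      have "L2norm N (\<lambda>h. (\<Sum>k<n. \<i> ^ k * of_real (f' k h)) + \<i> ^ n * of_real (f' n h)) \<le>
        L2norm N (\<lambda>h. \<Sum>k<n. \<i> ^ k * of_real (f' k h)) + L2norm N (\<lambda>h. \<i> ^ n * of_real (f' n h))"
        by (intro L2norm_triangle L2fun_sum L2fun_scale f')
      also have "L2norm N (\<lambda>h. \<i> ^ n * of_real (f' n h)) \<le> L2norm M F"
        using order_trans[OF f'(3)[of n] Nf[of n]] L2norm_scale[OF f'(2)[of n], of "\<i> ^ n"] by (simp add: norm_power)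
      finally show ?case using Suc by (simp add: algebra_simps)
    qed simp
    from this[of 4] show ?thesis by (simp add: F'_def[abs_def])
  qed
  ultimately show ?thesis using that by blast
qed

lemma pushD:
  assumes "push F F'"
  shows "L2fun M F" "L2fun N F'" "h \<notin> range \<theta> \<Longrightarrow> F' h = 0"
    "\<phi> \<in> borel_measurable borel \<Longrightarrow> integrable M (\<lambda>x. F x * \<phi> (\<theta> x)) \<Longrightarrow> (\<integral>x. F x * \<phi> (\<theta> x) \<partial>M) = (\<integral>h. F' h * \<phi> h \<partial>N)"
  using assms by (auto simp: push_def)

end

section \<open>Averages over small open sets\<close>

definition unit_measure :: "'a::topological_space measure \<Rightarrow> bool" where
  "unit_measure \<kappa> \<longleftrightarrow> sets \<kappa> = sets borel \<and> emeasure \<kappa> UNIV = 1"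

lemma unit_measureD:
  assumes "unit_measure \<kappa>"
  shows "sets \<kappa> = sets borel" "space \<kappa> = UNIV" "emeasure \<kappa> UNIV = 1" "finite_measure \<kappa>" "sigma_finite_measure \<kappa>"
proof -
  show s: "sets \<kappa> = sets borel" "emeasure \<kappa> UNIV = 1" using assms by (auto simp: unit_measure_def)
  show sp: "space \<kappa> = UNIV" using sets_eq_imp_space_eq[OF s(1)] by simp
  show f: "finite_measure \<kappa>" by (rule finite_measureI) (simp add: sp s)
  show "sigma_finite_measure \<kappa>" using f by (simp add: finite_measure_def)
qed

lemma nn_integral_unit_measure_le:
  assumes \<kappa>: "unit_measure \<kappa>" and b: "AE y in \<kappa>. f y \<le> c"
  shows "(\<integral>\<^sup>+y. f y \<partial>\<kappa>) \<le> c"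
proof -
  have "(\<integral>\<^sup>+y. f y \<partial>\<kappa>) \<le> (\<integral>\<^sup>+y. c \<partial>\<kappa>)" using b by (rule nn_integral_mono_AE)
  also have "\<dots> = c" using unit_measureD[OF \<kappa>] by simp
  finally show ?thesis .
qed

lemma integral_unit_measure_le:
  fixes f :: "'a::topological_space \<Rightarrow> complex"
  assumes \<kappa>: "unit_measure \<kappa>" and b: "AE y in \<kappa>. cmod (f y) \<le> c" and c: "0 \<le> c"
  shows "cmod (\<integral>y. f y \<partial>\<kappa>) \<le> c"
proof (cases "integrable \<kappa> f")
  case True
  have "ennreal (cmod (\<integral>y. f y \<partial>\<kappa>)) \<le> (\<integral>\<^sup>+y. ennreal (cmod (f y)) \<partial>\<kappa>)" by (rule integral_norm_bound_ennreal[OF True])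
  also have "\<dots> \<le> ennreal c"
    by (rule nn_integral_unit_measure_le[OF \<kappa>]) (use b in \<open>eventually_elim, simp add: ennreal_leI\<close>)
  finally show ?thesis using c by simp
next
  case False
  then show ?thesis using c by (simp add: not_integrable_integral_eq)
qed

lemma integrable_unit_measure:
  fixes f :: "'a::topological_space \<Rightarrow> complex"
  assumes \<kappa>: "unit_measure \<kappa>" and "f \<in> borel_measurable borel" and b: "\<And>y. cmod (f y) \<le> c"
  shows "integrable \<kappa> f"
proof -
  interpret finite_measure \<kappa> by (rule unit_measureD[OF \<kappa>])
  have "f \<in> borel_measurable \<kappa>" using assms(2) measurable_cong_sets[OF unit_measureD(1)[OF \<kappa>] refl] by auto
  then show ?thesis using b by (intro integrable_const_bound[of _ c]) auto
qed

context lcsc_haar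
begin

lemma unit_measure_uniform:
  assumes "open V" "V \<noteq> {}" "emeasure M V < \<infinity>"
  shows "unit_measure (uniform_measure M V)"
proof -
  have V: "V \<in> sets M" "emeasure M V \<noteq> 0" using assms open_pos[OF assms(1,2)] by auto
  have "emeasure (uniform_measure M V) UNIV = emeasure M V / emeasure M V"
    using V by (subst emeasure_uniform_measure) auto
  also have "\<dots> = 1" using V assms by (intro ennreal_divide_self) auto
  finally show ?thesis by (simp add: unit_measure_def)
qed

text \<open>One neighbourhood has to serve all terms of a series: the first \<open>n0\<close>
  vectors are handled by continuity of translation, the tail by the trivial bound
  \<open>2 * L2norm M (F n)\<close> and summability. The bounds \<open>\<omega> n\<close> do not
  depend on the translation, so they can be taken out of averages.\<close>

lemma small_moduli:
  assumes F: "\<And>n. L2fun M (F n)" and s: "summable (\<lambda>n. L2norm M (F n) * L2norm M (G n))" and e: "\<epsilon> > 0"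
  obtains U \<omega> where "open U" "0 \<in> U" "\<And>n. 0 \<le> \<omega> n" "\<And>n h. h \<in> U \<Longrightarrow> L2norm M (\<lambda>z. F n (- h + z) - F n z) \<le> \<omega> n"
    "summable (\<lambda>n. \<omega> n * L2norm M (G n))" "(\<Sum>n. \<omega> n * L2norm M (G n)) < \<epsilon>"
proof -
  let ?b = "\<lambda>n. 2 * (L2norm M (F n) * L2norm M (G n))"
  have sb: "summable ?b" by (intro summable_mult s)
  obtain n0 where n0: "norm (\<Sum>i. ?b (i + n0)) < \<epsilon> / 2" using suminf_exist_split[of "\<epsilon> / 2" ?b] e sb by auto
  define T where "T = (\<Sum>n<n0. L2norm M (G n))"
  have T: "T \<ge> 0" by (simp add: T_def sum_nonneg)
  \<comment> \<open>Chosen so that the first \<open>n0\<close> terms add up to at most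
    \<open>\<epsilon> / 2\<close>.\<close>
  define \<eta> where "\<eta> = \<epsilon> / (2 * (1 + T))"
  have \<eta>: "\<eta> > 0" using e T by (simp add: \<eta>_def)
  have "\<forall>\<^sub>F h in nhds 0. \<forall>n\<in>{..<n0}. L2norm M (\<lambda>z. F n (- h + z) - F n z) < \<eta>"
    by (intro eventually_ball_finite ballI L2_translation_continuous F \<eta>) simp
  then obtain U where U: "open U" "0 \<in> U" "\<And>h n. h \<in> U \<Longrightarrow> n < n0 \<Longrightarrow> L2norm M (\<lambda>z. F n (- h + z) - F n z) < \<eta>"
    unfolding eventually_nhds by auto
  define \<omega> where "\<omega> n = (if n < n0 then \<eta> else 2 * L2norm M (F n))" for n
  have sw: "summable (\<lambda>n. \<omega> n * L2norm M (G n))"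
  proof (rule summable_iff_shift[THEN iffD1, of _ n0])
    have "(\<lambda>n. \<omega> (n + n0) * L2norm M (G (n + n0))) = (\<lambda>n. ?b (n + n0))" by (auto simp: \<omega>_def)
    then show "summable (\<lambda>n. \<omega> (n + n0) * L2norm M (G (n + n0)))" using summable_iff_shift[of ?b n0] sb by simp
  qed
  have "(\<Sum>n. \<omega> n * L2norm M (G n)) = (\<Sum>n. \<omega> (n + n0) * L2norm M (G (n + n0))) + (\<Sum>n<n0. \<omega> n * L2norm M (G n))"
    by (rule suminf_split_initial_segment[OF sw])
  also have "(\<Sum>n<n0. \<omega> n * L2norm M (G n)) = \<eta> * T" by (simp add: \<omega>_def T_def sum_distrib_left)
  also have "(\<Sum>n. \<omega> (n + n0) * L2norm M (G (n + n0))) = (\<Sum>n. ?b (n + n0))" by (simp add: \<omega>_def mult.assoc)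
  also have "(\<Sum>n. ?b (n + n0)) < \<epsilon> / 2" using n0 by simp
  also have "\<eta> * T \<le> \<epsilon> / 2"
  proof -
    have "\<eta> * (1 + T) = \<epsilon> / 2" using T by (simp add: \<eta>_def field_simps add_nonneg_eq_0_iff)
    then show ?thesis using \<eta> by (simp add: algebra_simps)
  qed
  finally have lt: "(\<Sum>n. \<omega> n * L2norm M (G n)) < \<epsilon>" by simp
  show ?thesis
  proof (rule that[OF U(1,2) _ _ sw lt])
    show "0 \<le> \<omega> n" for n using \<eta> by (simp add: \<omega>_def)
    show "L2norm M (\<lambda>z. F n (- h + z) - F n z) \<le> \<omega> n" if "h \<in> U" for n h
      using U(3)[OF that, of n] L2_translation_bound[OF F, of n "- h"] by (auto simp: \<omega>_def)
  qed
qed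

text \<open>By \<open>conv_check_bound\<close> the series is dominated uniformly in
  \<open>y\<close>; with a bounded weight and a probability measure it may be summed inside the
  integral.\<close>

lemma conv_series_integral_sums:
  assumes L: "\<And>n. L2fun M (f n)" "\<And>n. L2fun M (g n)" and s: "summable (\<lambda>n. L2norm M (f n) * L2norm M (g n))"
    and u: "\<And>x. (\<lambda>n. conv_check M (f n) (g n) x) sums u x"
    and \<kappa>: "unit_measure \<kappa>" and q: "q \<in> borel_measurable borel" "\<And>y. cmod (q y) \<le> B"
  shows "(\<lambda>n. \<integral>y. q y * conv_check M (f n) (g n) (- y + x) \<partial>\<kappa>) sums (\<integral>y. q y * u (- y + x) \<partial>\<kappa>)"
proof -
  note [measurable] = conv_check_measurable[OF L(1)[THEN L2fun_measurable] L(2)[THEN L2fun_measurable]] q(1)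
  have B0: "0 \<le> B" using q(2)[of undefined] norm_ge_zero order_trans by blast
  have bd: "cmod (q y * conv_check M (f n) (g n) (- y + x)) \<le> B * (L2norm M (f n) * L2norm M (g n))" for n y
    unfolding norm_mult by (intro mult_mono q conv_check_bound L B0) auto
  have I: "integrable \<kappa> (\<lambda>y. q y * conv_check M (f n) (g n) (- y + x))" for n
    by (rule integrable_unit_measure[OF \<kappa> _ bd]) measurable
  have sB: "summable (\<lambda>n. B * (L2norm M (f n) * L2norm M (g n)))" by (intro summable_mult s)
  have "(\<lambda>n. \<integral>y. q y * conv_check M (f n) (g n) (- y + x) \<partial>\<kappa>) sums (\<integral>y. (\<Sum>n. q y * conv_check M (f n) (g n) (- y + x)) \<partial>\<kappa>)"
  proof (rule sums_integral[OF I])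
    show "AE y in \<kappa>. summable (\<lambda>n. norm (q y * conv_check M (f n) (g n) (- y + x)))"
    proof (rule AE_I2)
      show "summable (\<lambda>n. norm (q y * conv_check M (f n) (g n) (- y + x)))" for y
        using bd by (intro summable_comparison_test'[OF sB, of 0]) auto
    qed
    have nb: "(\<integral>y. norm (q y * conv_check M (f n) (g n) (- y + x)) \<partial>\<kappa>) \<le> B * (L2norm M (f n) * L2norm M (g n))" for n
    proof -
      have "(\<integral>y. norm (q y * conv_check M (f n) (g n) (- y + x)) \<partial>\<kappa>) \<le> (\<integral>y. B * (L2norm M (f n) * L2norm M (g n)) \<partial>\<kappa>)"
        using bd I finite_measure.emeasure_finite[OF unit_measureD(4)[OF \<kappa>]]
        by (intro integral_mono integrable_norm finite_measure.integrable_const[OF unit_measureD(4)[OF \<kappa>]])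
      then show ?thesis using unit_measureD[OF \<kappa>] by (simp add: measure_def)
    qed
    show "summable (\<lambda>n. \<integral>y. norm (q y * conv_check M (f n) (g n) (- y + x)) \<partial>\<kappa>)"
      using nb by (intro summable_comparison_test'[OF sB, of 0]) auto
  qed
  moreover have "(\<Sum>n. q y * conv_check M (f n) (g n) (- y + x)) = q y * u (- y + x)" for y
    using sums_mult[OF u[of "- y + x"], of "q y"] by (simp add: sums_iff)
  ultimately show ?thesis by simp
qed

text \<open>The difference is itself a coefficient with multiplicity space \<open>\<kappa>\<close>:
  the second vector is constant in \<open>h\<close>, the first is \<open>F (- h + z) - F z\<close>,
  and averaging over a probability measure keeps its norm below \<open>\<omega>\<close>.\<close>

lemma fbound_translation_average:
  assumes F: "L2fun M F" and G: "L2fun M G" and \<kappa>: "unit_measure \<kappa>"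
    and w: "AE h in \<kappa>. L2norm M (\<lambda>z. F (- h + z) - F z) \<le> \<omega>" "0 \<le> \<omega>"
  shows "fbound (\<lambda>x. (\<integral>h. conv_check M F G (- h + x) \<partial>\<kappa>) - conv_check M F G x) (24 * (\<omega> * L2norm M G))"
proof -
  note [measurable] = L2fun_measurable[OF F] L2fun_measurable[OF G]
  have [measurable_cong]: "sets \<kappa> = sets borel" by (rule unit_measureD[OF \<kappa>])
  have \<kappa>s: "sigma_finite_measure \<kappa>" by (rule unit_measureD[OF \<kappa>])
  interpret P: pair_sigma_finite M \<kappa> using \<kappa>s by (rule pair_sigma_finite_M)
  define A where "A p = F (- snd p + fst p) - F (fst p)" for p
  define B where "B p = G (fst p)" for p :: "'g \<times> 'g"
  have mA: "A \<in> borel_measurable (M \<Otimes>\<^sub>M \<kappa>)" and mB: "B \<in> borel_measurable (M \<Otimes>\<^sub>M \<kappa>)" unfolding A_def B_def by measurable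
  have "E2 (M \<Otimes>\<^sub>M \<kappa>) A = (\<integral>\<^sup>+h. E2 M (\<lambda>z. F (- h + z) - F z) \<partial>\<kappa>)" unfolding P.E2_snd[OF mA] by (simp add: A_def)
  also have "\<dots> \<le> ennreal (\<omega>\<^sup>2)"
    by (rule nn_integral_unit_measure_le[OF \<kappa>])
       (use w(1) in \<open>eventually_elim, simp add: E2_eq_L2norm L2fun_diff L2fun_shift F ennreal_leI power_mono\<close>)
  finally have eA: "E2 (M \<Otimes>\<^sub>M \<kappa>) A \<le> ennreal (\<omega>\<^sup>2)" .
  note LA = L2I[OF mA eA w(2)]
  have "E2 (M \<Otimes>\<^sub>M \<kappa>) B \<le> ennreal ((L2norm M G)\<^sup>2)" unfolding P.E2_snd[OF mB] 
    by (rule nn_integral_unit_measure_le[OF \<kappa>]) (simp add: B_def E2_eq_L2norm G)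
  note LB = L2I[OF mB this L2norm_nonneg]
  have "(\<integral>h. conv_check M F G (- h + x) \<partial>\<kappa>) - conv_check M F G x = dcoef \<kappa> A B x" for x
  proof -
    have I: "integrable (M \<Otimes>\<^sub>M \<kappa>) (case_prod (\<lambda>z h. A (z, h) * B (- x + z, h)))"
      using dcoef_integrable[OF \<kappa>s LA(1) LB(1), of "- x"] by (simp add: case_prod_beta')
    have "dcoef \<kappa> A B x = (\<integral>h. (\<integral>z. A (z, h) * B (- x + z, h) \<partial>M) \<partial>\<kappa>)"
      unfolding P.integral_snd[OF I] by (simp add: dcoef_def case_prod_beta')
    also have "\<dots> = (\<integral>h. conv_check M F G (- h + x) - conv_check M F G x \<partial>\<kappa>)"
    proof (rule Bochner_Integration.integral_cong[OF refl])
      fix h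
      have "conv_check M F G (- h + x) - conv_check M F G x = conv_check M (\<lambda>y. F (- h + y) - F y) G x"
        by (simp add: conv_check_diff_left L2fun_shift F G conv_check_shift)
      then show "(\<integral>z. A (z, h) * B (- x + z, h) \<partial>M) = conv_check M F G (- h + x) - conv_check M F G x"
        by (simp add: A_def B_def conv_check_def)
    qed
    also have "\<dots> = (\<integral>h. conv_check M F G (- h + x) \<partial>\<kappa>) - (\<integral>h. conv_check M F G x \<partial>\<kappa>)"
    proof (rule Bochner_Integration.integral_diff)
      note [measurable] = conv_check_measurable[OF L2fun_measurable[OF F] L2fun_measurable[OF G]]
      show "integrable \<kappa> (\<lambda>h. conv_check M F G (- h + x))"
        by (rule integrable_unit_measure[OF \<kappa> _ conv_check_bound[OF F G]]) measurable
      show "integrable \<kappa> (\<lambda>h. conv_check M F G x)"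
        by (rule integrable_unit_measure[OF \<kappa> _ conv_check_bound[OF F G]]) measurable
    qed
    also have "(\<integral>h. conv_check M F G x \<partial>\<kappa>) = conv_check M F G x"
      using unit_measureD[OF \<kappa>] by (simp add: measure_def)
    finally show ?thesis by simp
  qed
  then have "(\<lambda>x. (\<integral>h. conv_check M F G (- h + x) \<partial>\<kappa>) - conv_check M F G x) = dcoef \<kappa> A B" by auto
  moreover have "L2norm (M \<Otimes>\<^sub>M \<kappa>) A * L2norm (M \<Otimes>\<^sub>M \<kappa>) B \<le> \<omega> * L2norm M G"
    using LA(2) LB(2) w(2) by (intro mult_mono) auto
  ultimately show ?thesis using fbound_mono[OF fbound_dcoef[OF \<kappa>s LA(1) LB(1)]] by simp
qed

section \<open>Averages of coefficients over preimages descend to the target group\<close>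

lemma density_const_integral:
  assumes "c > 0" "distr M M (\<lambda>y. y + z) = density M (\<lambda>_. ennreal c)" and [measurable]: "k \<in> borel_measurable M"
  shows "(\<integral>y. k (y + z) \<partial>M) = of_real c * (\<integral>y. k y \<partial>M :: complex)"
proof -
  have "(\<integral>y. k (y + z) \<partial>M) = (\<integral>y. k y \<partial>distr M M (\<lambda>y. y + z))" by (subst integral_distr) auto
  also have "\<dots> = (\<integral>y. c *\<^sub>R k y \<partial>M)" unfolding assms(2) using assms(1) by (subst integral_density) auto
  also have "\<dots> = of_real c * (\<integral>y. k y \<partial>M)" by (simp add: scaleR_conv_of_real)
  finally show ?thesis .
qed

end

context haar_hom
begin

text \<open>The indicator of the preimage of \<open>V\<close> sees \<open>y\<close> only through
  \<open>\<theta> y\<close>. Integrating over \<open>y\<close> first therefore lets \<open>G\<close>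
  be replaced by its push and leaves a function of \<open>\<theta> z\<close>; integrating that
  against \<open>F\<close> lets \<open>F\<close> be replaced too. The equality is exact for every
  \<open>V\<close>, which reduces averages over preimages to ordinary averages near 0 in the
  target.\<close>

lemma average_identity:
  assumes PF: "push F F'" and PG: "push G G'" and V: "open V" "V \<subseteq> range \<theta>" "emeasure N V < \<infinity>"
  shows "(\<integral>y. indicator (\<theta> -` V) y * conv_check M F G (- y + x) \<partial>M) = (\<integral>h. indicator V h * conv_check N F' G' (- h + \<theta> x) \<partial>N)"
proof -
  note LF = pushD(1)[OF PF] and LF' = pushD(2)[OF PF] and LG = pushD(1)[OF PG] and LG' = pushD(2)[OF PG]
  note [measurable] = LF[THEN L2fun_measurable] LF'[THEN L2fun_measurable] LG[THEN L2fun_measurable] LG'[THEN L2fun_measurable]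
  have [measurable]: "V \<in> sets borel" using V by simp
  interpret MM: pair_sigma_finite M M ..
  interpret NN: pair_sigma_finite N N ..
  have AV: "emeasure M (\<theta> -` V) = emeasure N V" using V by (intro theta_measure) auto
  have As: "\<theta> -` V \<in> sets M" using open_vimage[OF V(1) theta_cont] by simp
  have [measurable]: "\<theta> -` V \<in> sets borel" using As by simp
  have ind: "indicator (\<theta> -` V) y = (indicator V (\<theta> y) :: complex)" for y by (simp add: indicator_def)
  have e1: "- (- y + x) = - x + y" for x y :: 'g by (simp add: minus_add)
  have e2: "- (- y + x) = - x + y" for x y :: 'h by (simp add: minus_add)
  define \<Psi> where "\<Psi> h = (\<integral>t. indicator V t * G' (- \<theta> x + t + h) \<partial>N)" for h
  have m\<Psi>: "\<Psi> \<in> borel_measurable borel" unfolding \<Psi>_def by measurable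
  have I1: "integrable (M \<Otimes>\<^sub>M M) (\<lambda>(y, z). indicator (\<theta> -` V) y * (F z * G (- x + y + z)))"
    using G.conv_average_integrable[OF LF LG As, of x] V(3) by (simp add: AV e1)
  have I2: "integrable (N \<Otimes>\<^sub>M N) (\<lambda>(t, h). indicator V t * (F' h * G' (- \<theta> x + t + h)))"
    using H.conv_average_integrable[OF LF' LG', of V "\<theta> x"] V by (simp add: e2)
  \<comment> \<open>The variable \<open>z\<close> acts on the right. Moving it out costs the factor
    \<open>c\<close> in the source, and moving it back in the target returns the same
    factor.\<close>
  have inner: "(\<integral>y. indicator V (\<theta> y) * G (- x + y + z) \<partial>M) = \<Psi> (\<theta> z)" for z
  proof -
    obtain c where c: "c > 0" "distr M M (\<lambda>y. y + z) = density M (\<lambda>_. ennreal c)"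
      "distr N N (\<lambda>h. h + \<theta> z) = density N (\<lambda>_. ennreal c)" by (fact right_translation_common)
    define \<phi> :: "'h \<Rightarrow> complex" where "\<phi> h = indicator V (\<theta> x + h - \<theta> z)" for h
    have m\<phi>[measurable]: "\<phi> \<in> borel_measurable borel" unfolding \<phi>_def diff_conv_add_uminus by measurable
    let ?B = "{t. \<theta> x + \<theta> t - \<theta> z \<in> V}"
    have oB: "open ?B"
    proof -
      have "open ((\<lambda>t. \<theta> x + \<theta> t - \<theta> z) -` V)"
        using V theta_cont by (intro open_vimage continuous_intros) auto
      then show ?thesis by (simp add: vimage_def)
    qed
    \<comment> \<open>Finite mass of \<open>?B\<close> supplies the integrability that
      \<open>push\<close> demands of the test function \<open>\<phi>\<close>.\<close>
    have "ennreal c * emeasure M ?B = emeasure (distr M M (\<lambda>y. y + z)) ?B"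
      unfolding c(2) using oB by (simp add: emeasure_density nn_integral_cmult_indicator)
    also have "\<dots> = emeasure M ((\<lambda>y. y + z) -` ?B)" using oB by (subst emeasure_distr) auto
    also have "(\<lambda>y. y + z) -` ?B = (\<lambda>y. x + y) -` (\<theta> -` V)" by (auto simp: theta_add add.assoc add_diff_eq[symmetric])
    also have "emeasure M \<dots> = emeasure (distr M M (\<lambda>y. x + y)) (\<theta> -` V)" using As by (subst emeasure_distr) auto
    also have "\<dots> < \<infinity>" using V(3) by (simp add: G.distr_shift AV)
    finally have "emeasure M ?B < \<infinity>" using c(1) by (auto simp: ennreal_mult_less_top)
    then have LB: "L2fun M (indicator ?B)" using oB by (intro L2fun_indicator) auto
    have I\<phi>: "integrable M (\<lambda>t. G t * \<phi> (\<theta> t))"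
      using L2_mult_integrable[OF LG LB] by (simp add: \<phi>_def indicator_def)
    have "(\<integral>y. indicator V (\<theta> y) * G (- x + y + z) \<partial>M) = (\<integral>y. indicator V (\<theta> (x + y)) * G (- x + (x + y) + z) \<partial>M)"
      by (rule G.integral_shift[symmetric, of "\<lambda>y. indicator V (\<theta> y) * G (- x + y + z)"]) measurable
    also have "\<dots> = (\<integral>y. G (y + z) * \<phi> (\<theta> (y + z)) \<partial>M)"
      by (simp add: \<phi>_def theta_add add.assoc add_diff_eq[symmetric] mult.commute)
    also have "\<dots> = of_real c * (\<integral>y. G y * \<phi> (\<theta> y) \<partial>M)"
      by (rule G.density_const_integral[OF c(1,2), of "\<lambda>y. G y * \<phi> (\<theta> y)"]) measurable
    also have "(\<integral>y. G y * \<phi> (\<theta> y) \<partial>M) = (\<integral>h. G' h * \<phi> h \<partial>N)" by (rule pushD(4)[OF PG m\<phi> I\<phi>])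
    also have "of_real c * (\<integral>h. G' h * \<phi> h \<partial>N) = (\<integral>h. G' (h + \<theta> z) * \<phi> (h + \<theta> z) \<partial>N)"
      by (rule H.density_const_integral[OF c(1,3), of "\<lambda>h. G' h * \<phi> h", symmetric]) measurable
    also have "\<dots> = (\<integral>h. indicator V (\<theta> x + h) * G' (- \<theta> x + (\<theta> x + h) + \<theta> z) \<partial>N)"
      by (simp add: \<phi>_def add.assoc add_diff_eq[symmetric] mult.commute)
    also have "\<dots> = \<Psi> (\<theta> z)"
      unfolding \<Psi>_def by (rule H.integral_shift[of "\<lambda>h. indicator V h * G' (- \<theta> x + h + \<theta> z)"]) measurable
    finally show ?thesis .
  qed
  have in2: "(\<integral>y. indicator (\<theta> -` V) y * (F z * G (- x + y + z)) \<partial>M) = F z * \<Psi> (\<theta> z)" for z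
  proof -
    have "(\<integral>y. indicator (\<theta> -` V) y * (F z * G (- x + y + z)) \<partial>M) = (\<integral>y. F z * (indicator V (\<theta> y) * G (- x + y + z)) \<partial>M)"
      by (simp add: ind mult_ac)
    also have "\<dots> = F z * \<Psi> (\<theta> z)" by (simp only: integral_mult_right_zero inner)
    finally show ?thesis .
  qed
  have "(\<integral>y. indicator (\<theta> -` V) y * conv_check M F G (- y + x) \<partial>M) = (\<integral>y. (\<integral>z. indicator (\<theta> -` V) y * (F z * G (- x + y + z)) \<partial>M) \<partial>M)"
    by (simp add: conv_check_def e1)
  also have "\<dots> = (\<integral>z. F z * \<Psi> (\<theta> z) \<partial>M)"
    using MM.Fubini_integral[OF I1] by (simp add: in2)
  also have "\<dots> = (\<integral>h. F' h * \<Psi> h \<partial>N)"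
  proof (rule pushD(4)[OF PF m\<Psi>])
    show "integrable M (\<lambda>z. F z * \<Psi> (\<theta> z))" using MM.integrable_snd[OF I1] by (simp add: in2)
  qed
  also have "\<dots> = (\<integral>h. (\<integral>t. indicator V t * (F' h * G' (- \<theta> x + t + h)) \<partial>N) \<partial>N)"
  proof (rule Bochner_Integration.integral_cong[OF refl])
    fix h
    have "(\<integral>t. indicator V t * (F' h * G' (- \<theta> x + t + h)) \<partial>N) = (\<integral>t. F' h * (indicator V t * G' (- \<theta> x + t + h)) \<partial>N)"
      by (simp add: mult_ac)
    then show "F' h * \<Psi> h = (\<integral>t. indicator V t * (F' h * G' (- \<theta> x + t + h)) \<partial>N)" by (simp add: \<Psi>_def)
  qed
  also have "\<dots> = (\<integral>t. (\<integral>h. indicator V t * (F' h * G' (- \<theta> x + t + h)) \<partial>N) \<partial>N)" by (rule NN.Fubini_integral[OF I2])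
  also have "\<dots> = (\<integral>h. indicator V h * conv_check N F' G' (- h + \<theta> x) \<partial>N)"
    by (simp add: conv_check_def e2)
  finally show ?thesis .
qed

lemma average_uniform_identity:
  assumes PF: "push F F'" and PG: "push G G'" and V: "open V" "V \<subseteq> range \<theta>" "emeasure N V < \<infinity>" "V \<noteq> {}"
  shows "(\<integral>y. conv_check M F G (- y + x) \<partial>uniform_measure M (\<theta> -` V)) = (\<integral>h. conv_check N F' G' (- h + \<theta> x) \<partial>uniform_measure N V)"
proof -
  have [measurable]: "V \<in> sets borel" using V by simp
  have As: "\<theta> -` V \<in> sets M" using open_vimage[OF V(1) theta_cont] by simp
  have AV: "emeasure M (\<theta> -` V) = emeasure N V" using V by (intro theta_measure) auto
  have pos: "emeasure N V > 0" by (rule H.open_pos[OF V(1,4)])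
  note [measurable] = G.conv_check_measurable[OF pushD(1)[OF PF, THEN L2fun_measurable] pushD(1)[OF PG, THEN L2fun_measurable]]
    H.conv_check_measurable[OF pushD(2)[OF PF, THEN L2fun_measurable] pushD(2)[OF PG, THEN L2fun_measurable]]
  show ?thesis
    using V pos As AV average_identity[OF PF PG V(1-3), of x]
    by (subst integral_uniform_measure; (simp add: integral_uniform_measure measure_def)?)
qed

text \<open>A Steinhaus argument. The image \<open>?K\<close> of a compact neighbourhood has
  positive mass because its preimage contains a nonempty open set. Its autocorrelation
  \<open>k\<close> is continuous and nonzero at 0, hence nonzero nearby, and wherever it is nonzero
  the point is a difference of two elements of \<open>?K\<close>.\<close>

lemma theta_open_at_0:
  assumes "open Q" "(0::'g) \<in> Q"
  obtains V where "open V" "0 \<in> V" "V \<subseteq> \<theta> ` Q"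
proof -
  have "open ((\<lambda>p. fst p - snd p :: 'g) -` Q)" using assms by (intro open_vimage continuous_intros) auto
  moreover have "(0, 0) \<in> (\<lambda>p. fst p - snd p :: 'g) -` Q" using assms by simp
  ultimately obtain A B where AB: "open A" "open B" "(0,0) \<in> A \<times> B" "A \<times> B \<subseteq> (\<lambda>p. fst p - snd p :: 'g) -` Q"
    by (rule open_prod_elim)
  have "open (A \<inter> B)" "0 \<in> A \<inter> B" using AB by auto
  then obtain U C where C: "open U" "compact C" "0 \<in> U" "U \<subseteq> C" "C \<subseteq> A \<inter> B" by (rule G.small_compact)
  let ?K = "\<theta> ` C"
  have K: "compact ?K" using C theta_cont by (intro compact_continuous_image) (auto intro: continuous_on_subset)
  then have Ks[measurable]: "?K \<in> sets borel" by (rule borel_compact)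
  have finK: "emeasure N ?K < \<infinity>" by (rule H.compact_finite[OF K])
  have "0 < emeasure M U" using G.open_pos[OF C(1)] C(3) by auto
  also have "\<dots> \<le> emeasure M (\<theta> -` ?K)"
    using C measurable_sets_borel[OF theta_measurable Ks] by (intro emeasure_mono) auto
  also have "\<dots> = emeasure N ?K" by (rule theta_measure) auto
  finally have pos: "emeasure N ?K > 0" .
  have L: "L2fun N (indicator ?K)" using finK by (intro L2fun_indicator) auto
  define k where "k = conv_check N (indicator ?K) (indicator ?K)"
  have kA: "k \<in> fourier_algebra N" unfolding k_def using H.fbound_conv_check[OF L L] by (simp add: H.fbound_def)
  have "k 0 = of_real (measure N ?K)"
  proof -
    have "k 0 = (\<integral>y. of_real (indicator ?K y) \<partial>N)"
      unfolding k_def conv_check_def by (intro Bochner_Integration.integral_cong) (auto simp: indicator_def)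
    then show ?thesis by (simp only: integral_complex_of_real) simp
  qed
  moreover have "measure N ?K > 0" using pos finK by (simp add: measure_def enn2real_positive_iff)
  ultimately have k0: "cmod (k 0) > 0" by simp
  have "\<forall>\<^sub>F a in nhds 0. a \<in> \<theta> ` Q"
    using H.fourier_algebra_uniformly_continuous[OF kA k0]
  proof eventually_elim
    case (elim a)
    then have "cmod (k (a + 0) - k 0) < cmod (k 0)" by blast
    then have "k a \<noteq> 0" by auto
    then have "\<exists>y. indicator ?K y * indicator ?K (- a + y) \<noteq> (0::complex)"
      unfolding k_def conv_check_def by (metis (no_types, lifting) Bochner_Integration.integral_cong integral_zero)
    then obtain y where "y \<in> ?K" "- a + y \<in> ?K" by (auto simp: indicator_def split: if_splits)
    then obtain c d where cd: "c \<in> C" "d \<in> C" "y = \<theta> c" "- a + y = \<theta> d" by auto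
    have "a = y - (- a + y)" by (simp add: diff_conv_add_uminus minus_add del: add_uminus_conv_diff)
    also have "\<dots> = \<theta> (c - d)" using cd theta_add[of c "- d"] by simp
    finally have "a = \<theta> (c - d)" .
    moreover have "(c, d) \<in> A \<times> B" using cd C(5) by auto
    then have "c - d \<in> Q" using AB(4) by fastforce
    ultimately show ?case by blast
  qed
  then show ?thesis using that unfolding eventually_nhds by auto
qed

section \<open>Averaging over fibres\<close>

definition admissible :: "'h set \<Rightarrow> bool" where
  "admissible V \<longleftrightarrow> open V \<and> 0 \<in> V \<and> V \<subseteq> range \<theta> \<and> emeasure N V < \<infinity>"

definition fibre_avg :: "'h set \<Rightarrow> ('g \<Rightarrow> complex) \<Rightarrow> 'g \<Rightarrow> complex" where
  "fibre_avg V w x = (\<integral>y. w (- y + x) \<partial>uniform_measure M (\<theta> -` V))"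

lemma admissibleD:
  assumes "admissible V"
  shows "open V" "0 \<in> V" "V \<subseteq> range \<theta>" "emeasure N V < \<infinity>" "V \<noteq> {}"
    "open (\<theta> -` V)" "emeasure M (\<theta> -` V) = emeasure N V"
    "unit_measure (uniform_measure M (\<theta> -` V))" "unit_measure (uniform_measure N V)"
proof -
  show V: "open V" "0 \<in> V" "V \<subseteq> range \<theta>" "emeasure N V < \<infinity>" "V \<noteq> {}" using assms by (auto simp: admissible_def)
  show o: "open (\<theta> -` V)" by (rule open_vimage[OF V(1) theta_cont])
  show e: "emeasure M (\<theta> -` V) = emeasure N V" using V by (intro theta_measure) auto
  have "0 \<in> \<theta> -` V" using V by simp
  then have "\<theta> -` V \<noteq> {}" by blast
  then show "unit_measure (uniform_measure M (\<theta> -` V))" using o e V by (intro G.unit_measure_uniform) auto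
  show "unit_measure (uniform_measure N V)" using V by (intro H.unit_measure_uniform)
qed

text \<open>As \<open>V\<close> shrinks, averaging over \<open>\<theta> -` V\<close> becomes averaging over the cosets of the kernel of \<open>\<theta>\<close>, so the
  limit descends to an element \<open>a\<close> of the Fourier algebra of the target. Since \<open>\<theta>\<close> is open onto its range, \<open>a\<close>
  vanishes on \<open>E\<close> when \<open>w\<close> vanishes on the full preimage.\<close>

lemma fibre_avg_limit:
  assumes w: "w \<in> I_ideal M (\<theta> -` E)"
  obtains a where "a \<in> I_ideal N E"
    "\<And>\<epsilon>. \<epsilon> > 0 \<Longrightarrow> \<exists>U. open U \<and> 0 \<in> U \<and> (\<forall>V. admissible V \<and> V \<subseteq> U \<longrightarrow> G.fbound (\<lambda>x. fibre_avg V w x - a (\<theta> x)) \<epsilon>)"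
proof -
  have wA: "w \<in> fourier_algebra M" and w0: "\<And>x. \<theta> x \<in> E \<Longrightarrow> w x = 0" using w by (auto simp: I_ideal_def)
  obtain f g where L: "\<And>n. L2fun M (f n)" "\<And>n. L2fun M (g n)" and s: "summable (\<lambda>n. L2norm M (f n) * L2norm M (g n))"
    and su: "\<And>x. (\<lambda>n. conv_check M (f n) (g n) x) sums w x"
    by (fact G.fbound_rep_sums[OF wA])
  have "\<exists>F'. push (f n) F' \<and> L2norm N F' \<le> 4 * L2norm M (f n)" for n by (rule push_exists[OF L(1)[of n]]) blast
  then obtain f' where f': "\<And>n. push (f n) (f' n)" "\<And>n. L2norm N (f' n) \<le> 4 * L2norm M (f n)" by metis
  have "\<exists>F'. push (g n) F' \<and> L2norm N F' \<le> 4 * L2norm M (g n)" for n by (rule push_exists[OF L(2)[of n]]) blast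
  then obtain g' where g': "\<And>n. push (g n) (g' n)" "\<And>n. L2norm N (g' n) \<le> 4 * L2norm M (g n)" by metis
  have L': "L2fun N (f' n)" "L2fun N (g' n)" for n using pushD(2)[OF f'(1)] pushD(2)[OF g'(1)] by auto
  have "norm (L2norm N (f' n) * L2norm N (g' n)) \<le> 16 * (L2norm M (f n) * L2norm M (g n))" for n
    using mult_mono[OF f'(2)[of n] g'(2)[of n]] by simp
  then have s': "summable (\<lambda>n. L2norm N (f' n) * L2norm N (g' n))"
    by (intro summable_comparison_test'[OF summable_mult[OF s, of 16], of 0]) auto
  \<comment> \<open>By \<open>average_uniform_identity\<close>, averaging \<open>w\<close> over the
    preimage of \<open>V\<close> is the same as averaging the translates of this function over
    \<open>V\<close> and evaluating at \<open>\<theta> x\<close>; so it is the only candidate for a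
    limit.\<close>
  define a where "a h = (\<Sum>n. conv_check N (f' n) (g' n) h)" for h
  have sa: "(\<lambda>n. conv_check N (f' n) (g' n) h) sums a h" for h
  proof -
    have "summable (\<lambda>n. conv_check N (f' n) (g' n) h)"
      using H.conv_check_bound[OF L'] by (intro summable_comparison_test'[OF s', of 0]) auto
    then show ?thesis by (simp add: a_def summable_sums)
  qed
  have aA: "a \<in> fourier_algebra N"
    using H.fbound_suminf[OF H.fbound_conv_check[OF L'] s' sa] by (simp add: H.fbound_def)
  have lim: "\<exists>U. open U \<and> 0 \<in> U \<and> (\<forall>V. admissible V \<and> V \<subseteq> U \<longrightarrow> G.fbound (\<lambda>x. fibre_avg V w x - a (\<theta> x)) \<epsilon>)"
    if e: "\<epsilon> > 0" for \<epsilon>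
  proof -
    \<comment> \<open>576 is 24 times 24: one factor from the averaging estimate in the target, one
      from the pull-back.\<close>
    have "\<epsilon> / 576 > 0" using e by simp
    then obtain U \<omega> where U: "open U" "0 \<in> U" "\<And>n. 0 \<le> \<omega> n" "\<And>n h. h \<in> U \<Longrightarrow> L2norm N (\<lambda>z. f' n (- h + z) - f' n z) \<le> \<omega> n"
      "summable (\<lambda>n. \<omega> n * L2norm N (g' n))" "(\<Sum>n. \<omega> n * L2norm N (g' n)) < \<epsilon> / 576"
      using H.small_moduli[OF L'(1) s'] by blast
    have "G.fbound (\<lambda>x. fibre_avg V w x - a (\<theta> x)) \<epsilon>" if V: "admissible V" and VU: "V \<subseteq> U" for V
    proof -
      note V = admissibleD[OF V]
      let ?\<kappa> = "uniform_measure M (\<theta> -` V)" and ?\<kappa>H = "uniform_measure N V"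
      have ae: "AE h in ?\<kappa>H. L2norm N (\<lambda>z. f' n (- h + z) - f' n z) \<le> \<omega> n" for n
        using V(1,4,5) H.open_pos[OF V(1,5)] VU U(4) by (intro AE_uniform_measureI) (auto intro!: AE_I2)
      have 1: "G.fbound (\<lambda>x. (\<integral>y. conv_check M (f n) (g n) (- y + x) \<partial>?\<kappa>) - conv_check N (f' n) (g' n) (\<theta> x)) (24 * (24 * (\<omega> n * L2norm N (g' n))))" for n
        using fbound_pullback[OF H.fbound_translation_average[OF L'(1) L'(2) V(9) ae U(3)]]
        by (simp only: average_uniform_identity[OF f'(1) g'(1) V(1,3,4,5)])
      have "G.fbound (\<lambda>x. fibre_avg V w x - a (\<theta> x)) (\<Sum>n. 24 * (24 * (\<omega> n * L2norm N (g' n))))"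
      proof (rule G.fbound_suminf[OF 1])
        show "summable (\<lambda>n. 24 * (24 * (\<omega> n * L2norm N (g' n))))" by (intro summable_mult U)
        fix x
        have "(\<lambda>n. \<integral>y. 1 * conv_check M (f n) (g n) (- y + x) \<partial>?\<kappa>) sums (\<integral>y. 1 * w (- y + x) \<partial>?\<kappa>)"
          by (rule G.conv_series_integral_sums[OF L s su V(8), of "\<lambda>_. 1" 1]) auto
        then show "(\<lambda>n. (\<integral>y. conv_check M (f n) (g n) (- y + x) \<partial>?\<kappa>) - conv_check N (f' n) (g' n) (\<theta> x)) sums (fibre_avg V w x - a (\<theta> x))"
          unfolding fibre_avg_def by (intro sums_diff sa) simp
      qed
      moreover have "(\<Sum>n. 24 * (24 * (\<omega> n * L2norm N (g' n)))) \<le> \<epsilon>"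
        using U(5,6) by (simp add: suminf_mult summable_mult)
      ultimately show ?thesis by (rule G.fbound_mono)
    qed
    then show ?thesis using U by blast
  qed
  \<comment> \<open>Off the range this follows from the supports of the pushed vectors; on the range
    \<open>a\<close> is compared with small averages of \<open>w\<close> at a point \<open>x\<close>
    over \<open>h\<close>.\<close>
  have "a h = 0" if h: "h \<in> E" for h
  proof (cases "h \<in> range \<theta>")
    case False
    have "conv_check N (f' n) (g' n) h = 0" for n
    proof -
      have "f' n y * g' n (- h + y) = 0" for y
      proof (rule ccontr)
        assume "f' n y * g' n (- h + y) \<noteq> 0"
        then have "y \<in> range \<theta>" "- h + y \<in> range \<theta>" using pushD(3)[OF f'(1)] pushD(3)[OF g'(1)] by fastforce+
        from range_add[OF this(1) range_uminus[OF this(2)]] have "h \<in> range \<theta>"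
          by (simp add: minus_add add.assoc[symmetric] del: add_uminus_conv_diff)
        then show False using False by simp
      qed
      then show ?thesis by (simp only: conv_check_def integral_zero)
    qed
    then show ?thesis by (simp add: a_def)
  next
    case True
    then obtain x where x: "h = \<theta> x" by auto
    have "cmod (a h) \<le> 0 + \<epsilon>" if e: "\<epsilon> > 0" for \<epsilon>
    proof -
      have e2: "\<epsilon> / 2 > 0" using e by simp
      obtain U where U: "open U" "0 \<in> U" "\<And>V. admissible V \<Longrightarrow> V \<subseteq> U \<Longrightarrow> G.fbound (\<lambda>x. fibre_avg V w x - a (\<theta> x)) (\<epsilon> / 2)"
        using lim[OF e2] by blast
      obtain Q where Q: "open Q" "0 \<in> Q" "\<And>q x. q \<in> Q \<Longrightarrow> cmod (w (q + x) - w x) < \<epsilon> / 2"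
        using G.fourier_algebra_uniformly_continuous[OF wA e2] unfolding eventually_nhds by blast
      have "open (uminus -` Q)" "0 \<in> uminus -` Q" using Q by (auto intro!: open_vimage continuous_intros)
      then obtain V1 where V1: "open V1" "0 \<in> V1" "V1 \<subseteq> \<theta> ` (uminus -` Q)" by (rule theta_open_at_0)
      have "open (V1 \<inter> U)" "0 \<in> V1 \<inter> U" using V1 U by auto
      then obtain V where V: "open V" "0 \<in> V" "V \<subseteq> V1 \<inter> U" "emeasure N V < \<infinity>" by (rule H.small_open)
      have adm: "admissible V" using V V1 by (auto simp: admissible_def)
      note AV = admissibleD[OF adm]
      \<comment> \<open>Openness of \<open>\<theta>\<close> provides a small \<open>q\<close> with
        the same image as \<open>y\<close>. Then \<open>q - y + x\<close> lies over the same point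
        as \<open>x\<close>, where \<open>w\<close> vanishes, and it differs from
        \<open>- y + x\<close> by a small left translation.\<close>
      have "cmod (w (- y + x)) \<le> \<epsilon> / 2" if "\<theta> y \<in> V" for y
      proof -
        have "\<theta> y \<in> \<theta> ` (uminus -` Q)" using that V(3) V1(3) by (meson Int_iff subsetD)
        then obtain q where q: "\<theta> y = \<theta> q" "- q \<in> Q" by auto
        have "\<theta> (q - y + x) = \<theta> x" using theta_add[of q "- y"] q by (simp add: theta_add)
        then have "w (q - y + x) = 0" using h x by (intro w0) simp
        moreover have "- y + x = - q + (q - y + x)" by (simp add: add.assoc[symmetric] diff_conv_add_uminus del: add_uminus_conv_diff)
        ultimately show ?thesis using Q(3)[OF q(2), of "q - y + x"] by simp
      qed
      then have "AE y in uniform_measure M (\<theta> -` V). cmod (w (- y + x)) \<le> \<epsilon> / 2"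
        using AV(6) by (intro AE_uniform_measureI) (auto intro!: AE_I2)
      then have "cmod (fibre_avg V w x) \<le> \<epsilon> / 2"
        unfolding fibre_avg_def using e2 by (intro integral_unit_measure_le[OF AV(8)]) auto
      moreover have "cmod (fibre_avg V w x - a (\<theta> x)) \<le> \<epsilon> / 2"
        using G.fbound_sup[OF U(3)[OF adm]] V by blast
      ultimately show ?thesis using norm_triangle_sub[of "a h" "fibre_avg V w x"] by (simp add: x norm_minus_commute)
    qed
    then have "cmod (a h) \<le> 0" by (rule field_le_epsilon)
    then show ?thesis by simp
  qed
  then have "a \<in> I_ideal N E" using aA by (simp add: I_ideal_def)
  then show ?thesis using that lim by blast
qed

end

section \<open>Kernels on the square of the group\<close>

context lcsc_haar
begin

text \<open>A coefficient of the regular representation of the product group with vectors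
  \<open>P\<close> and \<open>R\<close>, taken at the pair \<open>(x, - y + x)\<close>; for
  elementary tensors it splits as in \<open>kern_tensor\<close>.\<close>

definition kern :: "('g \<times> 'g \<Rightarrow> complex) \<Rightarrow> ('g \<times> 'g \<Rightarrow> complex) \<Rightarrow> 'g \<Rightarrow> 'g \<Rightarrow> complex" where
  "kern P R x y = (\<integral>p. P p * R (- x + fst p, - x + y + snd p) \<partial>(M \<Otimes>\<^sub>M M))"

text \<open>For each fixed \<open>s\<close> the second variable undergoes a left translation, so a
  shear by any measurable \<open>a\<close> preserves the product measure.\<close>

lemma E2_shear:
  assumes [measurable]: "P \<in> borel_measurable (M \<Otimes>\<^sub>M M)" "a \<in> borel_measurable borel"
  shows "(\<integral>\<^sup>+r. E2 M (\<lambda>s. P (s, a s + r)) \<partial>M) = E2 (M \<Otimes>\<^sub>M M) P"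
proof -
  interpret MM: pair_sigma_finite M M ..
  have "(\<integral>\<^sup>+r. E2 M (\<lambda>s. P (s, a s + r)) \<partial>M) = (\<integral>\<^sup>+s. (\<integral>\<^sup>+r. ennreal ((cmod (P (s, a s + r)))\<^sup>2) \<partial>M) \<partial>M)"
    unfolding E2_def by (rule MM.Fubini') measurable
  also have "\<dots> = (\<integral>\<^sup>+s. E2 M (\<lambda>r. P (s, r)) \<partial>M)"
    unfolding E2_def by (intro nn_integral_cong nn_integral_shift[of "\<lambda>r. ennreal ((cmod (P (_, r)))\<^sup>2)"]) measurable
  also have "\<dots> = E2 (M \<Otimes>\<^sub>M M) P" by (rule MM.E2_fst[symmetric]) measurable
  finally show ?thesis .
qed

lemma L2_shear:
  assumes P: "L2fun (M \<Otimes>\<^sub>M M) P" and [measurable]: "a \<in> borel_measurable borel"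
  shows L2fun_shear: "L2fun (M \<Otimes>\<^sub>M M) (\<lambda>p. P (fst p, a (fst p) + snd p))"
    and L2norm_shear: "L2norm (M \<Otimes>\<^sub>M M) (\<lambda>p. P (fst p, a (fst p) + snd p)) \<le> L2norm (M \<Otimes>\<^sub>M M) P"
proof -
  interpret MM: pair_sigma_finite M M ..
  note [measurable] = L2fun_measurable[OF P]
  have m: "(\<lambda>p. P (fst p, a (fst p) + snd p)) \<in> borel_measurable (M \<Otimes>\<^sub>M M)" by measurable
  have "E2 (M \<Otimes>\<^sub>M M) (\<lambda>p. P (fst p, a (fst p) + snd p)) \<le> ennreal ((L2norm (M \<Otimes>\<^sub>M M) P)\<^sup>2)"
    unfolding MM.E2_snd[OF m] using E2_shear[OF L2fun_measurable[OF P] assms(2)] by (simp add: E2_eq_L2norm[OF P])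
  note * = L2I[OF m this L2norm_nonneg]
  show "L2fun (M \<Otimes>\<^sub>M M) (\<lambda>p. P (fst p, a (fst p) + snd p))"
    "L2norm (M \<Otimes>\<^sub>M M) (\<lambda>p. P (fst p, a (fst p) + snd p)) \<le> L2norm (M \<Otimes>\<^sub>M M) P" by (fact *)+
qed

lemma L2fun_shift2:
  assumes P: "L2fun (M \<Otimes>\<^sub>M M) P"
  shows "L2fun (M \<Otimes>\<^sub>M M) (\<lambda>p. P (a + fst p, b + snd p))"
    and "L2norm (M \<Otimes>\<^sub>M M) (\<lambda>p. P (a + fst p, b + snd p)) \<le> L2norm (M \<Otimes>\<^sub>M M) P"
proof -
  note 1 = L2_shear[OF P, of "\<lambda>_. b", simplified]
  show "L2fun (M \<Otimes>\<^sub>M M) (\<lambda>p. P (a + fst p, b + snd p))"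
    using L2fun_pair_shift[OF sigma_finite_measure_axioms 1(1), of a] by simp
  show "L2norm (M \<Otimes>\<^sub>M M) (\<lambda>p. P (a + fst p, b + snd p)) \<le> L2norm (M \<Otimes>\<^sub>M M) P"
    using L2norm_pair_shift[OF sigma_finite_measure_axioms 1(1), of a] 1(2) by simp
qed

lemma kern_integrable:
  assumes "L2fun (M \<Otimes>\<^sub>M M) P" "L2fun (M \<Otimes>\<^sub>M M) R"
  shows "integrable (M \<Otimes>\<^sub>M M) (\<lambda>p. P p * R (- x + fst p, - x + y + snd p))"
  using assms by (intro L2_mult_integrable L2fun_shift2)

lemma kern_bound:
  assumes P: "L2fun (M \<Otimes>\<^sub>M M) P" and R: "L2fun (M \<Otimes>\<^sub>M M) R"
  shows "cmod (kern P R x y) \<le> L2norm (M \<Otimes>\<^sub>M M) P * L2norm (M \<Otimes>\<^sub>M M) R"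
  unfolding kern_def
  using L2_CS[OF P L2fun_shift2(1)[OF R, of "- x" "- x + y"]] mult_left_mono[OF L2fun_shift2(2)[OF R, of "- x" "- x + y"] L2norm_nonneg[of "M \<Otimes>\<^sub>M M" P]]
  by simp

lemma kern_measurable:
  assumes "L2fun (M \<Otimes>\<^sub>M M) P" "L2fun (M \<Otimes>\<^sub>M M) R"
  shows "kern P R x \<in> borel_measurable borel"
proof -
  interpret MM: pair_sigma_finite M M ..
  note [measurable] = assms[THEN L2fun_measurable]
  show ?thesis unfolding kern_def by measurable
qed

lemma kern_add_left:
  assumes "L2fun (M \<Otimes>\<^sub>M M) P" "L2fun (M \<Otimes>\<^sub>M M) P'" "L2fun (M \<Otimes>\<^sub>M M) R"
  shows "kern (\<lambda>p. P p + P' p) R x y = kern P R x y + kern P' R x y"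
  unfolding kern_def distrib_right using assms by (intro Bochner_Integration.integral_add kern_integrable)

lemma kern_add_right:
  assumes "L2fun (M \<Otimes>\<^sub>M M) P" "L2fun (M \<Otimes>\<^sub>M M) R" "L2fun (M \<Otimes>\<^sub>M M) R'"
  shows "kern P (\<lambda>p. R p + R' p) x y = kern P R x y + kern P R' x y"
  unfolding kern_def distrib_left using assms by (intro Bochner_Integration.integral_add kern_integrable)

lemma kern_diff_left:
  assumes "L2fun (M \<Otimes>\<^sub>M M) P" "L2fun (M \<Otimes>\<^sub>M M) P'" "L2fun (M \<Otimes>\<^sub>M M) R"
  shows "kern (\<lambda>p. P p - P' p) R x y = kern P R x y - kern P' R x y"
  unfolding kern_def left_diff_distrib using assms by (intro Bochner_Integration.integral_diff kern_integrable)

lemma kern_diff_right: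
  assumes "L2fun (M \<Otimes>\<^sub>M M) P" "L2fun (M \<Otimes>\<^sub>M M) R" "L2fun (M \<Otimes>\<^sub>M M) R'"
  shows "kern P (\<lambda>p. R p - R' p) x y = kern P R x y - kern P R' x y"
  unfolding kern_def right_diff_distrib using assms by (intro Bochner_Integration.integral_diff kern_integrable)

lemma kern_tensor:
  assumes "L2fun M p" "L2fun M q" "L2fun M p'" "L2fun M q'"
  shows "kern (\<lambda>z. p (fst z) * q (snd z)) (\<lambda>z. p' (fst z) * q' (snd z)) x y = conv_check M p p' x * conv_check M q q' (- y + x)"
proof -
  interpret MM: pair_sigma_finite M M ..
  have "kern (\<lambda>z. p (fst z) * q (snd z)) (\<lambda>z. p' (fst z) * q' (snd z)) x y =
    (\<integral>z. (p (fst z) * p' (- x + fst z)) * (q (snd z) * q' (- (- y + x) + snd z)) \<partial>(M \<Otimes>\<^sub>M M))"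
    unfolding kern_def by (simp add: mult_ac minus_add)
  also have "\<dots> = conv_check M p p' x * conv_check M q q' (- y + x)"
    unfolding conv_check_def
    by (rule MM.integral_tensor(2)[of "\<lambda>s. p s * p' (- x + s)" "\<lambda>t. q t * q' (- (- y + x) + t)"])
       (intro conv_check_integrable assms)+
  finally show ?thesis .
qed

text \<open>The substitution \<open>t = - y + s + r\<close> makes \<open>x\<close> act on
  \<open>s\<close> alone, by left translation, while \<open>y\<close> and \<open>r\<close> become
  parameters. The kernel is then a family of coefficients over
  \<open>\<kappa> \<Otimes>\<^sub>M M\<close>, and \<open>product_family\<close> multiplies it with
  the coefficient of \<open>f\<close> and \<open>g\<close>.\<close>

lemma fbound_kern_avg_conv:
  assumes f: "L2fun M f" and g: "L2fun M g" and P: "L2fun (M \<Otimes>\<^sub>M M) P" and R: "L2fun (M \<Otimes>\<^sub>M M) R" and \<kappa>: "unit_measure \<kappa>"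
  shows "fbound (\<lambda>x. \<integral>y. kern P R x y * conv_check M f g (- y + x) \<partial>\<kappa>)
    (24 * ((L2norm (M \<Otimes>\<^sub>M M) P * L2norm M f) * (L2norm (M \<Otimes>\<^sub>M M) R * L2norm M g)))"
proof -
  have [measurable_cong]: "sets \<kappa> = sets borel" by (rule unit_measureD[OF \<kappa>])
  interpret K: sigma_finite_measure \<kappa> by (rule unit_measureD[OF \<kappa>])
  interpret KM: pair_sigma_finite \<kappa> M ..
  interpret MM: pair_sigma_finite M M ..
  note [measurable] = f[THEN L2fun_measurable] g[THEN L2fun_measurable] P[THEN L2fun_measurable] R[THEN L2fun_measurable]
  let ?S = "\<kappa> \<Otimes>\<^sub>M M"
  have S: "sigma_finite_measure ?S" ..
  define F where "F p = P (fst p, - fst (snd p) + fst p + snd (snd p))" for p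
  define G where "G p = R (fst p, fst p + snd (snd p))" for p :: "'g \<times> 'g \<times> 'g"
  define H where "H p = f (- fst (snd p) + fst p)" for p :: "'g \<times> 'g \<times> 'g"
  define K where "K p = g (fst p)" for p :: "'g \<times> 'g \<times> 'g"
  have m: "F \<in> borel_measurable (M \<Otimes>\<^sub>M ?S)" "H \<in> borel_measurable (M \<Otimes>\<^sub>M ?S)"
     "G \<in> borel_measurable (M \<Otimes>\<^sub>M ?S)" "K \<in> borel_measurable (M \<Otimes>\<^sub>M ?S)"
    unfolding F_def G_def H_def K_def by measurable
  have E: "E2 M f = ennreal ((L2norm M f)\<^sup>2)" "E2 M g = ennreal ((L2norm M g)\<^sup>2)"
    "E2 (M \<Otimes>\<^sub>M M) P = ennreal ((L2norm (M \<Otimes>\<^sub>M M) P)\<^sup>2)" "E2 (M \<Otimes>\<^sub>M M) R = ennreal ((L2norm (M \<Otimes>\<^sub>M M) R)\<^sup>2)"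
    by (simp_all add: E2_eq_L2norm f g P R)
  have EP: "(\<integral>\<^sup>+r. E2 M (\<lambda>s. P (s, - y + s + r)) \<partial>M) = E2 (M \<Otimes>\<^sub>M M) P" for y
    by (rule E2_shear) measurable
  have ER: "(\<integral>\<^sup>+r. E2 M (\<lambda>s. R (s, s + r)) \<partial>M) = E2 (M \<Otimes>\<^sub>M M) R"
    by (rule E2_shear[of R "\<lambda>s. s"]) measurable
  have A: "(\<integral>\<^sup>+q. E2 M (\<lambda>s. F (s, q)) * E2 M (\<lambda>z. H (z, q)) \<partial>?S) \<le> ennreal ((L2norm (M \<Otimes>\<^sub>M M) P * L2norm M f)\<^sup>2)"
  proof -
    have [measurable]: "(\<lambda>q. E2 M (\<lambda>s. P (s, - fst q + s + snd q))) \<in> borel_measurable ?S" unfolding E2_def by measurable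
    have "(\<integral>\<^sup>+q. E2 M (\<lambda>s. F (s, q)) * E2 M (\<lambda>z. H (z, q)) \<partial>?S) = (\<integral>\<^sup>+q. E2 M (\<lambda>s. P (s, - fst q + s + snd q)) * E2 M f \<partial>?S)"
      by (intro nn_integral_cong) (simp add: F_def H_def E2_shift)
    also have "\<dots> = (\<integral>\<^sup>+q. E2 M (\<lambda>s. P (s, - fst q + s + snd q)) \<partial>?S) * E2 M f" by (rule nn_integral_multc) measurable
    also have "(\<integral>\<^sup>+q. E2 M (\<lambda>s. P (s, - fst q + s + snd q)) \<partial>?S) = (\<integral>\<^sup>+y. E2 (M \<Otimes>\<^sub>M M) P \<partial>\<kappa>)"
      by (subst nn_integral_fst[symmetric]) (auto simp: EP)
    also have "\<dots> = E2 (M \<Otimes>\<^sub>M M) P" using unit_measureD[OF \<kappa>] by simp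
    finally show ?thesis by (simp add: E power_mult_distrib ennreal_mult)
  qed
  have B: "(\<integral>\<^sup>+q. E2 M (\<lambda>s. G (s, q)) * E2 M (\<lambda>z. K (z, q)) \<partial>?S) \<le> ennreal ((L2norm (M \<Otimes>\<^sub>M M) R * L2norm M g)\<^sup>2)"
  proof -
    have [measurable]: "(\<lambda>q. E2 M (\<lambda>s. R (s, s + snd q))) \<in> borel_measurable ?S" unfolding E2_def by measurable
    have "(\<integral>\<^sup>+q. E2 M (\<lambda>s. G (s, q)) * E2 M (\<lambda>z. K (z, q)) \<partial>?S) = (\<integral>\<^sup>+q. E2 M (\<lambda>s. R (s, s + snd q)) * E2 M g \<partial>?S)"
      by (intro nn_integral_cong) (simp add: G_def K_def)
    also have "\<dots> = (\<integral>\<^sup>+q. E2 M (\<lambda>s. R (s, s + snd q)) \<partial>?S) * E2 M g" by (rule nn_integral_multc) measurable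
    also have "(\<integral>\<^sup>+q. E2 M (\<lambda>s. R (s, s + snd q)) \<partial>?S) = (\<integral>\<^sup>+y. E2 (M \<Otimes>\<^sub>M M) R \<partial>\<kappa>)"
      by (subst nn_integral_fst[symmetric]) (auto simp: ER)
    also have "\<dots> = E2 (M \<Otimes>\<^sub>M M) R" using unit_measureD[OF \<kappa>] by simp
    finally show ?thesis by (simp add: E power_mult_distrib ennreal_mult)
  qed
  have nn: "0 \<le> L2norm (M \<Otimes>\<^sub>M M) P * L2norm M f" "0 \<le> L2norm (M \<Otimes>\<^sub>M M) R * L2norm M g" by simp_all
  note PF = product_family[OF S m(1,2,3,4) A nn(1) B nn(2)]
  have "(\<integral>q. (\<integral>s. F (s, q) * G (- x + s, q) \<partial>M) * (\<integral>z. H (z, q) * K (- x + z, q) \<partial>M) \<partial>?S) =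
     (\<integral>y. kern P R x y * conv_check M f g (- y + x) \<partial>\<kappa>)" for x
  proof -
    have "(\<integral>q. (\<integral>s. F (s, q) * G (- x + s, q) \<partial>M) * (\<integral>z. H (z, q) * K (- x + z, q) \<partial>M) \<partial>?S) =
       (\<integral>y. (\<integral>r. (\<integral>s. F (s, (y, r)) * G (- x + s, (y, r)) \<partial>M) * (\<integral>z. H (z, (y, r)) * K (- x + z, (y, r)) \<partial>M) \<partial>M) \<partial>\<kappa>)"
      by (rule KM.integral_fst'[OF PF(2), symmetric])
    also have "\<dots> = (\<integral>y. kern P R x y * conv_check M f g (- y + x) \<partial>\<kappa>)"
    proof (rule Bochner_Integration.integral_cong[OF refl])
      fix y
      have c: "(\<integral>z. H (z, (y, r)) * K (- x + z, (y, r)) \<partial>M) = conv_check M f g (- y + x)" for r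
        by (simp add: H_def K_def conv_check_shift) (simp add: conv_check_def)
      have I: "integrable (M \<Otimes>\<^sub>M M) (\<lambda>(s, r). P (s, - y + s + r) * R (- x + s, - x + s + r))"
      proof -
        have "L2fun (M \<Otimes>\<^sub>M M) (\<lambda>p. P (fst p, - y + fst p + snd p))" by (rule L2fun_shear[OF P]) measurable
        moreover have "L2fun (M \<Otimes>\<^sub>M M) (\<lambda>p. R (fst p, fst p + snd p))" by (rule L2fun_shear[OF R, of "\<lambda>s. s"]) measurable
        from L2fun_pair_shift[OF sigma_finite_measure_axioms this, of "- x"]
        have "L2fun (M \<Otimes>\<^sub>M M) (\<lambda>p. R (- x + fst p, - x + fst p + snd p))" by simp
        ultimately show ?thesis using L2_mult_integrable by (simp add: case_prod_beta')
      qed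
      have "(\<integral>r. (\<integral>s. P (s, - y + s + r) * R (- x + s, - x + s + r) \<partial>M) \<partial>M) = (\<integral>s. (\<integral>r. P (s, - y + s + r) * R (- x + s, - x + s + r) \<partial>M) \<partial>M)"
        by (rule MM.Fubini_integral[OF I])
      also have "\<dots> = (\<integral>s. (\<integral>t. P (s, t) * R (- x + s, - x + y + t) \<partial>M) \<partial>M)"
      proof (rule Bochner_Integration.integral_cong[OF refl])
        fix s
        have e: "- x + y + ((- y + s) + r) = - x + s + r" for r
          by (simp only: add.assoc minus_add_cancel add_minus_cancel)
        have "(\<integral>r. P (s, (- y + s) + r) * R (- x + s, - x + y + ((- y + s) + r)) \<partial>M) = (\<integral>t. P (s, t) * R (- x + s, - x + y + t) \<partial>M)"
          by (rule integral_shift[of "\<lambda>t. P (s, t) * R (- x + s, - x + y + t)"]) measurable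
        then show "(\<integral>r. P (s, - y + s + r) * R (- x + s, - x + s + r) \<partial>M) = (\<integral>t. P (s, t) * R (- x + s, - x + y + t) \<partial>M)"
          by (simp only: e)
      qed
      also have "\<dots> = kern P R x y"
        unfolding kern_def using MM.integral_fst'[OF kern_integrable[OF P R, of x y]] by simp
      finally have k: "(\<integral>r. (\<integral>s. F (s, (y, r)) * G (- x + s, (y, r)) \<partial>M) \<partial>M) = kern P R x y"
        by (simp add: F_def G_def)
      have "(\<integral>r. (\<integral>s. F (s, (y, r)) * G (- x + s, (y, r)) \<partial>M) * (\<integral>z. H (z, (y, r)) * K (- x + z, (y, r)) \<partial>M) \<partial>M) =
        (\<integral>r. (\<integral>s. F (s, (y, r)) * G (- x + s, (y, r)) \<partial>M) * conv_check M f g (- y + x) \<partial>M)" by (simp only: c)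
      also have "\<dots> = kern P R x y * conv_check M f g (- y + x)" by (simp only: integral_mult_left_zero k)
      finally show "(\<integral>r. (\<integral>s. F (s, (y, r)) * G (- x + s, (y, r)) \<partial>M) * (\<integral>z. H (z, (y, r)) * K (- x + z, (y, r)) \<partial>M) \<partial>M) =
        kern P R x y * conv_check M f g (- y + x)" .
    qed
    finally show ?thesis .
  qed
  with PF(1) show ?thesis by simp
qed

text \<open>Two kinds of kernels matter: for tensor sums these averages tend to elements of the
  module span, and for kernels concentrated near \<open>y = 0\<close> they nearly multiply
  \<open>v\<close> by a coefficient. The bound \<open>fbound_kern_avg\<close> connects the
  two.\<close>

definition kern_avg :: "'g measure \<Rightarrow> ('g \<Rightarrow> complex) \<Rightarrow> ('g \<times> 'g \<Rightarrow> complex) \<Rightarrow> ('g \<times> 'g \<Rightarrow> complex) \<Rightarrow> 'g \<Rightarrow> complex" where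
  "kern_avg \<kappa> v P R x = (\<integral>y. kern P R x y * v (- y + x) \<partial>\<kappa>)"

lemma kern_avg_integrable:
  assumes v: "v \<in> fourier_algebra M" and P: "L2fun (M \<Otimes>\<^sub>M M) P" and R: "L2fun (M \<Otimes>\<^sub>M M) R" and \<kappa>: "unit_measure \<kappa>"
  shows "integrable \<kappa> (\<lambda>y. kern P R x y * v (- y + x))"
proof -
  note [measurable] = fourier_algebra_measurable[OF v] kern_measurable[OF P R]
  show ?thesis
  proof (rule integrable_unit_measure[OF \<kappa>])
    show "cmod (kern P R x y * v (- y + x)) \<le> (L2norm (M \<Otimes>\<^sub>M M) P * L2norm (M \<Otimes>\<^sub>M M) R) * fourier_norm M v" for y
      unfolding norm_mult using kern_bound[OF P R] fbound_sup[OF fboundI[OF v]] by (intro mult_mono) auto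
  qed measurable
qed

text \<open>\<open>\<kappa>\<close> enters the bound only through its total mass 1. This uniformity
  allows the kernel to be approximated by elementary tensors before the set to average over is
  chosen.\<close>

lemma fbound_kern_avg:
  assumes v: "fbound v c" and P: "L2fun (M \<Otimes>\<^sub>M M) P" and R: "L2fun (M \<Otimes>\<^sub>M M) R" and \<kappa>: "unit_measure \<kappa>"
  shows "fbound (kern_avg \<kappa> v P R) (24 * (L2norm (M \<Otimes>\<^sub>M M) P * L2norm (M \<Otimes>\<^sub>M M) R) * c)"
proof (rule fbound_epsilon)
  fix \<epsilon> :: real assume e: "\<epsilon> > 0"
  let ?n = "L2norm (M \<Otimes>\<^sub>M M) P * L2norm (M \<Otimes>\<^sub>M M) R"
  define \<delta> where "\<delta> = \<epsilon> / (24 * ?n + 1)"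
  have n0: "0 \<le> ?n" by simp
  have \<delta>: "\<delta> > 0" using e n0 by (simp add: \<delta>_def add_nonneg_pos)
  obtain f g where fg: "fourier_rep M v f g" "(\<Sum>n. L2norm M (f n) * L2norm M (g n)) < c + \<delta>" by (rule fbound_rep[OF v \<delta>])
  have L: "L2fun M (f n)" "L2fun M (g n)" and s: "summable (\<lambda>n. L2norm M (f n) * L2norm M (g n))" for n
    using fg by (auto simp: fourier_rep_def)
  have su: "(\<lambda>n. conv_check M (f n) (g n) x) sums v x" for x
  proof -
    have "summable (\<lambda>n. conv_check M (f n) (g n) x)"
      using conv_check_bound[OF L] by (intro summable_comparison_test'[OF s, of 0]) auto
    then show ?thesis using fg by (simp add: fourier_rep_def sums_iff)
  qed
  have "fbound (kern_avg \<kappa> v P R) (\<Sum>n. 24 * ?n * (L2norm M (f n) * L2norm M (g n)))"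
  proof (rule fbound_suminf)
    show "fbound (\<lambda>x. \<integral>y. kern P R x y * conv_check M (f n) (g n) (- y + x) \<partial>\<kappa>) (24 * ?n * (L2norm M (f n) * L2norm M (g n)))" for n
      using fbound_kern_avg_conv[OF L(1)[of n] L(2)[of n] P R \<kappa>] by (simp add: mult_ac)
    show "summable (\<lambda>n. 24 * ?n * (L2norm M (f n) * L2norm M (g n)))" by (intro summable_mult s)
    show "(\<lambda>n. \<integral>y. kern P R x y * conv_check M (f n) (g n) (- y + x) \<partial>\<kappa>) sums kern_avg \<kappa> v P R x" for x
      unfolding kern_avg_def by (rule conv_series_integral_sums[OF L s su \<kappa> kern_measurable[OF P R] kern_bound[OF P R]])
  qed
  then show "fbound (kern_avg \<kappa> v P R) (24 * ?n * c + \<epsilon>)"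
  proof (rule fbound_mono)
    have "(\<Sum>n. 24 * ?n * (L2norm M (f n) * L2norm M (g n))) = 24 * ?n * (\<Sum>n. L2norm M (f n) * L2norm M (g n))"
      by (rule suminf_mult[OF s])
    also have "\<dots> \<le> 24 * ?n * (c + \<delta>)" using fg(2) n0 by (intro mult_left_mono) auto
    also have "\<dots> \<le> 24 * ?n * c + \<epsilon>"
    proof -
      have "24 * ?n + 1 \<noteq> 0" using n0 by linarith
      then have "(24 * ?n + 1) * \<delta> = \<epsilon>" unfolding \<delta>_def by simp
      then show ?thesis using \<delta> by (simp add: algebra_simps)
    qed
    finally show "(\<Sum>n. 24 * ?n * (L2norm M (f n) * L2norm M (g n))) \<le> 24 * ?n * c + \<epsilon>" .
  qed
qed

text \<open>The weight \<open>W s\<close> only charges translations that hardly move \<open>f\<close>. The point is that its total mass enters linearly,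
  which forces the average over \<open>y\<close> to be taken inside the coefficient (the vector \<open>T s\<close>) before the norm.\<close>

lemma fbound_weighted_diff:
  assumes f: "L2fun M f" and g: "L2fun M g" and \<phi>: "L2fun M \<phi>" and \<psi>: "L2fun M \<psi>" and \<kappa>: "unit_measure \<kappa>"
    and W[measurable]: "(\<lambda>p. W (fst p) (snd p)) \<in> borel_measurable (borel \<Otimes>\<^sub>M borel)" and W0: "\<And>s y. 0 \<le> W s y" "\<And>s y. W s y \<le> (B::real)"
    and mass: "\<And>s. (\<integral>\<^sup>+y. ennreal (W s y) \<partial>\<kappa>) \<le> ennreal c" "0 \<le> c"
    and near: "\<And>s y. \<phi> s \<noteq> 0 \<Longrightarrow> W s y \<noteq> 0 \<Longrightarrow> L2norm M (\<lambda>z. f (- y + z) - f z) \<le> \<beta>" "0 \<le> \<beta>"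
  shows "fbound (\<lambda>x. \<integral>y. (\<integral>s. \<phi> s * \<psi> (- x + s) * of_real (W s y) \<partial>M) * (conv_check M f g (- y + x) - conv_check M f g x) \<partial>\<kappa>)
    (24 * ((c * \<beta> * L2norm M \<phi>) * (L2norm M \<psi> * L2norm M g)))"
proof -
  have [measurable_cong]: "sets \<kappa> = sets borel" by (rule unit_measureD[OF \<kappa>])
  interpret K: sigma_finite_measure \<kappa> by (rule unit_measureD[OF \<kappa>])
  interpret MK: pair_sigma_finite M \<kappa> ..
  interpret MM: pair_sigma_finite M M ..
  note [measurable] = f[THEN L2fun_measurable] g[THEN L2fun_measurable] \<phi>[THEN L2fun_measurable] \<psi>[THEN L2fun_measurable]
  have Wm[measurable (raw)]: "(\<lambda>x. W (a x) (b x)) \<in> borel_measurable X" if [measurable]: "a \<in> borel_measurable X" "b \<in> borel_measurable X" for a b X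
  proof -
    have "(\<lambda>x. (a x, b x)) \<in> measurable X (borel \<Otimes>\<^sub>M borel)" by measurable
    from measurable_compose[OF this W] show ?thesis by simp
  qed
  have B0: "0 \<le> B" using W0[of undefined undefined] by linarith
  define T where "T s z = (\<integral>y. of_real (W s y) * (f (- y + z) - f z) \<partial>\<kappa>)" for s z
  have Tm[measurable (raw)]: "(\<lambda>x. T (a x) (b x)) \<in> borel_measurable X" if [measurable]: "a \<in> borel_measurable X" "b \<in> borel_measurable X" for a b X
    unfolding T_def by measurable
  have Tb: "E2 M (T s) \<le> ennreal ((c * \<beta>)\<^sup>2)" if s: "\<phi> s \<noteq> 0" for s
  proof -
    \<comment> \<open>Cauchy-Schwarz with the weight split into two square roots: one factor becomes
      the total mass, the other keeps a second copy of the weight, so that the norm of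
      \<open>T s\<close> comes out linear in \<open>c\<close>.\<close>
    have Tp: "ennreal ((cmod (T s z))\<^sup>2) \<le> ennreal c * (\<integral>\<^sup>+y. ennreal (W s y) * ennreal ((cmod (f (- y + z) - f z))\<^sup>2) \<partial>\<kappa>)" for z
    proof -
      have "ennreal (cmod (T s z)) \<le> (\<integral>\<^sup>+y. ennreal (cmod (of_real (W s y) * (f (- y + z) - f z))) \<partial>\<kappa>)"
      proof (cases "integrable \<kappa> (\<lambda>y. of_real (W s y) * (f (- y + z) - f z))")
        case True then show ?thesis unfolding T_def by (rule integral_norm_bound_ennreal)
      qed (simp add: T_def not_integrable_integral_eq)
      also have "\<dots> = (\<integral>\<^sup>+y. ennreal (sqrt (W s y)) * ennreal (sqrt (W s y) * cmod (f (- y + z) - f z)) \<partial>\<kappa>)"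
        using W0 by (intro nn_integral_cong) (simp add: norm_mult ennreal_mult[symmetric] mult.assoc[symmetric])
      finally have "(ennreal (cmod (T s z)))\<^sup>2 \<le> (\<integral>\<^sup>+y. ennreal (sqrt (W s y)) * ennreal (sqrt (W s y) * cmod (f (- y + z) - f z)) \<partial>\<kappa>)\<^sup>2"
        by (intro power_mono) auto
      also have "\<dots> \<le> (\<integral>\<^sup>+y. (ennreal (sqrt (W s y)))\<^sup>2 \<partial>\<kappa>) * (\<integral>\<^sup>+y. (ennreal (sqrt (W s y) * cmod (f (- y + z) - f z)))\<^sup>2 \<partial>\<kappa>)"
        by (rule Cauchy_Schwarz_nn_integral) measurable
      also have "(\<integral>\<^sup>+y. (ennreal (sqrt (W s y)))\<^sup>2 \<partial>\<kappa>) = (\<integral>\<^sup>+y. ennreal (W s y) \<partial>\<kappa>)"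
        using W0 by (simp add: ennreal_power)
      also have "(\<integral>\<^sup>+y. (ennreal (sqrt (W s y) * cmod (f (- y + z) - f z)))\<^sup>2 \<partial>\<kappa>) = (\<integral>\<^sup>+y. ennreal (W s y) * ennreal ((cmod (f (- y + z) - f z))\<^sup>2) \<partial>\<kappa>)"
        using W0 by (simp add: ennreal_power power_mult_distrib ennreal_mult)
      also have "(\<integral>\<^sup>+y. ennreal (W s y) \<partial>\<kappa>) * (\<integral>\<^sup>+y. ennreal (W s y) * ennreal ((cmod (f (- y + z) - f z))\<^sup>2) \<partial>\<kappa>) \<le>
        ennreal c * (\<integral>\<^sup>+y. ennreal (W s y) * ennreal ((cmod (f (- y + z) - f z))\<^sup>2) \<partial>\<kappa>)"
        by (intro mult_right_mono mass) simp
      finally show ?thesis by (simp add: ennreal_power)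
    qed
    have "E2 M (T s) \<le> (\<integral>\<^sup>+z. ennreal c * (\<integral>\<^sup>+y. ennreal (W s y) * ennreal ((cmod (f (- y + z) - f z))\<^sup>2) \<partial>\<kappa>) \<partial>M)"
      unfolding E2_def by (intro nn_integral_mono Tp)
    also have "\<dots> = ennreal c * (\<integral>\<^sup>+z. \<integral>\<^sup>+y. ennreal (W s y) * ennreal ((cmod (f (- y + z) - f z))\<^sup>2) \<partial>\<kappa> \<partial>M)"
      by (rule nn_integral_cmult) measurable
    also have "(\<integral>\<^sup>+z. \<integral>\<^sup>+y. ennreal (W s y) * ennreal ((cmod (f (- y + z) - f z))\<^sup>2) \<partial>\<kappa> \<partial>M) = (\<integral>\<^sup>+y. \<integral>\<^sup>+z. ennreal (W s y) * ennreal ((cmod (f (- y + z) - f z))\<^sup>2) \<partial>M \<partial>\<kappa>)"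
      by (rule MK.Fubini'[symmetric]) measurable
    also have "\<dots> = (\<integral>\<^sup>+y. ennreal (W s y) * E2 M (\<lambda>z. f (- y + z) - f z) \<partial>\<kappa>)"
      unfolding E2_def by (intro nn_integral_cong nn_integral_cmult) measurable
    also have "\<dots> \<le> (\<integral>\<^sup>+y. ennreal (W s y) * ennreal (\<beta>\<^sup>2) \<partial>\<kappa>)"
    proof (rule nn_integral_mono)
      fix y
      show "ennreal (W s y) * E2 M (\<lambda>z. f (- y + z) - f z) \<le> ennreal (W s y) * ennreal (\<beta>\<^sup>2)"
      proof (cases "W s y = 0")
        case False
        then show ?thesis using near(1)[OF s False] 
          by (intro mult_left_mono) (auto simp: E2_eq_L2norm L2fun_diff L2fun_shift f intro!: ennreal_leI power_mono)
      qed simp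
    qed
    also have "\<dots> = (\<integral>\<^sup>+y. ennreal (W s y) \<partial>\<kappa>) * ennreal (\<beta>\<^sup>2)" by (rule nn_integral_multc) measurable
    also have "\<dots> \<le> ennreal c * ennreal (\<beta>\<^sup>2)" by (intro mult_right_mono mass) simp
    finally show ?thesis using mass(2) near(2) by (simp add: mult_left_mono mult_right_mono ennreal_mult[symmetric] power2_eq_square mult_ac)
  qed
  \<comment> \<open>The shift by \<open>s\<close> in the second variable lets \<open>x\<close> act
    by left translation of the first variable only, as \<open>dcoef\<close> demands.\<close>
  define F where "F p = \<phi> (fst p) * T (fst p) (fst p + snd p)" for p
  define G where "G p = \<psi> (fst p) * g (fst p + snd p)" for p
  have mF: "F \<in> borel_measurable (M \<Otimes>\<^sub>M M)" and mG: "G \<in> borel_measurable (M \<Otimes>\<^sub>M M)"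
    unfolding F_def G_def by measurable
  have "E2 (M \<Otimes>\<^sub>M M) F = (\<integral>\<^sup>+s. ennreal ((cmod (\<phi> s))\<^sup>2) * E2 M (\<lambda>r. T s (s + r)) \<partial>M)"
    unfolding MM.E2_fst[OF mF] unfolding F_def E2_def
    by (simp add: norm_mult power_mult_distrib ennreal_mult nn_integral_cmult)
  also have "\<dots> = (\<integral>\<^sup>+s. ennreal ((cmod (\<phi> s))\<^sup>2) * E2 M (T s) \<partial>M)"
    by (intro nn_integral_cong arg_cong2[where f="(*)"] refl E2_shift) measurable
  also have "\<dots> \<le> (\<integral>\<^sup>+s. ennreal ((cmod (\<phi> s))\<^sup>2) * ennreal ((c * \<beta>)\<^sup>2) \<partial>M)"
  proof (rule nn_integral_mono)
    fix s show "ennreal ((cmod (\<phi> s))\<^sup>2) * E2 M (T s) \<le> ennreal ((cmod (\<phi> s))\<^sup>2) * ennreal ((c * \<beta>)\<^sup>2)"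
      using Tb[of s] by (cases "\<phi> s = 0") (auto intro: mult_left_mono)
  qed
  also have "\<dots> = E2 M \<phi> * ennreal ((c * \<beta>)\<^sup>2)" unfolding E2_def by (rule nn_integral_multc) measurable
  also have "\<dots> = ennreal ((c * \<beta> * L2norm M \<phi>)\<^sup>2)"
    by (simp add: E2_eq_L2norm[OF \<phi>] power_mult_distrib ennreal_mult[symmetric] mult.commute)
  finally have EF: "E2 (M \<Otimes>\<^sub>M M) F \<le> ennreal ((c * \<beta> * L2norm M \<phi>)\<^sup>2)" .
  have cb: "0 \<le> c * \<beta> * L2norm M \<phi>" using mass near by simp
  note LF = L2I[OF mF EF cb]
  have LG: "L2fun (M \<Otimes>\<^sub>M M) G" "L2norm (M \<Otimes>\<^sub>M M) G \<le> L2norm M \<psi> * L2norm M g"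
  proof -
    note 1 = MM.L2_tensor[OF \<psi> g]
    note 2 = L2_shear[OF 1(1), of "\<lambda>s. s", simplified]
    show "L2fun (M \<Otimes>\<^sub>M M) G" using 2(1) by (simp add: G_def[abs_def])
    show "L2norm (M \<Otimes>\<^sub>M M) G \<le> L2norm M \<psi> * L2norm M g" using 2(2) 1(2) by (simp add: G_def[abs_def])
  qed
  have "dcoef M F G x = (\<integral>y. (\<integral>s. \<phi> s * \<psi> (- x + s) * of_real (W s y) \<partial>M) * (conv_check M f g (- y + x) - conv_check M f g x) \<partial>\<kappa>)" for x
  proof -
    define D where "D y = conv_check M f g (- y + x) - conv_check M f g x" for y
    note [measurable] = conv_check_measurable[OF L2fun_measurable[OF f] L2fun_measurable[OF g]]
    have Dm[measurable]: "D \<in> borel_measurable borel" unfolding D_def by measurable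
    have Db: "cmod (D y) \<le> 2 * (L2norm M f * L2norm M g)" for y
      using norm_triangle_ineq4[of "conv_check M f g (- y + x)" "conv_check M f g x"] conv_check_bound[OF f g, of "- y + x"] conv_check_bound[OF f g, of x]
      unfolding D_def by linarith
    have Dz: "D y = (\<integral>z. (f (- y + z) - f z) * g (- x + z) \<partial>M)" for y
    proof -
      have "D y = conv_check M (\<lambda>z. f (- y + z) - f z) g x"
        unfolding D_def by (simp add: conv_check_diff_left L2fun_shift f g conv_check_shift)
      then show ?thesis by (simp add: conv_check_def)
    qed
    have inner: "(\<integral>z. T s z * g (- x + z) \<partial>M) = (\<integral>y. of_real (W s y) * D y \<partial>\<kappa>)" for s
    proof -
      have I: "integrable (M \<Otimes>\<^sub>M \<kappa>) (\<lambda>(z, y). of_real (W s y) * (f (- y + z) - f z) * g (- x + z))"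
        unfolding integrable_iff_bounded
      proof
        have "(\<integral>\<^sup>+p. ennreal (norm (case p of (z, y) \<Rightarrow> of_real (W s y) * (f (- y + z) - f z) * g (- x + z))) \<partial>(M \<Otimes>\<^sub>M \<kappa>)) =
          (\<integral>\<^sup>+y. ennreal (W s y) * (\<integral>\<^sup>+z. ennreal (cmod ((f (- y + z) - f z) * g (- x + z))) \<partial>M) \<partial>\<kappa>)"
          using W0 by (subst MK.nn_integral_snd[symmetric]) (auto simp: norm_mult ennreal_mult nn_integral_cmult[symmetric] mult.assoc)
        also have "\<dots> \<le> (\<integral>\<^sup>+y. ennreal B * ennreal ((2 * L2norm M f) * L2norm M g) \<partial>\<kappa>)"
        proof (intro nn_integral_mono mult_mono)
          fix y
          have "(\<integral>\<^sup>+z. ennreal (cmod ((f (- y + z) - f z) * g (- x + z))) \<partial>M) \<le> ennreal (L2norm M (\<lambda>z. f (- y + z) - f z) * L2norm M (\<lambda>z. g (- x + z)))"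
            by (intro nn_CS L2fun_diff L2fun_shift f g)
          also have "\<dots> \<le> ennreal ((2 * L2norm M f) * L2norm M g)"
            unfolding L2norm_shift[OF g] by (intro ennreal_leI mult_right_mono L2_translation_bound f L2norm_nonneg)
          finally show "(\<integral>\<^sup>+z. ennreal (cmod ((f (- y + z) - f z) * g (- x + z))) \<partial>M) \<le> ennreal ((2 * L2norm M f) * L2norm M g)" .
        qed (auto intro!: ennreal_leI W0)
        also have "\<dots> < \<infinity>" using unit_measureD[OF \<kappa>] by (simp add: ennreal_mult_less_top)
        finally show "(\<integral>\<^sup>+p. ennreal (norm (case p of (z, y) \<Rightarrow> of_real (W s y) * (f (- y + z) - f z) * g (- x + z))) \<partial>(M \<Otimes>\<^sub>M \<kappa>)) < \<infinity>" .
      qed measurable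
      have "(\<integral>z. T s z * g (- x + z) \<partial>M) = (\<integral>z. (\<integral>y. of_real (W s y) * (f (- y + z) - f z) * g (- x + z) \<partial>\<kappa>) \<partial>M)"
        unfolding T_def by (simp only: integral_mult_left_zero)
      also have "\<dots> = (\<integral>y. (\<integral>z. of_real (W s y) * (f (- y + z) - f z) * g (- x + z) \<partial>M) \<partial>\<kappa>)"
        by (rule MK.Fubini_integral[OF I, symmetric])
      also have "\<dots> = (\<integral>y. of_real (W s y) * D y \<partial>\<kappa>)" by (simp add: Dz mult.assoc)
      finally show ?thesis .
    qed
    have I2: "integrable (M \<Otimes>\<^sub>M \<kappa>) (\<lambda>(s, y). \<phi> s * \<psi> (- x + s) * (of_real (W s y) * D y))"
    proof -
      have "integrable (M \<Otimes>\<^sub>M \<kappa>) (\<lambda>p. (\<phi> (fst p) * \<psi> (- x + fst p)) * of_real (B * (2 * (L2norm M f * L2norm M g))))"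
      proof (rule MK.integrable_tensor[of "\<lambda>s. \<phi> s * \<psi> (- x + s)" "\<lambda>_. of_real (B * (2 * (L2norm M f * L2norm M g)))"])
        show "integrable M (\<lambda>s. \<phi> s * \<psi> (- x + s))" by (rule conv_check_integrable[OF \<phi> \<psi>])
        show "integrable \<kappa> (\<lambda>_. complex_of_real (B * (2 * (L2norm M f * L2norm M g))))"
          by (rule integrable_unit_measure[OF \<kappa> _ order_refl]) simp
      qed
      then show ?thesis
      proof (rule Bochner_Integration.integrable_bound)
        show "AE p in M \<Otimes>\<^sub>M \<kappa>. norm (case p of (s, y) \<Rightarrow> \<phi> s * \<psi> (- x + s) * (of_real (W s y) * D y)) \<le>
          norm ((\<phi> (fst p) * \<psi> (- x + fst p)) * of_real (B * (2 * (L2norm M f * L2norm M g))))"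
        proof (rule AE_I2)
          fix p :: "'g \<times> 'g"
          obtain s y where p: "p = (s, y)" by fastforce
          have "cmod (of_real (W s y) * D y) \<le> B * (2 * (L2norm M f * L2norm M g))"
            unfolding norm_mult using W0[of s y] B0 Db by (intro mult_mono) auto
          moreover have "cmod (of_real (B * (2 * (L2norm M f * L2norm M g)))) = B * (2 * (L2norm M f * L2norm M g))"
            using B0 by (simp only: norm_of_real) simp
          ultimately show "norm (case p of (s, y) \<Rightarrow> \<phi> s * \<psi> (- x + s) * (of_real (W s y) * D y)) \<le>
            norm ((\<phi> (fst p) * \<psi> (- x + fst p)) * of_real (B * (2 * (L2norm M f * L2norm M g))))"
            by (simp only: p prod.case fst_conv norm_mult[of "\<phi> s * \<psi> (- x + s)"] mult_left_mono norm_ge_zero)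
        qed
      qed measurable
    qed
    have "dcoef M F G x = (\<integral>s. (\<integral>r. F (s, r) * G (- x + s, r) \<partial>M) \<partial>M)"
      unfolding dcoef_def
      using MM.integral_fst'[OF dcoef_integrable[OF sigma_finite_measure_axioms LF(1) LG(1), of "- x"]] by simp
    also have "\<dots> = (\<integral>s. (\<integral>y. \<phi> s * \<psi> (- x + s) * (of_real (W s y) * D y) \<partial>\<kappa>) \<partial>M)"
    proof (rule Bochner_Integration.integral_cong[OF refl])
      fix s
      have "(\<integral>r. F (s, r) * G (- x + s, r) \<partial>M) = (\<integral>r. \<phi> s * \<psi> (- x + s) * (T s (s + r) * g (- x + (s + r))) \<partial>M)"
        by (simp add: F_def G_def mult_ac add.assoc)
      also have "\<dots> = \<phi> s * \<psi> (- x + s) * (\<integral>r. T s (s + r) * g (- x + (s + r)) \<partial>M)" by (rule integral_mult_right_zero)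
      also have "(\<integral>r. T s (s + r) * g (- x + (s + r)) \<partial>M) = (\<integral>z. T s z * g (- x + z) \<partial>M)"
        by (rule integral_shift[of "\<lambda>z. T s z * g (- x + z)"]) measurable
      finally show "(\<integral>r. F (s, r) * G (- x + s, r) \<partial>M) = (\<integral>y. \<phi> s * \<psi> (- x + s) * (of_real (W s y) * D y) \<partial>\<kappa>)"
        by (simp only: inner integral_mult_right_zero)
    qed
    also have "\<dots> = (\<integral>y. (\<integral>s. \<phi> s * \<psi> (- x + s) * (of_real (W s y) * D y) \<partial>M) \<partial>\<kappa>)"
      by (rule MK.Fubini_integral[OF I2, symmetric])
    also have "\<dots> = (\<integral>y. (\<integral>s. \<phi> s * \<psi> (- x + s) * of_real (W s y) \<partial>M) * D y \<partial>\<kappa>)"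
      by (simp only: mult.assoc[symmetric] integral_mult_left_zero)
    finally show ?thesis by (simp add: D_def)
  qed
  then have eq: "(\<lambda>x. \<integral>y. (\<integral>s. \<phi> s * \<psi> (- x + s) * of_real (W s y) \<partial>M) * (conv_check M f g (- y + x) - conv_check M f g x) \<partial>\<kappa>) = dcoef M F G"
    by auto
  have "L2norm (M \<Otimes>\<^sub>M M) F * L2norm (M \<Otimes>\<^sub>M M) G \<le> (c * \<beta> * L2norm M \<phi>) * (L2norm M \<psi> * L2norm M g)"
    using LF(2) LG(2) cb by (intro mult_mono) auto
  then show ?thesis unfolding eq
    by (intro fbound_mono[OF fbound_dcoef[OF sigma_finite_measure_axioms LF(1) LG(1)]]) simp
qed

section \<open>Finite sums of elementary tensors\<close>

inductive tensor_sum :: "('g \<times> 'g \<Rightarrow> complex) \<Rightarrow> bool" where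
  tensor: "L2fun M p \<Longrightarrow> L2fun M q \<Longrightarrow> tensor_sum (\<lambda>z. p (fst z) * q (snd z))"
| add: "tensor_sum P \<Longrightarrow> tensor_sum R \<Longrightarrow> tensor_sum (\<lambda>z. P z + R z)"

lemma tensor_sum_L2: "tensor_sum P \<Longrightarrow> L2fun (M \<Otimes>\<^sub>M M) P"
proof (induction rule: tensor_sum.induct)
  case (tensor p q)
  interpret MM: pair_sigma_finite M M ..
  show ?case using tensor by (rule MM.L2fun_tensor)
qed (rule L2fun_add)

lemma tensor_sum_scale: "tensor_sum P \<Longrightarrow> tensor_sum (\<lambda>z. c * P z)"
proof (induction rule: tensor_sum.induct)
  case (tensor p q)
  from tensor_sum.tensor[OF L2fun_scale[OF tensor(1), of c] tensor(2)] show ?case by (simp add: mult.assoc)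
next
  case (add P R)
  from tensor_sum.add[OF add.IH] show ?case by (simp add: distrib_left)
qed

lemma tensor_sum_dense:
  assumes P: "L2fun (M \<Otimes>\<^sub>M M) P" and e: "\<epsilon> > 0"
  obtains R where "tensor_sum R" "L2norm (M \<Otimes>\<^sub>M M) (\<lambda>z. P z - R z) < \<epsilon>"
proof -
  interpret MM: pair_sigma_finite M M ..
  show ?thesis
  proof (rule MM.L2_dense_rect[where D=tensor_sum, OF P tensor_sum_L2 _ tensor_sum.add tensor_sum_scale e])
    show "tensor_sum (\<lambda>p. indicator A (fst p) * indicator B (snd p))"
      if "A \<in> sets M" "emeasure M A < \<infinity>" "B \<in> sets M" "emeasure M B < \<infinity>" for A B
      using that by (intro tensor_sum.tensor L2fun_indicator)
  qed (use that in auto)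
qed

text \<open>The mass of the intersection of \<open>s + Q\<close> with its left translate by
  \<open>- y\<close>: a bump in \<open>y\<close> around 0, based at \<open>s\<close>.\<close>

definition overlap :: "'g set \<Rightarrow> 'g \<Rightarrow> 'g \<Rightarrow> real" where
  "overlap Q s y = (\<integral>t. indicator Q (- s + t) * indicator Q (- s + y + t) \<partial>M)"

context
  fixes Q :: "'g set"
  assumes Q: "open Q" "emeasure M Q < \<infinity>"
begin

lemma Q_measurable[measurable]: "Q \<in> sets borel"
  using Q by simp

lemma Q_L2: "L2fun M (indicator Q)"
  using Q by (intro L2fun_indicator) auto

lemma overlap_measurable: "(\<lambda>p. overlap Q (fst p) (snd p)) \<in> borel_measurable (borel \<Otimes>\<^sub>M borel)"
  unfolding overlap_def by measurable

lemma overlap_nonneg: "0 \<le> overlap Q s y"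
  unfolding overlap_def by (intro integral_nonneg_AE) auto

lemma overlap_eq: "complex_of_real (overlap Q s y) = (\<integral>t. indicator Q (- s + t) * indicator Q (- s + y + t) \<partial>M)"
proof -
  have "(indicator Q (- s + t) * indicator Q (- s + y + t) :: complex) = of_real (indicator Q (- s + t) * indicator Q (- s + y + t))" for t
    by (simp add: indicator_def)
  then show ?thesis by (simp only: overlap_def integral_complex_of_real)
qed

lemma overlap_eq_conv:
  "complex_of_real (overlap Q s y) = conv_check M (\<lambda>t. indicator Q (- s + t)) (\<lambda>t. indicator Q (- s + t)) (- y + 0)"
  unfolding overlap_eq conv_check_def by (simp add: add.assoc)

lemma overlap_le: "overlap Q s y \<le> (L2norm M (indicator Q))\<^sup>2"
proof -
  have "\<bar>overlap Q s y\<bar> = cmod (complex_of_real (overlap Q s y))" by simp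
  also have "\<dots> \<le> L2norm M (\<lambda>t. indicator Q (- s + t)) * L2norm M (\<lambda>t. indicator Q (- s + t))"
    unfolding overlap_eq_conv by (intro conv_check_bound L2fun_shift Q_L2)
  also have "\<dots> = (L2norm M (indicator Q))\<^sup>2" by (simp add: L2norm_shift Q_L2 power2_eq_square)
  finally show ?thesis by linarith
qed

text \<open>A common point of the two translated windows writes \<open>y\<close> as the conjugate by
  \<open>s\<close> of a difference in \<open>Q\<close>. Outside the abelian case such a conjugate
  can be large; \<open>conjugation_window\<close> deals with this.\<close>

lemma overlap_nonzero:
  assumes "overlap Q s y \<noteq> 0"
  obtains a b where "a \<in> Q" "b \<in> Q" "y = s + (a - b) - s"
proof -
  have "\<exists>t. indicator Q (- s + t) * indicator Q (- s + y + t) \<noteq> (0::real)"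
  proof (rule ccontr)
    assume "\<not> ?thesis"
    then have "indicator Q (- s + t) * indicator Q (- s + y + t) = (0::real)" for t by blast
    then show False using assms by (simp only: overlap_def integral_zero)
  qed
  then obtain t where t: "- s + t \<in> Q" "- s + y + t \<in> Q" by (auto simp: indicator_def split: if_splits)
  have "s + ((- s + y + t) - (- s + t)) - s = y"
    by (simp add: diff_conv_add_uminus minus_add add.assoc del: add_uminus_conv_diff)
  then show ?thesis using that[OF t(2,1)] by simp
qed

text \<open>The windows depend on \<open>- s + t\<close>, in which a common left translation
  cancels. So \<open>x\<close> survives only in \<open>\<psi>\<close>, and the integral over
  \<open>t\<close> becomes a nonnegative weight in \<open>s\<close> and \<open>y\<close>.\<close>

lemma kern_window:
  assumes \<phi>: "L2fun M \<phi>" and \<psi>: "L2fun M \<psi>"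
  shows "L2fun (M \<Otimes>\<^sub>M M) (\<lambda>p. \<phi> (fst p) * indicator Q (- fst p + snd p))"
    and "kern (\<lambda>p. \<phi> (fst p) * indicator Q (- fst p + snd p)) (\<lambda>p. \<psi> (fst p) * indicator Q (- fst p + snd p)) x y =
      (\<integral>s. \<phi> s * \<psi> (- x + s) * of_real (overlap Q s y) \<partial>M)"
proof -
  interpret MM: pair_sigma_finite M M ..
  have L: "L2fun (M \<Otimes>\<^sub>M M) (\<lambda>p. \<phi> (fst p) * indicator Q (- fst p + snd p))" if "L2fun M \<phi>" for \<phi>
  proof -
    have "L2fun (M \<Otimes>\<^sub>M M) (\<lambda>p. \<phi> (fst p) * indicator Q (snd p))" by (rule MM.L2fun_tensor[OF that Q_L2])
    from L2fun_shear[OF this, of uminus] show ?thesis by simp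
  qed
  show "L2fun (M \<Otimes>\<^sub>M M) (\<lambda>p. \<phi> (fst p) * indicator Q (- fst p + snd p))" by (rule L[OF \<phi>])
  have e: "- (- x + s) + (- x + y + t) = - s + y + t" for s t
    by (simp only: minus_add minus_minus add.assoc add_minus_cancel)
  have "kern (\<lambda>p. \<phi> (fst p) * indicator Q (- fst p + snd p)) (\<lambda>p. \<psi> (fst p) * indicator Q (- fst p + snd p)) x y =
    (\<integral>s. (\<integral>t. \<phi> s * indicator Q (- s + t) * (\<psi> (- x + s) * indicator Q (- s + y + t)) \<partial>M) \<partial>M)"
    unfolding kern_def using MM.integral_fst'[OF kern_integrable[OF L[OF \<phi>] L[OF \<psi>], of x y]]
    by (simp only: fst_conv snd_conv e)
  also have "\<dots> = (\<integral>s. \<phi> s * \<psi> (- x + s) * of_real (overlap Q s y) \<partial>M)"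
  proof (rule Bochner_Integration.integral_cong[OF refl])
    fix s
    have "(\<integral>t. \<phi> s * indicator Q (- s + t) * (\<psi> (- x + s) * indicator Q (- s + y + t)) \<partial>M) =
      (\<integral>t. \<phi> s * \<psi> (- x + s) * (indicator Q (- s + t) * indicator Q (- s + y + t)) \<partial>M)" by (simp only: mult_ac)
    also have "\<dots> = \<phi> s * \<psi> (- x + s) * of_real (overlap Q s y)" unfolding overlap_eq by (rule integral_mult_right_zero)
    finally show "(\<integral>t. \<phi> s * indicator Q (- s + t) * (\<psi> (- x + s) * indicator Q (- s + y + t)) \<partial>M) = \<phi> s * \<psi> (- x + s) * of_real (overlap Q s y)" .
  qed
  finally show "kern (\<lambda>p. \<phi> (fst p) * indicator Q (- fst p + snd p)) (\<lambda>p. \<psi> (fst p) * indicator Q (- fst p + snd p)) x y =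
      (\<integral>s. \<phi> s * \<psi> (- x + s) * of_real (overlap Q s y) \<partial>M)" .
qed

definition overlap_mass :: "'g measure \<Rightarrow> 'g \<Rightarrow> real" where
  "overlap_mass \<kappa> s = (\<integral>y. overlap Q s y \<partial>\<kappa>)"

lemma overlap_mass_measurable:
  assumes "unit_measure \<kappa>" shows "overlap_mass \<kappa> \<in> borel_measurable borel"
proof -
  have [measurable_cong]: "sets \<kappa> = sets borel" by (rule unit_measureD[OF assms])
  interpret K: sigma_finite_measure \<kappa> by (rule unit_measureD[OF assms])
  have "(\<lambda>p. overlap Q (fst p) (snd p)) \<in> borel_measurable (borel \<Otimes>\<^sub>M \<kappa>)"
    using overlap_measurable by (simp cong: measurable_cong_sets)
  then have "(\<lambda>(s, y). overlap Q s y) \<in> borel_measurable (borel \<Otimes>\<^sub>M \<kappa>)" by (simp add: case_prod_beta')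
  from K.borel_measurable_lebesgue_integral[OF this] show ?thesis by (simp add: overlap_mass_def[abs_def])
qed

lemma overlap_integrable:
  assumes \<kappa>: "unit_measure \<kappa>" shows "integrable \<kappa> (\<lambda>y. complex_of_real (overlap Q s y))"
proof (rule integrable_unit_measure[OF \<kappa>])
  have "(\<lambda>y. (s, y)) \<in> measurable borel (borel \<Otimes>\<^sub>M borel)" by simp
  from measurable_compose[OF this overlap_measurable] show "(\<lambda>y. complex_of_real (overlap Q s y)) \<in> borel_measurable borel" by simp
  show "cmod (complex_of_real (overlap Q s y)) \<le> (L2norm M (indicator Q))\<^sup>2" for y
    using overlap_le[of s y] overlap_nonneg[of s y] by simp
qed

lemma overlap_mass_eq:
  assumes \<kappa>: "unit_measure \<kappa>"
  shows "complex_of_real (overlap_mass \<kappa> s) = (\<integral>y. of_real (overlap Q s y) \<partial>\<kappa>)"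
    and "(\<integral>\<^sup>+y. ennreal (overlap Q s y) \<partial>\<kappa>) = ennreal (overlap_mass \<kappa> s)" and "0 \<le> overlap_mass \<kappa> s"
proof -
  have I: "integrable \<kappa> (\<lambda>y. overlap Q s y)" using overlap_integrable[OF \<kappa>, of s] by (simp only: complex_of_real_integrable_eq)
  show "complex_of_real (overlap_mass \<kappa> s) = (\<integral>y. of_real (overlap Q s y) \<partial>\<kappa>)" by (simp add: overlap_mass_def)
  show "(\<integral>\<^sup>+y. ennreal (overlap Q s y) \<partial>\<kappa>) = ennreal (overlap_mass \<kappa> s)"
    unfolding overlap_mass_def by (rule nn_integral_eq_integral[OF I]) (simp add: overlap_nonneg)
  show "0 \<le> overlap_mass \<kappa> s" unfolding overlap_mass_def by (intro integral_nonneg_AE) (simp add: overlap_nonneg)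
qed

text \<open>By Fubini the total mass of the kernel over \<open>\<kappa>\<close> is again a
  coefficient. It is the factor by which \<open>v\<close> ends up multiplied, and it approaches a
  multiple of the coefficient of \<open>\<phi>\<close> and \<open>\<psi>\<close> as the masses
  become constant in \<open>s\<close>.\<close>

lemma kern_window_integral:
  assumes \<phi>: "L2fun M \<phi>" and \<psi>: "L2fun M \<psi>" and \<kappa>: "unit_measure \<kappa>"
  shows "(\<integral>y. (\<integral>s. \<phi> s * \<psi> (- x + s) * of_real (overlap Q s y) \<partial>M) \<partial>\<kappa>) = conv_check M (\<lambda>s. \<phi> s * of_real (overlap_mass \<kappa> s)) \<psi> x"
proof -
  have [measurable_cong]: "sets \<kappa> = sets borel" by (rule unit_measureD[OF \<kappa>])
  interpret K: sigma_finite_measure \<kappa> by (rule unit_measureD[OF \<kappa>])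
  interpret MK: pair_sigma_finite M \<kappa> ..
  note [measurable] = \<phi>[THEN L2fun_measurable] \<psi>[THEN L2fun_measurable]
  have om[measurable]: "(\<lambda>p. overlap Q (fst p) (snd p)) \<in> borel_measurable (M \<Otimes>\<^sub>M \<kappa>)"
    using overlap_measurable by (simp cong: measurable_cong_sets)
  let ?c = "complex_of_real ((L2norm M (indicator Q))\<^sup>2)"
  have I: "integrable (M \<Otimes>\<^sub>M \<kappa>) (\<lambda>(s, y). \<phi> s * \<psi> (- x + s) * of_real (overlap Q s y))"
  proof (rule Bochner_Integration.integrable_bound)
    show "integrable (M \<Otimes>\<^sub>M \<kappa>) (\<lambda>p. (\<phi> (fst p) * \<psi> (- x + fst p)) * ?c)"
    proof (rule MK.integrable_tensor[of "\<lambda>s. \<phi> s * \<psi> (- x + s)" "\<lambda>_. ?c"])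
      show "integrable M (\<lambda>s. \<phi> s * \<psi> (- x + s))" by (rule conv_check_integrable[OF \<phi> \<psi>])
      show "integrable \<kappa> (\<lambda>_. ?c)" by (rule integrable_unit_measure[OF \<kappa> _ order_refl]) simp
    qed
    have "(\<lambda>p. \<phi> (fst p) * \<psi> (- x + fst p) * complex_of_real (overlap Q (fst p) (snd p))) \<in> borel_measurable (M \<Otimes>\<^sub>M \<kappa>)" by measurable
    then show "(\<lambda>(s, y). \<phi> s * \<psi> (- x + s) * of_real (overlap Q s y)) \<in> borel_measurable (M \<Otimes>\<^sub>M \<kappa>)"
      by (simp add: case_prod_beta')
    show "AE p in M \<Otimes>\<^sub>M \<kappa>. norm (case p of (s, y) \<Rightarrow> \<phi> s * \<psi> (- x + s) * of_real (overlap Q s y)) \<le> norm ((\<phi> (fst p) * \<psi> (- x + fst p)) * ?c)"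
    proof (rule AE_I2)
      fix p :: "'g \<times> 'g"
      have "cmod (of_real (overlap Q (fst p) (snd p))) \<le> cmod ?c"
        using overlap_le[of "fst p" "snd p"] overlap_nonneg[of "fst p" "snd p"] by (simp only: norm_of_real)
      then show "norm (case p of (s, y) \<Rightarrow> \<phi> s * \<psi> (- x + s) * of_real (overlap Q s y)) \<le> norm ((\<phi> (fst p) * \<psi> (- x + fst p)) * ?c)"
        unfolding case_prod_beta norm_mult[of "\<phi> (fst p) * \<psi> (- x + fst p)"] by (intro mult_left_mono) auto
    qed
  qed
  have "(\<integral>y. (\<integral>s. \<phi> s * \<psi> (- x + s) * of_real (overlap Q s y) \<partial>M) \<partial>\<kappa>) = (\<integral>s. (\<integral>y. \<phi> s * \<psi> (- x + s) * of_real (overlap Q s y) \<partial>\<kappa>) \<partial>M)"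
    by (rule MK.Fubini_integral[OF I])
  also have "\<dots> = (\<integral>s. \<phi> s * of_real (overlap_mass \<kappa> s) * \<psi> (- x + s) \<partial>M)"
    by (simp only: integral_mult_right_zero overlap_mass_eq(1)[OF \<kappa>] mult_ac)
  finally show ?thesis by (simp only: conv_check_def)
qed

end

text \<open>Continuity of conjugation gives a window near each single \<open>s\<close>, and finitely
  many of these neighbourhoods cover \<open>C\<close>. Over a noncompact set there may be no common
  window, since small neighbourhoods of 0 need not be invariant under conjugation.\<close>

lemma conjugation_window:
  assumes U: "open U" "(0::'g) \<in> U" and C: "compact C"
  obtains Q where "open Q" "0 \<in> Q" "emeasure M Q < \<infinity>" "\<And>s a b. s \<in> C \<Longrightarrow> a \<in> Q \<Longrightarrow> b \<in> Q \<Longrightarrow> s + (a - b) - s \<in> U"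
proof -
  have ex: "\<exists>A B. open A \<and> s \<in> A \<and> open B \<and> 0 \<in> B \<and> (\<forall>t\<in>A. \<forall>a\<in>B. \<forall>b\<in>B. t + (a - b) - t \<in> U)" for s :: 'g
  proof -
    let ?f = "\<lambda>p::'g \<times> 'g \<times> 'g. fst p + (fst (snd p) - snd (snd p)) - fst p"
    have "open (?f -` U)" using U by (intro open_vimage continuous_intros) auto
    moreover have "(s, 0, 0) \<in> ?f -` U" using U by simp
    ultimately obtain A B' where A: "open A" "open B'" "(s, 0, 0) \<in> A \<times> B'" "A \<times> B' \<subseteq> ?f -` U" by (rule open_prod_elim)
    then have "(0, 0) \<in> B'" by simp
    with A(2) obtain B1 B2 where B: "open B1" "open B2" "(0, 0) \<in> B1 \<times> B2" "B1 \<times> B2 \<subseteq> B'" by (rule open_prod_elim)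
    have "t + (a - b) - t \<in> U" if "t \<in> A" "a \<in> B1 \<inter> B2" "b \<in> B1 \<inter> B2" for t a b
    proof -
      have "(a, b) \<in> B'" using that B(4) by auto
      then have "(t, a, b) \<in> ?f -` U" using that A(4) by auto
      then show ?thesis by simp
    qed
    then show ?thesis using A B by (intro exI[of _ A] exI[of _ "B1 \<inter> B2"]) auto
  qed
  then obtain A B where AB: "\<And>s. open (A s)" "\<And>s. s \<in> A s" "\<And>s. open (B s)" "\<And>s. (0::'g) \<in> B s"
    "\<And>s t a b. t \<in> A s \<Longrightarrow> a \<in> B s \<Longrightarrow> b \<in> B s \<Longrightarrow> t + (a - b) - t \<in> U" by metis
  have "C \<subseteq> (\<Union>s\<in>C. A s)" using AB(2) by auto
  then obtain D where D: "D \<subseteq> C" "finite D" "C \<subseteq> (\<Union>s\<in>D. A s)"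
    using compactE_image[OF C, of C A] AB(1) by metis
  have "open (\<Inter>s\<in>D. B s)" "0 \<in> (\<Inter>s\<in>D. B s)" using D AB(3,4) by auto
  then obtain Q where Q: "open Q" "0 \<in> Q" "Q \<subseteq> (\<Inter>s\<in>D. B s)" "emeasure M Q < \<infinity>" by (rule small_open)
  have "s + (a - b) - s \<in> U" if s: "s \<in> C" and ab: "a \<in> Q" "b \<in> Q" for s a b
  proof -
    obtain d where d: "d \<in> D" "s \<in> A d" using D(3) s by auto
    then have "a \<in> B d" "b \<in> B d" using Q(3) ab by auto
    then show ?thesis using AB(5) d by blast
  qed
  then show ?thesis using that Q by blast
qed

end

section \<open>Approximation by elements supported on the quotient\<close>

context haar_hom
begin

text \<open>Left translations pass through \<open>\<theta>\<close>, with the test function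
  translated back. This is used for the translated windows in \<open>overlap\<close>.\<close>

lemma push_shift:
  assumes P: "push F F'" shows "push (\<lambda>y. F (- s + y)) (\<lambda>h. F' (- \<theta> s + h))"
  unfolding push_def
proof (intro conjI allI impI ballI)
  note L = pushD(1,2)[OF P]
  note [measurable] = L[THEN L2fun_measurable]
  show "L2fun M (\<lambda>y. F (- s + y))" "L2fun N (\<lambda>h. F' (- \<theta> s + h))"
    using L by (auto intro: G.L2fun_shift H.L2fun_shift)
  show "F' (- \<theta> s + h) = 0" if h: "h \<notin> range \<theta>" for h
  proof (rule pushD(3)[OF P])
    show "- \<theta> s + h \<notin> range \<theta>"
    proof
      assume "- \<theta> s + h \<in> range \<theta>"
      from range_add[OF rangeI[of \<theta> s] this] show False using h by simp
    qed
  qed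
  fix \<phi> :: "'h \<Rightarrow> complex" assume [measurable]: "\<phi> \<in> borel_measurable borel" and I: "integrable M (\<lambda>x. F (- s + x) * \<phi> (\<theta> x))"
  have m: "(\<lambda>h. \<phi> (\<theta> s + h)) \<in> borel_measurable borel" by measurable
  have I': "integrable M (\<lambda>x. F x * \<phi> (\<theta> s + \<theta> x))"
    using G.integrable_shift[OF I, of s] by (simp add: theta_add)
  from P have *: "\<forall>\<phi> \<in> borel_measurable borel. integrable M (\<lambda>x. F x * \<phi> (\<theta> x)) \<longrightarrow>
       integrable N (\<lambda>h. F' h * \<phi> h) \<and> (\<integral>x. F x * \<phi> (\<theta> x) \<partial>M) = (\<integral>h. F' h * \<phi> h \<partial>N)" by (simp add: push_def)
  from bspec[OF * m] I' have J: "integrable N (\<lambda>h. F' h * \<phi> (\<theta> s + h))"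
    and eq: "(\<integral>x. F x * \<phi> (\<theta> s + \<theta> x) \<partial>M) = (\<integral>h. F' h * \<phi> (\<theta> s + h) \<partial>N)"
    by simp_all
  show "integrable N (\<lambda>h. F' (- \<theta> s + h) * \<phi> h)"
    using H.integrable_shift[OF J, of "- \<theta> s"] by simp
  have "(\<integral>x. F (- s + x) * \<phi> (\<theta> s + \<theta> (- s + x)) \<partial>M) = (\<integral>x. F x * \<phi> (\<theta> s + \<theta> x) \<partial>M)"
    by (rule G.integral_shift[of "\<lambda>x. F x * \<phi> (\<theta> s + \<theta> x)"]) measurable
  then have "(\<integral>x. F (- s + x) * \<phi> (\<theta> x) \<partial>M) = (\<integral>x. F x * \<phi> (\<theta> s + \<theta> x) \<partial>M)" by (simp add: theta_add)
  moreover have "(\<integral>h. F' (- \<theta> s + h) * \<phi> (\<theta> s + (- \<theta> s + h)) \<partial>N) = (\<integral>h. F' h * \<phi> (\<theta> s + h) \<partial>N)"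
    by (rule H.integral_shift[of "\<lambda>h. F' h * \<phi> (\<theta> s + h)"]) measurable
  ultimately show "(\<integral>x. F (- s + x) * \<phi> (\<theta> x) \<partial>M) = (\<integral>h. F' (- \<theta> s + h) * \<phi> h \<partial>N)" using eq by simp
qed

text \<open>The push of an indicator can be taken real, so the integral of its square is its squared
  norm \<open>n\<close>. This number is the limiting mass of the overlap kernel; it must be positive
  because the final approximation is divided by it.\<close>

lemma push_indicator:
  assumes Q: "open Q" "Q \<noteq> {}" "emeasure M Q < \<infinity>"
  obtains j' n where "push (indicator Q) j'" "n > 0" "(\<integral>h. j' h * j' h \<partial>N) = complex_of_real n" "(L2norm N j')\<^sup>2 = n"
proof -
  have ei: "(\<lambda>x. complex_of_real (indicator Q x)) = indicator Q" by (auto simp: indicator_def)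
  have L: "L2fun M (\<lambda>x. complex_of_real (indicator Q x))" unfolding ei using Q by (intro L2fun_indicator) auto
  have i0: "0 \<le> (indicator Q x :: real)" for x by simp
  obtain f' :: "'h \<Rightarrow> real" where f': "\<And>h. f' h \<ge> 0" "L2fun N (\<lambda>h. of_real (f' h))" "L2norm N (\<lambda>h. of_real (f' h)) \<le> L2norm M (\<lambda>x. of_real (indicator Q x))"
    "\<And>h. h \<notin> range \<theta> \<Longrightarrow> f' h = 0" "f' \<in> borel_measurable borel" "distr (density M (\<lambda>x. ennreal (indicator Q x))) N \<theta> = density N (\<lambda>h. ennreal (f' h))"
    by (fact push_nonneg[OF L i0])
  let ?j = "\<lambda>h. complex_of_real (f' h)"
  have im: "(indicator Q :: 'g \<Rightarrow> real) \<in> borel_measurable borel" using Q by simp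
  have P: "push (\<lambda>x. complex_of_real (indicator Q x)) ?j"
    unfolding push_def
  proof (intro conjI allI impI ballI L f')
    show "?j h = 0" if "h \<notin> range \<theta>" for h using f'(4)[OF that] by simp
    fix \<phi> :: "'h \<Rightarrow> complex" assume m: "\<phi> \<in> borel_measurable borel" and I: "integrable M (\<lambda>x. complex_of_real (indicator Q x) * \<phi> (\<theta> x))"
    show "integrable N (\<lambda>h. ?j h * \<phi> h)" "(\<integral>x. complex_of_real (indicator Q x) * \<phi> (\<theta> x) \<partial>M) = (\<integral>h. ?j h * \<phi> h \<partial>N)"
      by (fact push_real[OF im f'(5) m i0 f'(1) f'(6) I])+
  qed
  have sq: "(L2norm N ?j)\<^sup>2 = (\<integral>h. (f' h)\<^sup>2 \<partial>N)"
    unfolding L2norm_def by (simp add: integral_nonneg_AE)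
  have "(\<integral>h. ?j h * ?j h \<partial>N) = (\<integral>h. complex_of_real ((f' h)\<^sup>2) \<partial>N)" by (simp add: power2_eq_square)
  also have "\<dots> = complex_of_real ((L2norm N ?j)\<^sup>2)" unfolding sq by (rule integral_complex_of_real)
  finally have int: "(\<integral>h. ?j h * ?j h \<partial>N) = complex_of_real ((L2norm N ?j)\<^sup>2)" .
  have "L2norm N ?j \<noteq> 0"
  proof
    assume 0: "L2norm N ?j = 0"
    \<comment> \<open>If the push were null, testing it against the constant 1 would give
      \<open>Q\<close> mass zero.\<close>
    have I: "integrable M (\<lambda>x. complex_of_real (indicator Q x) * 1)" using Q by (simp add: integrable_real_indicator)
    have "(\<integral>x. complex_of_real (indicator Q x) * 1 \<partial>M) = (\<integral>h. ?j h * 1 \<partial>N)" using pushD(4)[OF P, of "\<lambda>_. 1"] I by simp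
    also have "\<dots> = 0" by (rule L2_mult_integral_eq_0[OF f'(2) 0])
    finally have "measure M Q = 0" by simp
    moreover have "measure M Q > 0" using G.open_pos[OF Q(1,2)] Q(3) by (simp add: measure_def enn2real_positive_iff)
    ultimately show False by simp
  qed
  then have "(L2norm N ?j)\<^sup>2 > 0" by simp
  then show ?thesis using that[OF P[unfolded ei] _ int] by simp
qed

definition vanishing :: "('h set \<Rightarrow> 'g \<Rightarrow> complex) \<Rightarrow> bool" where
  "vanishing e \<longleftrightarrow> (\<forall>\<epsilon>>0. \<exists>U. open U \<and> 0 \<in> U \<and> (\<forall>V. admissible V \<and> V \<subseteq> U \<longrightarrow> G.fbound (e V) \<epsilon>))"

lemma vanishing_add:
  assumes "vanishing e" "vanishing f"
  shows "vanishing (\<lambda>V x. e V x + f V x)"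
  unfolding vanishing_def
proof (intro allI impI)
  fix \<epsilon> :: real assume "\<epsilon> > 0"
  then have e: "\<epsilon> / 2 > 0" by simp
  obtain U1 where U1: "open U1" "0 \<in> U1" "\<And>V. admissible V \<Longrightarrow> V \<subseteq> U1 \<Longrightarrow> G.fbound (e V) (\<epsilon> / 2)"
    using assms(1) e unfolding vanishing_def by meson
  obtain U2 where U2: "open U2" "0 \<in> U2" "\<And>V. admissible V \<Longrightarrow> V \<subseteq> U2 \<Longrightarrow> G.fbound (f V) (\<epsilon> / 2)"
    using assms(2) e unfolding vanishing_def by meson
  have "G.fbound (\<lambda>x. e V x + f V x) \<epsilon>" if "admissible V" "V \<subseteq> U1 \<inter> U2" for V
    using G.fbound_add[OF U1(3)[of V] U2(3)[of V]] that by simp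
  then show "\<exists>U. open U \<and> 0 \<in> U \<and> (\<forall>V. admissible V \<and> V \<subseteq> U \<longrightarrow> G.fbound (\<lambda>x. e V x + f V x) \<epsilon>)"
    using U1 U2 by (intro exI[of _ "U1 \<inter> U2"]) auto
qed

inductive module_span :: "'h set \<Rightarrow> ('g \<Rightarrow> complex) \<Rightarrow> bool" for E where
  gen: "d \<in> fourier_algebra M \<Longrightarrow> a \<in> I_ideal N E \<Longrightarrow> module_span E (\<lambda>x. d x * a (\<theta> x))"
| add: "module_span E u \<Longrightarrow> module_span E v \<Longrightarrow> module_span E (\<lambda>x. u x + v x)"

lemma module_span_scale: "module_span E u \<Longrightarrow> module_span E (\<lambda>x. c * u x)"
proof (induction rule: module_span.induct)
  case (gen d a)
  have "(\<lambda>x. c * d x) \<in> fourier_algebra M" using G.fbound_scale[OF G.fboundI[OF gen(1)], of c] by (simp add: G.fbound_def)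
  from module_span.gen[OF this gen(2)] show ?case by (simp add: mult.assoc)
next
  case (add u v)
  from module_span.add[OF add.IH] show ?case by (simp add: distrib_left)
qed

text \<open>For elementary tensors the kernel is \<open>?d x * ?c (- y + x)\<close>: the first
  factor leaves the average, the second is absorbed into \<open>v\<close>, and the product stays in
  the ideal. \<open>fibre_avg_limit\<close> then supplies the limit, a generator of the module span;
  sums in either argument follow by bilinearity.\<close>

lemma kern_avg_tensor_limit:
  assumes v: "v \<in> I_ideal M (\<theta> -` E)" and P: "G.tensor_sum P" and R: "G.tensor_sum R"
  shows "\<exists>z. module_span E z \<and> vanishing (\<lambda>V x. G.kern_avg (uniform_measure M (\<theta> -` V)) v P R x - z x)"
  using P
proof (induction rule: G.tensor_sum.induct)
  case (tensor p q)
  have vA: "v \<in> fourier_algebra M" and v0: "\<And>x. \<theta> x \<in> E \<Longrightarrow> v x = 0" using v by (auto simp: I_ideal_def)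
  show ?case using R
  proof (induction rule: G.tensor_sum.induct)
    case (tensor p' q')
    let ?d = "conv_check M p p'" and ?c = "conv_check M q q'"
    have dA: "G.fbound ?d (L2norm M p * L2norm M p')" by (intro G.fbound_conv_check \<open>L2fun M p\<close> tensor)
    have cA: "G.fbound ?c (L2norm M q * L2norm M q')" by (intro G.fbound_conv_check \<open>L2fun M q\<close> tensor)
    have cv: "(\<lambda>x. ?c x * v x) \<in> I_ideal M (\<theta> -` E)"
      using G.fbound_mult[OF cA G.fboundI[OF vA]] v0 by (simp add: I_ideal_def G.fbound_def)
    obtain a where a: "a \<in> I_ideal N E" "\<And>\<epsilon>. \<epsilon> > 0 \<Longrightarrow> \<exists>U. open U \<and> 0 \<in> U \<and> (\<forall>V. admissible V \<and> V \<subseteq> U \<longrightarrow> G.fbound (\<lambda>x. fibre_avg V (\<lambda>x. ?c x * v x) x - a (\<theta> x)) \<epsilon>)"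
      by (fact fibre_avg_limit[OF cv])
    have eq: "G.kern_avg (uniform_measure M (\<theta> -` V)) v (\<lambda>z. p (fst z) * q (snd z)) (\<lambda>z. p' (fst z) * q' (snd z)) x - ?d x * a (\<theta> x) =
       ?d x * (fibre_avg V (\<lambda>x. ?c x * v x) x - a (\<theta> x))" for V x
      unfolding G.kern_avg_def fibre_avg_def G.kern_tensor[OF \<open>L2fun M p\<close> \<open>L2fun M q\<close> tensor]
      by (simp only: mult.assoc integral_mult_right_zero right_diff_distrib)
    have "vanishing (\<lambda>V x. ?d x * (fibre_avg V (\<lambda>x. ?c x * v x) x - a (\<theta> x)))"
      unfolding vanishing_def
    proof (intro allI impI)
      fix \<epsilon> :: real assume e: "\<epsilon> > 0"
      let ?n = "L2norm M p * L2norm M p'"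
      have n: "0 \<le> ?n" by simp
      then have n1: "24 * ?n + 1 > 0" by linarith
      then have e': "\<epsilon> / (24 * ?n + 1) > 0" using e by simp
      have le: "24 * (?n * (\<epsilon> / (24 * ?n + 1))) \<le> \<epsilon>"
      proof -
        have "(24 * ?n + 1) * (\<epsilon> / (24 * ?n + 1)) = \<epsilon>" using n1 by simp
        then have "24 * ?n * (\<epsilon> / (24 * ?n + 1)) + \<epsilon> / (24 * ?n + 1) = \<epsilon>" by (simp only: distrib_right mult_1)
        then show ?thesis using e' by (simp only: mult.assoc)
      qed
      obtain U where "open U" "0 \<in> U" "\<And>V. admissible V \<Longrightarrow> V \<subseteq> U \<Longrightarrow> G.fbound (\<lambda>x. fibre_avg V (\<lambda>x. ?c x * v x) x - a (\<theta> x)) (\<epsilon> / (24 * ?n + 1))"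
        using a(2)[OF e'] by blast
      then show "\<exists>U. open U \<and> 0 \<in> U \<and> (\<forall>V. admissible V \<and> V \<subseteq> U \<longrightarrow> G.fbound (\<lambda>x. ?d x * (fibre_avg V (\<lambda>x. ?c x * v x) x - a (\<theta> x))) \<epsilon>)"
        using G.fbound_mono[OF G.fbound_mult[OF dA] le] by (intro exI[of _ U]) blast
    qed
    then show ?case unfolding eq[symmetric]
      using module_span.gen[of ?d, OF _ a(1)] dA by (auto simp: G.fbound_def)
  next
    case (add R R')
    then obtain z z' where z: "module_span E z" "module_span E z'"
      "vanishing (\<lambda>V x. G.kern_avg (uniform_measure M (\<theta> -` V)) v (\<lambda>z. p (fst z) * q (snd z)) R x - z x)"
      "vanishing (\<lambda>V x. G.kern_avg (uniform_measure M (\<theta> -` V)) v (\<lambda>z. p (fst z) * q (snd z)) R' x - z' x)" by blast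
    have LP: "L2fun (M \<Otimes>\<^sub>M M) (\<lambda>z. p (fst z) * q (snd z))" using G.tensor_sum_L2[OF G.tensor_sum.tensor[OF tensor]] .
    have "vanishing (\<lambda>V x. G.kern_avg (uniform_measure M (\<theta> -` V)) v (\<lambda>z. p (fst z) * q (snd z)) (\<lambda>z. R z + R' z) x - (z x + z' x))"
      unfolding vanishing_def
    proof (intro allI impI)
      fix \<epsilon> :: real assume "\<epsilon> > 0"
      with vanishing_add[OF z(3,4)] obtain U where U: "open U" "0 \<in> U" "\<And>V. admissible V \<Longrightarrow> V \<subseteq> U \<Longrightarrow>
        G.fbound (\<lambda>x. (G.kern_avg (uniform_measure M (\<theta> -` V)) v (\<lambda>z. p (fst z) * q (snd z)) R x - z x) + (G.kern_avg (uniform_measure M (\<theta> -` V)) v (\<lambda>z. p (fst z) * q (snd z)) R' x - z' x)) \<epsilon>"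
        unfolding vanishing_def by meson
      have "G.fbound (\<lambda>x. G.kern_avg (uniform_measure M (\<theta> -` V)) v (\<lambda>z. p (fst z) * q (snd z)) (\<lambda>z. R z + R' z) x - (z x + z' x)) \<epsilon>"
        if V: "admissible V" "V \<subseteq> U" for V
      proof -
        note \<kappa> = admissibleD(8)[OF V(1)]
        note LR = G.tensor_sum_L2[OF add(1)] G.tensor_sum_L2[OF add(2)]
        have "G.kern_avg (uniform_measure M (\<theta> -` V)) v (\<lambda>z. p (fst z) * q (snd z)) (\<lambda>z. R z + R' z) x =
          G.kern_avg (uniform_measure M (\<theta> -` V)) v (\<lambda>z. p (fst z) * q (snd z)) R x + G.kern_avg (uniform_measure M (\<theta> -` V)) v (\<lambda>z. p (fst z) * q (snd z)) R' x" for x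
          unfolding G.kern_avg_def G.kern_add_right[OF LP LR] distrib_right
          by (intro Bochner_Integration.integral_add G.kern_avg_integrable vA LP LR \<kappa>)
        then show ?thesis using U(3)[OF V] by (simp add: algebra_simps)
      qed
      then show "\<exists>U. open U \<and> 0 \<in> U \<and> (\<forall>V. admissible V \<and> V \<subseteq> U \<longrightarrow> G.fbound (\<lambda>x. G.kern_avg (uniform_measure M (\<theta> -` V)) v (\<lambda>z. p (fst z) * q (snd z)) (\<lambda>z. R z + R' z) x - (z x + z' x)) \<epsilon>)"
        using U by blast
    qed
    then show ?case using module_span.add[OF z(1,2)] by blast
  qed
next
  case (add P P')
  have vA: "v \<in> fourier_algebra M" using v by (auto simp: I_ideal_def)
  from add obtain z z' where z: "module_span E z" "module_span E z'"
    "vanishing (\<lambda>V x. G.kern_avg (uniform_measure M (\<theta> -` V)) v P R x - z x)"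
    "vanishing (\<lambda>V x. G.kern_avg (uniform_measure M (\<theta> -` V)) v P' R x - z' x)" by blast
  have "vanishing (\<lambda>V x. G.kern_avg (uniform_measure M (\<theta> -` V)) v (\<lambda>z. P z + P' z) R x - (z x + z' x))"
    unfolding vanishing_def
  proof (intro allI impI)
    fix \<epsilon> :: real assume "\<epsilon> > 0"
    with vanishing_add[OF z(3,4)] obtain U where U: "open U" "0 \<in> U" "\<And>V. admissible V \<Longrightarrow> V \<subseteq> U \<Longrightarrow>
      G.fbound (\<lambda>x. (G.kern_avg (uniform_measure M (\<theta> -` V)) v P R x - z x) + (G.kern_avg (uniform_measure M (\<theta> -` V)) v P' R x - z' x)) \<epsilon>"
      unfolding vanishing_def by meson
    have "G.fbound (\<lambda>x. G.kern_avg (uniform_measure M (\<theta> -` V)) v (\<lambda>z. P z + P' z) R x - (z x + z' x)) \<epsilon>"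
      if V: "admissible V" "V \<subseteq> U" for V
    proof -
      note \<kappa> = admissibleD(8)[OF V(1)]
      note LP = G.tensor_sum_L2[OF add(1)] G.tensor_sum_L2[OF add(2)]
      note LR = G.tensor_sum_L2[OF R]
      have "G.kern_avg (uniform_measure M (\<theta> -` V)) v (\<lambda>z. P z + P' z) R x =
        G.kern_avg (uniform_measure M (\<theta> -` V)) v P R x + G.kern_avg (uniform_measure M (\<theta> -` V)) v P' R x" for x
        unfolding G.kern_avg_def G.kern_add_left[OF LP LR] distrib_right
        by (intro Bochner_Integration.integral_add G.kern_avg_integrable vA LP LR \<kappa>)
      then show ?thesis using U(3)[OF V] by (simp add: algebra_simps)
    qed
    then show "\<exists>U. open U \<and> 0 \<in> U \<and> (\<forall>V. admissible V \<and> V \<subseteq> U \<longrightarrow> G.fbound (\<lambda>x. G.kern_avg (uniform_measure M (\<theta> -` V)) v (\<lambda>z. P z + P' z) R x - (z x + z' x)) \<epsilon>)"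
      using U by blast
  qed
  then show ?case using module_span.add[OF z(1,2)] by blast
qed

text \<open>As a function of \<open>y\<close> the overlap is a coefficient of the translated window,
  so its average over the preimage of \<open>V\<close> is computed in the target from the translated
  push. Cauchy-Schwarz there gives a bound that depends neither on \<open>s\<close> nor on
  \<open>V\<close>.\<close>

lemma overlap_mass_bound:
  assumes Q: "open Q" "emeasure M Q < \<infinity>" and P: "push (indicator Q) j'" and V: "admissible V"
  shows "G.overlap_mass Q (uniform_measure M (\<theta> -` V)) s \<le> (L2norm N j')\<^sup>2"
    and "complex_of_real (G.overlap_mass Q (uniform_measure M (\<theta> -` V)) s) =
      (\<integral>h. conv_check N (\<lambda>h. j' (- \<theta> s + h)) (\<lambda>h. j' (- \<theta> s + h)) (- h + 0) \<partial>uniform_measure N V)"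
proof -
  let ?\<kappa> = "uniform_measure M (\<theta> -` V)"
  note VD = admissibleD[OF V]
  note Lj = pushD(2)[OF P]
  have "complex_of_real (G.overlap_mass Q ?\<kappa> s) = (\<integral>y. of_real (G.overlap Q s y) \<partial>?\<kappa>)" by (rule G.overlap_mass_eq(1)[OF Q VD(8)])
  also have "\<dots> = (\<integral>y. conv_check M (\<lambda>t. indicator Q (- s + t)) (\<lambda>t. indicator Q (- s + t)) (- y + 0) \<partial>?\<kappa>)"
    by (simp only: G.overlap_eq_conv[OF Q])
  also have "\<dots> = (\<integral>h. conv_check N (\<lambda>h. j' (- \<theta> s + h)) (\<lambda>h. j' (- \<theta> s + h)) (- h + \<theta> 0) \<partial>uniform_measure N V)"
    by (rule average_uniform_identity[OF push_shift[OF P] push_shift[OF P] VD(1,3,4,5)])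
  finally show eq: "complex_of_real (G.overlap_mass Q ?\<kappa> s) =
      (\<integral>h. conv_check N (\<lambda>h. j' (- \<theta> s + h)) (\<lambda>h. j' (- \<theta> s + h)) (- h + 0) \<partial>uniform_measure N V)" by simp
  have "cmod (complex_of_real (G.overlap_mass Q ?\<kappa> s)) \<le> L2norm N (\<lambda>h. j' (- \<theta> s + h)) * L2norm N (\<lambda>h. j' (- \<theta> s + h))"
    unfolding eq by (rule integral_unit_measure_le[OF VD(9)])
      (auto intro!: AE_I2 H.conv_check_bound H.L2fun_shift Lj simp del: add_0_right)
  then show "G.overlap_mass Q ?\<kappa> s \<le> (L2norm N j')\<^sup>2" by (simp add: H.L2norm_shift Lj power2_eq_square)
qed

text \<open>First countability provides a sequence, so that dominated convergence in
  \<open>s\<close> can be applied to the masses.\<close>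

lemma admissible_sequence:
  obtains V :: "nat \<Rightarrow> 'h set" where "\<And>i. admissible (V i)" "\<And>U. open U \<Longrightarrow> 0 \<in> U \<Longrightarrow> \<forall>\<^sub>F i in sequentially. V i \<subseteq> U"
proof -
  obtain A :: "nat \<Rightarrow> 'h set" where A: "\<And>i. open (A i)" "\<And>i. 0 \<in> A i" "\<And>S. open S \<Longrightarrow> 0 \<in> S \<Longrightarrow> \<forall>\<^sub>F i in sequentially. A i \<subseteq> S"
    by (rule countable_basis_at_decseq[of "0::'h"]) blast
  have "\<exists>V. admissible V \<and> V \<subseteq> A i" for i
  proof -
    have "open (A i \<inter> range \<theta>)" "0 \<in> A i \<inter> range \<theta>" using A range_open range_zero by auto
    then obtain V where "open V" "0 \<in> V" "V \<subseteq> A i \<inter> range \<theta>" "emeasure N V < \<infinity>" by (rule H.small_open)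
    then show ?thesis by (intro exI[of _ V]) (auto simp: admissible_def)
  qed
  then obtain V where V: "\<And>i. admissible (V i)" "\<And>i. V i \<subseteq> A i" by metis
  show ?thesis
  proof (rule that[OF V(1)])
    fix U :: "'h set" assume "open U" "0 \<in> U"
    from A(3)[OF this] show "\<forall>\<^sub>F i in sequentially. V i \<subseteq> U" by eventually_elim (use V(2) in blast)
  qed
qed

text \<open>The average over \<open>V i\<close> of the continuous autocorrelation \<open>k\<close>
  of the translated push tends to its value at 0, and left invariance makes that value
  \<open>n\<close> for every \<open>s\<close>.\<close>

lemma overlap_mass_tendsto:
  assumes Q: "open Q" "emeasure M Q < \<infinity>" and P: "push (indicator Q) j'" and n: "(\<integral>h. j' h * j' h \<partial>N) = complex_of_real n"
    and V: "\<And>i::nat. admissible (V i)" "\<And>U. open U \<Longrightarrow> 0 \<in> U \<Longrightarrow> \<forall>\<^sub>F i in sequentially. V i \<subseteq> U"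
  shows "(\<lambda>i. complex_of_real (G.overlap_mass Q (uniform_measure M (\<theta> -` V i)) s)) \<longlonglongrightarrow> complex_of_real n"
proof (rule tendstoI)
  fix \<epsilon> :: real assume e: "\<epsilon> > 0"
  then have e2: "\<epsilon> / 2 > 0" by simp
  note Lj = pushD(2)[OF P]
  note [measurable] = Lj[THEN L2fun_measurable]
  define k where "k = conv_check N (\<lambda>h. j' (- \<theta> s + h)) (\<lambda>h. j' (- \<theta> s + h))"
  have kA: "k \<in> fourier_algebra N" unfolding k_def
    using H.fbound_conv_check[OF H.L2fun_shift[OF Lj] H.L2fun_shift[OF Lj], of "- \<theta> s" "- \<theta> s"] by (simp add: H.fbound_def)
  note [measurable] = H.fourier_algebra_measurable[OF kA]
  have k0: "k 0 = complex_of_real n"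
    using H.integral_shift[of "\<lambda>h. j' h * j' h" "- \<theta> s"] n by (simp add: k_def conv_check_def)
  obtain U where U: "open U" "0 \<in> U" "\<And>a x. a \<in> U \<Longrightarrow> cmod (k (a + x) - k x) < \<epsilon> / 2"
    using H.fourier_algebra_uniformly_continuous[OF kA e2] unfolding eventually_nhds by blast
  have "open (uminus -` U)" "0 \<in> uminus -` U" using U by (auto intro!: open_vimage continuous_intros)
  from V(2)[OF this] show "\<forall>\<^sub>F i in sequentially. dist (complex_of_real (G.overlap_mass Q (uniform_measure M (\<theta> -` V i)) s)) (complex_of_real n) < \<epsilon>"
  proof eventually_elim
    case (elim i)
    note VD = admissibleD[OF V(1)[of i]]
    have I: "integrable (uniform_measure N (V i)) (\<lambda>h. k (- h + 0))"
    proof (rule integrable_unit_measure[OF VD(9)])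
      show "cmod (k (- h + 0)) \<le> fourier_norm N k" for h by (rule H.fbound_sup[OF H.fboundI[OF kA]])
    qed simp
    have "(\<integral>h. k (- h + 0) - k 0 \<partial>uniform_measure N (V i)) = (\<integral>h. k (- h + 0) \<partial>uniform_measure N (V i)) - (\<integral>h. k 0 \<partial>uniform_measure N (V i))"
      by (rule Bochner_Integration.integral_diff[OF I integrable_unit_measure[OF VD(9) _ order_refl]]) simp
    also have "(\<integral>h. k 0 \<partial>uniform_measure N (V i)) = complex_of_real n"
      using unit_measureD[OF VD(9)] by (simp add: measure_def k0)
    also have "(\<integral>h. k (- h + 0) \<partial>uniform_measure N (V i)) = complex_of_real (G.overlap_mass Q (uniform_measure M (\<theta> -` V i)) s)"
      unfolding k_def by (rule overlap_mass_bound(2)[OF Q P V(1), symmetric])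
    finally have eq: "complex_of_real (G.overlap_mass Q (uniform_measure M (\<theta> -` V i)) s) - complex_of_real n = (\<integral>h. k (- h + 0) - k 0 \<partial>uniform_measure N (V i))" by simp
    have "AE h in uniform_measure N (V i). cmod (k (- h + 0) - k 0) \<le> \<epsilon> / 2"
    proof (rule AE_uniform_measureI)
      show "V i \<in> sets N" using VD by simp
      have "cmod (k (- h + 0) - k 0) \<le> \<epsilon> / 2" if "h \<in> V i" for h
        using U(3)[of "- h" 0] that elim by (intro less_imp_le) auto
      then show "AE h in N. h \<in> V i \<longrightarrow> cmod (k (- h + 0) - k 0) \<le> \<epsilon> / 2" by (intro AE_I2) blast
    qed
    then have "cmod (\<integral>h. k (- h + 0) - k 0 \<partial>uniform_measure N (V i)) \<le> \<epsilon> / 2"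
      using e2 by (intro integral_unit_measure_le[OF VD(9)]) auto
    then show ?case using e by (simp only: dist_norm eq)
  qed
qed

end

section \<open>Approximating products with a coefficient by the module span\<close>

lemma absorb_factor:
  fixes t x y :: real
  assumes "0 \<le> t" "0 \<le> x" "0 \<le> y"
  shows "24 * (t / (24 * (x + 1) * (y + 1)) * y) * x \<le> t"
proof -
  define d where "d = (x + 1) * (y + 1)"
  have "24 * (t / (24 * (x + 1) * (y + 1)) * y) * x = t * ((x * y) / d)" by (simp only: d_def mult.assoc[of 24]) simp
  also have "\<dots> \<le> t * 1"
  proof (intro mult_left_mono assms)
    have "x * y \<le> (x + 1) * (y + 1)" using assms by (intro mult_mono) auto
    moreover have "(x + 1) * (y + 1) > 0" using assms by (intro mult_pos_pos) auto
    ultimately show "(x * y) / d \<le> 1" unfolding d_def by (simp only: divide_le_eq_1) simp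
  qed
  finally show ?thesis by simp
qed

context lcsc_haar
begin

lemma kern_avg_diff:
  assumes v: "v \<in> fourier_algebra M" and \<kappa>: "unit_measure \<kappa>"
    and P: "L2fun (M \<Otimes>\<^sub>M M) P" "L2fun (M \<Otimes>\<^sub>M M) P'" and R: "L2fun (M \<Otimes>\<^sub>M M) R" "L2fun (M \<Otimes>\<^sub>M M) R'"
  shows "kern_avg \<kappa> v P R x - kern_avg \<kappa> v P' R' x = kern_avg \<kappa> v (\<lambda>p. P p - P' p) R x + kern_avg \<kappa> v P' (\<lambda>p. R p - R' p) x"
proof -
  have "kern_avg \<kappa> v (\<lambda>p. P p - P' p) R x = kern_avg \<kappa> v P R x - kern_avg \<kappa> v P' R x"
    unfolding kern_avg_def kern_diff_left[OF P R(1)] left_diff_distrib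
    by (intro Bochner_Integration.integral_diff kern_avg_integrable v P R \<kappa>)
  moreover have "kern_avg \<kappa> v P' (\<lambda>p. R p - R' p) x = kern_avg \<kappa> v P' R x - kern_avg \<kappa> v P' R' x"
    unfolding kern_avg_def kern_diff_right[OF P(2) R] left_diff_distrib
    by (intro Bochner_Integration.integral_diff kern_avg_integrable v P R \<kappa>)
  ultimately show ?thesis by simp
qed

text \<open>Averaging \<open>v\<close> against the overlap kernel is, up to the modulus of continuity of \<open>v\<close>, multiplication of \<open>v\<close>
  by a coefficient function.\<close>

lemma fbound_kern_avg_window:
  assumes Q: "open Q" "emeasure M Q < \<infinity>" and \<phi>: "L2fun M \<phi>" and \<psi>: "L2fun M \<psi>" and \<kappa>: "unit_measure \<kappa>"
    and L: "\<And>k. L2fun M (f k)" "\<And>k. L2fun M (g k)" and s: "summable (\<lambda>k. L2norm M (f k) * L2norm M (g k))"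
    and su: "\<And>x. (\<lambda>k. conv_check M (f k) (g k) x) sums v x"
    and om: "\<And>s. overlap_mass Q \<kappa> s \<le> n" "0 \<le> n"
    and \<omega>: "\<And>k. 0 \<le> \<omega> k" "summable (\<lambda>k. \<omega> k * L2norm M (g k))"
      "\<And>k s y. \<phi> s \<noteq> 0 \<Longrightarrow> overlap Q s y \<noteq> 0 \<Longrightarrow> L2norm M (\<lambda>z. f k (- y + z) - f k z) \<le> \<omega> k"
  shows "fbound (\<lambda>x. kern_avg \<kappa> v (\<lambda>p. \<phi> (fst p) * indicator Q (- fst p + snd p)) (\<lambda>p. \<psi> (fst p) * indicator Q (- fst p + snd p)) x
      - v x * conv_check M (\<lambda>s. \<phi> s * of_real (overlap_mass Q \<kappa> s)) \<psi> x)
    (24 * (n * (L2norm M \<phi> * L2norm M \<psi>)) * (\<Sum>k. \<omega> k * L2norm M (g k)))"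
proof -
  let ?P = "\<lambda>p. \<phi> (fst p) * indicator Q (- fst p + snd p)" and ?R = "\<lambda>p. \<psi> (fst p) * indicator Q (- fst p + snd p)"
  note LP = kern_window(1)[OF Q \<phi> \<psi>] and LR = kern_window(1)[OF Q \<psi> \<phi>]
  note K = kern_window(2)[OF Q \<phi> \<psi>]
  let ?I = "\<lambda>x. conv_check M (\<lambda>s. \<phi> s * of_real (overlap_mass Q \<kappa> s)) \<psi> x"
  have Ikern: "(\<integral>y. kern ?P ?R x y \<partial>\<kappa>) = ?I x" for x unfolding K by (rule kern_window_integral[OF Q \<phi> \<psi> \<kappa>])
  have intk: "integrable \<kappa> (\<lambda>y. kern ?P ?R x y)" for x
    by (rule integrable_unit_measure[OF \<kappa> kern_measurable[OF LP LR] kern_bound[OF LP LR]])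
  have mass: "(\<integral>\<^sup>+y. ennreal (overlap Q s y) \<partial>\<kappa>) \<le> ennreal n" for s
    unfolding overlap_mass_eq(2)[OF Q \<kappa>] using om(1) by (rule ennreal_leI)
  define D where "D k x = (\<integral>y. kern ?P ?R x y * (conv_check M (f k) (g k) (- y + x) - conv_check M (f k) (g k) x) \<partial>\<kappa>)" for k x
  have Db: "fbound (D k) (24 * (n * (L2norm M \<phi> * L2norm M \<psi>)) * (\<omega> k * L2norm M (g k)))" for k
  proof -
    have "fbound (D k) (24 * ((n * \<omega> k * L2norm M \<phi>) * (L2norm M \<psi> * L2norm M (g k))))" unfolding D_def K
      by (rule fbound_weighted_diff[OF L(1) L(2) \<phi> \<psi> \<kappa> overlap_measurable[OF Q] overlap_nonneg[OF Q] overlap_le[OF Q] mass om(2) \<omega>(3) \<omega>(1)])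
    then show ?thesis by (simp only: mult_ac)
  qed
  have "fbound (\<lambda>x. kern_avg \<kappa> v ?P ?R x - v x * ?I x) (\<Sum>k. 24 * (n * (L2norm M \<phi> * L2norm M \<psi>)) * (\<omega> k * L2norm M (g k)))"
  proof (rule fbound_suminf[OF Db])
    show "summable (\<lambda>k. 24 * (n * (L2norm M \<phi> * L2norm M \<psi>)) * (\<omega> k * L2norm M (g k)))" by (intro summable_mult \<omega>)
    fix x
    have 1: "(\<lambda>k. \<integral>y. kern ?P ?R x y * conv_check M (f k) (g k) (- y + x) \<partial>\<kappa>) sums kern_avg \<kappa> v ?P ?R x"
      unfolding kern_avg_def by (rule conv_series_integral_sums[OF L s su \<kappa> kern_measurable[OF LP LR] kern_bound[OF LP LR]])
    have 2: "(\<lambda>k. conv_check M (f k) (g k) x * ?I x) sums (v x * ?I x)" by (intro sums_mult2 su)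
    have "D k x = (\<integral>y. kern ?P ?R x y * conv_check M (f k) (g k) (- y + x) \<partial>\<kappa>) - conv_check M (f k) (g k) x * ?I x" for k
    proof -
      have cA: "conv_check M (f k) (g k) \<in> fourier_algebra M" using fbound_conv_check[OF L] by (simp add: fbound_def)
      have "D k x = (\<integral>y. kern ?P ?R x y * conv_check M (f k) (g k) (- y + x) - conv_check M (f k) (g k) x * kern ?P ?R x y \<partial>\<kappa>)"
        unfolding D_def by (simp only: right_diff_distrib mult.commute[of _ "conv_check M (f k) (g k) x"])
      also have "\<dots> = (\<integral>y. kern ?P ?R x y * conv_check M (f k) (g k) (- y + x) \<partial>\<kappa>) - (\<integral>y. conv_check M (f k) (g k) x * kern ?P ?R x y \<partial>\<kappa>)"
        by (intro Bochner_Integration.integral_diff kern_avg_integrable[OF cA LP LR \<kappa>] integrable_mult_right intk)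
      finally show ?thesis by (simp only: integral_mult_right_zero Ikern)
    qed
    then show "(\<lambda>k. D k x) sums (kern_avg \<kappa> v ?P ?R x - v x * ?I x)" using sums_diff[OF 1 2] by simp
  qed
  then show ?thesis by (simp only: suminf_mult \<omega>(2))
qed

end

context haar_hom
begin

text \<open>The moduli of \<open>v\<close> give \<open>U\<close>; the window \<open>Q\<close>, whose
  conjugated differences lie in \<open>U\<close>, gives \<open>n\<close>; then come the tensor sums
  \<open>P'\<close> and \<open>R'\<close>, their limit \<open>z\<close>, and last the set
  \<open>V i\<close>. Each error is a fraction of \<open>n * \<epsilon>\<close>, and dividing by
  \<open>n\<close> ends the argument.\<close>

lemma module_span_approx_compact:
  assumes v: "v \<in> I_ideal M (\<theta> -` E)" and \<phi>: "L2fun M \<phi>" and \<psi>: "L2fun M \<psi>"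
    and C: "compact C" "\<And>s. \<phi> s \<noteq> 0 \<Longrightarrow> s \<in> C" and e: "\<epsilon> > 0"
  obtains z where "module_span E z" "G.fbound (\<lambda>x. v x * conv_check M \<phi> \<psi> x - z x) \<epsilon>"
proof -
  have vA: "v \<in> fourier_algebra M" using v by (auto simp: I_ideal_def)
  define c where "c = fourier_norm M v"
  have cv: "G.fbound v c" unfolding c_def by (rule G.fboundI[OF vA])
  have c0: "0 \<le> c" using G.fbound_nonneg[OF cv] .
  obtain f g where L: "\<And>n. L2fun M (f n)" "\<And>n. L2fun M (g n)" and s: "summable (\<lambda>n. L2norm M (f n) * L2norm M (g n))"
    and su: "\<And>x. (\<lambda>n. conv_check M (f n) (g n) x) sums v x"
    by (fact G.fbound_rep_sums[OF vA])
  define a where "a = L2norm M \<phi> * L2norm M \<psi>"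
  have a0: "0 \<le> a" by (simp add: a_def)
  \<comment> \<open>96 is 4 times 24: the estimate in \<open>step1\<close> has constant 24 and may
    use a quarter of the tolerance. It is proportional to \<open>n\<close>, which is not known at
    this point.\<close>
  define \<epsilon>' where "\<epsilon>' = \<epsilon> / (96 * (a + 1))"
  have e': "\<epsilon>' > 0" using e a0 by (simp add: \<epsilon>'_def)
  obtain U \<omega> where U: "open U" "0 \<in> U" "\<And>n. 0 \<le> \<omega> n" "\<And>n h. h \<in> U \<Longrightarrow> L2norm M (\<lambda>z. f n (- h + z) - f n z) \<le> \<omega> n"
      "summable (\<lambda>n. \<omega> n * L2norm M (g n))" "(\<Sum>n. \<omega> n * L2norm M (g n)) < \<epsilon>'"
    by (fact G.small_moduli[OF L(1) s e'])
  obtain Q where Q: "open Q" "0 \<in> Q" "emeasure M Q < \<infinity>" "\<And>s a b. s \<in> C \<Longrightarrow> a \<in> Q \<Longrightarrow> b \<in> Q \<Longrightarrow> s + (a - b) - s \<in> U"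
    by (fact G.conjugation_window[OF U(1,2) C(1)])
  have Qne: "Q \<noteq> {}" using Q(2) by auto
  obtain j' n where j: "push (indicator Q) j'" "n > 0" "(\<integral>h. j' h * j' h \<partial>N) = complex_of_real n" "(L2norm N j')\<^sup>2 = n"
    by (fact push_indicator[OF Q(1) Qne Q(3)])
  obtain V :: "nat \<Rightarrow> 'h set" where V: "\<And>i. admissible (V i)" "\<And>U. open U \<Longrightarrow> 0 \<in> U \<Longrightarrow> \<forall>\<^sub>F i in sequentially. V i \<subseteq> U"
    by (fact admissible_sequence)
  define \<kappa> where "\<kappa> i = uniform_measure M (\<theta> -` V i)" for i
  have \<kappa>: "unit_measure (\<kappa> i)" for i unfolding \<kappa>_def by (rule admissibleD(8)[OF V(1)])
  define m where "m i s = G.overlap_mass Q (\<kappa> i) s" for i s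
  have m0: "0 \<le> m i s" for i s unfolding m_def by (rule G.overlap_mass_eq(3)[OF Q(1,3) \<kappa>])
  have mn: "m i s \<le> n" for i s unfolding m_def \<kappa>_def using overlap_mass_bound(1)[OF Q(1,3) j(1) V(1)] j(4) by simp
  have mm[measurable]: "m i \<in> borel_measurable borel" for i
    unfolding m_def by (rule G.overlap_mass_measurable[OF Q(1,3) \<kappa>])
  define P where "P p = \<phi> (fst p) * indicator Q (- fst p + snd p)" for p
  define R where "R p = \<psi> (fst p) * indicator Q (- fst p + snd p)" for p
  have LP: "L2fun (M \<Otimes>\<^sub>M M) P" and LR: "L2fun (M \<Otimes>\<^sub>M M) R"
    unfolding P_def R_def by (rule G.kern_window(1)[OF Q(1,3) \<phi> \<psi>], rule G.kern_window(1)[OF Q(1,3) \<psi> \<phi>])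
  let ?KA = "\<lambda>i P R. G.kern_avg (\<kappa> i) v P R"
  let ?b = "conv_check M \<phi> \<psi>" and ?bm = "\<lambda>i. conv_check M (\<lambda>s. \<phi> s * of_real (m i s)) \<psi>"
  have near: "L2norm M (\<lambda>z. f k (- y + z) - f k z) \<le> \<omega> k" if nz: "\<phi> s \<noteq> 0" "G.overlap Q s y \<noteq> 0" for k s y
  proof -
    obtain a b where "a \<in> Q" "b \<in> Q" "y = s + (a - b) - s" by (rule G.overlap_nonzero[OF Q(1,3) nz(2)])
    then have "y \<in> U" using Q(4)[OF C(2)[OF nz(1)]] by blast
    then show ?thesis by (rule U(4))
  qed
  have step1: "G.fbound (\<lambda>x. ?KA i P R x - v x * ?bm i x) (n * \<epsilon> / 4)" for i
  proof (rule G.fbound_mono)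
    show "G.fbound (\<lambda>x. ?KA i P R x - v x * ?bm i x) (24 * (n * (L2norm M \<phi> * L2norm M \<psi>)) * (\<Sum>k. \<omega> k * L2norm M (g k)))"
      unfolding P_def R_def m_def
      by (rule G.fbound_kern_avg_window[OF Q(1,3) \<phi> \<psi> \<kappa> L s su mn[unfolded m_def] less_imp_le[OF j(2)] U(3) U(5) near])
    have "24 * (n * a) * (\<Sum>k. \<omega> k * L2norm M (g k)) \<le> 24 * (n * a) * \<epsilon>'"
      using U(6) j(2) a0 by (intro mult_left_mono) auto
    also have "\<dots> = n * \<epsilon> / 4 * (a / (a + 1))" unfolding \<epsilon>'_def by (simp del: distrib_left_numeral)
    also have "\<dots> \<le> n * \<epsilon> / 4 * 1" using a0 j(2) e by (intro mult_left_mono) auto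
    finally show "24 * (n * (L2norm M \<phi> * L2norm M \<psi>)) * (\<Sum>k. \<omega> k * L2norm M (g k)) \<le> n * \<epsilon> / 4" by (simp add: a_def)
  qed
  have L\<phi>n: "L2fun M (\<lambda>s. \<phi> s * of_real n)" using L2fun_scale[OF \<phi>, of "of_real n"] by (simp add: mult.commute)
  have L\<phi>m: "L2fun M (\<lambda>s. \<phi> s * of_real (m i s))" for i
  proof (rule L2fun_bmult[OF \<phi>])
    show "cmod (complex_of_real (m i s)) \<le> n" for s using m0 mn by simp
    show "0 \<le> n" using j(2) by simp
  qed measurable
  \<comment> \<open>The masses lie between 0 and \<open>n\<close> and converge pointwise to
    \<open>n\<close>, so \<open>\<phi> s * of_real n\<close> dominates.\<close>
  have "(\<lambda>i. L2norm M (\<lambda>s. \<phi> s * of_real n - \<phi> s * of_real (m i s))) \<longlonglongrightarrow> 0"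
  proof (rule L2_dominated_convergence[OF L2fun_measurable[OF L\<phi>m] L\<phi>n L\<phi>n])
    show "(\<lambda>i. \<phi> s * complex_of_real (m i s)) \<longlonglongrightarrow> \<phi> s * complex_of_real n" for s
      unfolding m_def \<kappa>_def by (intro tendsto_mult_left overlap_mass_tendsto[OF Q(1,3) j(1,3) V])
    show "cmod (\<phi> s * complex_of_real (m i s)) \<le> cmod (\<phi> s * complex_of_real n)" for i s
      unfolding norm_mult using m0[of i s] mn[of i s] by (intro mult_left_mono) auto
  qed
  then have t0: "(\<lambda>i. 24 * (c * (L2norm M (\<lambda>s. \<phi> s * of_real n - \<phi> s * of_real (m i s)) * L2norm M \<psi>))) \<longlonglongrightarrow> 24 * (c * (0 * L2norm M \<psi>))"
    by (intro tendsto_intros)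
  have ev2: "\<forall>\<^sub>F i in sequentially. 24 * (c * (L2norm M (\<lambda>s. \<phi> s * of_real n - \<phi> s * of_real (m i s)) * L2norm M \<psi>)) < n * \<epsilon> / 4"
    by (rule order_tendstoD(2)[OF t0]) (use e j(2) in simp)
  have step2: "G.fbound (\<lambda>x. v x * conv_check M (\<lambda>s. \<phi> s * of_real n - \<phi> s * of_real (m i s)) \<psi> x)
      (24 * (c * (L2norm M (\<lambda>s. \<phi> s * of_real n - \<phi> s * of_real (m i s)) * L2norm M \<psi>)))" for i
    by (intro G.fbound_mult cv G.fbound_conv_check L2fun_diff L\<phi>n L\<phi>m \<psi>)
  let ?N = "L2norm (M \<Otimes>\<^sub>M M)"
  \<comment> \<open>The two halves of the tensor approximation share a quarter of
    \<open>n * \<epsilon>\<close>.\<close>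
  define t where "t = n * \<epsilon> / 8"
  have t: "t > 0" using j(2) e by (simp add: t_def)
  have "t / (24 * (c + 1) * (?N R + 1)) > 0" using t c0 by (intro divide_pos_pos mult_pos_pos add_nonneg_pos) auto
  then obtain P' where P': "G.tensor_sum P'" "?N (\<lambda>p. P p - P' p) < t / (24 * (c + 1) * (?N R + 1))" by (rule G.tensor_sum_dense[OF LP])
  \<comment> \<open>The tolerance for \<open>R'\<close> is measured against \<open>P'\<close>, since
    the second difference pairs \<open>P'\<close> with \<open>R - R'\<close>.\<close>
  have "t / (24 * (c + 1) * (?N P' + 1)) > 0" using t c0 by (intro divide_pos_pos mult_pos_pos add_nonneg_pos) auto
  then obtain R' where R': "G.tensor_sum R'" "?N (\<lambda>p. R p - R' p) < t / (24 * (c + 1) * (?N P' + 1))" by (rule G.tensor_sum_dense[OF LR])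
  note LP' = G.tensor_sum_L2[OF P'(1)] and LR' = G.tensor_sum_L2[OF R'(1)]
  have step3a: "G.fbound (?KA i (\<lambda>p. P p - P' p) R) t" for i
  proof (rule G.fbound_mono[OF G.fbound_kern_avg[OF cv L2fun_diff[OF LP LP'] LR \<kappa>]])
    have "24 * (?N (\<lambda>p. P p - P' p) * ?N R) * c \<le> 24 * (t / (24 * (c + 1) * (?N R + 1)) * ?N R) * c"
      using P'(2) c0 by (intro mult_right_mono mult_left_mono) auto
    also have "\<dots> \<le> t" using t c0 by (intro absorb_factor) auto
    finally show "24 * (?N (\<lambda>p. P p - P' p) * ?N R) * c \<le> t" .
  qed
  have step3b: "G.fbound (?KA i P' (\<lambda>p. R p - R' p)) t" for i
  proof (rule G.fbound_mono[OF G.fbound_kern_avg[OF cv LP' L2fun_diff[OF LR LR'] \<kappa>]])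
    have "24 * (?N P' * ?N (\<lambda>p. R p - R' p)) * c = 24 * (?N (\<lambda>p. R p - R' p) * ?N P') * c" by simp
    also have "\<dots> \<le> 24 * (t / (24 * (c + 1) * (?N P' + 1)) * ?N P') * c"
      using R'(2) c0 by (intro mult_right_mono mult_left_mono) auto
    also have "\<dots> \<le> t" using t c0 by (intro absorb_factor) auto
    finally show "24 * (?N P' * ?N (\<lambda>p. R p - R' p)) * c \<le> t" .
  qed
  obtain z where z: "module_span E z" "vanishing (\<lambda>V x. G.kern_avg (uniform_measure M (\<theta> -` V)) v P' R' x - z x)"
    using kern_avg_tensor_limit[OF v P'(1) R'(1)] by blast
  have "n * \<epsilon> / 4 > 0" using j(2) e by simp
  then obtain U' where U': "open U'" "0 \<in> U'" "\<And>V. admissible V \<Longrightarrow> V \<subseteq> U' \<Longrightarrow> G.fbound (\<lambda>x. G.kern_avg (uniform_measure M (\<theta> -` V)) v P' R' x - z x) (n * \<epsilon> / 4)"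
    using z(2) unfolding vanishing_def by meson
  from eventually_conj[OF ev2 V(2)[OF U'(1,2)]] obtain i where
    i: "24 * (c * (L2norm M (\<lambda>s. \<phi> s * of_real n - \<phi> s * of_real (m i s)) * L2norm M \<psi>)) < n * \<epsilon> / 4" "V i \<subseteq> U'"
    by (auto simp: eventually_sequentially)
  have step2': "G.fbound (\<lambda>x. v x * conv_check M (\<lambda>s. \<phi> s * of_real n - \<phi> s * of_real (m i s)) \<psi> x) (n * \<epsilon> / 4)"
    by (rule G.fbound_mono[OF step2]) (use i(1) in simp)
  have step4: "G.fbound (\<lambda>x. ?KA i P' R' x - z x) (n * \<epsilon> / 4)"
    unfolding \<kappa>_def by (rule U'(3)[OF V(1) i(2)])
  have bd: "conv_check M (\<lambda>s. \<phi> s * of_real n - \<phi> s * of_real (m i s)) \<psi> x = of_real n * ?b x - ?bm i x" for x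
  proof -
    have "conv_check M (\<lambda>s. \<phi> s * of_real n - \<phi> s * of_real (m i s)) \<psi> x = conv_check M (\<lambda>s. \<phi> s * of_real n) \<psi> x - ?bm i x"
      by (rule G.conv_check_diff_left[OF L\<phi>n L\<phi>m \<psi>])
    moreover have "conv_check M (\<lambda>s. \<phi> s * of_real n) \<psi> x = (\<integral>y. of_real n * (\<phi> y * \<psi> (- x + y)) \<partial>M)"
      unfolding conv_check_def by (simp only: mult_ac)
    ultimately show ?thesis by (simp only: integral_mult_right_zero conv_check_def)
  qed
  \<comment> \<open>The chain runs from \<open>z\<close> through the tensor kernel, the window
    kernel and the variable mass \<open>m i\<close> to the constant mass \<open>n\<close>;
    \<open>eq\<close> checks that everything in between cancels.\<close>
  have total: "G.fbound (\<lambda>x. ((?KA i (\<lambda>p. P p - P' p) R x + ?KA i P' (\<lambda>p. R p - R' p) x) + (?KA i P' R' x - z x)) -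
      ((?KA i P R x - v x * ?bm i x) - v x * conv_check M (\<lambda>s. \<phi> s * of_real n - \<phi> s * of_real (m i s)) \<psi> x))
      (((t + t) + n * \<epsilon> / 4) + (n * \<epsilon> / 4 + n * \<epsilon> / 4))"
    by (intro G.fbound_diff G.fbound_add step1 step2' step3a step3b step4)
  have eq: "((?KA i (\<lambda>p. P p - P' p) R x + ?KA i P' (\<lambda>p. R p - R' p) x) + (?KA i P' R' x - z x)) -
      ((?KA i P R x - v x * ?bm i x) - v x * conv_check M (\<lambda>s. \<phi> s * of_real n - \<phi> s * of_real (m i s)) \<psi> x) =
      of_real n * (v x * ?b x) - z x" for x
    unfolding bd G.kern_avg_diff[OF vA \<kappa> LP LP' LR LR', symmetric] by (simp add: algebra_simps)
  have "((t + t) + n * \<epsilon> / 4) + (n * \<epsilon> / 4 + n * \<epsilon> / 4) = n * \<epsilon>" by (simp add: t_def)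
  from total[unfolded eq this] have "G.fbound (\<lambda>x. of_real n * (v x * ?b x) - z x) (n * \<epsilon>)" .
  from G.fbound_scale[OF this, of "of_real (1 / n)"]
  have "G.fbound (\<lambda>x. v x * ?b x - of_real (1 / n) * z x) \<epsilon>"
    using j(2) by (simp add: right_diff_distrib norm_divide)
  then show ?thesis using that module_span_scale[OF z(1)] by blast
qed

text \<open>Compact support of the first vector serves to control conjugation. A general
  \<open>\<phi>\<close> is cut off along the exhaustion, at a cost in Fourier norm proportional to
  the L2 error.\<close>

lemma module_span_approx:
  assumes v: "v \<in> I_ideal M (\<theta> -` E)" and \<phi>: "L2fun M \<phi>" and \<psi>: "L2fun M \<psi>" and e: "\<epsilon> > 0"
  obtains z where "module_span E z" "G.fbound (\<lambda>x. v x * conv_check M \<phi> \<psi> x - z x) \<epsilon>"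
proof -
  have vA: "v \<in> fourier_algebra M" using v by (auto simp: I_ideal_def)
  define c where "c = fourier_norm M v"
  have cv: "G.fbound v c" unfolding c_def by (rule G.fboundI[OF vA])
  obtain Om :: "nat \<Rightarrow> 'g set" where Om: "\<And>n. open (Om n)" "\<And>n. emeasure M (Om n) < \<infinity>" "incseq Om" "(\<Union>n. Om n) = UNIV"
    "\<And>n. \<exists>K. compact K \<and> Om n \<subseteq> K" by (fact G.open_exhaustion)
  have [measurable]: "Om n \<in> sets borel" for n using Om by simp
  define \<phi>' where "\<phi>' n s = \<phi> s * indicator (Om n) s" for n s
  have L': "L2fun M (\<phi>' n)" for n unfolding \<phi>'_def
    by (rule L2fun_bmult[OF \<phi>, of _ 1]) (auto simp: indicator_def)
  have "(\<lambda>n. L2norm M (\<lambda>s. \<phi> s - \<phi>' n s)) \<longlonglongrightarrow> 0"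
  proof (rule L2_dominated_convergence[OF L2fun_measurable[OF L'] \<phi> \<phi>])
    fix s
    obtain n0 where "s \<in> Om n0" using Om(4) by blast
    then have "s \<in> Om n" if "n \<ge> n0" for n using incseqD[OF Om(3) that] by auto
    then have "\<forall>\<^sub>F n in sequentially. \<phi>' n s = \<phi> s" unfolding eventually_sequentially \<phi>'_def by (intro exI[of _ n0]) auto
    then show "(\<lambda>n. \<phi>' n s) \<longlonglongrightarrow> \<phi> s" by (rule tendsto_eventually)
    show "cmod (\<phi>' n s) \<le> cmod (\<phi> s)" for n by (auto simp: \<phi>'_def indicator_def)
  qed
  then have t0: "(\<lambda>n. 24 * (c * (L2norm M (\<lambda>s. \<phi> s - \<phi>' n s) * L2norm M \<psi>))) \<longlonglongrightarrow> 24 * (c * (0 * L2norm M \<psi>))"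
    by (intro tendsto_intros)
  have "\<forall>\<^sub>F n in sequentially. 24 * (c * (L2norm M (\<lambda>s. \<phi> s - \<phi>' n s) * L2norm M \<psi>)) < \<epsilon> / 2"
    by (rule order_tendstoD(2)[OF t0]) (use e in simp)
  then obtain n where n: "24 * (c * (L2norm M (\<lambda>s. \<phi> s - \<phi>' n s) * L2norm M \<psi>)) < \<epsilon> / 2" by (auto simp: eventually_sequentially)
  obtain K where K: "compact K" "Om n \<subseteq> K" using Om(5) by blast
  have supp: "s \<in> K" if "\<phi>' n s \<noteq> 0" for s using that K by (auto simp: \<phi>'_def indicator_def split: if_splits)
  have e2: "\<epsilon> / 2 > 0" using e by simp
  obtain z where z: "module_span E z" "G.fbound (\<lambda>x. v x * conv_check M (\<phi>' n) \<psi> x - z x) (\<epsilon> / 2)"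
    by (rule module_span_approx_compact[OF v L' \<psi> K(1) supp e2])
  have "G.fbound (\<lambda>x. v x * conv_check M (\<lambda>s. \<phi> s - \<phi>' n s) \<psi> x) (24 * (c * (L2norm M (\<lambda>s. \<phi> s - \<phi>' n s) * L2norm M \<psi>)))"
    by (intro G.fbound_mult cv G.fbound_conv_check L2fun_diff \<phi> L' \<psi>)
  then have "G.fbound (\<lambda>x. v x * conv_check M (\<lambda>s. \<phi> s - \<phi>' n s) \<psi> x) (\<epsilon> / 2)"
    by (rule G.fbound_mono) (use n in simp)
  from G.fbound_add[OF this z(2)] have "G.fbound (\<lambda>x. v x * conv_check M \<phi> \<psi> x - z x) \<epsilon>"
    by (simp add: G.conv_check_diff_left \<phi> L' \<psi> algebra_simps)
  then show ?thesis using that z(1) by blast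
qed

section \<open>Lifting the approximate unit\<close>

text \<open>The pulled-back net acts as an approximate unit at the single function \<open>v\<close>.
  The filter lives on the target; the pull-back is built into the condition.\<close>

definition stabilised :: "('h \<Rightarrow> complex) filter \<Rightarrow> ('g \<Rightarrow> complex) \<Rightarrow> bool" where
  "stabilised F v \<longleftrightarrow> (\<forall>\<epsilon>>0. \<forall>\<^sub>F u in F. G.fbound (\<lambda>x. u (\<theta> x) * v x - v x) \<epsilon>)"

lemma stabilised_add:
  assumes "stabilised F v" "stabilised F w" shows "stabilised F (\<lambda>x. v x + w x)"
  unfolding stabilised_def
proof (intro allI impI)
  fix \<epsilon> :: real assume "\<epsilon> > 0"
  then have e: "\<epsilon> / 2 > 0" by simp
  from assms(1)[unfolded stabilised_def, rule_format, OF e] assms(2)[unfolded stabilised_def, rule_format, OF e]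
  show "\<forall>\<^sub>F u in F. G.fbound (\<lambda>x. u (\<theta> x) * (v x + w x) - (v x + w x)) \<epsilon>"
  proof eventually_elim
    case (elim u)
    from G.fbound_add[OF elim] show ?case by (simp add: algebra_simps)
  qed
qed

text \<open>Boundedness of the net enters here: multiplication by the pulled-back functions is
  uniformly bounded, so the stabilised functions form a closed set.\<close>

lemma stabilised_limit:
  assumes bdd: "\<forall>\<^sub>F u in F. H.fbound u C" and F: "F \<noteq> bot"
    and ap: "\<And>\<epsilon>. \<epsilon> > 0 \<Longrightarrow> \<exists>w. stabilised F w \<and> G.fbound (\<lambda>x. v x - w x) \<epsilon>"
  shows "stabilised F v"
  unfolding stabilised_def
proof (intro allI impI)
  fix \<epsilon> :: real assume e: "\<epsilon> > 0"
  have C0: "0 \<le> C" using eventually_happens'[OF F bdd] H.fbound_nonneg by blast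
  \<comment> \<open>576 is 24 times 24, one factor for the product and one for the pull-back; the
    summand 1 accounts for the term without \<open>u\<close>.\<close>
  define \<delta> where "\<delta> = \<epsilon> / (2 * (576 * C + 1))"
  have \<delta>: "\<delta> > 0" using e C0 by (simp add: \<delta>_def add_nonneg_pos)
  have \<delta>e: "24 * ((24 * C) * \<delta>) + \<delta> = \<epsilon> / 2"
  proof -
    have "576 * C + 1 \<noteq> 0" using C0 by linarith
    then have "(576 * C + 1) * \<delta> = \<epsilon> / 2" unfolding \<delta>_def by (simp del: distrib_left_numeral)
    then show ?thesis by (simp add: algebra_simps)
  qed
  obtain w where w: "stabilised F w" "G.fbound (\<lambda>x. v x - w x) \<delta>" using ap[OF \<delta>] by blast
  have "\<epsilon> / 2 > 0" using e by simp
  from w(1)[unfolded stabilised_def, rule_format, OF this] bdd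
  show "\<forall>\<^sub>F u in F. G.fbound (\<lambda>x. u (\<theta> x) * v x - v x) \<epsilon>"
  proof eventually_elim
    case (elim u)
    have "G.fbound (\<lambda>x. (u (\<theta> x) * w x - w x) + (u (\<theta> x) * (v x - w x) - (v x - w x))) (\<epsilon> / 2 + (24 * ((24 * C) * \<delta>) + \<delta>))"
      by (intro G.fbound_add G.fbound_diff elim(1) G.fbound_mult fbound_pullback elim(2) w(2))
    then show ?case unfolding \<delta>e by (simp add: algebra_simps)
  qed
qed

text \<open>On a generator the error is \<open>d\<close> times the pull-back of
  \<open>u * a - a\<close>, so convergence in the target is enough.\<close>

lemma stabilised_module_span:
  assumes bdd: "\<forall>\<^sub>F u in F. H.fbound u C"
    and conv: "\<And>a. a \<in> I_ideal N E \<Longrightarrow> ((\<lambda>u. fourier_norm N (\<lambda>x. u x * a x - a x)) \<longlongrightarrow> 0) F"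
    and z: "module_span E z"
  shows "stabilised F z"
  using z
proof (induction rule: module_span.induct)
  case (gen d a)
  define n where "n = fourier_norm M d"
  have d: "G.fbound d n" unfolding n_def by (rule G.fboundI[OF gen(1)])
  have aA: "a \<in> fourier_algebra N" using gen(2) by (simp add: I_ideal_def)
  show ?case unfolding stabilised_def
  proof (intro allI impI)
    fix \<epsilon> :: real assume e: "\<epsilon> > 0"
    have t0: "((\<lambda>u. 24 * (n * (24 * fourier_norm N (\<lambda>x. u x * a x - a x)))) \<longlongrightarrow> 24 * (n * (24 * 0))) F"
      by (intro tendsto_intros conv gen)
    have "\<forall>\<^sub>F u in F. 24 * (n * (24 * fourier_norm N (\<lambda>x. u x * a x - a x))) < \<epsilon>"
      by (rule order_tendstoD(2)[OF t0]) (use e in simp)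
    from bdd this show "\<forall>\<^sub>F u in F. G.fbound (\<lambda>x. u (\<theta> x) * (d x * a (\<theta> x)) - d x * a (\<theta> x)) \<epsilon>"
    proof eventually_elim
      case (elim u)
      have "(\<lambda>x. u x * a x - a x) \<in> fourier_algebra N"
        using H.fbound_diff[OF H.fbound_mult[OF elim(1) H.fboundI[OF aA]] H.fboundI[OF aA]] by (simp add: H.fbound_def)
      from G.fbound_mult[OF d fbound_pullback[OF H.fboundI[OF this]]]
      have "G.fbound (\<lambda>x. d x * (u (\<theta> x) * a (\<theta> x) - a (\<theta> x))) \<epsilon>"
        by (rule G.fbound_mono) (use elim(2) in simp)
      then show ?case by (simp add: algebra_simps)
    qed
  qed
next
  case (add u v)
  then show ?case by (intro stabilised_add)
qed

text \<open>The approximate identity is consulted for one \<open>v\<close> and one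
  \<open>\<epsilon>\<close> at a time, to replace \<open>v\<close> by \<open>v * w\<close> with a
  fixed \<open>w\<close>; this is why it may be unbounded. The series of \<open>w\<close> then
  reduces \<open>v * w\<close> to products with single coefficients, up to a small tail.\<close>

lemma stabilised_ideal:
  assumes bdd: "\<forall>\<^sub>F u in F. H.fbound u C" and F: "F \<noteq> bot"
    and conv: "\<And>a. a \<in> I_ideal N E \<Longrightarrow> ((\<lambda>u. fourier_norm N (\<lambda>x. u x * a x - a x)) \<longlongrightarrow> 0) F"
    and ai: "has_approx_identity M" and v: "v \<in> I_ideal M (\<theta> -` E)"
  shows "stabilised F v"
proof (rule stabilised_limit[OF bdd F])
  have vA: "v \<in> fourier_algebra M" using v by (simp add: I_ideal_def)
  define c where "c = fourier_norm M v"
  have cv: "G.fbound v c" unfolding c_def by (rule G.fboundI[OF vA])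
  fix \<epsilon> :: real assume e: "\<epsilon> > 0"
  obtain B :: "('g \<Rightarrow> complex) filter" where B: "B \<noteq> bot" "\<forall>\<^sub>F w in B. w \<in> fourier_algebra M"
    "\<And>u. u \<in> fourier_algebra M \<Longrightarrow> ((\<lambda>w. fourier_norm M (\<lambda>x. w x * u x - u x)) \<longlongrightarrow> 0) B"
    using ai unfolding has_approx_identity_def by blast
  have "\<forall>\<^sub>F w in B. fourier_norm M (\<lambda>x. w x * v x - v x) < \<epsilon>" using B(3)[OF vA] e by (rule order_tendstoD)
  from eventually_happens'[OF B(1) eventually_conj[OF this B(2)]]
  obtain w where w: "fourier_norm M (\<lambda>x. w x * v x - v x) < \<epsilon>" "w \<in> fourier_algebra M" by blast
  have "G.fbound (\<lambda>x. w x * v x - v x) \<epsilon>"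
    using G.fbound_diff[OF G.fbound_mult[OF G.fboundI[OF w(2)] cv] cv] w(1) by (simp add: G.fbound_def)
  from G.fbound_scale[OF this, of "-1"] have close: "G.fbound (\<lambda>x. v x - v x * w x) \<epsilon>"
    by (simp add: algebra_simps)
  have "stabilised F (\<lambda>x. v x * w x)"
  proof (rule stabilised_limit[OF bdd F])
    fix \<delta> :: real assume \<delta>: "\<delta> > 0"
    obtain f g where L: "\<And>n. L2fun M (f n)" "\<And>n. L2fun M (g n)" and s: "summable (\<lambda>n. L2norm M (f n) * L2norm M (g n))"
      and su: "\<And>x. (\<lambda>n. conv_check M (f n) (g n) x) sums w x"
      by (fact G.fbound_rep_sums[OF w(2)])
    have S: "stabilised F (\<lambda>x. v x * conv_check M (f n) (g n) x)" for n
    proof (rule stabilised_limit[OF bdd F])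
      fix \<eta> :: real assume "\<eta> > 0"
      then obtain z where "module_span E z" "G.fbound (\<lambda>x. v x * conv_check M (f n) (g n) x - z x) \<eta>"
        by (rule module_span_approx[OF v L(1) L(2)])
      then show "\<exists>z. stabilised F z \<and> G.fbound (\<lambda>x. v x * conv_check M (f n) (g n) x - z x) \<eta>"
        using stabilised_module_span[OF bdd conv] by blast
    qed
    have SS: "stabilised F (\<lambda>x. \<Sum>n<k. v x * conv_check M (f n) (g n) x)" for k :: nat
    proof (induction k)
      case 0
      show ?case using G.fbound_mono[OF G.fbound_zero] by (simp add: stabilised_def)
    next
      case (Suc k)
      from stabilised_add[OF Suc S[of k]] show ?case by simp
    qed
    have c0: "0 \<le> c" by (rule G.fbound_nonneg[OF cv])
    have c1: "24 * c + 1 > 0" using c0 by linarith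
    then have "\<delta> / (24 * c + 1) > 0" using \<delta> by simp
    then obtain k where k: "norm (\<Sum>i. L2norm M (f (i + k)) * L2norm M (g (i + k))) < \<delta> / (24 * c + 1)"
      using suminf_exist_split[OF _ s] by blast
    have sk: "summable (\<lambda>i. L2norm M (f (i + k)) * L2norm M (g (i + k)))" by (rule summable_ignore_initial_segment[OF s])
    have "G.fbound (\<lambda>x. w x - (\<Sum>n<k. conv_check M (f n) (g n) x)) (\<Sum>i. L2norm M (f (i + k)) * L2norm M (g (i + k)))"
      by (rule G.fbound_suminf[OF G.fbound_conv_check[OF L(1) L(2)] sk]) (rule sums_split_initial_segment[OF su])
    from G.fbound_mult[OF cv this]
    have "G.fbound (\<lambda>x. v x * w x - (\<Sum>n<k. v x * conv_check M (f n) (g n) x)) (24 * (c * (\<Sum>i. L2norm M (f (i + k)) * L2norm M (g (i + k)))))"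
      by (simp add: right_diff_distrib sum_distrib_left)
    then have "G.fbound (\<lambda>x. v x * w x - (\<Sum>n<k. v x * conv_check M (f n) (g n) x)) \<delta>"
    proof (rule G.fbound_mono)
      have "24 * (c * (\<Sum>i. L2norm M (f (i + k)) * L2norm M (g (i + k)))) \<le> 24 * (c * (\<delta> / (24 * c + 1)))"
        using k c0 by (intro mult_left_mono) auto
      also have "\<dots> = \<delta> * (24 * c / (24 * c + 1))" by simp
      also have "\<dots> \<le> \<delta> * 1" using \<delta> c0 by (intro mult_left_mono) auto
      finally show "24 * (c * (\<Sum>i. L2norm M (f (i + k)) * L2norm M (g (i + k)))) \<le> \<delta>" by simp
    qed
    then show "\<exists>y. stabilised F y \<and> G.fbound (\<lambda>x. v x * w x - y x) \<delta>" using SS by blast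
  qed
  then show "\<exists>y. stabilised F y \<and> G.fbound (\<lambda>x. v x - y x) \<epsilon>" using close by blast
qed

lemma J0_pullback:
  assumes "u \<in> J0_ideal N E" shows "(\<lambda>x. u (\<theta> x)) \<in> J0_ideal M (\<theta> -` E)"
proof -
  obtain U where U: "open U" "E \<subseteq> U" "\<And>x. x \<in> U \<Longrightarrow> u x = 0" and uA: "u \<in> fourier_algebra N"
    using assms by (auto simp: J0_ideal_def)
  have "(\<lambda>x. u (\<theta> x)) \<in> fourier_algebra M" using fbound_pullback[OF H.fboundI[OF uA]] by (simp add: G.fbound_def)
  moreover have "open (\<theta> -` U)" by (rule open_vimage[OF U(1) theta_cont])
  ultimately show ?thesis using U(2,3) unfolding J0_ideal_def by (intro CollectI conjI exI[of _ "\<theta> -` U"]) auto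
qed

lemma ultra_strong_ditkin_vimage:
  assumes ai: "has_approx_identity M" and E: "ultra_strong_ditkin N E"
  shows "ultra_strong_ditkin M (\<theta> -` E)"
proof -
  obtain F :: "('h \<Rightarrow> complex) filter" and C where F: "F \<noteq> bot"
    "\<forall>\<^sub>F v in F. v \<in> J0_ideal N E \<and> fourier_norm N v \<le> C"
    "\<And>u. u \<in> I_ideal N E \<Longrightarrow> ((\<lambda>v. fourier_norm N (\<lambda>x. v x * u x - u x)) \<longlongrightarrow> 0) F"
    using E unfolding ultra_strong_ditkin_def by blast
  have bdd: "\<forall>\<^sub>F u in F. H.fbound u C"
    using F(2) by eventually_elim (auto simp: H.fbound_def J0_ideal_def)
  let ?F = "filtermap (\<lambda>u x. u (\<theta> x)) F"
  have "?F \<noteq> bot" using F(1) by (simp add: filtermap_bot_iff)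
  moreover have "\<forall>\<^sub>F v in ?F. v \<in> J0_ideal M (\<theta> -` E) \<and> fourier_norm M v \<le> 24 * C"
    unfolding eventually_filtermap using F(2) bdd
  proof eventually_elim
    case (elim u)
    then show ?case using J0_pullback fbound_pullback[OF elim(2)] by (simp add: G.fbound_def)
  qed
  moreover have "((\<lambda>v. fourier_norm M (\<lambda>x. v x * u x - u x)) \<longlongrightarrow> 0) ?F" if u: "u \<in> I_ideal M (\<theta> -` E)" for u
    unfolding filterlim_filtermap
  proof (rule tendstoI)
    fix \<epsilon> :: real assume e: "\<epsilon> > 0"
    \<comment> \<open>Halved because \<open>fbound\<close> is a non-strict bound while convergence
      asks for a strict one.\<close>
    then have "\<epsilon> / 2 > 0" by simp
    have "stabilised F u" by (rule stabilised_ideal[OF bdd F(1) F(3) ai u])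
    from this[unfolded stabilised_def, rule_format, OF \<open>\<epsilon> / 2 > 0\<close>]
    show "\<forall>\<^sub>F v in F. dist (fourier_norm M (\<lambda>x. v (\<theta> x) * u x - u x)) 0 < \<epsilon>"
    proof eventually_elim
      case (elim v)
      then have "0 \<le> fourier_norm M (\<lambda>x. v (\<theta> x) * u x - u x)" "fourier_norm M (\<lambda>x. v (\<theta> x) * u x - u x) \<le> \<epsilon> / 2"
        using G.fourier_norm_nonneg by (auto simp: G.fbound_def)
      then show ?case using e by simp
    qed
  qed
  ultimately show ?thesis unfolding ultra_strong_ditkin_def by blast
qed

end

theorem theorem3p9:
  fixes M :: "'g::{topological_group_add, t2_space, second_countable_topology} measure"
    and N :: "'h::{topological_group_add, t2_space, second_countable_topology} measure"
    and \<theta> :: "'g \<Rightarrow> 'h"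
    and E :: "'h set"
  assumes "lcsc_group TYPE('g)" and "lcsc_group TYPE('h)"
    and "haar_measure M" and "haar_measure N"
    and "continuous_on UNIV \<theta>"
    and "\<And>x y. \<theta> (x + y) = \<theta> x + \<theta> y"
    and "absolutely_continuous N (distr M N \<theta>)"
    and "open (range \<theta>)"
    and "\<And>\<alpha>. \<alpha> \<in> sets borel \<Longrightarrow> \<alpha> \<subseteq> range \<theta> \<Longrightarrow> emeasure M (\<theta> -` \<alpha>) = emeasure N \<alpha>"
    and "closed E"
    and "has_approx_identity M"
    and "ultra_strong_ditkin N E"
  shows "ultra_strong_ditkin M (\<theta> -` E)"
proof -
  interpret haar_hom M N \<theta>
    by unfold_locales (use assms in auto)
  show ?thesis using assms(11,12) by (rule ultra_strong_ditkin_vimage)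
qed

end
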